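(* Let $k\ge4$ be an even integer and let $\gamma=\begin{pmatrix}a&b\\c&d\end{pmatrix}\in{\bf SL}_2({\bf Z})$ with $c\ne0$. (a) If $|d|<|c|$, the set ${\rm Z}({\rm E}_k')\cap\gamma{\rm D}$ is empty. (b) If $|d|\ge|c|>0$, the set ${\rm Z}({\rm E}_k')\cap\gamma{\rm D}$ has cardinality $[\frac{k+2}{6}]$. It is contained in the interior of $\gamma{\rm D}$ when $|d|\ne|c|$; when $|d|=|c|$, it is contained in $\gamma{\rm C}$, where ${\rm C}=\{e^{i\theta} : \frac\pi3<\theta<\frac{2\pi}{3}\}$.
   Context: $\mathfrak{H}$ is the upper half-plane, on which ${\bf SL}_2({\bf Z})$ acts by $\gamma z=\frac{az+b}{cz+d}$. For even $k\ge4$, ${\rm E}_k(z)=1-\frac{2k}{{\rm B}_k}\sum_{n\ge1}\sigma_{k-1}(n)q^n$, $q=e^{2\pi i z}$, is the normalized Eisenstein series of weight $k$ (${\rm B}_k$ Bernoulli number, $\sigma_{k-1}(n)=\sum_{d\mid n}d^{k-1}$), and ${\rm E}_k'$ its derivative in $z$. ${\rm Z}({\rm E}_k')$ denotes the set of zeros of ${\rm E}_k'$ in $\mathfrak{H}$ which are not zeros of ${\rm E}_k$. ${\rm D}=\{z\in\mathfrak{H}: |\Re z|\le\frac12, |z|\ge1\}$, and $\gamma{\rm D}$, $\gamma{\rm C}$ are images under the action. $[x]$ is the largest integer $\le x$. *)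

theory Defs
  imports "HOL-Analysis.Analysis"
begin

definition upper_half_plane :: "complex set" where
  "upper_half_plane = {z. Im z > 0}"

text \<open>Exponential generating function: \<open>\<Sum> B\<^sub>n X\<^sup>n / n! = X / (e\<^sup>X - 1)\<close>.\<close>

definition bernoulli :: "nat \<Rightarrow> real" where
  "bernoulli n = fact n * fps_nth (fps_X / (fps_exp 1 - 1)) n"

definition divisor_sigma :: "nat \<Rightarrow> nat \<Rightarrow> nat" where
  "divisor_sigma m n = (\<Sum>d | d dvd n. d ^ m)"

text \<open>
  The series converges, and the formula is meaningful, only for \<open>z\<close> in the upper half-plane.
  As that set is open, \<open>deriv (eisenstein k) z\<close> depends only on the values there.
\<close>

definition eisenstein :: "nat \<Rightarrow> complex \<Rightarrow> complex" where
  "eisenstein k z =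
     1 - of_real (2 * real k / bernoulli k) *
       (\<Sum>n. of_nat (divisor_sigma (k - 1) (Suc n)) * exp (2 * of_real pi * \<i> * z) ^ Suc n)"

definition eisenstein_critical :: "nat \<Rightarrow> complex set" where
  "eisenstein_critical k =
     {z \<in> upper_half_plane. deriv (eisenstein k) z = 0 \<and> eisenstein k z \<noteq> 0}"

definition fund_domain :: "complex set" where
  "fund_domain = {z \<in> upper_half_plane. \<bar>Re z\<bar> \<le> 1 / 2 \<and> norm z \<ge> 1}"

definition fund_arc :: "complex set" where
  "fund_arc = {exp (\<i> * of_real \<theta>) | \<theta>. pi / 3 < \<theta> \<and> \<theta> < 2 * pi / 3}"

abbreviation moebius_int :: "int \<Rightarrow> int \<Rightarrow> int \<Rightarrow> int \<Rightarrow> complex \<Rightarrow> complex" where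
  "moebius_int a b c d \<equiv> moebius (of_int a) (of_int b) (of_int c) (of_int d)"

end

theory Submission
  imports Defs "HOL-Complex_Analysis.Complex_Analysis"
begin

text \<open>
  Write \<open>\<zeta>(k) E\<^sub>k(z) = z B(z) + A(z)\<close>, where \<open>A\<close> and \<open>B\<close> are half the lattice sums of
  \<open>n (m z + n)\<^sup>-\<^sup>k\<^sup>-\<^sup>1\<close> and \<open>m (m z + n)\<^sup>-\<^sup>k\<^sup>-\<^sup>1\<close>. Then \<open>\<zeta>(k) E\<^sub>k' = - k B\<close>, and the pair \<open>(A, B)\<close>
  transforms linearly under the modular group. So a zero of \<open>E\<^sub>k'\<close> in \<open>\<gamma> D\<close> that is no zero of \<open>E\<^sub>k\<close> is a point
  \<open>\<gamma> z\<close> with \<open>z \<in> D\<close>, \<open>B(z) \<noteq> 0\<close> and \<open>c A(z) = d B(z)\<close>.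

  The reflection \<open>z \<mapsto> - cnj z\<close> reduces everything to the right half of \<open>D\<close>. There \<open>Re A > 0\<close>
  and \<open>B \<noteq> 0\<close>, by explicit estimates, hence \<open>- A / B = exp l\<close> with \<open>l\<close> holomorphic, and the solutions for
  \<open>\<bar>d / c\<bar> = exp t\<close> are the points with \<open>l z = t + \<i> \<pi> j\<close> for some integer \<open>j\<close>. Such points cannot
  escape to the cusp, to the vertical sides or to the corner. On the unit circle \<open>Re l = 0\<close>. Hence, by an open and closed argument
  in \<open>t\<close>, for each \<open>j\<close> there are none for \<open>t < 0\<close>, those for \<open>t = 0\<close> lie on the circle, \<open>Im l\<close> increases
  strictly along the circle at each of them, and for \<open>t > 0\<close> there are as many as for \<open>t = 0\<close>, namely at most one. On the circle
  \<open>Im l = \<pi> + (k + 1) \<theta> + 2 Arg A\<close>, so its values at both ends of the arc count the levels \<open>j\<close> that occur.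
\<close>

section \<open>Bernoulli numbers, zeta values and the Lipschitz formula\<close>

text \<open>The analytic core is \<open>Re (eis_A k z) > 0\<close> and, for Re z < 1/2,
  \<open>eis_B k z \<noteq> 0\<close> in a half strip containing the right half of D. The corner
  exp(i pi / 3) is the main obstacle. For k mod 6 = 2 both halves vanish there, so A must be
  estimated relative to the distance from the corner, and the ratio A / B only has a limit. That
  limit depends on k mod 6 and so decides at which level the arc starts. No single expansion settles
  B at all heights and weights. For k <= 10, and for (Im z)^2 >= k / 6, one term of the q-expansion
  outweighs the rest once its predecessor has been rotated to the real axis. For larger k and
  smaller height the lattice sum is used; its two leading terms, of index (1, 0) and (1, -1), have
  equal modulus on the line Re z = 1/2, and comparison with the mirror image in that line gives a
  bound uniform up to it. The levels met on the arc are those with floor((k + 1) / 3) + 1 < j <= k /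
  2 + 1; their number k / 2 - floor((k + 1) / 3) equals [(k + 2) / 6] for even k.\<close>

definition powsum :: "nat \<Rightarrow> complex \<Rightarrow> complex" where
  "powsum j q = (\<Sum>n. of_nat n ^ j * q ^ n)"

text \<open>\<open>diffs\<close> encodes the derivative, and multiplication by q makes it the Euler
  operator q d/dq, which scales the n-th coefficient by n. The term of index 0 is then zero, so the
  index shift is harmless.\<close>

lemma mult_diffs_sums:
  fixes q :: complex
  assumes "summable (\<lambda>n. diffs c n * q ^ n)"
  shows "(\<lambda>n. of_nat n * c n * q ^ n) sums (q * (\<Sum>n. diffs c n * q ^ n))"
proof -
  have "(\<lambda>n. q * (diffs c n * q ^ n)) sums (q * (\<Sum>n. diffs c n * q ^ n))"
    by (intro sums_mult summable_sums assms)
  hence "(\<lambda>n. of_nat (Suc n) * c (Suc n) * q ^ Suc n) sums (q * (\<Sum>n. diffs c n * q ^ n))"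
    by (simp add: diffs_def mult_ac)
  thus ?thesis by (subst (asm) sums_Suc_iff) simp
qed

text \<open>Each application of q d/dq raises the exponent of n by one. Termwise differentiation
  needs convergence on the whole disc, so the induction keeps \<open>q\<close> arbitrary.\<close>

lemma summable_powsum:
  fixes q :: complex
  assumes "norm q < 1"
  shows "summable (\<lambda>n. of_nat n ^ j * q ^ n)"
  using assms
proof (induction j arbitrary: q)
  case 0
  thus ?case by (simp add: summable_geometric)
next
  case (Suc j)
  have "summable (\<lambda>n. diffs (\<lambda>n. of_nat n ^ j) n * q ^ n)"
    by (rule termdiff_converges[where K = 1]) (use Suc in auto)
  from sums_summable[OF mult_diffs_sums[OF this]] show ?case by (simp add: mult_ac)
qed

definition nome :: "complex \<Rightarrow> complex" where
  "nome z = exp (2 * of_real pi * \<i> * z)"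

lemma norm_nome: "norm (nome z) = exp (- 2 * pi * Im z)"
  by (simp add: nome_def norm_exp_eq_Re)

lemma norm_nome_less_1: "Im z > 0 \<Longrightarrow> norm (nome z) < 1"
  by (simp add: norm_nome)

lemma has_field_derivative_nome_series:
  assumes a: "\<And>q. norm q < 1 \<Longrightarrow> summable (\<lambda>n. a n * q ^ n)" and z: "Im z > 0"
  shows "((\<lambda>z. \<Sum>n. a n * nome z ^ n) has_field_derivative
            2 * of_real pi * \<i> * (\<Sum>n. of_nat n * a n * nome z ^ n)) (at z)"
proof -
  have q: "norm (nome z) < 1" by (rule norm_nome_less_1[OF z])
  obtain r where r: "norm (nome z) < r" "r < 1" using q dense by blast
  have "((\<lambda>q. \<Sum>n. a n * q ^ n) has_field_derivative (\<Sum>n. diffs a n * nome z ^ n)) (at (nome z))"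
    by (rule termdiffs_strong[where K = "of_real r"])
       (use r in \<open>auto intro!: a\<close>, (use norm_ge_zero[of "nome z"] in linarith)+)
  moreover have "(nome has_field_derivative 2 * of_real pi * \<i> * nome z) (at z)"
    unfolding nome_def by (auto intro!: derivative_eq_intros)
  ultimately have "((\<lambda>z. \<Sum>n. a n * nome z ^ n) has_field_derivative
      (\<Sum>n. diffs a n * nome z ^ n) * (2 * of_real pi * \<i> * nome z)) (at z)"
    by (rule DERIV_chain2)
  moreover have "summable (\<lambda>n. diffs a n * nome z ^ n)"
    by (rule termdiff_converges[where K = 1]) (use q in \<open>auto intro: a\<close>)
  from sums_unique[OF mult_diffs_sums[OF this]]
    have "(\<Sum>n. diffs a n * nome z ^ n) * nome z = (\<Sum>n. of_nat n * a n * nome z ^ n)"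
    by (simp add: mult.commute)
  moreover have "D * (2 * of_real pi * \<i> * q) = 2 * of_real pi * \<i> * (D * q)" for D q :: complex
    by (simp only: mult_ac)
  ultimately show ?thesis by simp
qed

lemma has_field_derivative_powsum_nome:
  assumes "Im z > 0"
  shows "((\<lambda>z. powsum j (nome z)) has_field_derivative
            (2 * pi * \<i> * powsum (Suc j) (nome z))) (at z)"
  using has_field_derivative_nome_series[OF summable_powsum assms, of j]
  by (simp add: powsum_def mult.assoc)

text \<open>The j-th derivative of psi(w) - psi(1 - w) = - pi cot(pi w); the sign comes from the
  inner function 1 - w. For j >= 1 it is (-1)^(j+1) j! times the sum of (w + n)^(-j-1) over all
  integers n.\<close>

definition polysum :: "nat \<Rightarrow> complex \<Rightarrow> complex" where
  "polysum j w = Polygamma j w + (-1) ^ Suc j * Polygamma j (1 - w)"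

lemma Im_pos_not_Ints: "Im w > 0 \<Longrightarrow> w \<notin> \<int>"
  by (auto elim!: Ints_cases)

lemma has_field_derivative_polysum:
  assumes "w \<notin> \<int>"
  shows "(polysum j has_field_derivative polysum (Suc j) w) (at w)"
proof -
  have "w \<notin> \<int>\<^sub>\<le>\<^sub>0" using assms by auto
  moreover have "1 - w \<notin> \<int>\<^sub>\<le>\<^sub>0"
    using assms nonpos_Ints_subset_Ints by (metis Ints_1 Ints_diff diff_diff_eq2 add_diff_cancel_left' in_mono)
  ultimately show ?thesis unfolding polysum_def
    by (auto intro!: derivative_eq_intros DERIV_chain2[OF has_field_derivative_Polygamma, where s = UNIV] simp: )
qed

lemma sin_pi_eq_0_imp_Ints:
  assumes "sin (complex_of_real pi * w) = 0"
  shows "w \<in> \<int>"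
proof -
  obtain n :: int where "complex_of_real pi * w = of_real (of_int n * pi)"
    using assms by (auto simp: sin_eq_0)
  hence "w = of_int n" by (simp add: mult.commute)
  thus ?thesis by auto
qed

text \<open>Differentiate the reflection formula: Gamma(w) Gamma(1 - w) sin(pi w) is constant off
  the integers, so its derivative vanishes there.\<close>

lemma polysum_0:
  fixes w :: complex
  assumes "w \<notin> \<int>"
  shows "polysum 0 w = - pi * cot (pi * w)"
proof -
  have "w \<notin> \<int>\<^sub>\<le>\<^sub>0" using assms by auto
  moreover have "1 - w \<notin> \<int>\<^sub>\<le>\<^sub>0"
    using assms nonpos_Ints_subset_Ints by (metis Ints_1 Ints_diff diff_diff_eq2 add_diff_cancel_left' in_mono)
  ultimately have w: "w \<notin> \<int>\<^sub>\<le>\<^sub>0" "1 - w \<notin> \<int>\<^sub>\<le>\<^sub>0" by blast+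
  have sin0: "sin (complex_of_real pi * w) \<noteq> 0" using sin_pi_eq_0_imp_Ints assms by blast
  have eq: "Gamma w * Gamma (1 - w) * sin (complex_of_real pi * w) = pi" if "w \<notin> \<int>" for w :: complex
    using sin_pi_eq_0_imp_Ints[of w] that by (auto simp: Gamma_reflection_complex)
  let ?F = "\<lambda>w. Gamma w * Gamma (1 - w) * sin (complex_of_real pi * w)"
  have "(?F has_field_derivative
     (Gamma w * Digamma w * Gamma (1 - w) - Gamma w * (Gamma (1 - w) * Digamma (1 - w))) * sin (complex_of_real pi * w)
      + Gamma w * Gamma (1 - w) * (of_real pi * cos (complex_of_real pi * w))) (at w)"
    using w by (auto intro!: derivative_eq_intros simp: algebra_simps)
  moreover have "(?F has_field_derivative 0) (at w)"
  proof (rule has_field_derivative_transform_within_open[where S = "- \<int>"])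
    show "((\<lambda>_. complex_of_real pi) has_field_derivative 0) (at w)" by auto
    show "open (- \<int> :: complex set)" by (simp add: closed_Ints open_Compl)
  qed (use assms eq in auto)
  ultimately have "(Gamma w * Digamma w * Gamma (1 - w) - Gamma w * (Gamma (1 - w) * Digamma (1 - w))) * sin (complex_of_real pi * w)
      + Gamma w * Gamma (1 - w) * (of_real pi * cos (complex_of_real pi * w)) = 0"
    by (rule DERIV_unique)
  hence "Gamma w * Gamma (1 - w) * ((Digamma w - Digamma (1 - w)) * sin (complex_of_real pi * w) + of_real pi * cos (complex_of_real pi * w)) = 0"
    by (simp add: algebra_simps)
  moreover have "Gamma w * Gamma (1 - w) \<noteq> 0" using w by (simp add: Gamma_eq_zero_iff)
  ultimately have "(Digamma w - Digamma (1 - w)) * sin (complex_of_real pi * w) = - of_real pi * cos (complex_of_real pi * w)"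
    by (simp add: add_eq_0_iff2)
  thus ?thesis using sin0 by (simp add: polysum_def cot_def field_simps)
qed

lemma cot_nome:
  assumes "w \<notin> \<int>"
  shows "cot (complex_of_real pi * w) * (nome w - 1) = \<i> * (nome w + 1)"
proof -
  define e where "e = exp (\<i> * (complex_of_real pi * w))"
  have e: "e \<noteq> 0" "nome w = e ^ 2" by (auto simp: e_def nome_def exp_double[symmetric] mult_ac)
  have s: "sin (complex_of_real pi * w) = (e - 1 / e) / (2 * \<i>)"
    by (simp add: sin_exp_eq e_def exp_minus inverse_eq_divide)
  have c: "cos (complex_of_real pi * w) = (e + 1 / e) / 2"
    by (simp add: cos_exp_eq e_def exp_minus inverse_eq_divide)
  have "sin (complex_of_real pi * w) \<noteq> 0" using sin_pi_eq_0_imp_Ints assms by blast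
  hence e1: "e \<noteq> 1 / e" by (auto simp: s)
  have nz: "e ^ 2 - 1 \<noteq> 0"
  proof
    assume "e ^ 2 - 1 = 0"
    hence "e = 1 / e" using e(1) by (simp add: field_simps power2_eq_square)
    with e1 show False by blast
  qed
  have "e - 1 / e = (e ^ 2 - 1) / e" "e + 1 / e = (e ^ 2 + 1) / e"
    using e(1) by (simp_all add: field_simps power2_eq_square)
  hence "cot (complex_of_real pi * w) = \<i> * (e ^ 2 + 1) / (e ^ 2 - 1)"
    unfolding cot_def s c using e(1) nz by (simp add: divide_simps)
  thus ?thesis using e nz by simp
qed

text \<open>Since \<open>0 ^ 0 = 1\<close>, \<open>powsum 0 q\<close> includes the constant term and
  equals 1 / (1 - q); the correction \<open>- pi * \<i>\<close> compensates for counting that term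
  fully rather than by half.\<close>

lemma polysum_0_nome:
  assumes "Im w > 0"
  shows "polysum 0 w = 2 * pi * \<i> * powsum 0 (nome w) - pi * \<i>"
proof -
  have q: "norm (nome w) < 1" by (rule norm_nome_less_1[OF assms])
  have p: "powsum 0 (nome w) = 1 / (1 - nome w)"
    using q by (simp add: powsum_def suminf_geometric)
  have q1: "1 - nome w \<noteq> 0" using q by auto
  have I: "w \<notin> \<int>" by (rule Im_pos_not_Ints[OF assms])
  have "polysum 0 w * (1 - nome w) = pi * (cot (complex_of_real pi * w) * (nome w - 1))"
    by (simp add: polysum_0[OF I] algebra_simps)
  also have "\<dots> = pi * (\<i> * (nome w + 1))" by (simp only: cot_nome[OF I])
  finally have "polysum 0 w = pi * \<i> * (nome w + 1) / (1 - nome w)"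
    using q1 by (simp add: field_simps)
  also have "\<dots> = 2 * pi * \<i> * (1 / (1 - nome w)) - pi * \<i>"
    using q1 by (simp add: field_simps)
  finally show ?thesis by (simp only: p)
qed

text \<open>Repeated differentiation of the cotangent expansion, each step contributing 2 pi i. The
  induction starts at the first derivative, where the constant \<open>- pi * \<i>\<close> has
  disappeared.\<close>

lemma polysum_nome:
  assumes "Im w > 0"
  shows "polysum (Suc j) w = (2 * pi * \<i>) ^ Suc (Suc j) * powsum (Suc j) (nome w)"
  using assms
proof (induction j arbitrary: w)
  case (0 w)
  have "((\<lambda>w. 2 * pi * \<i> * powsum 0 (nome w) - pi * \<i>) has_field_derivative
            2 * pi * \<i> * (2 * pi * \<i> * powsum (Suc 0) (nome w))) (at w)"
    using has_field_derivative_powsum_nome[OF 0, of 0] by (auto intro!: derivative_eq_intros)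
  hence "(polysum 0 has_field_derivative 2 * pi * \<i> * (2 * pi * \<i> * powsum (Suc 0) (nome w))) (at w)"
    by (rule has_field_derivative_transform_within_open[OF _ open_halfspace_Im_gt[of 0]])
       (use 0 polysum_0_nome in auto)
  from DERIV_unique[OF this has_field_derivative_polysum[OF Im_pos_not_Ints[OF 0]]]
  show ?case by (simp add: mult_ac)
next
  case (Suc j w)
  have "((\<lambda>w. (2 * pi * \<i>) ^ Suc (Suc j) * powsum (Suc j) (nome w)) has_field_derivative
            (2 * pi * \<i>) ^ Suc (Suc j) * (2 * pi * \<i> * powsum (Suc (Suc j)) (nome w))) (at w)"
    using has_field_derivative_powsum_nome[OF Suc.prems, of "Suc j"] by (rule DERIV_cmult)
  hence "(polysum (Suc j) has_field_derivative (2 * pi * \<i>) ^ Suc (Suc j) * (2 * pi * \<i> * powsum (Suc (Suc j)) (nome w))) (at w)"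
    by (rule has_field_derivative_transform_within_open[OF _ open_halfspace_Im_gt[of 0]])
       (use Suc in auto)
  from DERIV_unique[OF this has_field_derivative_polysum[OF Im_pos_not_Ints[OF Suc.prems]], symmetric]
  show ?case by (simp add: mult_ac)
qed

text \<open>The imaginary part of m z + n is m Im z, which controls m; then n = (m z + n) - m z
  controls n.\<close>

lemma max_abs_le_norm_lattice:
  fixes z :: complex and m n :: int
  assumes "Im z > 0"
  shows "max \<bar>of_int m\<bar> \<bar>of_int n\<bar> \<le> (1 + (1 + norm z) / Im z) * norm (of_int m * z + of_int n)"
proof -
  let ?w = "of_int m * z + of_int n"
  have "\<bar>of_int m * Im z\<bar> \<le> norm ?w" using abs_Im_le_cmod[of ?w] by simp
  hence m: "\<bar>of_int m\<bar> \<le> norm ?w / Im z" using assms by (simp add: field_simps abs_mult)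
  have "norm (of_int n :: complex) \<le> norm ?w + norm (of_int m * z)"
    by (metis add_diff_cancel_left' norm_triangle_ineq4)
  hence "\<bar>of_int n\<bar> \<le> norm ?w + \<bar>of_int m\<bar> * norm z" by (simp add: norm_mult)
  also have "\<dots> \<le> norm ?w + norm ?w / Im z * norm z"
    using m by (intro add_mono mult_right_mono) auto
  finally have "\<bar>of_int n\<bar> \<le> norm ?w + norm ?w / Im z * norm z" .
  also have "\<dots> = (1 + norm z / Im z) * norm ?w" by (simp add: algebra_simps)
  also have "\<dots> \<le> (1 + (1 + norm z) / Im z) * norm ?w"
    using assms by (intro mult_right_mono add_left_mono divide_right_mono) auto
  finally have "\<bar>of_int n\<bar> \<le> (1 + (1 + norm z) / Im z) * norm ?w" .
  moreover have "norm ?w / Im z \<le> (1 + (1 + norm z) / Im z) * norm ?w"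
  proof -
    have "1 / Im z \<le> 1 + (1 + norm z) / Im z" using assms by (simp add: field_simps)
    from mult_right_mono[OF this norm_ge_zero[of ?w]] show ?thesis by simp
  qed
  ultimately show ?thesis using m by (intro max.boundedI) auto
qed

lemma summable_on_inverse_square_int: "(\<lambda>n::int. 1 / (1 + \<bar>of_int n\<bar>) ^ 2 :: real) summable_on UNIV"
proof -
  have s: "(\<lambda>n::nat. 1 / (1 + real n) ^ 2) summable_on UNIV"
    using summable_nonneg_imp_summable_on[of "\<lambda>n. 1 / (1 + real n) ^ 2"] inverse_squares_sums
    by (auto simp: sums_iff add_ac)
  have 1: "(\<lambda>n::int. 1 / (1 + \<bar>of_int n\<bar>) ^ 2 :: real) summable_on (range int)"
    using s by (subst summable_on_reindex) (auto simp: o_def)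
  have 2: "(\<lambda>n::int. 1 / (1 + \<bar>of_int n\<bar>) ^ 2 :: real) summable_on (range (\<lambda>n. - int n))"
    using s by (subst summable_on_reindex) (auto simp: o_def inj_on_def)
  have "UNIV = range int \<union> range (\<lambda>n. - int n)"
    by (auto simp: image_iff) (metis int_cases2)
  thus ?thesis using summable_on_union[OF 1 2] by simp
qed

text \<open>With M the maximum of |m| and |n|, the product (1 + |m|)(1 + |n|) is at most 4 M^2 off
  the origin, and its square at most 16 M^4; this is where p >= 4 enters. The origin contributes 0
  because 1 / 0 = 0.\<close>

lemma summable_on_lattice:
  fixes z :: complex
  assumes z: "Im z > 0" and p: "p \<ge> 4"
  shows "(\<lambda>(m::int,n::int). 1 / norm (of_int m * z + of_int n) ^ p) summable_on UNIV"
proof (rule summable_on_comparison_test)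
  define C where "C = 1 + (1 + norm z) / Im z"
  have C: "C > 0" using z by (auto simp: C_def intro!: add_pos_nonneg)
  let ?g = "\<lambda>n::int. 1 / (1 + \<bar>of_int n\<bar>) ^ 2 :: real"
  have "(\<lambda>(m,n). ?g m * ?g n) summable_on (UNIV \<times> UNIV)"
  proof (rule summable_on_SigmaI[where g = "\<lambda>m. ?g m * infsum ?g UNIV"])
    show "((\<lambda>n. case (m, n) of (m, n) \<Rightarrow> ?g m * ?g n) has_sum ?g m * infsum ?g UNIV) UNIV" for m
      using has_sum_cmult_right[OF has_sum_infsum[OF summable_on_inverse_square_int], of "?g m"] by simp
    show "(\<lambda>m. ?g m * infsum ?g UNIV) summable_on UNIV"
      by (intro summable_on_cmult_left summable_on_inverse_square_int)
  qed auto
  thus "(\<lambda>x. 16 * C ^ p * (case x of (m,n) \<Rightarrow> ?g m * ?g n)) summable_on UNIV"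
    by (intro summable_on_cmult_right) simp
next
  fix x :: "int \<times> int"
  define C where "C = 1 + (1 + norm z) / Im z"
  have C: "C > 0" using z by (auto simp: C_def intro!: add_pos_nonneg)
  obtain m n where x: "x = (m, n)" by force
  show "(case x of (m,n) \<Rightarrow> 1 / norm (of_int m * z + of_int n) ^ p) \<le>
     16 * C ^ p * (case x of (m,n) \<Rightarrow> 1 / (1 + \<bar>of_int m\<bar>) ^ 2 * (1 / (1 + \<bar>of_int n\<bar>) ^ 2))"
  proof (cases "m = 0 \<and> n = 0")
    case True
    thus ?thesis using C p by (simp add: x power_0_left)
  next
    case False
    define M where "M = max \<bar>of_int m\<bar> \<bar>of_int n :: real\<bar>"
    have M1: "M \<ge> 1" using False unfolding M_def
      by (cases "m = 0") (auto simp: le_max_iff_disj)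
    define w where "w = norm (of_int m * z + of_int n)"
    have Mw: "M \<le> C * w" using max_abs_le_norm_lattice[OF z, of m n] by (simp add: C_def w_def M_def)
    have w: "w > 0" using Mw M1 C by (metis less_le_trans less_numeral_extra(1) mult.commute zero_less_mult_pos2)
    have "(1 + \<bar>of_int m\<bar>) * (1 + \<bar>of_int n\<bar>) \<le> (2 * M) * (2 * M)"
      using M1 by (intro mult_mono) (auto simp: M_def)
    hence "((1 + \<bar>of_int m\<bar>) * (1 + \<bar>of_int n\<bar>)) ^ 2 \<le> (4 * M ^ 2) ^ 2"
      by (intro power_mono) (auto simp: power2_eq_square)
    also have "\<dots> = 16 * M ^ 4" by (simp add: power_mult_distrib)
    also have "\<dots> \<le> 16 * M ^ p" using M1 p by (intro mult_left_mono power_increasing) auto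
    also have "\<dots> \<le> 16 * (C * w) ^ p" using M1 Mw by (intro mult_left_mono power_mono) auto
    finally have "((1 + \<bar>of_int m\<bar>) * (1 + \<bar>of_int n\<bar>)) ^ 2 \<le> 16 * C ^ p * w ^ p"
      by (simp add: power_mult_distrib)
    moreover have "1 / a \<le> c / b" if "b \<le> c * a" "0 < a" "0 < b" for a b c :: real
      using that by (simp add: field_simps)
    moreover have "((1 + \<bar>of_int m\<bar>) * (1 + \<bar>of_int n\<bar> :: real)) ^ 2 > 0"
      by (intro zero_less_power mult_pos_pos) auto
    ultimately have "1 / w ^ p \<le> 16 * C ^ p / ((1 + \<bar>of_int m\<bar>) * (1 + \<bar>of_int n\<bar>)) ^ 2"
      using w by simp
    thus ?thesis by (simp add: x w_def power_mult_distrib)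
  qed
qed auto

lemma summable_on_lattice_row:
  fixes w :: complex
  assumes "Im w > 0" "p \<ge> 4"
  shows "(\<lambda>n::int. 1 / (w + of_int n) ^ p) summable_on UNIV"
proof -
  have "(\<lambda>(m::int,n::int). 1 / norm (of_int m * w + of_int n) ^ p) summable_on (Pair 1 ` UNIV)"
    by (rule summable_on_subset[OF summable_on_lattice[OF assms]]) auto
  hence "(\<lambda>n::int. 1 / norm (w + of_int n) ^ p) summable_on UNIV"
    by (subst (asm) summable_on_reindex) (auto simp: inj_on_def o_def)
  hence "(\<lambda>n::int. norm (1 / (w + of_int n) ^ p)) summable_on UNIV"
    by (simp only: norm_divide norm_power norm_one)
  thus ?thesis by (rule abs_summable_summable)
qed

text \<open>The integers n >= 0 give the Polygamma series at w, the integers n < 0, written as -(i +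
  1), the one at 1 - w. Together they form \<open>polysum\<close>, whose q-expansion is
  known.\<close>

lemma lipschitz_has_sum:
  fixes w :: complex
  assumes w: "Im w > 0" and j: "j \<ge> 3"
  shows "((\<lambda>n::int. 1 / (w + of_int n) ^ Suc j) has_sum
            ((- 2 * pi * \<i>) ^ Suc j / fact j * powsum j (nome w))) UNIV"
proof -
  have w0: "w \<noteq> 0" "1 - w \<noteq> 0" using w by auto
  let ?f = "\<lambda>n::int. 1 / (w + of_int n) ^ Suc j"
  have summ: "?f summable_on A" for A
    by (rule summable_on_subset[OF summable_on_lattice_row]) (use w j in auto)
  have 1: "(?f has_sum ((-1) ^ Suc j / fact j * Polygamma j w)) (range int)"
  proof -
    have "(?f \<circ> int) summable_on UNIV"
      using summ[of "range int"] by (subst (asm) summable_on_reindex) auto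
    then obtain S where S: "(?f \<circ> int has_sum S) UNIV" unfolding summable_on_def by blast
    have "(\<lambda>k. inverse ((w + of_nat k) ^ Suc j)) sums S"
      using has_sum_imp_sums[OF S] by (simp add: o_def inverse_eq_divide)
    from sums_unique[OF this] have "S = (-1) ^ Suc j / fact j * Polygamma j w"
      using j by (simp add: Polygamma_def)
    thus ?thesis using S by (subst has_sum_reindex) auto
  qed
  have 2: "(?f has_sum ((-1) ^ Suc j / fact j * ((-1) ^ Suc j * Polygamma j (1 - w)))) (range (\<lambda>n. - int (Suc n)))"
  proof -
    have inj: "inj (\<lambda>n. - int (Suc n))" by (auto simp: inj_on_def)
    have "(?f \<circ> (\<lambda>n. - int (Suc n))) summable_on UNIV"
      using summ[of "range (\<lambda>n. - int (Suc n))"] by (subst (asm) summable_on_reindex) (use inj in auto)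
    then obtain S where S: "(?f \<circ> (\<lambda>n. - int (Suc n)) has_sum S) UNIV" unfolding summable_on_def by blast
    have "(\<lambda>k. (-1) ^ Suc j * inverse ((1 - w + of_nat k) ^ Suc j)) sums S"
    proof -
      have "1 / (w + of_int (- int (Suc k))) ^ Suc j = (-1) ^ Suc j * inverse ((1 - w + of_nat k) ^ Suc j)" for k
      proof -
        have "w + of_int (- int (Suc k)) = (-1) * (1 - w + of_nat k)" by simp
        thus ?thesis by (simp only: power_mult_distrib) (cases "even j"; simp add: inverse_eq_divide)
      qed
      thus ?thesis using has_sum_imp_sums[OF S] by (simp add: o_def)
    qed
    moreover have "(\<lambda>k. (-1) ^ Suc j * inverse ((1 - w + of_nat k) ^ Suc j)) sums
         ((-1) ^ Suc j * (\<Sum>k. inverse ((1 - w + of_nat k) ^ Suc j)))"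
      using j w0 by (intro sums_mult summable_sums Polygamma_converges') auto
    ultimately have "S = (-1) ^ Suc j * (\<Sum>k. inverse ((1 - w + of_nat k) ^ Suc j))"
      by (rule sums_unique2)
    hence "S = (-1) ^ Suc j / fact j * ((-1) ^ Suc j * Polygamma j (1 - w))"
      using j by (simp add: Polygamma_def)
    thus ?thesis using S inj by (subst has_sum_reindex) auto
  qed
  have "x \<in> range int \<union> range (\<lambda>n. - int (Suc n))" for x
    by (cases x rule: int_cases) blast+
  hence Un: "range int \<union> range (\<lambda>n. - int (Suc n)) = UNIV" by blast
  have disj: "range int \<inter> range (\<lambda>n. - int (Suc n)) = {}" by auto
  have "(?f has_sum ((-1) ^ Suc j / fact j * Polygamma j w +
     (-1) ^ Suc j / fact j * ((-1) ^ Suc j * Polygamma j (1 - w)))) UNIV"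
    using has_sum_Un_disjoint[OF 1 2 disj] unfolding Un .
  also have "(-1) ^ Suc j / fact j * Polygamma j w +
     (-1) ^ Suc j / fact j * ((-1) ^ Suc j * Polygamma j (1 - w)) = (-1) ^ Suc j / fact j * polysum j w"
    by (simp add: polysum_def algebra_simps)
  also have "polysum j w = (2 * pi * \<i>) ^ Suc j * powsum j (nome w)"
    using polysum_nome[OF w, of "j - 1"] j by simp
  also have "(-1) ^ Suc j / fact j * ((2 * pi * \<i>) ^ Suc j * powsum j (nome w)) =
               ((-1) * (2 * pi * \<i>)) ^ Suc j / fact j * powsum j (nome w)"
    by (simp only: power_mult_distrib) simp
  finally show ?thesis by simp
qed

section \<open>Even zeta values and Bernoulli numbers\<close>

definition zeta_nat :: "nat \<Rightarrow> real" where
  "zeta_nat k = (\<Sum>n. 1 / real (Suc n) ^ k)"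

text \<open>Both sides are the coefficient of z^k in pi z cot(pi z) - pi i z = c z / (exp(c z) - 1),
  c = 2 pi i. The right-hand form is the Bernoulli generating function in the variable c z. The
  left-hand form is 1 + z g(z) - pi i z, where the Taylor coefficients of g are Polygamma values at
  1, that is, zeta values.\<close>

lemma bernoulli_zeta:
  assumes k: "even k" "k \<ge> 2"
  shows "of_real (bernoulli k) * (2 * complex_of_real pi * \<i>) ^ k / fact k = - 2 * complex_of_real (zeta_nat k)"
proof -
  define c where "c = 2 * complex_of_real pi * \<i>"
  have c0: "c \<noteq> 0" by (simp add: c_def)
  \<comment> \<open>psi(z) has a pole at 0. Using psi(1 + z) = psi(z) + 1 / z instead leaves a
    function holomorphic in the whole unit disc.\<close>
  define g where "g = (\<lambda>z::complex. Digamma (1 - z) - Digamma (1 + z))"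
  have nI: "w \<notin> \<int>\<^sub>\<le>\<^sub>0" if "norm (1 - w) < 1" for w :: complex
  proof
    assume "w \<in> \<int>\<^sub>\<le>\<^sub>0"
    then obtain n where n: "w = of_int n" "n \<le> 0" by (auto elim: nonpos_Ints_cases)
    hence "norm (1 - w) = \<bar>of_int (1 - n)\<bar>" by (metis norm_of_int of_int_1 of_int_diff)
    with that n show False by auto
  qed
  have hol: "Polygamma 0 holomorphic_on ball (1::complex) 1"
    by (rule holomorphic_on_Polygamma) (auto simp: dist_norm disjoint_iff dest: nI)
  have hol1: "(\<lambda>z. Digamma (1 - z)) holomorphic_on ball (0::complex) 1"
    by (rule holomorphic_on_compose_gen[OF _ hol, of "\<lambda>z. 1 - z" "ball 0 1", unfolded o_def])
       (auto simp: dist_norm intro!: holomorphic_intros)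
  have hol2: "(\<lambda>z. Digamma (1 + z)) holomorphic_on ball (0::complex) 1"
    by (rule holomorphic_on_compose_gen[OF _ hol, of "\<lambda>z. 1 + z" "ball 0 1", unfolded o_def])
       (auto simp: dist_norm intro!: holomorphic_intros)
  have ghol: "g holomorphic_on ball 0 1" unfolding g_def
    by (intro holomorphic_intros hol1 hol2)
  define G where "G = fps_expansion g 0"
  have G: "g has_fps_expansion G" unfolding G_def
    by (rule has_fps_expansion_fps_expansion[OF _ _ ghol]) auto
  have eq: "(z * g z + 1 - pi * \<i> * z) * (exp (c * z) - 1) = c * z" if z: "norm z < 1" for z
  proof (cases "z = 0")
    case False
    have zI: "z \<notin> \<int>"
    proof
      assume "z \<in> \<int>"
      then obtain n where "z = of_int n" by (auto elim: Ints_cases)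
      with z False show False by auto
    qed
    have "Digamma (1 - z) = Digamma z + pi * cot (complex_of_real pi * z)"
      using polysum_0[OF zI] by (simp add: polysum_def algebra_simps)
    hence "g z = pi * cot (complex_of_real pi * z) - 1 / z"
      using Digamma_plus1[of z] False by (simp add: g_def add.commute)
    hence 1: "z * g z + 1 = pi * z * cot (complex_of_real pi * z)"
      using False by (simp add: right_diff_distrib)
    have 2: "exp (c * z) = nome z" by (simp add: c_def nome_def)
    have "(z * g z + 1 - pi * \<i> * z) * (exp (c * z) - 1) =
       pi * z * (cot (complex_of_real pi * z) * (nome z - 1)) - pi * \<i> * z * (nome z - 1)"
      unfolding 1 2 by (simp only: left_diff_distrib mult.assoc)
    also have "\<dots> = c * z" unfolding cot_nome[OF zI] by (simp add: c_def algebra_simps)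
    finally show ?thesis .
  qed auto
  have F1: "(\<lambda>z. (z * g z + 1 - pi * \<i> * z) * (exp (c * z) - 1)) has_fps_expansion
          (fps_X * G + 1 - fps_const (pi * \<i>) * fps_X) * (fps_exp c - 1)"
    by (intro fps_expansion_intros G)
  have "eventually (\<lambda>z. z \<in> ball 0 1) (nhds (0::complex))"
    by (intro eventually_nhds_in_open) auto
  hence "eventually (\<lambda>z. (z * g z + 1 - pi * \<i> * z) * (exp (c * z) - 1) = c * z) (nhds 0)"
    by eventually_elim (use eq in auto)
  from F1 has_fps_expansion_cong[OF this refl]
  have "(\<lambda>z. c * z) has_fps_expansion (fps_X * G + 1 - fps_const (pi * \<i>) * fps_X) * (fps_exp c - 1)"
    by blast
  moreover have "(\<lambda>z. c * z) has_fps_expansion (fps_const c * fps_X)"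
    by (intro fps_expansion_intros)
  ultimately have eqG: "(fps_X * G + 1 - fps_const (pi * \<i>) * fps_X) * (fps_exp c - 1) = fps_const c * fps_X"
    by (rule fps_expansion_unique_complex)
  define b where "b = fps_X / (fps_exp 1 - 1 :: real fps)"
  have sd: "subdegree (fps_exp 1 - 1 :: real fps) = 1"
    by (rule subdegreeI) auto
  have b: "b * (fps_exp 1 - 1) = fps_X"
  proof -
    have nz: "fps_exp 1 - 1 \<noteq> (0 :: real fps)" using sd by (metis subdegree_0 zero_neq_one)
    have "fps_exp 1 - 1 dvd (fps_X :: real fps)"
      using nz sd by (subst fps_dvd_iff) auto
    thus ?thesis unfolding b_def by (rule dvd_div_mult_self)
  qed
  define b' where "b' = Abs_fps (\<lambda>n. of_real (fps_nth b n) * c ^ n)"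
  have b': "b' * (fps_exp c - 1) = fps_const c * fps_X"
  proof (rule fps_ext)
    fix n
    have "fps_nth (b' * (fps_exp c - 1)) n = (\<Sum>i=0..n. of_real (fps_nth b i) * c ^ i * fps_nth (fps_exp c - 1) (n - i))"
      by (simp add: fps_mult_nth b'_def)
    also have "\<dots> = (\<Sum>i=0..n. c ^ n * of_real (fps_nth b i * fps_nth (fps_exp 1 - 1) (n - i)))"
    proof (intro sum.cong refl)
      fix i assume "i \<in> {0..n}"
      hence cn: "c ^ i * c ^ (n - i) = c ^ n" by (simp add: power_add[symmetric])
      have "fps_nth (fps_exp c - 1) m = c ^ m * of_real (fps_nth (fps_exp 1 - 1) m)" for m
        by (cases "m = 0") auto
      hence "of_real (fps_nth b i) * c ^ i * fps_nth (fps_exp c - 1) (n - i) =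
          (c ^ i * c ^ (n - i)) * of_real (fps_nth b i * fps_nth (fps_exp 1 - 1) (n - i))"
        by (simp only: of_real_mult mult_ac)
      thus "of_real (fps_nth b i) * c ^ i * fps_nth (fps_exp c - 1) (n - i) = c ^ n * of_real (fps_nth b i * fps_nth (fps_exp 1 - 1) (n - i))"
        by (simp only: cn)
    qed
    also have "\<dots> = c ^ n * of_real (fps_nth (b * (fps_exp 1 - 1)) n)"
      by (simp add: fps_mult_nth sum_distrib_left)
    also have "\<dots> = fps_nth (fps_const c * fps_X) n" by (cases "n = 1") (auto simp: b fps_X_nth)
    finally show "fps_nth (b' * (fps_exp c - 1)) n = fps_nth (fps_const c * fps_X) n" .
  qed
  have "fps_exp c - 1 \<noteq> (0 :: complex fps)"
  proof
    assume "fps_exp c - 1 = (0 :: complex fps)"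
    from arg_cong[OF this, of "\<lambda>f. fps_nth f 1"] show False using c0 by simp
  qed
  moreover have "b' * (fps_exp c - 1) = (fps_X * G + 1 - fps_const (pi * \<i>) * fps_X) * (fps_exp c - 1)"
    by (simp only: eqG b')
  ultimately have bG: "b' = fps_X * G + 1 - fps_const (pi * \<i>) * fps_X"
    by (rule mult_right_cancel[THEN iffD1])
  obtain j where j: "k = Suc j" "odd j" using k by (cases k) auto
  have "fps_nth b' k = fps_nth (fps_X * G) k + fps_nth 1 k - fps_nth (fps_const (pi * \<i>) * fps_X) k"
    by (simp only: bG fps_add_nth fps_sub_nth)
  also have "\<dots> = fps_nth G j" using j k by (auto simp: j(1) elim: oddE)
  also have "fps_nth G j = (deriv ^^ j) g 0 / fact j" by (simp add: G_def fps_expansion_def)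
  also have "(deriv ^^ j) g 0 = (deriv ^^ j) (\<lambda>w. Digamma (1 - w)) 0 - (deriv ^^ j) (\<lambda>w. Digamma (1 + w)) 0"
    unfolding g_def
    by (rule higher_deriv_diff[where S = "ball 0 1"])
       (use hol1 hol2 in auto)
  also have "(deriv ^^ j) (\<lambda>w. Digamma (1 - w)) 0 = (-1) ^ j * Polygamma j (1 :: complex)"
  proof -
    have "(deriv ^^ j) (\<lambda>w. Digamma ((-1) * w + 1)) (0::complex) = (-1) ^ j * (deriv ^^ j) Digamma ((-1) * 0 + 1)"
      by (rule higher_deriv_compose_linear'[OF hol, where S = "ball 0 1"]) (auto simp: dist_norm)
    thus ?thesis using nI[of 1] by (simp add: higher_deriv_Polygamma)
  qed
  also have "(deriv ^^ j) (\<lambda>w. Digamma (1 + w)) 0 = Polygamma j (1 :: complex)"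
  proof -
    have "(deriv ^^ j) (\<lambda>w. Digamma (1 * w + 1)) (0::complex) = 1 ^ j * (deriv ^^ j) Digamma (1 * 0 + 1)"
      by (rule higher_deriv_compose_linear'[OF hol, where S = "ball 0 1"]) (auto simp: dist_norm)
    thus ?thesis using nI[of 1] by (simp add: higher_deriv_Polygamma add.commute)
  qed
  finally have 1: "fps_nth b' k = - 2 * Polygamma j 1 / fact j" using j by simp
  have "Polygamma j (1 :: real) = fact j * zeta_nat k"
    using j by (auto simp: Polygamma_def zeta_nat_def inverse_eq_divide add_ac odd_pos)
  hence "Polygamma j (1 :: complex) = fact j * of_real (zeta_nat k)"
    using Polygamma_of_real[of 1 j, where 'a = complex] by simp
  hence 2: "fps_nth b' k = - 2 * of_real (zeta_nat k)" using 1 by simp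
  have 3: "fps_nth b' k = of_real (bernoulli k) * c ^ k / fact k"
  proof -
    have "bernoulli k = fact k * fps_nth b k" by (simp only: bernoulli_def b_def)
    thus ?thesis by (simp add: b'_def)
  qed
  show ?thesis using 2 unfolding 3 c_def .
qed

section \<open>The two halves of the Eisenstein series\<close>

abbreviation lat :: "complex \<Rightarrow> int \<Rightarrow> int \<Rightarrow> complex" where
  "lat z m n \<equiv> of_int m * z + of_int n"

definition eis_A :: "nat \<Rightarrow> complex \<Rightarrow> complex" where
  "eis_A k z = (\<Sum>\<^sub>\<infinity>(m,n)\<in>(UNIV :: (int \<times> int) set). of_int n / lat z m n ^ Suc k) / 2"

definition eis_B :: "nat \<Rightarrow> complex \<Rightarrow> complex" where
  "eis_B k z = (\<Sum>\<^sub>\<infinity>(m,n)\<in>(UNIV :: (int \<times> int) set). of_int m / lat z m n ^ Suc k) / 2"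

lemma lat_eq_0_iff: "Im z > 0 \<Longrightarrow> lat z m n = 0 \<longleftrightarrow> m = 0 \<and> n = 0"
  by (auto simp: complex_eq_iff)

text \<open>The numerator is at most a constant times |m z + n|, so it cancels one power of the
  denominator and the exponent k >= 4 remains.\<close>

lemma abs_summable_lat:
  fixes a :: "int \<Rightarrow> int \<Rightarrow> int"
  assumes z: "Im z > 0" and k: "k \<ge> 4" and a: "\<And>m n. \<bar>a m n\<bar> \<le> max \<bar>m\<bar> \<bar>n\<bar>"
  shows "(\<lambda>(m,n). norm (of_int (a m n) / lat z m n ^ Suc k)) summable_on (UNIV :: (int \<times> int) set)"
proof (rule summable_on_comparison_test)
  define C where "C = 1 + (1 + norm z) / Im z"
  show "(\<lambda>x. C * (case x of (m,n) \<Rightarrow> 1 / norm (lat z m n) ^ k)) summable_on UNIV"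
    by (intro summable_on_cmult_right summable_on_lattice z k)
  fix x :: "int \<times> int"
  obtain m n where x: "x = (m, n)" by force
  have "norm (of_int (a m n) / lat z m n ^ Suc k) \<le> C * (1 / norm (lat z m n) ^ k)"
  proof (cases "lat z m n = 0")
    case False
    have "\<bar>of_int (a m n)\<bar> \<le> max \<bar>of_int m\<bar> \<bar>of_int n :: real\<bar>" using a[of m n]
      by (simp add: le_max_iff_disj) linarith
    also have "\<dots> \<le> C * norm (lat z m n)" using max_abs_le_norm_lattice[OF z] by (simp add: C_def)
    finally have "\<bar>of_int (a m n)\<bar> / norm (lat z m n) ^ Suc k \<le> C * norm (lat z m n) / norm (lat z m n) ^ Suc k"
      by (rule divide_right_mono) auto
    also have "\<dots> = C * (1 / norm (lat z m n) ^ k)" using False by simp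
    finally show ?thesis by (simp only: norm_divide norm_power norm_of_int)
  next
    case True
    thus ?thesis using k by (simp add: power_0_left)
  qed
  thus "(case x of (m,n) \<Rightarrow> norm (of_int (a m n) / lat z m n ^ Suc k)) \<le>
          C * (case x of (m,n) \<Rightarrow> 1 / norm (lat z m n) ^ k)" by (simp add: x)
qed auto

lemma summable_lat:
  fixes a :: "int \<Rightarrow> int \<Rightarrow> int"
  assumes "Im z > 0" "k \<ge> 4" "\<And>m n. \<bar>a m n\<bar> \<le> max \<bar>m\<bar> \<bar>n\<bar>"
  shows "(\<lambda>(m,n). of_int (a m n) / lat z m n ^ Suc k) summable_on (UNIV :: (int \<times> int) set)"
  using abs_summable_summable[of "\<lambda>(m,n). of_int (a m n) / lat z m n ^ Suc k" UNIV] abs_summable_lat[OF assms]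
  by (simp add: case_prod_unfold)

lemma has_sum_eis_A:
  assumes "Im z > 0" "k \<ge> 4"
  shows "((\<lambda>(m,n). of_int n / lat z m n ^ Suc k) has_sum (2 * eis_A k z)) UNIV"
  using has_sum_infsum[OF summable_lat[OF assms, of "\<lambda>m n. n"]] by (simp add: eis_A_def)

lemma has_sum_eis_B:
  assumes "Im z > 0" "k \<ge> 4"
  shows "((\<lambda>(m,n). of_int m / lat z m n ^ Suc k) has_sum (2 * eis_B k z)) UNIV"
  using has_sum_infsum[OF summable_lat[OF assms, of "\<lambda>m n. m"]] by (simp add: eis_B_def)

lemma has_sum_eis:
  assumes z: "Im z > 0" and k: "k \<ge> 4"
  shows "((\<lambda>(m,n). 1 / lat z m n ^ k) has_sum (2 * (z * eis_B k z + eis_A k z))) UNIV"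
proof -
  have "((\<lambda>x. z * (case x of (m,n) \<Rightarrow> of_int m / lat z m n ^ Suc k) + (case x of (m,n) \<Rightarrow> of_int n / lat z m n ^ Suc k))
          has_sum (z * (2 * eis_B k z) + 2 * eis_A k z)) UNIV"
    by (intro has_sum_add has_sum_cmult_right has_sum_eis_A has_sum_eis_B z k)
  moreover have "z * (case x of (m,n) \<Rightarrow> of_int m / lat z m n ^ Suc k) + (case x of (m,n) \<Rightarrow> of_int n / lat z m n ^ Suc k) =
     (case x of (m,n) \<Rightarrow> 1 / lat z m n ^ k)" for x
  proof -
    obtain m n where x: "x = (m, n)" by force
    show ?thesis
    proof (cases "lat z m n = 0")
      case True
      thus ?thesis using k lat_eq_0_iff[OF z, of m n] by (simp add: x power_0_left)
    next
      case False
      have "z * (of_int m / lat z m n ^ Suc k) + of_int n / lat z m n ^ Suc k = lat z m n / lat z m n ^ Suc k"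
        by (simp add: add_divide_distrib mult.commute)
      also have "\<dots> = 1 / lat z m n ^ k" using False by simp
      finally show ?thesis by (simp add: x)
    qed
  qed
  ultimately show ?thesis by (simp add: algebra_simps)
qed

section \<open>Action of the modular group and of the reflection on the two halves\<close>

lemma moebius_denom_nonzero:
  assumes "Im z > 0" "a * d - b * c = (1::int)"
  shows "of_int c * z + of_int d \<noteq> 0"
proof
  assume "of_int c * z + of_int d = 0"
  hence "c = 0 \<and> d = 0" using lat_eq_0_iff[OF assms(1)] by blast
  with assms(2) show False by simp
qed

lemma Im_moebius_int:
  assumes z: "Im z > 0" and det: "a * d - b * c = (1::int)"
  shows "Im (moebius_int a b c d z) = Im z / norm (of_int c * z + of_int d) ^ 2"
proof -
  have det': "real_of_int a * real_of_int d - real_of_int b * real_of_int c = 1"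
    using det by (metis of_int_1 of_int_diff of_int_mult)
  have "Im (moebius_int a b c d z) =
     ((of_int a * Im z) * (of_int c * Re z + of_int d) - (of_int a * Re z + of_int b) * (of_int c * Im z)) /
       norm (of_int c * z + of_int d) ^ 2"
    by (simp add: moebius_def Im_divide cmod_power2)
  also have "(of_int a * Im z) * (of_int c * Re z + of_int d) - (of_int a * Re z + of_int b) * (of_int c * Im z) =
      Im z * (real_of_int a * real_of_int d - real_of_int b * real_of_int c)"
    by (simp add: algebra_simps)
  finally show ?thesis by (simp add: det')
qed

lemma Im_moebius_int_pos:
  assumes "Im z > 0" "a * d - b * c = (1::int)"
  shows "Im (moebius_int a b c d z) > 0"
  using assms moebius_denom_nonzero[OF assms] by (simp add: Im_moebius_int)

lemma has_sum_diff:
  fixes f g :: "'a \<Rightarrow> complex"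
  assumes "(f has_sum a) A" "(g has_sum b) A"
  shows "((\<lambda>x. f x - g x) has_sum (a - b)) A"
  using has_sum_add[OF assms(1) has_sum_uminusI[OF assms(2)]] by simp

lemma double_cancel:
  fixes X P D C b a :: complex
  assumes "2 * X = P * (D * (2 * b) - C * (2 * a))"
  shows "X = P * (D * b - C * a)"
proof -
  have "P * (D * (2 * b) - C * (2 * a)) = 2 * (P * (D * b - C * a))" by (simp add: algebra_simps)
  with assms show ?thesis by (metis mult_cancel_left zero_neq_numeral)
qed

text \<open>With g the image point and J = c z + d, the lattice spanned by g and 1, multiplied by J,
  is the one spanned by z and 1. Reindexing by (m, n) -> (d m - c n, a n - b m), a bijection because
  the determinant is 1, turns the denominators into those at z and the numerators into linear
  combinations of m and n.\<close>

lemma eis_transform: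
  assumes z: "Im z > 0" and k: "k \<ge> 4" and det: "a * d - b * c = (1::int)"
  shows "eis_B k (moebius_int a b c d z) = (of_int c * z + of_int d) ^ Suc k * (of_int d * eis_B k z - of_int c * eis_A k z)"
    and "eis_A k (moebius_int a b c d z) = (of_int c * z + of_int d) ^ Suc k * (of_int a * eis_A k z - of_int b * eis_B k z)"
proof -
  define g where "g = moebius_int a b c d z"
  define J where "J = of_int c * z + of_int d"
  have J: "J \<noteq> 0" unfolding J_def by (rule moebius_denom_nonzero[OF z det])
  have g: "Im g > 0" unfolding g_def by (rule Im_moebius_int_pos[OF z det])
  define \<phi> where "\<phi> = (\<lambda>(m::int,n::int). (d * m - c * n, a * n - b * m))"
  define \<psi> where "\<psi> = (\<lambda>(m::int,n::int). (a * m + c * n, b * m + d * n))"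
  have 1: "\<psi> (\<phi> x) = x" for x
  proof -
    obtain m n where x: "x = (m, n)" by force
    have "a * (d * m - c * n) + c * (a * n - b * m) = (a * d - b * c) * m"
         "b * (d * m - c * n) + d * (a * n - b * m) = (a * d - b * c) * n" by (simp_all add: algebra_simps)
    thus ?thesis by (simp add: x \<phi>_def \<psi>_def det)
  qed
  have 2: "\<phi> (\<psi> x) = x" for x
  proof -
    obtain m n where x: "x = (m, n)" by force
    have "d * (a * m + c * n) - c * (b * m + d * n) = (a * d - b * c) * m"
         "a * (b * m + d * n) - b * (a * m + c * n) = (a * d - b * c) * n" by (simp_all add: algebra_simps)
    thus ?thesis by (simp add: x \<phi>_def \<psi>_def det)
  qed
  have bij: "bij_betw \<phi> UNIV UNIV" by (rule bij_betwI[of _ _ _ \<psi>]) (auto simp: 1 2)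
  have lat: "lat g (d * m - c * n) (a * n - b * m) * J = lat z m n" for m n
  proof -
    have "g * J = of_int a * z + of_int b" using J by (simp add: g_def moebius_def J_def)
    hence "lat g (d * m - c * n) (a * n - b * m) * J = of_int (d * m - c * n) * (of_int a * z + of_int b) + of_int (a * n - b * m) * J"
      by (simp only: distrib_right mult.assoc)
    also have "\<dots> = of_int ((a * d - b * c) * m) * z + of_int ((a * d - b * c) * n)"
      by (simp add: J_def algebra_simps)
    finally show ?thesis by (simp add: det)
  qed
  have lat': "w / lat g (d * m - c * n) (a * n - b * m) ^ Suc k = J ^ Suc k * (w / lat z m n ^ Suc k)" for w m n
  proof -
    have "lat z m n ^ Suc k = lat g (d * m - c * n) (a * n - b * m) ^ Suc k * J ^ Suc k"
      unfolding lat[symmetric] by (rule power_mult_distrib)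
    moreover have "J ^ Suc k \<noteq> 0" using J by simp
    ultimately show ?thesis by simp
  qed
  have "((\<lambda>(m,n). of_int m / lat g m n ^ Suc k) has_sum (2 * eis_B k g)) UNIV"
    by (rule has_sum_eis_B[OF g k])
  hence "((\<lambda>x. (case \<phi> x of (m,n) \<Rightarrow> of_int m / lat g m n ^ Suc k)) has_sum (2 * eis_B k g)) UNIV"
    by (subst has_sum_reindex_bij_betw[OF bij])
  moreover have "(case \<phi> x of (m,n) \<Rightarrow> of_int m / lat g m n ^ Suc k) =
     J ^ Suc k * (of_int d * (case x of (m,n) \<Rightarrow> of_int m / lat z m n ^ Suc k) - of_int c * (case x of (m,n) \<Rightarrow> of_int n / lat z m n ^ Suc k))" for x
    unfolding \<phi>_def by (cases x) (simp only: prod.case lat', simp add: diff_divide_distrib algebra_simps)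
  ultimately have "((\<lambda>x. J ^ Suc k * (of_int d * (case x of (m,n) \<Rightarrow> of_int m / lat z m n ^ Suc k) - of_int c * (case x of (m,n) \<Rightarrow> of_int n / lat z m n ^ Suc k))) has_sum (2 * eis_B k g)) UNIV"
    by (simp only:)
  moreover have "((\<lambda>x. J ^ Suc k * (of_int d * (case x of (m,n) \<Rightarrow> of_int m / lat z m n ^ Suc k) - of_int c * (case x of (m,n) \<Rightarrow> of_int n / lat z m n ^ Suc k)))
     has_sum (J ^ Suc k * (of_int d * (2 * eis_B k z) - of_int c * (2 * eis_A k z)))) UNIV"
    by (intro has_sum_cmult_right has_sum_diff has_sum_eis_A has_sum_eis_B z k)
  ultimately have "2 * eis_B k g = J ^ Suc k * (of_int d * (2 * eis_B k z) - of_int c * (2 * eis_A k z))"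
    by (rule has_sum_unique)
  thus "eis_B k (moebius_int a b c d z) = (of_int c * z + of_int d) ^ Suc k * (of_int d * eis_B k z - of_int c * eis_A k z)"
    unfolding g_def[symmetric] J_def[symmetric] by (rule double_cancel)
  have "((\<lambda>(m,n). of_int n / lat g m n ^ Suc k) has_sum (2 * eis_A k g)) UNIV"
    by (rule has_sum_eis_A[OF g k])
  hence "((\<lambda>x. (case \<phi> x of (m,n) \<Rightarrow> of_int n / lat g m n ^ Suc k)) has_sum (2 * eis_A k g)) UNIV"
    by (subst has_sum_reindex_bij_betw[OF bij])
  moreover have "(case \<phi> x of (m,n) \<Rightarrow> of_int n / lat g m n ^ Suc k) =
     J ^ Suc k * (of_int a * (case x of (m,n) \<Rightarrow> of_int n / lat z m n ^ Suc k) - of_int b * (case x of (m,n) \<Rightarrow> of_int m / lat z m n ^ Suc k))" for x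
    unfolding \<phi>_def by (cases x) (simp only: prod.case lat', simp add: diff_divide_distrib algebra_simps)
  ultimately have "((\<lambda>x. J ^ Suc k * (of_int a * (case x of (m,n) \<Rightarrow> of_int n / lat z m n ^ Suc k) - of_int b * (case x of (m,n) \<Rightarrow> of_int m / lat z m n ^ Suc k))) has_sum (2 * eis_A k g)) UNIV"
    by (simp only:)
  moreover have "((\<lambda>x. J ^ Suc k * (of_int a * (case x of (m,n) \<Rightarrow> of_int n / lat z m n ^ Suc k) - of_int b * (case x of (m,n) \<Rightarrow> of_int m / lat z m n ^ Suc k)))
     has_sum (J ^ Suc k * (of_int a * (2 * eis_A k z) - of_int b * (2 * eis_B k z)))) UNIV"
    by (intro has_sum_cmult_right has_sum_diff has_sum_eis_A has_sum_eis_B z k)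
  ultimately have "2 * eis_A k g = J ^ Suc k * (of_int a * (2 * eis_A k z) - of_int b * (2 * eis_B k z))"
    by (rule has_sum_unique)
  thus "eis_A k (moebius_int a b c d z) = (of_int c * z + of_int d) ^ Suc k * (of_int a * eis_A k z - of_int b * eis_B k z)"
    unfolding g_def[symmetric] J_def[symmetric] by (rule double_cancel)
qed

lemma bij_neg_fst: "bij_betw (\<lambda>(m::int,n::int). (- m, n)) UNIV UNIV"
  by (rule bij_betwI[of _ _ _ "\<lambda>(m,n). (- m, n)"]) auto

text \<open>Changing the sign of m turns the lattice point over \<open>- cnj z\<close> into the
  conjugate of the one over z. The numerator m of B changes sign, the numerator n of A does
  not.\<close>

lemma eis_reflect:
  assumes z: "Im z > 0" and k: "k \<ge> 4"
  shows "eis_A k (- cnj z) = cnj (eis_A k z)" "eis_B k (- cnj z) = - cnj (eis_B k z)"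
proof -
  have z': "Im (- cnj z) > 0" using z by simp
  have "((\<lambda>x. case (case x of (m,n) \<Rightarrow> (- m, n)) of (m,n) \<Rightarrow> of_int n / lat (- cnj z) m n ^ Suc k) has_sum (2 * eis_A k (- cnj z))) UNIV"
    using has_sum_eis_A[OF z' k] by (subst has_sum_reindex_bij_betw[OF bij_neg_fst])
  moreover have "(case (case x of (m,n) \<Rightarrow> (- m, n)) of (m,n) \<Rightarrow> of_int n / lat (- cnj z) m n ^ Suc k) =
      cnj (case x of (m,n) \<Rightarrow> of_int n / lat z m n ^ Suc k)" for x
    by (cases x) (simp add: add.commute)
  ultimately have "((\<lambda>x. cnj (case x of (m,n) \<Rightarrow> of_int n / lat z m n ^ Suc k)) has_sum (2 * eis_A k (- cnj z))) UNIV"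
    by (simp only:)
  moreover have "((\<lambda>x. cnj (case x of (m,n) \<Rightarrow> of_int n / lat z m n ^ Suc k)) has_sum cnj (2 * eis_A k z)) UNIV"
    using has_sum_eis_A[OF z k] by (simp only: has_sum_cnj_iff)
  ultimately have "2 * eis_A k (- cnj z) = cnj (2 * eis_A k z)" by (rule has_sum_unique)
  thus "eis_A k (- cnj z) = cnj (eis_A k z)" by simp
  have "((\<lambda>x. case (case x of (m,n) \<Rightarrow> (- m, n)) of (m,n) \<Rightarrow> of_int m / lat (- cnj z) m n ^ Suc k) has_sum (2 * eis_B k (- cnj z))) UNIV"
    using has_sum_eis_B[OF z' k] by (subst has_sum_reindex_bij_betw[OF bij_neg_fst])
  moreover have "(case (case x of (m,n) \<Rightarrow> (- m, n)) of (m,n) \<Rightarrow> of_int m / lat (- cnj z) m n ^ Suc k) =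
      - cnj (case x of (m,n) \<Rightarrow> of_int m / lat z m n ^ Suc k)" for x
    by (cases x) (simp add: add.commute)
  ultimately have "((\<lambda>x. - cnj (case x of (m,n) \<Rightarrow> of_int m / lat z m n ^ Suc k)) has_sum (2 * eis_B k (- cnj z))) UNIV"
    by (simp only:)
  moreover have "((\<lambda>x. - cnj (case x of (m,n) \<Rightarrow> of_int m / lat z m n ^ Suc k)) has_sum - cnj (2 * eis_B k z)) UNIV"
    using has_sum_eis_B[OF z k] by (intro has_sum_uminusI) (simp only: has_sum_cnj_iff)
  ultimately have "2 * eis_B k (- cnj z) = - cnj (2 * eis_B k z)" by (rule has_sum_unique)
  thus "eis_B k (- cnj z) = - cnj (eis_B k z)" by simp
qed

text \<open>Since \<open>f\<close> is even, the terms with negative first index double those with positive first index.\<close>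

lemma has_sum_half_lattice:
  fixes f :: "int \<times> int \<Rightarrow> complex"
  assumes S: "(f has_sum S) UNIV" and even: "\<And>m n. f (- m, - n) = f (m, n)"
    and T: "((\<lambda>n. f (0, n)) has_sum T) UNIV"
  shows "((\<lambda>(i::nat,n). f (int (Suc i), n)) has_sum ((S - T) / 2)) UNIV"
proof -
  let ?P = "range (\<lambda>(i::nat,n::int). (int (Suc i), n))"
  let ?N = "range (\<lambda>(i::nat,n::int). (- int (Suc i), - n))"
  let ?Z = "range (\<lambda>n::int. (0::int, n))"
  have injP: "inj (\<lambda>(i::nat,n::int). (int (Suc i), n))" by (auto simp: inj_on_def)
  have injN: "inj (\<lambda>(i::nat,n::int). (- int (Suc i), - n))" by (auto simp: inj_on_def)
  have summ: "f summable_on A" for A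
    using summable_on_subset[of f UNIV A] S has_sum_imp_summable by blast
  obtain H where H: "(f has_sum H) ?P" using summ unfolding summable_on_def by blast
  have H': "((\<lambda>(i::nat,n). f (int (Suc i), n)) has_sum H) UNIV"
    using H by (subst (asm) has_sum_reindex[OF injP]) (simp add: o_def case_prod_unfold)
  have N: "(f has_sum H) ?N"
    using H' by (subst has_sum_reindex[OF injN]) (simp add: o_def case_prod_unfold even del: of_nat_Suc)
  have Z: "(f has_sum T) ?Z"
    using T by (subst has_sum_reindex) (auto simp: inj_on_def o_def)
  have "(f has_sum (H + H + T)) (?P \<union> ?N \<union> ?Z)"
    by (intro has_sum_Un_disjoint H N Z) auto
  moreover have "x \<in> ?P \<union> ?N \<union> ?Z" for x
  proof -
    obtain m n where x: "x = (m, n)" by force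
    consider "m = 0" | i where "m = int (Suc i)" | i where "m = - int (Suc i)"
      by (metis gr0_implies_Suc int_cases2 not_gr_zero of_nat_0 minus_zero of_nat_0)
    thus ?thesis
    proof cases
      case 1 thus ?thesis by (auto simp: x)
    next
      case 2
      hence "x = (\<lambda>(i::nat,n::int). (int (Suc i), n)) (i, n)" by (simp add: x)
      thus ?thesis by blast
    next
      case 3
      hence "x = (\<lambda>(i::nat,n::int). (- int (Suc i), - n)) (i, - n)" by (simp add: x)
      thus ?thesis by blast
    qed
  qed
  hence "?P \<union> ?N \<union> ?Z = UNIV" by blast
  ultimately have "(f has_sum (H + H + T)) UNIV" by simp
  from has_sum_unique[OF this S] have "H = (S - T) / 2" by (simp add: field_simps)
  thus ?thesis using H' by (simp only:)
qed

section \<open>Lambert series and q-expansions\<close>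

lemma summable_on_poly_geometric:
  fixes r :: real
  assumes "0 \<le> r" "r < 1"
  shows "(\<lambda>n::nat. real (Suc n) ^ a * r ^ n) summable_on UNIV"
proof -
  have "summable (\<lambda>n. complex_of_nat n ^ a * of_real r ^ n)" for a
    using assms by (intro summable_powsum) simp
  obtain r' where r': "r < r'" "r' < 1" using assms dense by blast
  have "summable (\<lambda>n. norm (complex_of_nat n ^ a * of_real r' ^ n))"
  proof (cases "r' = 0")
    case False
    obtain r'' where r'': "r' < r''" "r'' < 1" using r' dense by blast
    have "summable (\<lambda>n. complex_of_nat n ^ a * of_real r'' ^ n)"
      using r' r'' assms by (intro summable_powsum) simp
    from powser_insidea[OF this, of "of_real r'"] show ?thesis using r' r'' assms by simp
  qed (use r' assms in auto)
  hence "summable (\<lambda>n. real n ^ a * r' ^ n)" using r' assms by (simp add: norm_mult norm_power)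
  hence "summable (\<lambda>n. real (Suc n) ^ a * r' ^ Suc n)" by (subst summable_Suc_iff)
  hence "summable (\<lambda>n. inverse r' * (real (Suc n) ^ a * r' ^ Suc n))" by (rule summable_mult)
  moreover have "inverse r' * (real (Suc n) ^ a * r' ^ Suc n) = real (Suc n) ^ a * r' ^ n" for n
    using r' assms by simp
  ultimately have *: "summable (\<lambda>n. real (Suc n) ^ a * r' ^ n)" by (simp only:)
  have "summable (\<lambda>n. real (Suc n) ^ a * r ^ n)"
    by (rule summable_comparison_test'[OF *, of 0])
       (use r' assms in \<open>auto simp: abs_mult intro!: mult_left_mono power_mono\<close>)
  thus ?thesis using assms by (intro summable_nonneg_imp_summable_on) auto
qed

text \<open>The double series converges absolutely, so it may be regrouped by the product M = (i +
  1)(N + 1), with d = N + 1 running over the divisors of M.\<close>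

lemma lambert_series:
  fixes q :: complex
  assumes q: "norm q < 1"
  obtains S where "((\<lambda>(i,N). of_nat (Suc i) ^ a * of_nat (Suc N) ^ b * q ^ (Suc i * Suc N)) has_sum S) (UNIV :: (nat \<times> nat) set)"
    and "(\<lambda>M. of_nat (\<Sum>d | d dvd M. (M div d) ^ a * d ^ b) * q ^ M) sums S"
proof -
  let ?f = "\<lambda>(i,N). complex_of_nat (Suc i) ^ a * of_nat (Suc N) ^ b * q ^ (Suc i * Suc N)"
  define r where "r = norm q"
  have r: "0 \<le> r" "r < 1" using q by (auto simp: r_def)
  have "(\<lambda>x. norm (?f x)) summable_on UNIV"
  proof (rule summable_on_comparison_test)
    show "(\<lambda>(i,N). (real (Suc i) ^ a * r ^ i) * (real (Suc N) ^ b * r ^ N)) summable_on UNIV"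
    proof -
      let ?g = "\<lambda>a n. real (Suc n) ^ a * r ^ n"
      have "(\<lambda>(i,N). ?g a i * ?g b N) summable_on (UNIV \<times> UNIV)"
      proof (rule summable_on_SigmaI[where g = "\<lambda>m. ?g a m * infsum (?g b) UNIV"])
        show "((\<lambda>n. case (m, n) of (m, n) \<Rightarrow> ?g a m * ?g b n) has_sum ?g a m * infsum (?g b) UNIV) UNIV" for m
          using has_sum_cmult_right[OF has_sum_infsum[OF summable_on_poly_geometric[OF r, of b]], of "?g a m"] by simp
        show "(\<lambda>m. ?g a m * infsum (?g b) UNIV) summable_on UNIV"
          by (intro summable_on_cmult_left summable_on_poly_geometric r)
      qed (use r in auto)
      thus ?thesis by simp
    qed
    fix x :: "nat \<times> nat"
    obtain i N where x: "x = (i, N)" by force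
    have "norm (?f x) = real (Suc i) ^ a * real (Suc N) ^ b * r ^ (Suc i * Suc N)"
      by (simp add: x norm_mult norm_power r_def del: of_nat_Suc mult_Suc mult_Suc_right)
    also have "\<dots> \<le> real (Suc i) ^ a * real (Suc N) ^ b * r ^ (i + N)"
      using r by (intro mult_left_mono power_decreasing) auto
    finally show "norm (?f x) \<le> (case x of (i,N) \<Rightarrow> (real (Suc i) ^ a * r ^ i) * (real (Suc N) ^ b * r ^ N))"
      by (simp add: x power_add mult_ac)
  qed auto
  hence "?f summable_on UNIV" by (rule abs_summable_summable)
  then obtain S where S: "(?f has_sum S) UNIV" unfolding summable_on_def by blast
  let ?h = "\<lambda>(i,N). (Suc i * Suc N, Suc N)"
  let ?F = "\<lambda>(M,d). of_nat (M div d) ^ a * of_nat d ^ b * q ^ M"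
  let ?Sg = "SIGMA M:{1..}. {d. d dvd M}"
  have bij: "bij_betw ?h UNIV ?Sg"
  proof (rule bij_betwI[of _ _ _ "\<lambda>(M,d). (M div d - 1, d - 1)"])
    show "?h \<in> UNIV \<rightarrow> ?Sg" by (auto simp del: mult_Suc mult_Suc_right)
    show "(\<lambda>(M,d). (M div d - 1, d - 1)) (?h x) = x" for x
      by (cases x) (simp del: mult_Suc mult_Suc_right)
    fix y :: "nat \<times> nat" assume y: "y \<in> ?Sg"
    obtain M d where Md: "y = (M, d)" "M \<ge> 1" "d dvd M" using y by auto
    then obtain e where "M = d * e" by auto
    with Md show "?h ((\<lambda>(M,d). (M div d - 1, d - 1)) y) = y"
      by (cases d; cases e) (auto simp del: mult_Suc mult_Suc_right simp: mult.commute)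
  qed auto
  have "((\<lambda>x. ?F (?h x)) has_sum S) UNIV"
  proof -
    have "?F (?h x) = ?f x" for x by (cases x) (simp del: mult_Suc mult_Suc_right of_nat_Suc)
    thus ?thesis using S by (simp only:)
  qed
  hence "(?F has_sum S) ?Sg" by (subst (asm) has_sum_reindex_bij_betw[OF bij])
  hence "((\<lambda>M. \<Sum>d | d dvd M. of_nat (M div d) ^ a * of_nat d ^ b * q ^ M) has_sum S) {1..}"
    by (rule has_sum_SigmaD) (auto intro!: has_sum_finiteI)
  moreover have "(\<Sum>d | d dvd M. of_nat (M div d) ^ a * of_nat d ^ b * q ^ M) =
       of_nat (\<Sum>d | d dvd M. (M div d) ^ a * d ^ b) * q ^ M" for M
    by (simp add: sum_distrib_right)
  ultimately have "((\<lambda>M. of_nat (\<Sum>d | d dvd M. (M div d) ^ a * d ^ b) * q ^ M) has_sum S) {1..}"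
    by (simp only:)
  \<comment> \<open>For M = 0 the divisors are all of \<open>nat\<close>, an infinite set over which
    the finite sum is 0 by convention; so the index 0 may be added.\<close>
  also have "?this \<longleftrightarrow> ((\<lambda>M. of_nat (\<Sum>d | d dvd M. (M div d) ^ a * d ^ b) * q ^ M) has_sum S) UNIV"
    by (rule has_sum_cong_neutral) (auto simp: not_less_eq_eq)
  finally show ?thesis using S by (intro that has_sum_imp_sums)
qed

lemma nome_of_nat_mult: "nome (of_nat i * z) = nome z ^ i"
  by (simp add: nome_def exp_of_nat_mult[symmetric] mult_ac)

text \<open>Row m >= 1 is summed over n by the Lipschitz formula at m z, whose nome is the m-th
  power of that of z. The row sums are a fixed constant times those of the Lambert double series,
  hence so is the total.\<close>

lemma lattice_rows:
  fixes z :: complex and c :: "nat \<Rightarrow> complex"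
  assumes z: "Im z > 0" and j: "j \<ge> 3"
    and S: "((\<lambda>(i::nat,n::int). of_nat (Suc i) ^ a / lat z (int (Suc i)) n ^ Suc j) has_sum S) UNIV"
  shows "S = (- 2 * pi * \<i>) ^ Suc j / fact j * (\<Sum>M. of_nat (\<Sum>d | d dvd M. (M div d) ^ a * d ^ j) * nome z ^ M)"
    and "summable (\<lambda>M. complex_of_nat (\<Sum>d | d dvd M. (M div d) ^ a * d ^ j) * nome z ^ M)"
proof -
  define C where "C = (- 2 * pi * \<i>) ^ Suc j / fact j"
  have q: "norm (nome z) < 1" by (rule norm_nome_less_1[OF z])
  obtain L where L: "((\<lambda>(i,N). of_nat (Suc i) ^ a * of_nat (Suc N) ^ j * nome z ^ (Suc i * Suc N)) has_sum L) (UNIV :: (nat \<times> nat) set)"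
    "(\<lambda>M. of_nat (\<Sum>d | d dvd M. (M div d) ^ a * d ^ j) * nome z ^ M) sums L"
    by (rule lambert_series[OF q])
  have row: "((\<lambda>n. of_nat (Suc i) ^ a / lat z (int (Suc i)) n ^ Suc j) has_sum
               (of_nat (Suc i) ^ a * (C * powsum j (nome z ^ Suc i)))) UNIV" for i
  proof -
    have "Im (of_nat (Suc i) * z) > 0" using z by simp
    from has_sum_cmult_right[OF lipschitz_has_sum[OF this j], of "of_nat (Suc i) ^ a"] show ?thesis
      by (simp only: C_def nome_of_nat_mult of_int_of_nat_eq times_divide_eq_right mult_1_right mult.assoc)
  qed
  have 1: "((\<lambda>i. of_nat (Suc i) ^ a * (C * powsum j (nome z ^ Suc i))) has_sum S) UNIV"
  proof (rule has_sum_SigmaD[where f = "\<lambda>(i::nat,n::int). of_nat (Suc i) ^ a / lat z (int (Suc i)) n ^ Suc j" and B = "\<lambda>_. UNIV"])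
    show "((\<lambda>(i::nat,n::int). of_nat (Suc i) ^ a / lat z (int (Suc i)) n ^ Suc j) has_sum S) (UNIV \<times> UNIV)"
      using S by (simp only: UNIV_Times_UNIV)
  qed (use row in \<open>simp only: prod.case\<close>)
  have row': "((\<lambda>N. of_nat (Suc i) ^ a * of_nat (Suc N) ^ j * nome z ^ (Suc i * Suc N)) has_sum
               (of_nat (Suc i) ^ a * powsum j (nome z ^ Suc i))) UNIV" for i
  proof -
    have "(\<lambda>(i,N). of_nat (Suc i) ^ a * of_nat (Suc N) ^ j * nome z ^ (Suc i * Suc N)) summable_on (UNIV \<times> UNIV :: (nat \<times> nat) set)"
      using L(1) has_sum_imp_summable by auto
    from summable_on_SigmaD1[OF this, of i]
    obtain R where R: "((\<lambda>N. of_nat (Suc i) ^ a * of_nat (Suc N) ^ j * nome z ^ (Suc i * Suc N)) has_sum R) UNIV"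
      unfolding summable_on_def by auto
    from has_sum_imp_sums[OF this]
    have "(\<lambda>N. of_nat (Suc i) ^ a * of_nat (Suc N) ^ j * nome z ^ (Suc i * Suc N)) sums R" .
    hence "(\<lambda>N. of_nat (Suc i) ^ a * of_nat N ^ j * nome z ^ (Suc i * N)) sums R"
      using j by (subst (asm) sums_Suc_iff) (simp add: power_0_left)
    moreover have "norm (nome z) ^ Suc i \<le> norm (nome z) ^ 1" using q by (intro power_decreasing) auto
    hence "norm (nome z ^ Suc i) < 1" using q unfolding norm_power by simp
    from sums_mult[OF summable_sums[OF summable_powsum[OF this, of j]], of "of_nat (Suc i) ^ a"]
    have "(\<lambda>N. of_nat (Suc i) ^ a * of_nat N ^ j * nome z ^ (Suc i * N)) sums (of_nat (Suc i) ^ a * powsum j (nome z ^ Suc i))"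
      by (simp only: powsum_def power_mult mult.assoc)
    ultimately have "R = of_nat (Suc i) ^ a * powsum j (nome z ^ Suc i)" by (rule sums_unique2)
    with R show ?thesis by (simp only:)
  qed
  have 2: "((\<lambda>i. of_nat (Suc i) ^ a * powsum j (nome z ^ Suc i)) has_sum L) UNIV"
  proof (rule has_sum_SigmaD[where f = "\<lambda>(i,N). of_nat (Suc i) ^ a * of_nat (Suc N) ^ j * nome z ^ (Suc i * Suc N)" and B = "\<lambda>_. UNIV"])
    show "((\<lambda>(i,N). of_nat (Suc i) ^ a * of_nat (Suc N) ^ j * nome z ^ (Suc i * Suc N)) has_sum L) (UNIV \<times> UNIV :: (nat \<times> nat) set)"
      using L(1) by (simp only: UNIV_Times_UNIV)
  qed (use row' in \<open>simp only: prod.case\<close>)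
  have "((\<lambda>i. of_nat (Suc i) ^ a * (C * powsum j (nome z ^ Suc i))) has_sum (C * L)) UNIV"
    using has_sum_cmult_right[OF 2, of C] by (simp only: mult.left_commute)
  from has_sum_unique[OF 1 this] have "S = C * L" .
  thus "S = (- 2 * pi * \<i>) ^ Suc j / fact j * (\<Sum>M. of_nat (\<Sum>d | d dvd M. (M div d) ^ a * d ^ j) * nome z ^ M)"
    unfolding C_def using sums_unique[OF L(2)] by simp
  show "summable (\<lambda>M. complex_of_nat (\<Sum>d | d dvd M. (M div d) ^ a * d ^ j) * nome z ^ M)"
    using L(2) by (rule sums_summable)
qed

lemma has_sum_eis_B_half:
  assumes z: "Im z > 0" and k: "even k" "k \<ge> 4"
  shows "((\<lambda>(i::nat,n::int). of_nat (Suc i) / lat z (int (Suc i)) n ^ Suc k) has_sum eis_B k z) UNIV"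
proof -
  have "((\<lambda>(i::nat,n::int). (\<lambda>(m,n). of_int m / lat z m n ^ Suc k) (int (Suc i), n)) has_sum ((2 * eis_B k z - 0) / 2)) UNIV"
  proof (rule has_sum_half_lattice[OF has_sum_eis_B[OF z k(2)]])
    fix m n :: int
    have lm: "lat z (- m) (- n) = - lat z m n" by simp
    have pw: "(- lat z m n) ^ Suc k = - (lat z m n ^ Suc k)" using k by (intro power_minus_odd) simp
    show "(case (- m, - n) of (m, n) \<Rightarrow> of_int m / lat z m n ^ Suc k) = (case (m, n) of (m, n) \<Rightarrow> of_int m / lat z m n ^ Suc k)"
      unfolding prod.case lm pw by (simp only: of_int_minus minus_divide_divide)
  qed auto
  thus ?thesis by (simp only: prod.case of_int_of_nat_eq) simp
qed

lemma has_sum_int_inverse_power: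
  assumes k: "even k" "k \<ge> 2"
  shows "((\<lambda>n::int. 1 / of_int n ^ k :: complex) has_sum (2 * of_real (zeta_nat k))) UNIV"
proof -
  have "summable (\<lambda>n. 1 / real (Suc n) ^ k)"
    using inverse_power_summable[of k, where 'a = real] k by (subst summable_Suc_iff) (simp add: inverse_eq_divide)
  hence "(\<lambda>n. 1 / real (Suc n) ^ k) sums zeta_nat k" unfolding zeta_nat_def by (rule summable_sums)
  hence "((\<lambda>n. 1 / real (Suc n) ^ k) has_sum zeta_nat k) UNIV" by (intro sums_nonneg_imp_has_sum) auto
  hence "((\<lambda>n. complex_of_real (1 / real (Suc n) ^ k)) has_sum of_real (zeta_nat k)) UNIV" by (rule has_sum_of_real)
  hence *: "((\<lambda>n. 1 / complex_of_nat (Suc n) ^ k) has_sum of_real (zeta_nat k)) UNIV"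
    by (simp only: of_real_divide of_real_power of_real_1 of_real_of_nat_eq)
  have P: "((\<lambda>n::int. 1 / of_int n ^ k :: complex) has_sum of_real (zeta_nat k)) (range (\<lambda>n. int (Suc n)))"
    using * by (subst has_sum_reindex) (auto simp: inj_on_def o_def)
  have N: "((\<lambda>n::int. 1 / of_int n ^ k :: complex) has_sum of_real (zeta_nat k)) (range (\<lambda>n. - int (Suc n)))"
  proof (subst has_sum_reindex)
    have "1 / of_int (- int (Suc n)) ^ k = 1 / complex_of_nat (Suc n) ^ k" for n
      using k by (simp only: of_int_minus power_minus_even of_int_of_nat_eq)
    thus "((\<lambda>n::int. 1 / of_int n ^ k :: complex) \<circ> (\<lambda>n. - int (Suc n)) has_sum of_real (zeta_nat k)) UNIV"
      using * by (simp only: o_def)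
  qed (auto simp: inj_on_def)
  have Z: "((\<lambda>n::int. 1 / of_int n ^ k :: complex) has_sum 0) {0}"
    using k by (intro has_sum_finiteI) (auto simp: power_0_left)
  have "((\<lambda>n::int. 1 / of_int n ^ k :: complex) has_sum (of_real (zeta_nat k) + of_real (zeta_nat k) + 0)) (range (\<lambda>n. int (Suc n)) \<union> range (\<lambda>n. - int (Suc n)) \<union> {0})"
    by (intro has_sum_Un_disjoint P N Z) auto
  moreover have "x \<in> range (\<lambda>n. int (Suc n)) \<union> range (\<lambda>n. - int (Suc n)) \<union> {0}" for x
  proof (cases x rule: int_cases)
    case (nonneg n)
    thus ?thesis by (cases n) auto
  next
    case (neg n)
    thus ?thesis by blast
  qed
  hence "range (\<lambda>n. int (Suc n)) \<union> range (\<lambda>n. - int (Suc n)) \<union> {0} = UNIV" by blast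
  ultimately show ?thesis by simp
qed

lemma has_sum_eis_half:
  assumes z: "Im z > 0" and k: "even k" "k \<ge> 4"
  shows "((\<lambda>(i::nat,n::int). 1 / lat z (int (Suc i)) n ^ k) has_sum (z * eis_B k z + eis_A k z - of_real (zeta_nat k))) UNIV"
proof -
  have "((\<lambda>(i::nat,n::int). (\<lambda>(m,n). 1 / lat z m n ^ k) (int (Suc i), n)) has_sum ((2 * (z * eis_B k z + eis_A k z) - 2 * of_real (zeta_nat k)) / 2)) UNIV"
  proof (rule has_sum_half_lattice[OF has_sum_eis[OF z k(2)]])
    fix m n :: int
    have "lat z (- m) (- n) = - lat z m n" by simp
    thus "(case (- m, - n) of (m, n) \<Rightarrow> 1 / lat z m n ^ k) = (case (m, n) of (m, n) \<Rightarrow> 1 / lat z m n ^ k)"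
      using k by (simp only: prod.case power_minus_even)
  next
    show "((\<lambda>n. case (0, n) of (m, n) \<Rightarrow> 1 / lat z m n ^ k) has_sum 2 * of_real (zeta_nat k)) UNIV"
      using has_sum_int_inverse_power[of k] k by simp
  qed
  moreover have "(2 * (z * eis_B k z + eis_A k z) - 2 * of_real (zeta_nat k)) / 2 = z * eis_B k z + eis_A k z - of_real (zeta_nat k)"
    by (simp add: field_simps)
  ultimately show ?thesis by (simp only: prod.case)
qed

lemma has_sum_eis_A_half:
  assumes z: "Im z > 0" and k: "even k" "k \<ge> 4"
  shows "((\<lambda>(i::nat,n::int). of_int n / lat z (int (Suc i)) n ^ Suc k) has_sum (eis_A k z - of_real (zeta_nat k))) UNIV"
proof -
  have "((\<lambda>(i::nat,n::int). (\<lambda>(m,n). of_int n / lat z m n ^ Suc k) (int (Suc i), n)) has_sum ((2 * eis_A k z - 2 * of_real (zeta_nat k)) / 2)) UNIV"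
  proof (rule has_sum_half_lattice[OF has_sum_eis_A[OF z k(2)]])
    fix m n :: int
    have lm: "lat z (- m) (- n) = - lat z m n" by simp
    have pw: "(- lat z m n) ^ Suc k = - (lat z m n ^ Suc k)" using k by (intro power_minus_odd) simp
    show "(case (- m, - n) of (m, n) \<Rightarrow> of_int n / lat z m n ^ Suc k) = (case (m, n) of (m, n) \<Rightarrow> of_int n / lat z m n ^ Suc k)"
      unfolding prod.case lm pw by (simp only: of_int_minus minus_divide_divide)
  next
    have "of_int n / lat z 0 n ^ Suc k = 1 / of_int n ^ k" for n using k by (cases "n = 0") (auto simp: power_0_left)
    thus "((\<lambda>n. case (0, n) of (m, n) \<Rightarrow> of_int n / lat z m n ^ Suc k) has_sum 2 * of_real (zeta_nat k)) UNIV"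
      using has_sum_int_inverse_power[of k] k by (simp only: prod.case)
  qed
  moreover have "(2 * eis_A k z - 2 * of_real (zeta_nat k)) / 2 = eis_A k z - of_real (zeta_nat k)"
    by (simp add: field_simps)
  ultimately show ?thesis by (simp only: prod.case)
qed

lemma zeta_nat_ge_1:
  assumes "k \<ge> 2"
  shows "zeta_nat k \<ge> 1"
proof -
  have "summable (\<lambda>n. 1 / real (Suc n) ^ k)"
    using inverse_power_summable[of k, where 'a = real] assms by (subst summable_Suc_iff) (simp add: inverse_eq_divide)
  from sum_le_suminf[OF this, of "{0}"] show ?thesis by (simp add: zeta_nat_def)
qed

theorem eis_B_nome_series:
  assumes z: "Im z > 0" and k: "even k" "k \<ge> 4"
  shows "eis_B k z = (- 2 * pi * \<i>) ^ Suc k / fact k * (\<Sum>M. of_nat (M * divisor_sigma (k - 1) M) * nome z ^ M)"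
    and "summable (\<lambda>M. complex_of_nat (M * divisor_sigma (k - 1) M) * nome z ^ M)"
proof -
  have *: "(\<Sum>d | d dvd M. (M div d) ^ 1 * d ^ k) = M * divisor_sigma (k - 1) M" for M
  proof (cases "M = 0")
    case False
    have "(M div d) ^ 1 * d ^ k = M * d ^ (k - 1)" if "d dvd M" for d
    proof -
      have "d ^ k = d * d ^ (k - 1)" using k by (cases k) auto
      thus ?thesis using that by simp
    qed
    thus ?thesis by (simp add: divisor_sigma_def sum_distrib_left)
  qed simp
  have "((\<lambda>(i::nat,n::int). of_nat (Suc i) ^ 1 / lat z (int (Suc i)) n ^ Suc k) has_sum eis_B k z) UNIV"
    using has_sum_eis_B_half[OF z k] by (simp only: power_one_right)
  from lattice_rows[OF z _ this] k
  show "eis_B k z = (- 2 * pi * \<i>) ^ Suc k / fact k * (\<Sum>M. of_nat (M * divisor_sigma (k - 1) M) * nome z ^ M)"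
    and "summable (\<lambda>M. complex_of_nat (M * divisor_sigma (k - 1) M) * nome z ^ M)"
    unfolding * by auto
qed

text \<open>The rows without numerator (a = 0) produce the divisor sums, and
  \<open>bernoulli_zeta\<close> converts the factor (2 pi i)^k / (k - 1)! into the Bernoulli
  normalisation.\<close>

theorem eisenstein_lattice:
  assumes z: "Im z > 0" and k: "even k" "k \<ge> 4"
  shows "of_real (zeta_nat k) * eisenstein k z = z * eis_B k z + eis_A k z"
    and "summable (\<lambda>M. complex_of_nat (divisor_sigma (k - 1) M) * nome z ^ M)"
proof -
  have *: "(\<Sum>d | d dvd M. (M div d) ^ 0 * d ^ (k - 1)) = divisor_sigma (k - 1) M" for M
    by (simp add: divisor_sigma_def)
  have sk: "Suc (k - 1) = k" using k by simp
  have "((\<lambda>(i::nat,n::int). of_nat (Suc i) ^ 0 / lat z (int (Suc i)) n ^ Suc (k - 1)) has_sum (z * eis_B k z + eis_A k z - of_real (zeta_nat k))) UNIV"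
    unfolding sk using has_sum_eis_half[OF z k] by (simp only: power_0)
  from lattice_rows[OF z _ this] k
  have 1: "z * eis_B k z + eis_A k z - of_real (zeta_nat k) = (- 2 * pi * \<i>) ^ k / fact (k - 1) * (\<Sum>M. of_nat (divisor_sigma (k - 1) M) * nome z ^ M)"
    and 2: "summable (\<lambda>M. complex_of_nat (divisor_sigma (k - 1) M) * nome z ^ M)"
    unfolding * sk by auto
  show "summable (\<lambda>M. complex_of_nat (divisor_sigma (k - 1) M) * nome z ^ M)" by fact
  have b: "of_real (bernoulli k) * (2 * complex_of_real pi * \<i>) ^ k / fact k = - 2 * complex_of_real (zeta_nat k)"
    by (rule bernoulli_zeta) (use k in auto)
  have z0: "zeta_nat k \<noteq> 0" using zeta_nat_ge_1[of k] k by auto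
  hence b0: "bernoulli k \<noteq> 0" using b by auto
  have "(- 2 * pi * \<i>) ^ k = (2 * complex_of_real pi * \<i>) ^ k" using k by (simp add: power_minus_even)
  moreover have "fact k = of_nat k * (fact (k - 1) :: complex)" using k by (simp add: fact_reduce)
  ultimately have c: "(- 2 * pi * \<i>) ^ k / fact (k - 1) = - of_real (zeta_nat k) * of_real (2 * real k / bernoulli k)"
    using b b0 k by (simp add: field_simps)
  have "summable (\<lambda>n. complex_of_nat (divisor_sigma (k - 1) (Suc n)) * nome z ^ Suc n)"
    using 2 by (subst summable_Suc_iff)
  hence 3: "(\<Sum>n. complex_of_nat (divisor_sigma (k - 1) (Suc n)) * nome z ^ Suc n) = (\<Sum>M. of_nat (divisor_sigma (k - 1) M) * nome z ^ M)"
    using suminf_split_head[OF 2] by (simp add: divisor_sigma_def)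
  have "eisenstein k z = 1 - of_real (2 * real k / bernoulli k) * (\<Sum>M. of_nat (divisor_sigma (k - 1) M) * nome z ^ M)"
    unfolding eisenstein_def nome_def[symmetric] 3 ..
  hence "of_real (zeta_nat k) * eisenstein k z = of_real (zeta_nat k) +
     (- of_real (zeta_nat k) * of_real (2 * real k / bernoulli k)) * (\<Sum>M. of_nat (divisor_sigma (k - 1) M) * nome z ^ M)"
  proof -
    have "Z * (1 - x * S) = Z + (- Z * x) * S" for Z x S :: complex by (simp add: algebra_simps)
    thus "eisenstein k z = 1 - of_real (2 * real k / bernoulli k) * (\<Sum>M. of_nat (divisor_sigma (k - 1) M) * nome z ^ M) \<Longrightarrow> ?thesis"
      by (simp only:)
  qed
  also have "\<dots> = of_real (zeta_nat k) + (z * eis_B k z + eis_A k z - of_real (zeta_nat k))"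
    unfolding 1 c ..
  finally show "of_real (zeta_nat k) * eisenstein k z = z * eis_B k z + eis_A k z" by simp
qed

lemma summable_divisor_sigma:
  fixes q :: complex
  assumes q: "norm q < 1"
  shows "summable (\<lambda>M. of_nat (divisor_sigma j M) * q ^ M)"
proof -
  obtain S where "(\<lambda>M. of_nat (\<Sum>d | d dvd M. (M div d) ^ 0 * d ^ j) * q ^ M) sums S"
    using lambert_series[OF q, of 0 j] by blast
  thus ?thesis by (simp add: divisor_sigma_def sums_iff)
qed

text \<open>Termwise differentiation brings down 2 pi i M, and M sigma_{k-1}(M) is the coefficient
  in the expansion of B. The series is taken with its lattice constant instead of the Bernoulli
  number, so that only powers of 2 pi i and factorials have to be compared.\<close>

theorem has_field_derivative_eisenstein:
  assumes z: "Im z > 0" and k: "even k" "k \<ge> 4"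
  shows "(eisenstein k has_field_derivative (- of_nat k * eis_B k z / of_real (zeta_nat k))) (at z)"
proof -
  define c where "c = (- 2 * pi * \<i>) ^ k / fact (k - 1)"
  define Z where "Z = complex_of_real (zeta_nat k)"
  have Z0: "Z \<noteq> 0" using zeta_nat_ge_1[of k] k by (auto simp: Z_def)
  let ?S = "\<lambda>z. \<Sum>M. of_nat (divisor_sigma (k - 1) M) * nome z ^ M"
  have eq: "eisenstein k w = 1 + c / Z * ?S w" if w: "Im w > 0" for w
  proof -
    have sk: "Suc (k - 1) = k" using k by simp
    have *: "(\<Sum>d | d dvd M. (M div d) ^ 0 * d ^ (k - 1)) = divisor_sigma (k - 1) M" for M
      by (simp add: divisor_sigma_def)
    have "((\<lambda>(i::nat,n::int). of_nat (Suc i) ^ 0 / lat w (int (Suc i)) n ^ Suc (k - 1)) has_sum (w * eis_B k w + eis_A k w - of_real (zeta_nat k))) UNIV"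
      unfolding sk using has_sum_eis_half[OF w k] by (simp only: power_0)
    from lattice_rows(1)[OF w _ this] k
    have "w * eis_B k w + eis_A k w - Z = c * ?S w" unfolding * sk c_def Z_def by auto
    hence "Z * eisenstein k w = Z + c * ?S w" using eisenstein_lattice(1)[OF w k] by (simp add: Z_def algebra_simps)
    hence "eisenstein k w = (Z + c * ?S w) / Z" using Z0 by (simp add: field_simps)
    thus ?thesis using Z0 by (simp add: add_divide_distrib)
  qed
  have "((\<lambda>w. 1 + c / Z * ?S w) has_field_derivative
      0 + c / Z * (2 * of_real pi * \<i> * (\<Sum>M. of_nat M * of_nat (divisor_sigma (k - 1) M) * nome z ^ M))) (at z)"
    by (intro DERIV_add DERIV_const DERIV_cmult has_field_derivative_nome_series summable_divisor_sigma z)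
  hence "((\<lambda>w. 1 + c / Z * ?S w) has_field_derivative
      c / Z * (2 * of_real pi * \<i> * (\<Sum>M. of_nat M * of_nat (divisor_sigma (k - 1) M) * nome z ^ M))) (at z)"
    by (simp only: add_0)
  hence "(eisenstein k has_field_derivative
      c / Z * (2 * of_real pi * \<i> * (\<Sum>M. of_nat M * of_nat (divisor_sigma (k - 1) M) * nome z ^ M))) (at z)"
    by (rule has_field_derivative_transform_within_open[OF _ open_halfspace_Im_gt[of 0]]) (use z eq in auto)
  also have "c / Z * (2 * of_real pi * \<i> * (\<Sum>M. of_nat M * of_nat (divisor_sigma (k - 1) M) * nome z ^ M)) = - of_nat k * eis_B k z / Z"
  proof -
    have "fact k = of_nat k * (fact (k - 1) :: complex)" using k by (simp add: fact_reduce)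
    hence "(- 2 * pi * \<i>) ^ Suc k / fact k * of_nat k = - (c * (2 * of_real pi * \<i>))"
      using k by (simp add: c_def field_simps)
    hence "of_nat k * eis_B k z = - (c * (2 * of_real pi * \<i>)) * (\<Sum>M. of_nat (M * divisor_sigma (k - 1) M) * nome z ^ M)"
    proof -
      have "of_nat k * (a * S) = (a * of_nat k) * S" for a S :: complex by (simp only: mult_ac)
      thus "(- 2 * pi * \<i>) ^ Suc k / fact k * of_nat k = - (c * (2 * of_real pi * \<i>)) \<Longrightarrow> ?thesis"
        unfolding eis_B_nome_series(1)[OF z k] by (simp only:)
    qed
    thus ?thesis by (simp add: mult_ac)
  qed
  finally show ?thesis by (simp add: Z_def)
qed

section \<open>Non-vanishing of the derivative high in the strip\<close>

text \<open>Machin's formula pi / 4 = 4 arctan(1/5) - arctan(1/239), with the Taylor polynomials of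
  arctan of degree 3 from below and degree 5 from above; the derivatives of the errors have constant
  sign.\<close>

lemma pi_bounds: "pi \<ge> 313 / 100" "pi \<le> 316 / 100"
proof -
  have p: "1 + x ^ 2 > 0" for x :: real by (intro add_pos_nonneg) auto
  have "arctan 0 - 0 + 0 ^ 3 / 3 \<le> arctan (1 / 5) - 1 / 5 + (1 / 5) ^ 3 / (3 :: real)"
  proof (rule DERIV_nonneg_imp_nondecreasing[of 0 "1/5" "\<lambda>x. arctan x - x + x ^ 3 / 3"], simp)
    fix x :: real
    have "((\<lambda>x. arctan x - x + x ^ 3 / 3) has_real_derivative (inverse (1 + x ^ 2) - 1 + x ^ 2)) (at x)"
      by (auto intro!: derivative_eq_intros)
    moreover have "inverse (1 + x ^ 2) - 1 + x ^ 2 = x ^ 4 / (1 + x ^ 2)"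
      using p[of x] by (simp add: field_simps power2_eq_square power4_eq_xxxx)
    moreover have "x ^ 4 / (1 + x ^ 2) \<ge> 0" using p[of x] by simp
    ultimately show "\<exists>y. ((\<lambda>x. arctan x - x + x ^ 3 / 3) has_real_derivative y) (at x) \<and> 0 \<le> y" by metis
  qed
  hence a: "arctan (1 / 5) \<ge> 1 / 5 - 1 / 375" by (simp add: power3_eq_cube)
  have "arctan (1 / 5) - 1 / 5 + (1 / 5) ^ 3 / 3 - (1 / 5) ^ 5 / 5 \<le> arctan 0 - 0 + 0 ^ 3 / 3 - 0 ^ 5 / (5 :: real)"
  proof (rule DERIV_nonpos_imp_nonincreasing[of 0 "1/5" "\<lambda>x. arctan x - x + x ^ 3 / 3 - x ^ 5 / 5"], simp)
    fix x :: real
    have "((\<lambda>x. arctan x - x + x ^ 3 / 3 - x ^ 5 / 5) has_real_derivative (inverse (1 + x ^ 2) - 1 + x ^ 2 - x ^ 4)) (at x)"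
      by (auto intro!: derivative_eq_intros)
    moreover have "inverse (1 + x ^ 2) - 1 + x ^ 2 - x ^ 4 = - (x ^ 6 / (1 + x ^ 2))"
      using p[of x] by (simp add: field_simps eval_nat_numeral)
    moreover have "- (x ^ 6 / (1 + x ^ 2)) \<le> 0" using p[of x] by simp
    ultimately show "\<exists>y. ((\<lambda>x. arctan x - x + x ^ 3 / 3 - x ^ 5 / 5) has_real_derivative y) (at x) \<and> y \<le> 0"
      by (intro exI[of _ "- (x ^ 6 / (1 + x ^ 2))"] conjI) (simp only:)
  qed
  hence b: "arctan (1 / 5) \<le> 1 / 5 - 1 / 375 + 1 / 15625" by (simp add: eval_nat_numeral)
  have c: "0 \<le> arctan (1 / 239)" by simp
  have "arctan (1 / 239) \<le> 1 / 239" by (rule arctan_le_self) simp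
  with a b c machin show "pi \<ge> 313 / 100" "pi \<le> 316 / 100" by linarith+
qed

text \<open>This bounds |q| at height sqrt 3 / 2, the least height in the fundamental domain. The
  exponent 5.42 is cut into ten equal parts so that five Taylor terms of exp(0.542) suffice.\<close>

lemma exp_pi_sqrt_3: "exp (- pi * sqrt 3) \<le> 1 / 225"
proof -
  have "sqrt 3 \<ge> 173205 / 100000" by (rule real_le_rsqrt) (simp add: power2_eq_square)
  hence "(313 / 100) * (173205 / 100000) \<le> pi * sqrt 3"
    using pi_bounds by (intro mult_mono) auto
  hence le: "542 / 100 \<le> pi * sqrt 3" by simp
  have e1: "exp (542 / 1000 :: real) \<ge> 17189 / 10000"
  proof -
    have "(\<Sum>n<5. (542 / 1000 :: real) ^ n / fact n) \<le> exp (542 / 1000)"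
    proof -
      have "summable (\<lambda>n. (542 / 1000 :: real) ^ n / fact n)"
        using summable_exp_generic[of "542 / 1000 :: real"] by (simp add: field_simps scaleR_conv_of_real)
      moreover have "exp (542 / 1000) = (\<Sum>n. (542 / 1000 :: real) ^ n / fact n)"
        by (simp add: exp_def scaleR_conv_of_real field_simps)
      ultimately show ?thesis by (simp add: sum_le_suminf)
    qed
    thus ?thesis by (simp add: numeral_eq_Suc lessThan_Suc)
  qed
  have "(225 :: real) \<le> (17189 / 10000) ^ 10" by (simp add: power_divide)
  also have "\<dots> \<le> exp (542 / 1000) ^ 10" by (intro power_mono e1) simp
  also have "\<dots> = exp (542 / 100)" by (simp add: exp_of_nat_mult[symmetric])
  also have "\<dots> \<le> exp (pi * sqrt 3)" using le by simp
  finally have "225 \<le> exp (pi * sqrt 3)" .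
  hence "1 / exp (pi * sqrt 3) \<le> 1 / 225" by (intro divide_left_mono) auto
  thus ?thesis by (simp add: exp_minus inverse_eq_divide)
qed

text \<open>1 / e^3 is at most 1 / ((e - 1) e (e + 1)), which telescopes as the difference of 1 / (2
  (e - 1) e) and 1 / (2 e (e + 1)).\<close>

lemma sum_inverse_cubes_le:
  assumes a: "a \<ge> 1"
  shows "(\<Sum>e\<in>{Suc a..j}. 1 / real e ^ 3) \<le> 1 / (2 * real a * (real a + 1))"
proof (cases "j \<ge> a")
  case True
  have "(\<Sum>e\<in>{Suc a..j}. 1 / real e ^ 3) \<le> 1 / (2 * real a * (real a + 1)) - 1 / (2 * real j * (real j + 1))"
    using True
  proof (induction j rule: dec_induct)
    case (step j)
    have j: "real j > 0" using step a by simp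
    have "(\<Sum>e\<in>{Suc a..Suc j}. 1 / real e ^ 3) = (\<Sum>e\<in>{Suc a..j}. 1 / real e ^ 3) + 1 / real (Suc j) ^ 3"
      by (subst sum.cl_ivl_Suc) (use step in auto)
    also have "\<dots> \<le> 1 / (2 * real a * (real a + 1)) - 1 / (2 * real j * (real j + 1)) + 1 / (real j * (real j + 1) * (real j + 2))"
    proof (intro add_mono)
      have "real j * (real j + 1) * (real j + 2) \<le> real (Suc j) ^ 3"
        by (simp add: power3_eq_cube algebra_simps)
      thus "1 / real (Suc j) ^ 3 \<le> 1 / (real j * (real j + 1) * (real j + 2))"
        using j by (intro divide_left_mono) auto
    qed (use step.IH in auto)
    also have "\<dots> = 1 / (2 * real a * (real a + 1)) - 1 / (2 * real (Suc j) * (real (Suc j) + 1))"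
    proof -
      have "1 / (2 * real j * (real j + 1)) - 1 / (real j * (real j + 1) * (real j + 2)) = 1 / (2 * real (Suc j) * (real (Suc j) + 1))"
        using j by (simp add: divide_simps) (simp add: algebra_simps)
      thus ?thesis by simp
    qed
    finally show ?case .
  qed simp
  thus ?thesis by (smt (verit) divide_nonneg_nonneg of_nat_0_le_iff mult_nonneg_nonneg)
qed simp

text \<open>Dividing by j^(k-1) and replacing d by e = j / d leaves the sum of e^(1-k) over the
  divisors e. The terms with e >= 2 are at most 2^(4-k) times those of the tail of zeta(3), which is
  at most 1/4.\<close>

lemma divisor_sigma_bounds:
  assumes k: "k \<ge> 4" and j: "j \<ge> 1"
  shows "real j ^ (k - 1) \<le> real (divisor_sigma (k - 1) j)"
    and "real (divisor_sigma (k - 1) j) \<le> (1 + 1 / 2 ^ (k - 2)) * real j ^ (k - 1)"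
proof -
  have fin: "finite {d. d dvd j}" using j by simp
  have "j ^ (k - 1) \<le> (\<Sum>d | d dvd j. d ^ (k - 1))"
    using fin by (intro member_le_sum) auto
  thus "real j ^ (k - 1) \<le> real (divisor_sigma (k - 1) j)"
    unfolding divisor_sigma_def by (metis of_nat_le_iff of_nat_power)
  have bij: "bij_betw (\<lambda>d. j div d) {d. d dvd j} {d. d dvd j}"
    by (rule bij_betwI[of _ _ _ "\<lambda>d. j div d"]) (use j in \<open>auto elim!: dvdE\<close>)
  have "real (divisor_sigma (k - 1) j) = (\<Sum>d | d dvd j. real d ^ (k - 1))"
    by (simp add: divisor_sigma_def)
  also have "\<dots> = (\<Sum>e | e dvd j. real (j div e) ^ (k - 1))"
    by (rule sum.reindex_bij_betw[OF bij, symmetric])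
  also have "\<dots> = (\<Sum>e | e dvd j. real j ^ (k - 1) * (1 / real e ^ (k - 1)))"
    by (intro sum.cong refl) (auto simp: real_of_nat_div power_divide)
  also have "\<dots> = real j ^ (k - 1) * (\<Sum>e | e dvd j. 1 / real e ^ (k - 1))"
    by (rule sum_distrib_left[symmetric])
  also have "(\<Sum>e | e dvd j. 1 / real e ^ (k - 1)) \<le> (\<Sum>e\<in>{1..j}. 1 / real e ^ (k - 1))"
    using j by (intro sum_mono2) (auto dest: dvd_imp_le intro: Nat.gr0I)
  also have "{1..j} = insert 1 {2..j}" using j by auto
  also have "(\<Sum>e\<in>insert 1 {2..j}. 1 / real e ^ (k - 1)) = 1 + (\<Sum>e\<in>{2..j}. 1 / real e ^ (k - 1))" by simp
  also have "(\<Sum>e\<in>{2..j}. 1 / real e ^ (k - 1)) \<le> (\<Sum>e\<in>{2..j}. 1 / 2 ^ (k - 4) * (1 / real e ^ 3))"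
  proof (intro sum_mono)
    fix e assume e: "e \<in> {2..j}"
    have "2 ^ (k - 4) * real e ^ 3 \<le> real e ^ (k - 4) * real e ^ 3"
      using e by (intro mult_right_mono power_mono) auto
    also have "\<dots> = real e ^ (k - 1)" using k by (simp add: power_add[symmetric])
    finally show "1 / real e ^ (k - 1) \<le> 1 / 2 ^ (k - 4) * (1 / real e ^ 3)"
      using e by (simp add: field_simps)
  qed
  also have "\<dots> = 1 / 2 ^ (k - 4) * (\<Sum>e\<in>{2..j}. 1 / real e ^ 3)" by (rule sum_distrib_left[symmetric])
  also have "\<dots> \<le> 1 / 2 ^ (k - 4) * (1 / 4)"
    using sum_inverse_cubes_le[of 1 j] by (intro mult_left_mono) (auto simp: numeral_2_eq_2)
  also have "1 / 2 ^ (k - 4) * (1 / 4) = 1 / (2 ^ (k - 2) :: real)"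
  proof -
    have "k - 2 = (k - 4) + 2" using k by simp
    thus ?thesis by (simp add: power_add)
  qed
  finally show "real (divisor_sigma (k - 1) j) \<le> (1 + 1 / 2 ^ (k - 2)) * real j ^ (k - 1)"
    using j by (simp add: mult.commute)
qed

section \<open>Non-vanishing of a series with one dominant term\<close>

lemma abs_sin_int_mult_le:
  fixes m :: int and \<phi> :: real
  assumes "sin \<phi> \<ge> 0"
  shows "\<bar>sin (of_int m * \<phi>)\<bar> \<le> \<bar>of_int m\<bar> * sin \<phi>"
proof -
  have nat: "\<bar>sin (real n * \<phi>)\<bar> \<le> real n * sin \<phi>" for n
  proof (induction n)
    case (Suc n)
    have eq: "real (Suc n) * \<phi> = real n * \<phi> + \<phi>" by (simp add: algebra_simps)
    have "\<bar>sin (real (Suc n) * \<phi>)\<bar> = \<bar>sin (real n * \<phi>) * cos \<phi> + cos (real n * \<phi>) * sin \<phi>\<bar>"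
      unfolding eq sin_add ..
    also have "\<dots> \<le> \<bar>sin (real n * \<phi>)\<bar> * \<bar>cos \<phi>\<bar> + \<bar>cos (real n * \<phi>)\<bar> * \<bar>sin \<phi>\<bar>"
      by (simp add: abs_mult[symmetric])
    also have "\<dots> \<le> \<bar>sin (real n * \<phi>)\<bar> * 1 + 1 * \<bar>sin \<phi>\<bar>"
      by (intro add_mono mult_left_mono mult_right_mono) auto
    also have "\<dots> \<le> real (Suc n) * sin \<phi>" using Suc assms by (simp add: distrib_right)
    finally show ?case .
  qed auto
  show ?thesis
  proof (cases "m \<ge> 0")
    case True
    then obtain n where "m = int n" by (metis nonneg_int_cases)
    thus ?thesis using nat[of n] by simp
  next
    case False
    then obtain n where "m = - int n" by (metis int_cases2 of_nat_0_le_iff)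
    thus ?thesis using nat[of n] by simp
  qed
qed

text \<open>Take the imaginary part after rotating the term of index \<open>n\<close> to the real axis; \<open>\<bar>sin (j \<phi>)\<bar> \<le> j sin \<phi>\<close> then removes the dependence on \<open>\<phi>\<close>.\<close>

lemma cis_series_nonzero:
  fixes c :: "nat \<Rightarrow> real"
  assumes c: "\<And>j. c j \<ge> 0" and s: "summable (\<lambda>j. real j * c j)" and \<phi>: "0 < \<phi>" "\<phi> < pi"
    and H: "(\<Sum>j. \<bar>real j - real n\<bar> * c j) < 2 * c (Suc n)"
  shows "(\<Sum>j. of_real (c j) * cis (real j * \<phi>)) \<noteq> 0"
proof -
  have s0: "summable c"
  proof (rule summable_comparison_test'[OF s, of 1])
    fix j :: nat assume "1 \<le> j"
    hence "1 * c j \<le> real j * c j" using c by (intro mult_right_mono) auto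
    thus "norm (c j) \<le> real j * c j" using c[of j] by simp
  qed
  have s1: "summable (\<lambda>j. \<bar>real j - real n\<bar> * c j)"
  proof (rule summable_comparison_test'[OF summable_add[OF s summable_mult[OF s0, of "real n"]], of 0])
    fix j :: nat
    have "\<bar>real j - real n\<bar> * c j \<le> (real j + real n) * c j" using c by (intro mult_right_mono) auto
    thus "norm (\<bar>real j - real n\<bar> * c j) \<le> real j * c j + real n * c j" using c by (simp add: abs_mult algebra_simps)
  qed
  have sinp: "sin \<phi> > 0" using \<phi> by (intro sin_gt_zero)
  let ?t = "\<lambda>j. of_real (c j) * cis (real j * \<phi>)"
  have "summable (\<lambda>j. norm (?t j))" using s0 c by (simp add: norm_mult)
  hence st: "summable ?t" by (rule summable_norm_cancel)
  have "(\<lambda>j. ?t j * cis (- (real n * \<phi>))) sums ((\<Sum>j. ?t j) * cis (- (real n * \<phi>)))"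
    by (intro sums_mult2 summable_sums st)
  from sums_Im[OF this]
  have sI: "(\<lambda>j. c j * sin (of_int (int j - int n) * \<phi>)) sums Im ((\<Sum>j. ?t j) * cis (- (real n * \<phi>)))"
    by (simp add: mult.assoc cis_mult left_diff_distrib)
  have sA: "(\<lambda>j. c j * sin (of_int (int j - int n) * \<phi>) + sin \<phi> * (\<bar>real j - real n\<bar> * c j)) sums
     (Im ((\<Sum>j. ?t j) * cis (- (real n * \<phi>))) + sin \<phi> * (\<Sum>j. \<bar>real j - real n\<bar> * c j))"
    by (intro sums_add sI sums_mult summable_sums s1)
  have nonneg: "c j * sin (of_int (int j - int n) * \<phi>) + sin \<phi> * (\<bar>real j - real n\<bar> * c j) \<ge> 0" for j
  proof -
    have "\<bar>sin (of_int (int j - int n) * \<phi>)\<bar> \<le> \<bar>real j - real n\<bar> * sin \<phi>"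
      using abs_sin_int_mult_le[of \<phi> "int j - int n"] sinp by simp
    hence "0 \<le> sin (of_int (int j - int n) * \<phi>) + \<bar>real j - real n\<bar> * sin \<phi>" by linarith
    from mult_left_mono[OF this c[of j]] show ?thesis by (simp add: algebra_simps)
  qed
  \<comment> \<open>The term of index n + 1 contributes + c(n + 1) sin \<phi>. Its own weight also
    occurs in the sum over all j and is added back, whence the factor 2.\<close>
  have "(\<Sum>j\<in>{Suc n}. c j * sin (of_int (int j - int n) * \<phi>) + sin \<phi> * (\<bar>real j - real n\<bar> * c j)) \<le>
     Im ((\<Sum>j. ?t j) * cis (- (real n * \<phi>))) + sin \<phi> * (\<Sum>j. \<bar>real j - real n\<bar> * c j)"
    using sum_le_suminf[OF sums_summable[OF sA], of "{Suc n}"] nonneg sums_unique[OF sA] by simp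
  hence "2 * c (Suc n) * sin \<phi> - sin \<phi> * (\<Sum>j. \<bar>real j - real n\<bar> * c j) \<le> Im ((\<Sum>j. ?t j) * cis (- (real n * \<phi>)))"
    by (simp add: algebra_simps)
  moreover have "0 < (2 * c (Suc n) - (\<Sum>j. \<bar>real j - real n\<bar> * c j)) * sin \<phi>" using H sinp by simp
  ultimately have "0 < Im ((\<Sum>j. ?t j) * cis (- (real n * \<phi>)))" by (simp add: algebra_simps)
  thus ?thesis by auto
qed

text \<open>The leading index is N = n + 1. Beyond it j^k r^j decays at least like w^i, by 1 + i/N
  <= (1 + 1/N)^i; below it \<open>low\<close> supplies the decay V^m. The weights |j - n| turn the
  two geometric series into 1 / (1 - w)^2 - 1 and V / (1 - V)^2, and the term of index n has weight
  0.\<close>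

lemma power_series_dominance:
  fixes b :: "nat \<Rightarrow> real" and r \<beta> w \<tau> V :: real
  assumes r: "0 < r" "r < 1" and b: "\<And>j. real j ^ k \<le> b j" "\<And>j. b j \<le> \<beta> * real j ^ k" and k: "k \<ge> 1"
    and w: "w = (1 + 1 / real (Suc n)) ^ k * r" "w < 1" and V: "0 \<le> V" "V < 1" and \<tau>: "\<tau> \<ge> 0"
    and low: "\<And>m. m \<le> n \<Longrightarrow> real (n - m) ^ k * r ^ (n - m) \<le> \<tau> * V ^ m * (real (Suc n) ^ k * r ^ Suc n)"
    and bd: "\<beta> * (1 / (1 - w) ^ 2 - 1 + \<tau> * V / (1 - V) ^ 2) < 1"
  shows "summable (\<lambda>j. real j * (b j * r ^ j))"
    and "(\<Sum>j. \<bar>real j - real n\<bar> * (b j * r ^ j)) < 2 * (b (Suc n) * r ^ Suc n)"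
proof -
  define a where "a = (\<lambda>j. real j ^ k * r ^ j)"
  define N where "N = Suc n"
  have N: "N \<ge> 1" by (simp add: N_def)
  have aN: "a N > 0" using r by (simp add: a_def N_def)
  have b0: "b j \<ge> 0" for j using b(1)[of j] by (metis of_nat_0_le_iff order_trans zero_le_power)
  have \<beta>: "\<beta> \<ge> 1" using b[of 1] by simp
  have w0: "w > 0" using r by (auto simp: w intro!: mult_pos_pos zero_less_power add_pos_pos)
  have ba: "b j * r ^ j \<le> \<beta> * a j" for j
    using mult_right_mono[OF b(2)[of j], of "r ^ j"] r by (simp add: a_def mult_ac)
  have up: "a (N + i) \<le> a N * w ^ i" for i
  proof -
    have "1 + real i / real N \<le> (1 + 1 / real N) ^ i"
    proof -
      have "-1 \<le> 1 / real N" by (rule order_trans[of _ 0]) auto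
      from Bernoulli_inequality[OF this, of i] show ?thesis by (simp add: mult.commute)
    qed
    hence "(1 + real i / real N) ^ k \<le> ((1 + 1 / real N) ^ i) ^ k" by (intro power_mono) auto
    also have "\<dots> = ((1 + 1 / real N) ^ k) ^ i" by (simp add: power_mult[symmetric] mult.commute)
    finally have "real N ^ k * (1 + real i / real N) ^ k \<le> real N ^ k * ((1 + 1 / real N) ^ k) ^ i"
      by (intro mult_left_mono) auto
    moreover have "real N ^ k * (1 + real i / real N) ^ k = real (N + i) ^ k"
      using N by (subst power_mult_distrib[symmetric]) (simp add: distrib_left)
    ultimately have "real (N + i) ^ k \<le> real N ^ k * ((1 + 1 / real N) ^ k) ^ i" by simp
    from mult_right_mono[OF this, of "r ^ (N + i)"] r show ?thesis
      by (simp add: a_def w power_add power_mult_distrib N_def mult_ac)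
  qed
  have geo: "(\<lambda>i. real (Suc i) * w ^ i) sums (1 / (1 - w) ^ 2)"
    using geometric_deriv_sums[of w] w w0 by simp
  have geo': "(\<lambda>i. real (Suc (Suc i)) * w ^ Suc i) sums (1 / (1 - w) ^ 2 - 1)"
    using geo by (subst sums_Suc_iff[of "\<lambda>i. real (Suc i) * w ^ i"]) simp
  have geoV: "(\<lambda>i. real i * V ^ i) sums (V / (1 - V) ^ 2)"
  proof -
    have "(\<lambda>i. V * (real (Suc i) * V ^ i)) sums (V * (1 / (1 - V) ^ 2))"
      using geometric_deriv_sums[of V] V by (intro sums_mult) simp
    hence "(\<lambda>i. real (Suc i) * V ^ Suc i) sums (V / (1 - V) ^ 2)" by (simp add: mult_ac)
    thus ?thesis by (subst (asm) sums_Suc_iff) simp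
  qed
  let ?g = "\<lambda>j. \<bar>real j - real n\<bar> * (b j * r ^ j)"
  have g_up: "?g (i + Suc N) \<le> \<beta> * a N * (real (Suc (Suc i)) * w ^ Suc i)" for i
  proof -
    have "?g (i + Suc N) = real (Suc (Suc i)) * (b (i + Suc N) * r ^ (i + Suc N))" by (simp add: N_def)
    also have "\<dots> \<le> real (Suc (Suc i)) * (\<beta> * a (i + Suc N))" by (intro mult_left_mono ba) auto
    also have "\<dots> \<le> real (Suc (Suc i)) * (\<beta> * (a N * w ^ Suc i))"
      using up[of "Suc i"] \<beta> by (intro mult_left_mono) (auto simp: add_ac)
    finally show ?thesis by (simp add: mult_ac)
  qed
  have s_tail: "summable (\<lambda>i. ?g (i + Suc N))"
    by (rule summable_comparison_test'[OF summable_mult[OF sums_summable[OF geo'], of "\<beta> * a N"], of 0])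
       (use g_up b0 r in \<open>auto simp: abs_mult\<close>)
  hence s_g: "summable ?g" by (subst (asm) summable_iff_shift)
  show "summable (\<lambda>j. real j * (b j * r ^ j))"
  proof (subst summable_iff_shift[symmetric, of _ "Suc N"], rule summable_comparison_test'[OF summable_mult[OF s_tail, of "real (Suc N) + 1"], of 0])
    fix i :: nat
    have "real (i + Suc N) \<le> (real (Suc N) + 1) * \<bar>real (i + Suc N) - real n\<bar>"
    proof -
      have "\<bar>real (i + Suc N) - real n\<bar> = real i + 2" by (simp add: N_def)
      thus ?thesis by (simp add: distrib_left distrib_right add_increasing)
    qed
    from mult_right_mono[OF this, of "b (i + Suc N) * r ^ (i + Suc N)"] b0[of "i + Suc N"] r
    show "norm (real (i + Suc N) * (b (i + Suc N) * r ^ (i + Suc N))) \<le> (real (Suc N) + 1) * ?g (i + Suc N)"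
      by (simp add: abs_mult mult.assoc del: of_nat_add of_nat_Suc)
  qed
  have "suminf ?g = (\<Sum>i. ?g (i + Suc N)) + sum ?g {..<Suc N}"
    by (rule suminf_split_initial_segment[OF s_g])
  also have "sum ?g {..<Suc N} = b N * r ^ N + sum ?g {..<N}" by (simp add: N_def)
  also have "(\<Sum>i. ?g (i + Suc N)) \<le> \<beta> * a N * (1 / (1 - w) ^ 2 - 1)"
    using suminf_le[OF g_up s_tail summable_mult[OF sums_summable[OF geo'], of "\<beta> * a N"]]
      sums_unique[OF sums_mult[OF geo', of "\<beta> * a N"]] by simp
  also have "sum ?g {..<N} \<le> \<beta> * a N * (\<tau> * V / (1 - V) ^ 2)"
  proof -
    have "sum ?g {..<N} = (\<Sum>m<N. ?g (n - m))"
      unfolding N_def using sum.nat_diff_reindex[of ?g "Suc n"] by simp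
    also have "\<dots> \<le> (\<Sum>m<N. \<beta> * a N * \<tau> * (real m * V ^ m))"
    proof (intro sum_mono)
      fix m assume "m \<in> {..<N}"
      hence m: "m \<le> n" by (simp add: N_def)
      have "?g (n - m) = real m * (b (n - m) * r ^ (n - m))" using m by (simp add: of_nat_diff)
      also have "\<dots> \<le> real m * (\<beta> * a (n - m))" by (intro mult_left_mono ba) auto
      also have "\<dots> \<le> real m * (\<beta> * (\<tau> * V ^ m * a N))"
        using low[OF m] \<beta> by (intro mult_left_mono) (auto simp: a_def N_def)
      finally show "?g (n - m) \<le> \<beta> * a N * \<tau> * (real m * V ^ m)" by (simp add: mult_ac)
    qed
    also have "\<dots> = \<beta> * a N * \<tau> * (\<Sum>m<N. real m * V ^ m)" by (rule sum_distrib_left[symmetric])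
    also have "(\<Sum>m<N. real m * V ^ m) \<le> V / (1 - V) ^ 2"
      using sum_le_suminf[OF sums_summable[OF geoV], of "{..<N}"] sums_unique[OF geoV] V by simp
    hence "\<beta> * a N * \<tau> * (\<Sum>m<N. real m * V ^ m) \<le> \<beta> * a N * \<tau> * (V / (1 - V) ^ 2)"
      using \<beta> aN \<tau> by (intro mult_left_mono) auto
    finally show ?thesis by (simp add: mult_ac)
  qed
  finally have "suminf ?g \<le> b N * r ^ N + a N * (\<beta> * (1 / (1 - w) ^ 2 - 1 + \<tau> * V / (1 - V) ^ 2))"
    by (simp add: algebra_simps)
  also have "\<dots> < b N * r ^ N + a N * 1" using bd aN by (intro add_strict_left_mono mult_strict_left_mono)
  also have "a N \<le> b N * r ^ N" unfolding a_def using b(1)[of N] r by (intro mult_right_mono) auto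
  finally show "suminf ?g < 2 * (b (Suc n) * r ^ Suc n)" by (simp add: N_def mult_ac)
qed

lemma nome_polar: "nome z = of_real (exp (- 2 * pi * Im z)) * cis (2 * pi * Re z)"
proof -
  have "nome z = exp (of_real (- 2 * pi * Im z) + \<i> * of_real (2 * pi * Re z))"
    unfolding nome_def by (rule arg_cong[of _ _ exp]) (simp add: complex_eq_iff)
  also have "\<dots> = exp (of_real (- 2 * pi * Im z)) * exp (\<i> * of_real (2 * pi * Re z))" by (rule exp_add)
  finally show ?thesis by (simp only: exp_of_real cis_conv_exp)
qed

text \<open>The coefficients are j sigma_{k-1}(j) and the angle is 2 pi Re z, which lies strictly
  between 0 and pi for 0 < Re z < 1/2. On the imaginary axis the sine argument is void, but all
  terms are non-negative and the first is positive.\<close>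

lemma eis_B_nonzero_of_dominance:
  fixes k n :: nat and z :: complex and V \<tau> :: real
  defines "r \<equiv> exp (- 2 * pi * Im z)"
  defines "w \<equiv> (1 + 1 / real (Suc n)) ^ k * r"
  assumes z: "Im z > 0" "0 \<le> Re z" "Re z < 1 / 2" and k: "even k" "k \<ge> 4"
    and "w < 1" "0 \<le> V" "V < 1" "\<tau> \<ge> 0"
    and "\<And>m. m \<le> n \<Longrightarrow> real (n - m) ^ k * r ^ (n - m) \<le> \<tau> * V ^ m * (real (Suc n) ^ k * r ^ Suc n)"
    and "(1 + 1 / 2 ^ (k - 2)) * (1 / (1 - w) ^ 2 - 1 + \<tau> * V / (1 - V) ^ 2) < 1"
  shows "eis_B k z \<noteq> 0"
proof -
  define b where "b = (\<lambda>j. real (j * divisor_sigma (k - 1) j))"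
  have r: "0 < r" "r < 1" using z by (auto simp: r_def)
  have pw: "real j * real j ^ (k - 1) = real j ^ k" for j using k by (cases k) auto
  have b1: "real j ^ k \<le> b j" "b j \<le> (1 + 1 / 2 ^ (k - 2)) * real j ^ k" for j
  proof -
    have "real j ^ k \<le> b j \<and> b j \<le> (1 + 1 / 2 ^ (k - 2)) * real j ^ k"
    proof (cases "j = 0")
      case False
      hence j: "j \<ge> 1" by simp
      have "real j * real j ^ (k - 1) \<le> b j"
        unfolding b_def of_nat_mult using divisor_sigma_bounds(1)[OF k(2) j] by (intro mult_left_mono) auto
      moreover have "b j \<le> real j * ((1 + 1 / 2 ^ (k - 2)) * real j ^ (k - 1))"
        unfolding b_def of_nat_mult using divisor_sigma_bounds(2)[OF k(2) j] by (intro mult_left_mono) auto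
      ultimately show ?thesis unfolding pw[symmetric] by (simp add: mult.left_commute)
    qed (use k in \<open>auto simp: b_def power_0_left\<close>)
    thus "real j ^ k \<le> b j" "b j \<le> (1 + 1 / 2 ^ (k - 2)) * real j ^ k" by auto
  qed
  have b0: "b j \<ge> 0" for j by (simp add: b_def)
  have k1: "k \<ge> 1" using k by simp
  note dom = power_series_dominance[OF r b1 k1 w_def[THEN meta_eq_to_obj_eq] assms(8-13)[unfolded r_def[symmetric]]]
  have "(\<Sum>j. complex_of_real (b j * r ^ j) * cis (real j * (2 * pi * Re z))) \<noteq> 0"
  proof (cases "Re z = 0")
    case False
    show ?thesis
      by (rule cis_series_nonzero[where n = n]) (use dom b0 r z False in auto)
  next
    case True
    have "summable (\<lambda>j. b j * r ^ j)"
    proof (rule summable_comparison_test'[OF dom(1), of 1])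
      fix j :: nat assume "1 \<le> j"
      hence "1 * (b j * r ^ j) \<le> real j * (b j * r ^ j)" using b0 r by (intro mult_right_mono) auto
      thus "norm (b j * r ^ j) \<le> real j * (b j * r ^ j)" using b0[of j] r by simp
    qed
    hence "(\<lambda>j. b j * r ^ j) sums (\<Sum>j. b j * r ^ j)" and pos: "(\<Sum>j. b j * r ^ j) \<ge> b 1 * r ^ 1"
      using sum_le_suminf[of "\<lambda>j. b j * r ^ j" "{1}"] b0 r by (auto intro: summable_sums)
    hence "(\<lambda>j. complex_of_real (b j * r ^ j)) sums of_real (\<Sum>j. b j * r ^ j)" by (subst sums_of_real_iff)
    from sums_unique[OF this]
    have "(\<Sum>j. complex_of_real (b j * r ^ j) * cis (real j * (2 * pi * Re z))) = of_real (\<Sum>j. b j * r ^ j)"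
      using True by simp
    moreover have "b 1 * r ^ 1 > 0" using b1(1)[of 1] r by simp
    hence "(\<Sum>j. b j * r ^ j) \<noteq> 0" using pos by linarith
    ultimately show ?thesis by simp
  qed
  moreover have "complex_of_real (b j * r ^ j) * cis (real j * (2 * pi * Re z)) = of_nat (j * divisor_sigma (k - 1) j) * nome z ^ j" for j
  proof -
    have "nome z ^ j = of_real (r ^ j) * cis (real j * (2 * pi * Re z))"
      unfolding nome_polar r_def power_mult_distrib Complex.DeMoivre by (simp only: of_real_power)
    thus ?thesis by (simp only: b_def of_real_mult of_real_of_nat_eq mult.assoc)
  qed
  ultimately have "(\<Sum>j. of_nat (j * divisor_sigma (k - 1) j) * nome z ^ j) \<noteq> 0" by (simp only: not_False_eq_True)
  moreover have "(- 2 * complex_of_real pi * \<i>) ^ Suc k / fact k \<noteq> 0" by simp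
  ultimately show ?thesis unfolding eis_B_nome_series(1)[OF z(1) k] by (simp only: mult_eq_0_iff) simp
qed

lemma exp_minus_2_pi_le:
  assumes "Im z \<ge> sqrt 3 / 2"
  shows "exp (- 2 * pi * Im z) \<le> 1 / 225"
proof -
  have "pi * sqrt 3 \<le> pi * (2 * Im z)" using assms by (intro mult_left_mono) auto
  hence "exp (- 2 * pi * Im z) \<le> exp (- pi * sqrt 3)" by simp
  thus ?thesis using exp_pi_sqrt_3 by linarith
qed

text \<open>Take n = 1: the term q is rotated to the real axis and the term of index 2 outweighs the
  later ones, since w = (3/2)^k r is at most 0.26 for k <= 10. With V = 0 only m = 0 has to be
  compared, and \<tau> = 1 / (2^k r) makes this an equality.\<close>

lemma eis_B_nonzero_small_weight:
  assumes z: "Im z \<ge> sqrt 3 / 2" "0 \<le> Re z" "Re z < 1 / 2" and k: "even k" "k \<ge> 4" "k \<le> 10"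
  shows "eis_B k z \<noteq> 0"
proof -
  have "sqrt 3 / 2 > (0::real)" by simp
  with z have zp: "Im z > 0" by linarith
  define r where "r = exp (- 2 * pi * Im z)"
  have r: "0 < r" "r \<le> 1 / 225" using exp_minus_2_pi_le[OF z(1)] by (auto simp: r_def)
  define w where "w = (1 + 1 / real (Suc 1)) ^ k * r"
  have w0: "w \<ge> 0" using r by (simp add: w_def)
  have "k \<in> {4, 6, 8, 10}" using k by (auto elim!: evenE)
  hence "w < 1 \<and> (1 + 1 / 2 ^ (k - 2)) * (1 / (1 - w) ^ 2 - 1) < 1"
  proof -
    have key: "w < 1 \<and> \<beta> * (1 / (1 - w) ^ 2 - 1) < 1"
      if "w \<le> W" "W < 1" "\<beta> * (1 / (1 - W) ^ 2 - 1) < 1" "\<beta> \<ge> 0" for W \<beta>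
    proof -
      have "(1 - W) ^ 2 \<le> (1 - w) ^ 2" using that by (intro power_mono) auto
      hence "1 / (1 - w) ^ 2 \<le> 1 / (1 - W) ^ 2" using that by (intro divide_left_mono mult_pos_pos) auto
      hence "\<beta> * (1 / (1 - w) ^ 2 - 1) \<le> \<beta> * (1 / (1 - W) ^ 2 - 1)" using that by (intro mult_left_mono) auto
      thus ?thesis using that by linarith
    qed
    have wk: "w \<le> (3 / 2) ^ k * (1 / 225)" unfolding w_def using r by (simp add: mult_left_mono)
    show ?thesis
    proof (cases "k = 10")
      case True
      show ?thesis by (rule key[of "26 / 100"]) (use wk True in \<open>auto simp: power_divide\<close>)
    next
      case False
      show ?thesis
        by (rule key[of "12 / 100"]) (use wk False \<open>k \<in> _\<close> in \<open>auto simp: power_divide\<close>)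
    qed
  qed
  moreover have "real (1 - m) ^ k * r ^ (1 - m) \<le> (1 / (2 ^ k * r)) * 0 ^ m * (real (Suc 1) ^ k * r ^ Suc 1)" if "m \<le> 1" for m
    using that k r by (cases m) (auto simp: power2_eq_square power_0_left)
  ultimately show ?thesis
    using eis_B_nonzero_of_dominance[OF zp z(2,3) k(1,2), of 1 0 "1 / (2 ^ k * r)"] r
    unfolding w_def r_def by simp
qed

lemma exp_ge_taylor3: "x \<ge> 0 \<Longrightarrow> exp x \<ge> 1 + x + x ^ 2 / 2 + x ^ 3 / (6 :: real)"
proof -
  assume x: "x \<ge> 0"
  have "summable (\<lambda>n. x ^ n / fact n)"
    using summable_exp_generic[of x] by (simp add: field_simps scaleR_conv_of_real)
  moreover have "exp x = (\<Sum>n. x ^ n / fact n)"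
    by (simp add: exp_def scaleR_conv_of_real field_simps)
  ultimately have "(\<Sum>n<4. x ^ n / fact n) \<le> exp x" using x by (simp add: sum_le_suminf)
  thus ?thesis by (simp add: numeral_eq_Suc lessThan_Suc)
qed

text \<open>Let n be the first index for which the term n + 2 of j^k r^j is at most 1/4 of the term
  n + 1. Minimality says that the term n is less than 4 times the term n + 1, which gives \<tau> =
  4; log-concavity of j^k then bounds the ratios further down by V = 4 X with X = (1 -
  1/n^2)^k.\<close>

lemma eis_B_nonzero_high:
  assumes z: "Im z > 0" "0 \<le> Re z" "Re z < 1 / 2" and k: "even k" "k \<ge> 12" and y: "(Im z) ^ 2 \<ge> real k / 6"
  shows "eis_B k z \<noteq> 0"
proof -
  define r where "r = exp (- 2 * pi * Im z)"
  have r: "0 < r" by (simp add: r_def)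
  have ex: "\<exists>n. (1 + 1 / real (Suc n)) ^ k * r \<le> 1 / 4"
  proof -
    have "(\<lambda>n. (1 + 1 / real (Suc n)) ^ k * r) \<longlonglongrightarrow> (1 + 0) ^ k * r"
      by (intro tendsto_intros LIMSEQ_Suc lim_1_over_n)
    moreover have "r < 1 / 4"
    proof -
      have "Im z > 1"
      proof (rule ccontr)
        assume "\<not> Im z > 1"
        hence "(Im z) ^ 2 \<le> 1 ^ 2" using z by (intro power_mono) auto
        with y k show False by simp
      qed
      hence "3 * 1 \<le> pi * Im z" using pi_bounds by (intro mult_mono) auto
      hence "r \<le> exp (- 6)" unfolding r_def by simp
      also have "exp (- 6 :: real) < 1 / 4"
        using exp_ge_taylor3[of 6] by (simp add: exp_minus field_simps)
      finally show ?thesis .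
    qed
    ultimately have "eventually (\<lambda>n. (1 + 1 / real (Suc n)) ^ k * r < 1 / 4) sequentially"
      by (intro order_tendstoD) auto
    then obtain n where "(1 + 1 / real (Suc n)) ^ k * r < 1 / 4" by (auto simp: eventually_sequentially)
    thus ?thesis by (intro exI[of _ n]) simp
  qed
  define n where "n = (LEAST n. (1 + 1 / real (Suc n)) ^ k * r \<le> 1 / 4)"
  define w where "w = (1 + 1 / real (Suc n)) ^ k * r"
  have w: "w \<le> 1 / 4" unfolding w_def n_def using LeastI_ex[OF ex] .
  have w0: "w \<ge> 0" using r by (simp add: w_def)
  have least: "1 / 4 < (1 + 1 / real (Suc m)) ^ k * r" if "m < n" for m
    using not_less_Least[of m "\<lambda>n. (1 + 1 / real (Suc n)) ^ k * r \<le> 1 / 4"] that by (auto simp: n_def)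
  define X where "X = (if n = 0 then 0 else (1 - 1 / real n ^ 2) ^ k)"
  define V where "V = 4 * X"
  have X0: "X \<ge> 0"
  proof -
    have "1 / real n ^ 2 \<le> 1" if "n > 0" using that by simp
    thus ?thesis unfolding X_def by (auto intro!: zero_le_power)
  qed
  \<comment> \<open>Minimality of n gives k/n > 2 pi Im z - ln 4. With Im z >= sqrt(k / 6) and k >=
    12 the right side is at least 2.15 sqrt k, so k / n^2 > 4.62 and X <= exp(-4.62).\<close>
  have X: "X \<le> 1 / 98"
  proof (cases "n = 0")
    case False
    define \<kappa> where "\<kappa> = sqrt (real k)"
    have \<kappa>2: "\<kappa> ^ 2 = real k" by (simp add: \<kappa>_def)
    have \<kappa>: "\<kappa> \<ge> 346 / 100" unfolding \<kappa>_def using k by (intro real_le_rsqrt) (simp add: power2_eq_square)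
    have "1 / 4 < (1 + 1 / real n) ^ k * r" using least[of "n - 1"] False by simp
    hence "ln (1 / 4) < ln ((1 + 1 / real n) ^ k * r)"
      using r False by (subst ln_less_cancel_iff) (auto intro!: mult_pos_pos zero_less_power add_pos_pos)
    also have "\<dots> = real k * ln (1 + 1 / real n) - 2 * pi * Im z"
    proof -
      have p: "1 + 1 / real n > 0" by (intro add_pos_nonneg) auto
      have "ln ((1 + 1 / real n) ^ k * r) = ln ((1 + 1 / real n) ^ k) + ln r"
        using p r by (intro ln_mult_pos zero_less_power)
      also have "ln ((1 + 1 / real n) ^ k) = real k * ln (1 + 1 / real n)" by (rule ln_realpow)
      finally show ?thesis by (simp add: r_def)
    qed
    also have "\<dots> \<le> real k * (1 / real n) - 2 * pi * Im z"
      using ln_add_one_self_le_self[of "1 / real n"] by (intro diff_right_mono mult_left_mono) auto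
    finally have 1: "2 * pi * Im z - ln 4 < real k / real n" by (simp add: ln_div)
    have ln4: "ln 4 \<le> (139 / 100 :: real)"
    proof -
      have "(14148 / 10000 :: real) \<le> exp (139 / 400)"
        using exp_ge_taylor3[of "139 / 400"] by (simp add: power2_eq_square power3_eq_cube)
      hence "(14148 / 10000 :: real) ^ 4 \<le> exp (139 / 400) ^ 4" by (intro power_mono) auto
      hence "(4::real) \<le> exp (139 / 400) ^ 4" by (simp add: power_divide)
      also have "\<dots> = exp (139 / 100)" by (simp add: exp_of_nat_mult[symmetric])
      finally have "ln 4 \<le> ln (exp (139 / 100 :: real))" by (subst ln_le_cancel_iff) auto
      thus ?thesis by simp
    qed
    have "\<kappa> * (408 / 1000) \<le> Im z"
    proof (rule power2_le_imp_le)
      have "(\<kappa> * (408 / 1000)) ^ 2 = real k * (408 / 1000) ^ 2" unfolding power_mult_distrib \<kappa>2 ..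
      also have "\<dots> \<le> real k * (1 / 6)" by (intro mult_left_mono) (auto simp: power2_eq_square)
      finally show "(\<kappa> * (408 / 1000)) ^ 2 \<le> (Im z) ^ 2" using y by simp
    qed (use z in simp)
    hence "2 * (313 / 100) * (\<kappa> * (408 / 1000)) \<le> 2 * pi * Im z"
      using pi_bounds \<kappa> by (intro mult_mono) auto
    hence "\<kappa> * (255408 / 100000) - 139 / 100 < \<kappa> ^ 2 / real n" using 1 ln4 \<kappa>2 by simp
    moreover have "\<kappa> * (215 / 100) \<le> \<kappa> * (255408 / 100000) - 139 / 100" using \<kappa> by simp
    ultimately have "\<kappa> * (215 / 100) < \<kappa> * (\<kappa> / real n)" by (simp add: power2_eq_square)
    hence "215 / 100 < \<kappa> / real n" using \<kappa> by (subst (asm) mult_less_cancel_left_pos) auto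
    hence "(215 / 100) ^ 2 < (\<kappa> / real n) ^ 2" by (intro power_strict_mono) auto
    hence c: "(215 / 100) ^ 2 < real k / real n ^ 2" by (simp add: power_divide \<kappa>2)
    have "X = (1 - 1 / real n ^ 2) ^ k" using False by (simp add: X_def)
    also have "\<dots> \<le> exp (- 1 / real n ^ 2) ^ k"
      using exp_ge_add_one_self[of "- 1 / real n ^ 2"] False by (intro power_mono) auto
    also have "\<dots> = exp (- (real k / real n ^ 2))" by (simp add: exp_of_nat_mult[symmetric])
    also have "\<dots> \<le> exp (- (462 / 100))"
    proof -
      have "(462 / 100 :: real) \<le> (215 / 100) ^ 2" by (simp add: power2_eq_square)
      with c have "462 / 100 \<le> real k / real n ^ 2" by linarith
      thus ?thesis by (simp only: exp_le_cancel_iff neg_le_iff_le)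
    qed
    also have "\<dots> \<le> 1 / 98"
    proof -
      have "(1776 / 1000 :: real) \<le> exp (5775 / 10000)"
        using exp_ge_taylor3[of "5775 / 10000"] by (simp add: power2_eq_square power3_eq_cube)
      hence "(1776 / 1000 :: real) ^ 8 \<le> exp (5775 / 10000) ^ 8" by (intro power_mono) auto
      also have "\<dots> = exp (462 / 100)" by (simp add: exp_of_nat_mult[symmetric])
      finally have "98 \<le> exp (462 / 100 :: real)" by (simp add: power_divide)
      thus ?thesis by (simp add: exp_minus field_simps)
    qed
    finally show ?thesis .
  qed (simp add: X_def)
  have low: "real (n - m) ^ k * r ^ (n - m) \<le> 4 * V ^ m * (real (Suc n) ^ k * r ^ Suc n)" if "m \<le> n" for m
    using that
  proof (induction m)
    case 0
    show ?case
    proof (cases "n = 0")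
      case False
      have "1 \<le> 4 * ((1 + 1 / real n) ^ k * r)" using least[of "n - 1"] False by simp
      hence "real n ^ k * r ^ n * 1 \<le> real n ^ k * r ^ n * (4 * ((1 + 1 / real n) ^ k * r))"
        using r by (intro mult_left_mono) auto
      also have "\<dots> = 4 * ((real n ^ k * (1 + 1 / real n) ^ k) * r ^ Suc n)" by simp
      also have "real n ^ k * (1 + 1 / real n) ^ k = real (Suc n) ^ k"
        using False by (subst power_mult_distrib[symmetric]) (simp add: distrib_left add.commute)
      finally show ?thesis by simp
    qed (use k r in \<open>auto simp: power_0_left\<close>)
  next
    case (Suc m)
    define j where "j = n - m"
    have j: "j \<ge> 1" "j \<le> n" "n - Suc m = j - 1" using Suc.prems by (auto simp: j_def)
    have n0: "n > 0" using Suc.prems by simp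
    \<comment> \<open>For j <= n the ratio of the terms j - 1 and j is at most (1 - 1/n)^k / r, and
      1 / r < 4 (1 + 1/n)^k by minimality; the product is 4 X = V.\<close>
    have "real (j - 1) \<le> real j * (1 - 1 / real n)"
      using j n0 by (simp add: of_nat_diff right_diff_distrib field_simps)
    hence "real (j - 1) ^ k \<le> (real j * (1 - 1 / real n)) ^ k" by (intro power_mono) auto
    hence "real (j - 1) ^ k * 1 \<le> (real j ^ k * (1 - 1 / real n) ^ k) * (4 * ((1 + 1 / real n) ^ k * r))"
      using least[of "n - 1"] n0 r by (intro mult_mono) (auto simp: power_mult_distrib)
    also have "\<dots> = 4 * real j ^ k * ((1 - 1 / real n) ^ k * (1 + 1 / real n) ^ k) * r" by (simp only: mult_ac)
    also have "(1 - 1 / real n) ^ k * (1 + 1 / real n) ^ k = X"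
      using n0 by (simp add: X_def power_mult_distrib[symmetric] algebra_simps power2_eq_square)
    finally have "real (j - 1) ^ k \<le> V * (real j ^ k * r)" by (simp add: V_def mult_ac)
    from mult_right_mono[OF this, of "r ^ (j - 1)"] r
    have "real (j - 1) ^ k * r ^ (j - 1) \<le> V * (real j ^ k * r ^ j)"
      using j by (cases j) (auto simp: mult_ac)
    also have "\<dots> \<le> V * (4 * V ^ m * (real (Suc n) ^ k * r ^ Suc n))"
      using Suc X0 unfolding j_def by (intro mult_left_mono) (auto simp: V_def)
    finally show ?case unfolding j(3) by (simp only: power_Suc mult_ac)
  qed
  have bd: "(1 + 1 / 2 ^ (k - 2)) * (1 / (1 - w) ^ 2 - 1 + 4 * V / (1 - V) ^ 2) < 1"
  proof -
    have V: "0 \<le> V" "V \<le> 41 / 1000" using X X0 by (auto simp: V_def)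
    have "(3 / 4) ^ 2 \<le> (1 - w) ^ 2" using w by (intro power_mono) auto
    hence "1 / (1 - w) ^ 2 \<le> 1 / (3 / 4) ^ 2" using w by (intro divide_left_mono mult_pos_pos) auto
    moreover have "(959 / 1000) ^ 2 \<le> (1 - V) ^ 2" using V by (intro power_mono) auto
    hence "4 * V / (1 - V) ^ 2 \<le> 4 * (41 / 1000) / (959 / 1000) ^ 2" using V by (intro frac_le) auto
    ultimately have le: "1 / (1 - w) ^ 2 - 1 + 4 * V / (1 - V) ^ 2 \<le> 957 / 1000" by (simp add: power2_eq_square)
    have "(2::real) ^ 10 \<le> 2 ^ (k - 2)" using k by (intro power_increasing) auto
    hence "1 / (2::real) ^ (k - 2) \<le> 1 / 2 ^ 10" by (intro divide_left_mono) auto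
    hence \<beta>: "1 + 1 / (2::real) ^ (k - 2) \<le> 1001 / 1000" by simp
    have "(1 + 1 / 2 ^ (k - 2)) * (1 / (1 - w) ^ 2 - 1 + 4 * V / (1 - V) ^ 2) \<le> (1 + 1 / 2 ^ (k - 2)) * (957 / 1000)"
      using le by (intro mult_left_mono) auto
    also have "\<dots> \<le> 1001 / 1000 * (957 / 1000)" using \<beta> by (intro mult_right_mono) auto
    finally show ?thesis by simp
  qed
  show ?thesis
    by (rule eis_B_nonzero_of_dominance[of z k n V 4])
       (use z k w w0 X X0 low bd in \<open>auto simp: w_def r_def V_def\<close>)
qed

section \<open>Positivity of the real part of the first half\<close>

lemma summable_zeta_nat: "k \<ge> 2 \<Longrightarrow> summable (\<lambda>n. 1 / real (Suc n) ^ k)"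
  using inverse_power_summable[of k, where 'a = real] by (subst summable_Suc_iff) (simp add: inverse_eq_divide)

lemma has_sum_zeta_nat: "k \<ge> 2 \<Longrightarrow> ((\<lambda>n. 1 / real (Suc n) ^ k) has_sum zeta_nat k) UNIV"
  unfolding zeta_nat_def by (intro sums_nonneg_imp_has_sum summable_sums summable_zeta_nat) auto

lemma zeta_nat_le:
  assumes k: "k \<ge> 3"
  shows "zeta_nat k \<le> 1 + 1 / 2 ^ k + 1 / 3 ^ (k - 3) * (1 / 12)"
  unfolding zeta_nat_def
proof (rule suminf_le_const[OF summable_zeta_nat])
  fix n
  have "(\<Sum>i<n. 1 / real (Suc i) ^ k) \<le> (\<Sum>i<n+2. 1 / real (Suc i) ^ k)" by (intro sum_mono2) auto
  also have "\<dots> = (\<Sum>e\<in>{1..n+2}. 1 / real e ^ k)"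
    by (rule sum.reindex_bij_witness[of _ "\<lambda>e. e - 1" Suc]) auto
  also have "{1..n+2} = {1,2} \<union> {Suc 2..n+2}" by auto
  also have "(\<Sum>e\<in>\<dots>. 1 / real e ^ k) = 1 + 1 / 2 ^ k + (\<Sum>e\<in>{Suc 2..n+2}. 1 / real e ^ k)"
    by (subst sum.union_disjoint) auto
  also have "(\<Sum>e\<in>{Suc 2..n+2}. 1 / real e ^ k) \<le> (\<Sum>e\<in>{Suc 2..n+2}. 1 / 3 ^ (k - 3) * (1 / real e ^ 3))"
  proof (intro sum_mono)
    fix e assume e: "e \<in> {Suc 2..n+2}"
    have "3 ^ (k - 3) * real e ^ 3 \<le> real e ^ (k - 3) * real e ^ 3"
      using e by (intro mult_right_mono power_mono) auto
    also have "\<dots> = real e ^ k" using k by (simp add: power_add[symmetric])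
    finally show "1 / real e ^ k \<le> 1 / 3 ^ (k - 3) * (1 / real e ^ 3)" using e by (simp add: field_simps)
  qed
  also have "\<dots> = 1 / 3 ^ (k - 3) * (\<Sum>e\<in>{Suc 2..n+2}. 1 / real e ^ 3)" by (rule sum_distrib_left[symmetric])
  also have "\<dots> \<le> 1 / 3 ^ (k - 3) * (1 / 12)" using sum_inverse_cubes_le[of 2 "n + 2"] by (intro mult_left_mono) auto
  finally show "(\<Sum>i<n. 1 / real (Suc i) ^ k) \<le> 1 + 1 / 2 ^ k + 1 / 3 ^ (k - 3) * (1 / 12)" by simp
qed (use k in auto)

lemma zeta_nat_bounds:
  "zeta_nat 3 \<le> 121 / 100" "zeta_nat 4 \<le> 1091 / 1000"
  using zeta_nat_le[of 3] zeta_nat_le[of 4] by (simp_all add: eval_nat_numeral)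

lemma zeta_nat_nonneg: "k \<ge> 2 \<Longrightarrow> 0 \<le> zeta_nat k"
  using zeta_nat_ge_1[of k] by linarith

lemma has_sum_product_nonneg:
  fixes f g :: "nat \<Rightarrow> real"
  assumes "(f has_sum F) UNIV" "(g has_sum G) UNIV" "\<And>i. f i \<ge> 0" "\<And>i. g i \<ge> 0"
  shows "((\<lambda>(i,j). f i * g j) has_sum (F * G)) UNIV"
proof -
  have row: "((\<lambda>j. case (i, j) of (i, j) \<Rightarrow> f i * g j) has_sum (f i * G)) UNIV" for i
    using has_sum_cmult_right[OF assms(2), of "f i"] by simp
  have col: "((\<lambda>i. f i * G) has_sum (F * G)) UNIV" by (rule has_sum_cmult_left[OF assms(1)])
  have "(\<lambda>(i,j). f i * g j) summable_on (UNIV \<times> UNIV)"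
    by (rule summable_on_SigmaI[OF row has_sum_imp_summable[OF col]]) (use assms in auto)
  from has_sum_SigmaI[OF row col this] show ?thesis by simp
qed

section \<open>Decomposition of the lattice into cones and bounds for the remainder\<close>

definition zeta_term :: "nat \<Rightarrow> nat \<Rightarrow> nat \<times> nat \<Rightarrow> real" where
  "zeta_term a b = (\<lambda>(i,j). 1 / real (Suc i) ^ a * (1 / real (Suc j) ^ b))"

lemma has_sum_zeta_term: "a \<ge> 2 \<Longrightarrow> b \<ge> 2 \<Longrightarrow> (zeta_term a b has_sum (zeta_nat a * zeta_nat b)) UNIV"
  unfolding zeta_term_def by (intro has_sum_product_nonneg has_sum_zeta_nat) auto

text \<open>Each cone is parametrised by a free pair of positive integers. In these parameters the
  squared modulus is at least a constant times their product, so the sums are bounded by products of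
  zeta values.\<close>

definition lat1 :: "complex \<Rightarrow> nat \<times> nat \<Rightarrow> complex" where
  "lat1 z = (\<lambda>(i,j). of_nat (Suc i) * z + of_nat (Suc j))"
definition lat2 :: "complex \<Rightarrow> nat \<times> nat \<Rightarrow> complex" where
  "lat2 z = (\<lambda>(i,j). of_nat (Suc i) * z - of_nat (Suc i + Suc j))"
definition lat3 :: "complex \<Rightarrow> nat \<times> nat \<Rightarrow> complex" where
  "lat3 z = (\<lambda>(i,j). of_nat (Suc i + Suc j) * z - of_nat (Suc j))"

lemma has_sum_half_lattice_split:
  fixes f :: "nat \<times> int \<Rightarrow> complex"
  assumes S: "(f has_sum S) UNIV"
    and Z: "((\<lambda>i. f (i, 0)) has_sum a) UNIV" and D: "((\<lambda>i. f (i, - int (Suc i))) has_sum b) UNIV"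
  obtains p1 p2 p3 where
    "((\<lambda>(i,j). f (i, int (Suc j))) has_sum p1) UNIV"
    "((\<lambda>(i,j). f (i, - int (Suc i + Suc j))) has_sum p2) UNIV"
    "((\<lambda>(i,j). f (i + Suc j, - int (Suc j))) has_sum p3) UNIV"
    "S = a + b + p1 + p2 + p3"
proof -
  let ?h1 = "\<lambda>(i,j). (i::nat, int (Suc j))" and ?h2 = "\<lambda>(i,j). (i::nat, - int (Suc i + Suc j))"
    and ?h3 = "\<lambda>(i,j). (i + Suc j, - int (Suc j))"
    and ?hz = "\<lambda>i::nat. (i, 0::int)" and ?hd = "\<lambda>i::nat. (i, - int (Suc i))"
  have inj: "inj ?h1" "inj ?h2" "inj ?h3" "inj ?hz" "inj ?hd" by (auto simp: inj_on_def)
  have summ: "f summable_on A" for A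
    using summable_on_subset[of f UNIV A] S has_sum_imp_summable by blast
  obtain p1 where p1: "(f has_sum p1) (range ?h1)" using summ unfolding summable_on_def by blast
  obtain p2 where p2: "(f has_sum p2) (range ?h2)" using summ unfolding summable_on_def by blast
  obtain p3 where p3: "(f has_sum p3) (range ?h3)" using summ unfolding summable_on_def by blast
  have z: "(f has_sum a) (range ?hz)" using Z by (subst has_sum_reindex[OF inj(4)]) (simp add: o_def)
  have d: "(f has_sum b) (range ?hd)" using D by (subst has_sum_reindex[OF inj(5)]) (simp add: o_def)
  have "(f has_sum (a + b + p1 + p2 + p3)) (range ?hz \<union> range ?hd \<union> range ?h1 \<union> range ?h2 \<union> range ?h3)"
    by (intro has_sum_Un_disjoint z d p1 p2 p3) auto
  moreover have "x \<in> range ?hz \<union> range ?hd \<union> range ?h1 \<union> range ?h2 \<union> range ?h3" for x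
  proof -
    obtain i n where x: "x = (i, n)" by force
    consider "n = 0" | j where "n = int (Suc j)" | j where "n = - int (Suc j)"
      by (metis gr0_implies_Suc int_cases2 not_gr_zero of_nat_0 minus_zero of_nat_0)
    thus ?thesis
    proof cases
      case 1 thus ?thesis by (auto simp: x)
    next
      case 2
      hence "x = ?h1 (i, j)" by (simp add: x)
      thus ?thesis by blast
    next
      case 3
      note n3 = this
      consider "j = i" | "j > i" | "j < i" by linarith
      thus ?thesis
      proof cases
        case 1
        hence "x = ?hd i" using n3 by (simp add: x)
        thus ?thesis by blast
      next
        case 2
        hence "x = ?h2 (i, j - Suc i)" using n3 by (simp add: x of_nat_diff)
        thus ?thesis by blast
      next
        case 3
        hence "x = ?h3 (i - Suc j, j)" using n3 by (simp add: x)
        thus ?thesis by blast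
      qed
    qed
  qed
  hence "range ?hz \<union> range ?hd \<union> range ?h1 \<union> range ?h2 \<union> range ?h3 = UNIV" by blast
  ultimately have "(f has_sum (a + b + p1 + p2 + p3)) UNIV" by simp
  from has_sum_unique[OF S this] have "S = a + b + p1 + p2 + p3" .
  moreover have "((\<lambda>(i,j). f (i, int (Suc j))) has_sum p1) UNIV"
    using p1 by (subst (asm) has_sum_reindex[OF inj(1)]) (simp add: o_def case_prod_unfold)
  moreover have "((\<lambda>(i,j). f (i, - int (Suc i + Suc j))) has_sum p2) UNIV"
    using p2 by (subst (asm) has_sum_reindex[OF inj(2)]) (simp add: o_def case_prod_unfold)
  moreover have "((\<lambda>(i,j). f (i + Suc j, - int (Suc j))) has_sum p3) UNIV"
    using p3 by (subst (asm) has_sum_reindex[OF inj(3)]) (simp add: o_def case_prod_unfold)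
  ultimately show ?thesis using that by blast
qed

text \<open>The rows \<open>m \<ge> 1\<close> of the lattice with the column \<open>n = 0\<close> and the diagonal \<open>n = - m\<close> removed fall into the cones \<open>n > 0\<close>,
  \<open>n < - m\<close> and \<open>- m < n < 0\<close>, summed by \<open>p1\<close>, \<open>p2\<close> and \<open>p3\<close>.\<close>

definition rest_terms :: "nat \<Rightarrow> complex \<Rightarrow> complex \<Rightarrow> complex \<Rightarrow> complex \<Rightarrow> bool" where
  "rest_terms k z p1 p2 p3 \<longleftrightarrow>
     ((\<lambda>x. of_nat (Suc (snd x)) / lat1 z x ^ Suc k) has_sum p1) UNIV \<and>
     ((\<lambda>x. - (of_nat (Suc (fst x) + Suc (snd x)) / lat2 z x ^ Suc k)) has_sum p2) UNIV \<and>
     ((\<lambda>x. - (of_nat (Suc (snd x)) / lat3 z x ^ Suc k)) has_sum p3) UNIV"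

text \<open>The row m = 0 contributes zeta(k), the column n = 0 nothing, since n is the numerator,
  and the diagonal n = - m, where m z + n = m (z - 1), contributes - zeta(k) / (z - 1)^(k+1). The
  diagonal stays apart because |z - 1| = 1 at the corner, which makes it as large as the constant
  term.\<close>

lemma eis_A_split:
  assumes z: "Im z > 0" and k: "even k" "k \<ge> 4"
  obtains p1 p2 p3 where "rest_terms k z p1 p2 p3"
    "eis_A k z = of_real (zeta_nat k) * (1 - 1 / (z - 1) ^ Suc k) + p1 + p2 + p3"
proof -
  define f where "f = (\<lambda>(i::nat,n::int). of_int n / lat z (int (Suc i)) n ^ Suc k)"
  have S: "(f has_sum (eis_A k z - of_real (zeta_nat k))) UNIV"
    unfolding f_def by (rule has_sum_eis_A_half[OF z k])
  have Z: "((\<lambda>i. f (i, 0)) has_sum 0) UNIV" by (simp add: f_def)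
  have "((\<lambda>n. complex_of_real (1 / real (Suc n) ^ k)) has_sum of_real (zeta_nat k)) UNIV"
    using k by (intro has_sum_of_real has_sum_zeta_nat) auto
  from has_sum_cmult_right[OF this, of "- (1 / (z - 1) ^ Suc k)"]
  have "((\<lambda>n. - (1 / (z - 1) ^ Suc k) * complex_of_real (1 / real (Suc n) ^ k)) has_sum - (1 / (z - 1) ^ Suc k) * of_real (zeta_nat k)) UNIV" .
  moreover have "- (1 / (z - 1) ^ Suc k) * complex_of_real (1 / real (Suc i) ^ k) = f (i, - int (Suc i))" for i
  proof -
    have "lat z (int (Suc i)) (- int (Suc i)) = of_nat (Suc i) * (z - 1)" by (simp add: algebra_simps)
    hence "f (i, - int (Suc i)) = - of_nat (Suc i) / (of_nat (Suc i) * (z - 1)) ^ Suc k"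
      by (simp only: f_def prod.case of_int_minus of_int_of_nat_eq)
    also have "\<dots> = - (of_nat (Suc i) / of_nat (Suc i) ^ Suc k / (z - 1) ^ Suc k)"
      by (simp only: power_mult_distrib divide_divide_eq_left minus_divide_left)
    also have "of_nat (Suc i) / of_nat (Suc i) ^ Suc k = (1 / of_nat (Suc i) ^ k :: complex)"
      using of_nat_neq_0[of i, where 'a = complex] by (simp del: of_nat_Suc)
    finally show ?thesis by (simp del: of_nat_Suc power_Suc)
  qed
  ultimately have D: "((\<lambda>i. f (i, - int (Suc i))) has_sum - (1 / (z - 1) ^ Suc k) * of_real (zeta_nat k)) UNIV"
    by (simp only:)
  obtain p1 p2 p3 where p:
    "((\<lambda>(i,j). f (i, int (Suc j))) has_sum p1) UNIV"
    "((\<lambda>(i,j). f (i, - int (Suc i + Suc j))) has_sum p2) UNIV"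
    "((\<lambda>(i,j). f (i + Suc j, - int (Suc j))) has_sum p3) UNIV"
    "eis_A k z - of_real (zeta_nat k) = 0 + - (1 / (z - 1) ^ Suc k) * of_real (zeta_nat k) + p1 + p2 + p3"
    by (rule has_sum_half_lattice_split[OF S Z D])
  have 1: "(case x of (i,j) \<Rightarrow> f (i, int (Suc j))) = of_nat (Suc (snd x)) / lat1 z x ^ Suc k" for x
    by (cases x) (simp only: f_def lat1_def prod.case fst_conv snd_conv of_int_of_nat_eq)
  have 2: "(case x of (i,j) \<Rightarrow> f (i, - int (Suc i + Suc j))) = - (of_nat (Suc (fst x) + Suc (snd x)) / lat2 z x ^ Suc k)" for x
    by (cases x) (simp only: f_def lat2_def prod.case fst_conv snd_conv of_int_of_nat_eq of_int_minus minus_divide_left diff_conv_add_uminus)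
  have 3: "(case x of (i,j) \<Rightarrow> f (i + Suc j, - int (Suc j))) = - (of_nat (Suc (snd x)) / lat3 z x ^ Suc k)" for x
  proof -
    obtain i j where x: "x = (i, j)" by force
    have "Suc (i + Suc j) = Suc i + Suc j" by simp
    thus ?thesis unfolding x f_def lat3_def
      by (simp only: prod.case fst_conv snd_conv of_int_of_nat_eq of_int_minus minus_divide_left diff_conv_add_uminus)
  qed
  have "((\<lambda>x. of_nat (Suc (snd x)) / lat1 z x ^ Suc k) has_sum p1) UNIV"
    using p(1) by (rule has_sum_cong[THEN iffD1, rotated]) (simp only: 1)
  moreover have "((\<lambda>x. - (of_nat (Suc (fst x) + Suc (snd x)) / lat2 z x ^ Suc k)) has_sum p2) UNIV"
    using p(2) by (rule has_sum_cong[THEN iffD1, rotated]) (simp only: 2)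
  moreover have "((\<lambda>x. - (of_nat (Suc (snd x)) / lat3 z x ^ Suc k)) has_sum p3) UNIV"
    using p(3) by (rule has_sum_cong[THEN iffD1, rotated]) (simp only: 3)
  ultimately have "rest_terms k z p1 p2 p3" unfolding rest_terms_def by blast
  moreover have "eis_A k z = of_real (zeta_nat k) * (1 - 1 / (z - 1) ^ Suc k) + p1 + p2 + p3"
    using p(4) by (simp add: algebra_simps)
  ultimately show ?thesis by (rule that)
qed

text \<open>Larger than the right half of the fundamental domain: it reaches below the unit circle,
  so that the estimates hold in a neighbourhood of the open arc from the corner to i.\<close>

definition half_strip :: "complex set" where
  "half_strip = {z. 0 \<le> Re z \<and> Re z \<le> 1 / 2 \<and> Im z \<ge> sqrt 3 / 2}"

lemma Im_half_strip:
  assumes "z \<in> half_strip"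
  shows "Im z > 0" "(Im z) ^ 2 \<ge> 3 / 4"
proof -
  have "0 < sqrt 3 / (2 :: real)" by simp
  moreover have "Im z \<ge> sqrt 3 / 2" using assms by (simp add: half_strip_def)
  ultimately show "Im z > 0" by linarith
  have "(sqrt 3 / 2) ^ 2 \<le> (Im z) ^ 2"
    using \<open>0 < sqrt 3 / 2\<close> \<open>Im z \<ge> sqrt 3 / 2\<close> by (intro power_mono) auto
  thus "(Im z) ^ 2 \<ge> 3 / 4" by (simp add: power_divide)
qed

text \<open>Arithmetic-geometric mean: n^2 + (3/4) m^2 >= sqrt 3 m n on the first cone, m^2 + m n +
  n^2 >= 3 m n and (3/4) (m + n)^2 >= 3 m n on the others. The number 1.732 approximates sqrt 3 from
  below.\<close>

lemma lat_lower_bounds: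
  assumes z: "z \<in> half_strip"
  shows "norm (lat1 z x) ^ 2 \<ge> 1732 / 1000 * (real (Suc (fst x)) * real (Suc (snd x)))"
    and "norm (lat2 z x) ^ 2 \<ge> 3 * (real (Suc (fst x)) * real (Suc (snd x)))"
    and "norm (lat3 z x) ^ 2 \<ge> 3 * (real (Suc (fst x)) * real (Suc (snd x)))"
proof -
  obtain i j where x: "x = (i, j)" by force
  define m n where "m = real (Suc i)" and "n = real (Suc j)"
  have mn: "m > 0" "n > 0" by (auto simp: m_def n_def)
  have xz: "0 \<le> Re z" "Re z \<le> 1 / 2" using z by (auto simp: half_strip_def)
  have y: "(Im z) ^ 2 \<ge> 3 / 4" using Im_half_strip[OF z] by blast
  have l1: "lat1 z x = of_real m * z + of_real n" by (simp add: x lat1_def m_def n_def)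
  have l2: "lat2 z x = of_real m * z - of_real (m + n)" by (simp add: x lat2_def m_def n_def)
  have l3: "lat3 z x = of_real (m + n) * z - of_real n" by (simp add: x lat3_def m_def n_def)
  have im: "(c * Im z) ^ 2 \<ge> c ^ 2 * (3 / 4)" for c
    unfolding power_mult_distrib using y by (intro mult_left_mono) auto
  have "norm (lat1 z x) ^ 2 = (m * Re z + n) ^ 2 + (m * Im z) ^ 2" by (simp add: l1 cmod_power2)
  also have "\<dots> \<ge> n ^ 2 + m ^ 2 * (3 / 4)" using im[of m] mn xz by (intro add_mono power_mono) auto
  also have "n ^ 2 + m ^ 2 * (3 / 4) \<ge> 1732 / 1000 * (m * n)"
  proof -
    have "(n - 866 / 1000 * m) ^ 2 = n ^ 2 - 1732 / 1000 * (m * n) + 749956 / 1000000 * m ^ 2"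
      by (simp add: power2_eq_square algebra_simps)
    moreover have "0 \<le> (n - 866 / 1000 * m) ^ 2" "0 \<le> m ^ 2" by auto
    ultimately show ?thesis by linarith
  qed
  finally show "norm (lat1 z x) ^ 2 \<ge> 1732 / 1000 * (real (Suc (fst x)) * real (Suc (snd x)))" by (simp add: x m_def n_def)
  have "norm (lat2 z x) ^ 2 = (m + n - m * Re z) ^ 2 + (m * Im z) ^ 2"
    by (simp add: l2 cmod_power2 power2_commute)
  also have "\<dots> \<ge> (m / 2 + n) ^ 2 + m ^ 2 * (3 / 4)"
  proof (intro add_mono power_mono im)
    have "m * Re z \<le> m * (1 / 2)" using xz mn by (intro mult_left_mono) auto
    thus "m / 2 + n \<le> m + n - m * Re z" by simp
  qed (use mn in auto)
  also have "(m / 2 + n) ^ 2 + m ^ 2 * (3 / 4) \<ge> 3 * (m * n)"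
  proof -
    have "0 \<le> (m - n) ^ 2" by simp
    thus ?thesis unfolding power2_diff power2_sum by (simp add: power_divide algebra_simps)
  qed
  finally show "norm (lat2 z x) ^ 2 \<ge> 3 * (real (Suc (fst x)) * real (Suc (snd x)))" by (simp add: x m_def n_def)
  have "norm (lat3 z x) ^ 2 = ((m + n) * Re z - n) ^ 2 + ((m + n) * Im z) ^ 2" by (simp add: l3 cmod_power2)
  also have "\<dots> \<ge> 0 + (m + n) ^ 2 * (3 / 4)" by (intro add_mono im) auto
  also have "0 + (m + n) ^ 2 * (3 / 4) \<ge> 3 * (m * n)"
  proof -
    have "0 \<le> (m - n) ^ 2" by simp
    thus ?thesis unfolding power2_diff power2_sum by (simp add: algebra_simps)
  qed
  finally show "norm (lat3 z x) ^ 2 \<ge> 3 * (real (Suc (fst x)) * real (Suc (snd x)))" by (simp add: x m_def n_def)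
qed

text \<open>Only the square of a is controlled, so the odd power 7 is interpolated between 6 and 8
  by 2 t a <= t^2 a^2 + 1. The two coefficients agree for t = 1 / sqrt c; hence the later choices t
  = 0.76 for c = 1.732 and t = 0.577 for c = 3.\<close>

lemma inverse_power_7_le:
  fixes a c p t :: real
  assumes a: "a ^ 2 \<ge> c * p" "c > 1" "p \<ge> 1" "a \<ge> 0" and t: "t > 0" and k: "k \<ge> 7"
  shows "1 / a ^ k \<le> t / (2 * c ^ 3) / p ^ 3 + 1 / (2 * t * c ^ 4) / p ^ 4"
proof -
  have cp: "1 * 1 \<le> c * p" using a by (intro mult_mono) auto
  have a1: "a \<ge> 1"
  proof (rule ccontr)
    assume "\<not> a \<ge> 1"
    hence "a * a < 1 * 1" using a by (intro mult_strict_mono') auto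
    with a cp show False by (simp add: power2_eq_square)
  qed
  have "1 / a ^ k \<le> 1 / a ^ 7" using a1 k by (intro divide_left_mono power_increasing) auto
  also have "1 / a ^ 7 = (1 / a ^ 3) * (1 / a ^ 4)" by (simp add: power_add[symmetric])
  also have "\<dots> = (1 / a ^ 6) * a ^ 3 / a ^ 4" using a1 by (simp add: power_add[symmetric] divide_simps)
  also have "\<dots> \<le> t / 2 * (1 / a ^ 6) + 1 / (2 * t) * (1 / a ^ 8)"
  proof -
    have "0 \<le> (t * a - 1) ^ 2" by simp
    hence "2 * t * a \<le> t ^ 2 * a ^ 2 + 1" by (simp add: power2_diff power_mult_distrib)
    hence "2 * t * a / (2 * t * a ^ 8) \<le> (t ^ 2 * a ^ 2 + 1) / (2 * t * a ^ 8)"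
      using t a1 by (intro divide_right_mono) auto
    also have "\<dots> = t / 2 * (1 / a ^ 6) + 1 / (2 * t) * (1 / a ^ 8)"
      using t a1 by (simp add: field_simps eval_nat_numeral)
    also have "2 * t * a / (2 * t * a ^ 8) = (1 / a ^ 6) * a ^ 3 / a ^ 4"
      using t a1 by (simp add: field_simps eval_nat_numeral)
    finally show ?thesis .
  qed
  also have "\<dots> \<le> t / 2 * (1 / (c * p) ^ 3) + 1 / (2 * t) * (1 / (c * p) ^ 4)"
  proof (intro add_mono mult_left_mono)
    have "(c * p) ^ 3 \<le> (a ^ 2) ^ 3" using a by (intro power_mono) auto
    thus "1 / a ^ 6 \<le> 1 / (c * p) ^ 3"
      using cp a1 by (intro divide_left_mono) (auto simp: power_mult[symmetric] intro!: mult_pos_pos)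
    have "(c * p) ^ 4 \<le> (a ^ 2) ^ 4" using a by (intro power_mono) auto
    thus "1 / a ^ 8 \<le> 1 / (c * p) ^ 4"
      using cp a1 by (intro divide_left_mono) (auto simp: power_mult[symmetric] intro!: mult_pos_pos)
  qed (use t in auto)
  finally show ?thesis by (simp add: power_mult_distrib mult.assoc)
qed

lemma zeta_nat_2_le: "zeta_nat 2 \<le> 1665 / 1000"
proof -
  have "zeta_nat 2 = pi ^ 2 / 6"
    unfolding zeta_nat_def using sums_unique[OF inverse_squares_sums] by (simp add: add.commute)
  moreover have "pi ^ 2 \<le> (316 / 100) ^ 2" using pi_bounds by (intro power_mono) auto
  ultimately show ?thesis by (simp add: power2_eq_square)
qed

lemma zeta_term_apply: "zeta_term a b x = 1 / real (Suc (fst x)) ^ a * (1 / real (Suc (snd x)) ^ b)"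
  by (simp add: zeta_term_def case_prod_unfold)

text \<open>Lowering the exponent k + 1 to 7 makes the bound uniform in the weight. The total has to
  stay below about 0.36, the lower bound available for the main term when k mod 6 is not 2.\<close>

lemma rest_bound:
  assumes z: "z \<in> half_strip" and k: "k \<ge> 6" and p: "rest_terms k z p1 p2 p3"
  shows "norm (p1 + p2 + p3) \<le> 352 / 1000"
proof -
  define m n where "m = (\<lambda>x::nat\<times>nat. real (Suc (fst x)))" and "n = (\<lambda>x::nat\<times>nat. real (Suc (snd x)))"
  have mn: "m x \<ge> 1" "n x \<ge> 1" for x by (auto simp: m_def n_def)
  have mn1: "m x * n x \<ge> 1" for x using mult_mono[of 1 "m x" 1 "n x"] mn[of x] by simp
  note lb = lat_lower_bounds[OF z]
  have k7: "Suc k \<ge> 7" using k by simp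
  let ?a = "732 / 10000 :: real"
  have "norm p1 \<le> ?a * (zeta_nat 3 * zeta_nat 2) + ?a * (zeta_nat 4 * zeta_nat 3)"
  proof (rule norm_infsum_le)
    show "((\<lambda>x. of_nat (Suc (snd x)) / lat1 z x ^ Suc k) has_sum p1) UNIV" using p by (simp add: rest_terms_def)
    show "((\<lambda>x. ?a * zeta_term 3 2 x + ?a * zeta_term 4 3 x) has_sum (?a * (zeta_nat 3 * zeta_nat 2) + ?a * (zeta_nat 4 * zeta_nat 3))) UNIV"
      by (intro has_sum_add has_sum_cmult_right has_sum_zeta_term) auto
    fix x
    have "1 / norm (lat1 z x) ^ Suc k \<le> (76/100) / (2 * (1732/1000) ^ 3) / (m x * n x) ^ 3 + 1 / (2 * (76/100) * (1732/1000) ^ 4) / (m x * n x) ^ 4"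
      using lb(1)[of x] mn1[of x] by (intro inverse_power_7_le k7) (auto simp: m_def n_def)
    also have "\<dots> \<le> ?a / (m x * n x) ^ 3 + ?a / (m x * n x) ^ 4"
      using mn1[of x] by (intro add_mono divide_right_mono) (auto simp: power_divide)
    finally have "n x * (1 / norm (lat1 z x) ^ Suc k) \<le> n x * (?a / (m x * n x) ^ 3 + ?a / (m x * n x) ^ 4)"
      using mn[of x] by (intro mult_left_mono) auto
    also have "\<dots> = ?a * zeta_term 3 2 x + ?a * zeta_term 4 3 x"
      unfolding zeta_term_apply m_def[symmetric] n_def[symmetric] using mn[of x]
      by (simp add: m_def n_def field_simps eval_nat_numeral del: of_nat_Suc)
    finally show "norm (of_nat (Suc (snd x)) / lat1 z x ^ Suc k) \<le> ?a * zeta_term 3 2 x + ?a * zeta_term 4 3 x"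
      by (simp add: norm_divide norm_power n_def del: of_nat_Suc power_Suc)
  qed
  also have "\<dots> \<le> ?a * (121 / 100 * (1665 / 1000)) + ?a * (1091 / 1000 * (121 / 100))"
    using zeta_nat_bounds zeta_nat_2_le zeta_nat_nonneg[of 2] zeta_nat_nonneg[of 3] zeta_nat_nonneg[of 4]
    by (intro add_mono mult_left_mono mult_mono) auto
  finally have b1: "norm p1 \<le> 2442 / 10000" by simp
  let ?b = "1070 / 100000 :: real"
  have l: "1 / norm l ^ Suc k \<le> ?b / (m x * n x) ^ 3 + ?b / (m x * n x) ^ 4"
    if "norm (l :: complex) ^ 2 \<ge> 3 * (m x * n x)" for l x
  proof -
    have "1 / norm l ^ Suc k \<le> (577/1000) / (2 * 3 ^ 3) / (m x * n x) ^ 3 + 1 / (2 * (577/1000) * 3 ^ 4) / (m x * n x) ^ 4"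
      using that mn1[of x] by (intro inverse_power_7_le k7) auto
    also have "\<dots> \<le> ?b / (m x * n x) ^ 3 + ?b / (m x * n x) ^ 4"
      using mn1[of x] by (intro add_mono divide_right_mono) auto
    finally show ?thesis .
  qed
  have "norm p2 \<le> ?b * (zeta_nat 2 * zeta_nat 3) + ?b * (zeta_nat 3 * zeta_nat 2) + ?b * (zeta_nat 3 * zeta_nat 4) + ?b * (zeta_nat 4 * zeta_nat 3)"
  proof (rule norm_infsum_le)
    show "((\<lambda>x. - (of_nat (Suc (fst x) + Suc (snd x)) / lat2 z x ^ Suc k)) has_sum p2) UNIV" using p by (simp add: rest_terms_def)
    show "((\<lambda>x. ?b * zeta_term 2 3 x + ?b * zeta_term 3 2 x + ?b * zeta_term 3 4 x + ?b * zeta_term 4 3 x) has_sum (?b * (zeta_nat 2 * zeta_nat 3) + ?b * (zeta_nat 3 * zeta_nat 2) + ?b * (zeta_nat 3 * zeta_nat 4) + ?b * (zeta_nat 4 * zeta_nat 3))) UNIV"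
      by (intro has_sum_add has_sum_cmult_right has_sum_zeta_term) auto
    fix x
    have "(m x + n x) * (1 / norm (lat2 z x) ^ Suc k) \<le> (m x + n x) * (?b / (m x * n x) ^ 3 + ?b / (m x * n x) ^ 4)"
      using mn[of x] lb(2)[of x] by (intro mult_left_mono l) (auto simp: m_def n_def)
    also have "\<dots> = ?b * zeta_term 2 3 x + ?b * zeta_term 3 2 x + ?b * zeta_term 3 4 x + ?b * zeta_term 4 3 x"
      unfolding zeta_term_apply m_def[symmetric] n_def[symmetric] using mn[of x]
      by (simp add: m_def n_def field_simps eval_nat_numeral del: of_nat_Suc)
    finally show "norm (- (of_nat (Suc (fst x) + Suc (snd x)) / lat2 z x ^ Suc k)) \<le> ?b * zeta_term 2 3 x + ?b * zeta_term 3 2 x + ?b * zeta_term 3 4 x + ?b * zeta_term 4 3 x"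
      by (simp only: norm_minus_cancel norm_divide norm_power norm_of_nat) (simp add: m_def n_def del: power_Suc)
  qed
  also have "\<dots> \<le> ?b * (1665 / 1000 * (121 / 100)) + ?b * (121 / 100 * (1665 / 1000)) + ?b * (121 / 100 * (1091 / 1000)) + ?b * (1091 / 1000 * (121 / 100))"
    using zeta_nat_bounds zeta_nat_2_le zeta_nat_nonneg[of 2] zeta_nat_nonneg[of 3] zeta_nat_nonneg[of 4]
    by (intro add_mono mult_left_mono mult_mono) auto
  finally have b2: "norm p2 \<le> 714 / 10000" by simp
  have "norm p3 \<le> ?b * (zeta_nat 3 * zeta_nat 2) + ?b * (zeta_nat 4 * zeta_nat 3)"
  proof (rule norm_infsum_le)
    show "((\<lambda>x. - (of_nat (Suc (snd x)) / lat3 z x ^ Suc k)) has_sum p3) UNIV" using p by (simp add: rest_terms_def)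
    show "((\<lambda>x. ?b * zeta_term 3 2 x + ?b * zeta_term 4 3 x) has_sum (?b * (zeta_nat 3 * zeta_nat 2) + ?b * (zeta_nat 4 * zeta_nat 3))) UNIV"
      by (intro has_sum_add has_sum_cmult_right has_sum_zeta_term) auto
    fix x
    have "n x * (1 / norm (lat3 z x) ^ Suc k) \<le> n x * (?b / (m x * n x) ^ 3 + ?b / (m x * n x) ^ 4)"
      using mn[of x] lb(3)[of x] by (intro mult_left_mono l) (auto simp: m_def n_def)
    also have "\<dots> = ?b * zeta_term 3 2 x + ?b * zeta_term 4 3 x"
      unfolding zeta_term_apply m_def[symmetric] n_def[symmetric] using mn[of x]
      by (simp add: m_def n_def field_simps eval_nat_numeral del: of_nat_Suc)
    finally show "norm (- (of_nat (Suc (snd x)) / lat3 z x ^ Suc k)) \<le> ?b * zeta_term 3 2 x + ?b * zeta_term 4 3 x"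
      by (simp add: norm_divide norm_power n_def del: of_nat_Suc power_Suc)
  qed
  also have "\<dots> \<le> ?b * (121 / 100 * (1665 / 1000)) + ?b * (1091 / 1000 * (121 / 100))"
    using zeta_nat_bounds zeta_nat_2_le zeta_nat_nonneg[of 2] zeta_nat_nonneg[of 3] zeta_nat_nonneg[of 4]
    by (intro add_mono mult_left_mono mult_mono) auto
  finally have b3: "norm p3 \<le> 358 / 10000" by simp
  have "norm (p1 + p2 + p3) \<le> norm p1 + norm p2 + norm p3"
    using norm_triangle_ineq[of "p1 + p2" p3] norm_triangle_ineq[of p1 p2] by linarith
  thus ?thesis using b1 b2 b3 by simp
qed

lemma norm_power_diff_le:
  fixes a b :: complex
  assumes "norm a \<le> M" "norm b \<le> M"
  shows "norm (a ^ Suc n - b ^ Suc n) \<le> real (Suc n) * norm (a - b) * M ^ n"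
proof -
  have M: "M \<ge> 0" using assms norm_ge_zero order_trans by blast
  have "a ^ Suc n - b ^ Suc n = (a - b) * (\<Sum>i<Suc n. b ^ (Suc n - Suc i) * a ^ i)"
    by (rule power_diff_sumr2)
  hence "norm (a ^ Suc n - b ^ Suc n) = norm (a - b) * norm (\<Sum>i<Suc n. b ^ (Suc n - Suc i) * a ^ i)"
    by (simp only: norm_mult)
  also have "norm (\<Sum>i<Suc n. b ^ (Suc n - Suc i) * a ^ i) \<le> (\<Sum>i<Suc n. M ^ n)"
  proof (rule sum_norm_le)
    fix i assume i: "i \<in> {..<Suc n}"
    have "norm (b ^ (Suc n - Suc i) * a ^ i) \<le> M ^ (n - i) * M ^ i"
      using assms M by (simp add: norm_mult norm_power) (intro mult_mono power_mono; simp)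
    also have "\<dots> = M ^ n" using i by (simp add: power_add[symmetric])
    finally show "norm (b ^ (Suc n - Suc i) * a ^ i) \<le> M ^ n" .
  qed
  finally have "norm (a ^ Suc n - b ^ Suc n) \<le> norm (a - b) * (\<Sum>i<Suc n. M ^ n)"
    by (simp add: mult_left_mono)
  thus ?thesis by (simp add: mult_ac)
qed

text \<open>1/a and 1/b have modulus at most X^(-1/2). Their k-th powers are bounded by X^(-k/2), an
  integer power because k is even, and k >= 8 yields X^(-4); the last factor 1 / X comes from 1/a -
  1/b = (b - a) / (a b).\<close>

lemma inverse_power_diff_le:
  fixes a b :: complex
  assumes X: "X \<ge> 1" "norm a ^ 2 \<ge> X" "norm b ^ 2 \<ge> X" and k: "even k" "k \<ge> 8"
  shows "norm (1 / a ^ Suc k - 1 / b ^ Suc k) \<le> real (Suc k) * norm (a - b) / X ^ 5"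
proof -
  have nz: "a \<noteq> 0" "b \<noteq> 0" using X by auto
  define M where "M = sqrt (1 / X)"
  have M2: "M ^ 2 = 1 / X" using X by (simp add: M_def)
  have le: "norm (1 / c) \<le> M" if "norm c ^ 2 \<ge> X" for c :: complex
  proof -
    have "(norm (1 / c)) ^ 2 \<le> M ^ 2" unfolding M2 using that X by (simp add: norm_divide power_divide frac_le)
    thus ?thesis by (rule power2_le_imp_le) (use X in \<open>simp add: M_def\<close>)
  qed
  have "norm (1 / a ^ Suc k - 1 / b ^ Suc k) = norm ((1 / a) ^ Suc k - (1 / b) ^ Suc k)"
    by (simp only: power_one_over)
  also have "\<dots> \<le> real (Suc k) * norm (1 / a - 1 / b) * M ^ k"
    by (rule norm_power_diff_le) (use le X in auto)
  also have "norm (1 / a - 1 / b) \<le> norm (a - b) / X"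
  proof -
    have "1 / a - 1 / b = (b - a) * ((1 / a) * (1 / b))" using nz by (simp add: field_simps)
    hence "norm (1 / a - 1 / b) = norm (a - b) * (norm (1 / a) * norm (1 / b))"
      by (simp only: norm_mult norm_minus_commute)
    also have "\<dots> \<le> norm (a - b) * (M * M)" using le X by (intro mult_left_mono mult_mono) (auto simp: M_def)
    finally show ?thesis using M2 by (simp add: power2_eq_square)
  qed
  hence "real (Suc k) * norm (1 / a - 1 / b) * M ^ k \<le> real (Suc k) * (norm (a - b) / X) * M ^ k"
    using X by (intro mult_right_mono mult_left_mono) (auto simp: M_def)
  also have "M ^ k = 1 / X ^ (k div 2)"
  proof -
    have "M ^ k = (M ^ 2) ^ (k div 2)" using k by (simp add: power_mult[symmetric])
    thus ?thesis by (simp add: M2 power_one_over)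
  qed
  also have "real (Suc k) * (norm (a - b) / X) * (1 / X ^ (k div 2)) \<le> real (Suc k) * (norm (a - b) / X) * (1 / X ^ 4)"
    using X k by (intro mult_left_mono divide_left_mono power_increasing) auto
  also have "\<dots> = real (Suc k) * norm (a - b) / X ^ 5" by (simp add: eval_nat_numeral)
  finally show ?thesis .
qed

text \<open>Used with c the corner and k mod 6 = 2. The remainder vanishes there, and a bound
  proportional to the distance replaces the absolute one, in the same quantity (k + 1) |z - c| in
  which the main term is measured.\<close>

lemma rest_diff_bound:
  assumes z: "z \<in> half_strip" and c: "c \<in> half_strip" and k: "even k" "k \<ge> 8"
    and p: "rest_terms k z p1 p2 p3" and q: "rest_terms k c q1 q2 q3"
  shows "norm ((p1 + p2 + p3) - (q1 + q2 + q3)) \<le> real (Suc k) * norm (z - c) * (97 / 1000)"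
proof -
  define D where "D = real (Suc k) * norm (z - c)"
  have D: "D \<ge> 0" by (simp add: D_def)
  define m n where "m = (\<lambda>x::nat\<times>nat. real (Suc (fst x)))" and "n = (\<lambda>x::nat\<times>nat. real (Suc (snd x)))"
  have mn: "m x \<ge> 1" "n x \<ge> 1" for x by (auto simp: m_def n_def)
  have mn1: "m x * n x \<ge> 1" for x using mult_mono[of 1 "m x" 1 "n x"] mn[of x] by simp
  note lbz = lat_lower_bounds[OF z] and lbc = lat_lower_bounds[OF c]
  have d1: "norm (lat1 z x - lat1 c x) = m x * norm (z - c)" for x
    by (simp add: lat1_def case_prod_unfold m_def right_diff_distrib[symmetric] norm_mult del: of_nat_Suc)
  have d2: "norm (lat2 z x - lat2 c x) = m x * norm (z - c)" for x
    by (simp add: lat2_def case_prod_unfold m_def right_diff_distrib[symmetric] norm_mult del: of_nat_Suc)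
  have d3: "norm (lat3 z x - lat3 c x) = (m x + n x) * norm (z - c)" for x
  proof -
    have "lat3 z x - lat3 c x = of_nat (Suc (fst x) + Suc (snd x)) * (z - c)"
      by (simp add: lat3_def case_prod_unfold right_diff_distrib del: of_nat_Suc of_nat_add)
    thus ?thesis by (simp only: norm_mult norm_of_nat of_nat_add[symmetric] m_def n_def)
  qed
  let ?a = "6417 / 100000 :: real"
  have "norm (p1 - q1) \<le> D * ?a * (zeta_nat 4 * zeta_nat 4)"
  proof (rule norm_infsum_le)
    show "((\<lambda>x. of_nat (Suc (snd x)) / lat1 z x ^ Suc k - of_nat (Suc (snd x)) / lat1 c x ^ Suc k) has_sum (p1 - q1)) UNIV"
      using p q by (intro has_sum_diff) (simp_all add: rest_terms_def)
    show "((\<lambda>x. D * ?a * zeta_term 4 4 x) has_sum (D * ?a * (zeta_nat 4 * zeta_nat 4))) UNIV"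
      by (intro has_sum_cmult_right has_sum_zeta_term) auto
    fix x
    have X1: "1732 / 1000 * (m x * n x) \<ge> 1" using mn1[of x] by simp
    have "norm (of_nat (Suc (snd x)) / lat1 z x ^ Suc k - of_nat (Suc (snd x)) / lat1 c x ^ Suc k) =
       n x * norm (1 / lat1 z x ^ Suc k - 1 / lat1 c x ^ Suc k)"
    proof -
      have "of_nat (Suc (snd x)) / lat1 z x ^ Suc k - of_nat (Suc (snd x)) / lat1 c x ^ Suc k = of_nat (Suc (snd x)) * (1 / lat1 z x ^ Suc k - 1 / lat1 c x ^ Suc k)"
        by (simp only: right_diff_distrib times_divide_eq_right mult_1_right)
      thus ?thesis by (simp only: norm_mult norm_of_nat n_def)
    qed
    also have "\<dots> \<le> n x * (real (Suc k) * norm (lat1 z x - lat1 c x) / (1732 / 1000 * (m x * n x)) ^ 5)"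
      using mn[of x] lbz(1)[of x] lbc(1)[of x] k
      by (intro mult_left_mono inverse_power_diff_le[OF X1]) (simp_all add: m_def n_def mult.assoc del: of_nat_Suc)
    also have "\<dots> = D * (1 / (1732 / 1000) ^ 5) * (m x * n x / (m x * n x) ^ 5)"
      unfolding d1 D_def power_mult_distrib by (simp add: field_simps)
    also have "\<dots> \<le> D * ?a * (m x * n x / (m x * n x) ^ 5)"
      using D mn1[of x] by (intro mult_right_mono mult_left_mono) (auto simp: power_divide)
    also have "m x * n x / (m x * n x) ^ 5 = zeta_term 4 4 x"
      unfolding zeta_term_apply m_def[symmetric] n_def[symmetric] using mn[of x]
      by (simp add: m_def n_def field_simps eval_nat_numeral del: of_nat_Suc)
    finally show "norm (of_nat (Suc (snd x)) / lat1 z x ^ Suc k - of_nat (Suc (snd x)) / lat1 c x ^ Suc k) \<le> D * ?a * zeta_term 4 4 x" .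
  qed
  also have "\<dots> \<le> D * ?a * (1091 / 1000 * (1091 / 1000))"
    using zeta_nat_bounds zeta_nat_nonneg[of 4] D by (intro mult_left_mono mult_mono) auto
  finally have b1: "norm (p1 - q1) \<le> D * (765 / 10000)" using D by simp
  have "norm (p2 - q2) \<le> D * (1 / 243) * (zeta_nat 3 * zeta_nat 5 + zeta_nat 4 * zeta_nat 4)"
  proof (rule norm_infsum_le)
    show "((\<lambda>x. - (of_nat (Suc (fst x) + Suc (snd x)) / lat2 z x ^ Suc k) - - (of_nat (Suc (fst x) + Suc (snd x)) / lat2 c x ^ Suc k)) has_sum (p2 - q2)) UNIV"
      using p q by (intro has_sum_diff) (simp_all add: rest_terms_def)
    show "((\<lambda>x. D * (1 / 243) * (zeta_term 3 5 x + zeta_term 4 4 x)) has_sum (D * (1 / 243) * (zeta_nat 3 * zeta_nat 5 + zeta_nat 4 * zeta_nat 4))) UNIV"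
      by (intro has_sum_cmult_right has_sum_add has_sum_zeta_term) auto
    fix x
    have X1: "3 * (m x * n x) \<ge> 1" using mn1[of x] by simp
    have "norm (- (of_nat (Suc (fst x) + Suc (snd x)) / lat2 z x ^ Suc k) - - (of_nat (Suc (fst x) + Suc (snd x)) / lat2 c x ^ Suc k)) =
       (m x + n x) * norm (1 / lat2 z x ^ Suc k - 1 / lat2 c x ^ Suc k)"
    proof -
      have "- (of_nat (Suc (fst x) + Suc (snd x)) / lat2 z x ^ Suc k) - - (of_nat (Suc (fst x) + Suc (snd x)) / lat2 c x ^ Suc k) = - (of_nat (Suc (fst x) + Suc (snd x)) * (1 / lat2 z x ^ Suc k - 1 / lat2 c x ^ Suc k))"
        by (simp only: right_diff_distrib times_divide_eq_right mult_1_right) simp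
      thus ?thesis by (simp only: norm_minus_cancel norm_mult norm_of_nat of_nat_add[symmetric] m_def n_def)
    qed
    also have "\<dots> \<le> (m x + n x) * (real (Suc k) * norm (lat2 z x - lat2 c x) / (3 * (m x * n x)) ^ 5)"
      using mn[of x] lbz(2)[of x] lbc(2)[of x] k
      by (intro mult_left_mono inverse_power_diff_le[OF X1]) (simp_all add: m_def n_def mult.assoc del: of_nat_Suc)
    also have "\<dots> = D * (1 / 243) * ((m x + n x) * m x / (m x * n x) ^ 5)"
      unfolding d2 D_def power_mult_distrib by (simp add: field_simps)
    also have "(m x + n x) * m x / (m x * n x) ^ 5 = zeta_term 3 5 x + zeta_term 4 4 x"
      unfolding zeta_term_apply m_def[symmetric] n_def[symmetric] using mn[of x]
      by (simp add: m_def n_def field_simps eval_nat_numeral del: of_nat_Suc)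
    finally show "norm (- (of_nat (Suc (fst x) + Suc (snd x)) / lat2 z x ^ Suc k) - - (of_nat (Suc (fst x) + Suc (snd x)) / lat2 c x ^ Suc k)) \<le> D * (1 / 243) * (zeta_term 3 5 x + zeta_term 4 4 x)"
      by simp
  qed
  also have "\<dots> \<le> D * (1 / 243) * (121 / 100 * (1041 / 1000) + 1091 / 1000 * (1091 / 1000))"
    using zeta_nat_bounds zeta_nat_le[of 5] zeta_nat_nonneg[of 3] zeta_nat_nonneg[of 4] zeta_nat_nonneg[of 5] D
    by (intro mult_left_mono add_mono mult_mono) auto
  finally have b2: "norm (p2 - q2) \<le> D * (101 / 10000)" using D by simp
  have "norm (p3 - q3) \<le> D * (1 / 243) * (zeta_nat 4 * zeta_nat 4 + zeta_nat 5 * zeta_nat 3)"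
  proof (rule norm_infsum_le)
    show "((\<lambda>x. - (of_nat (Suc (snd x)) / lat3 z x ^ Suc k) - - (of_nat (Suc (snd x)) / lat3 c x ^ Suc k)) has_sum (p3 - q3)) UNIV"
      using p q by (intro has_sum_diff) (simp_all add: rest_terms_def)
    show "((\<lambda>x. D * (1 / 243) * (zeta_term 4 4 x + zeta_term 5 3 x)) has_sum (D * (1 / 243) * (zeta_nat 4 * zeta_nat 4 + zeta_nat 5 * zeta_nat 3))) UNIV"
      by (intro has_sum_cmult_right has_sum_add has_sum_zeta_term) auto
    fix x
    have X1: "3 * (m x * n x) \<ge> 1" using mn1[of x] by simp
    have "norm (- (of_nat (Suc (snd x)) / lat3 z x ^ Suc k) - - (of_nat (Suc (snd x)) / lat3 c x ^ Suc k)) =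
       n x * norm (1 / lat3 z x ^ Suc k - 1 / lat3 c x ^ Suc k)"
    proof -
      have "- (of_nat (Suc (snd x)) / lat3 z x ^ Suc k) - - (of_nat (Suc (snd x)) / lat3 c x ^ Suc k) = - (of_nat (Suc (snd x)) * (1 / lat3 z x ^ Suc k - 1 / lat3 c x ^ Suc k))"
        by (simp only: right_diff_distrib times_divide_eq_right mult_1_right) simp
      thus ?thesis by (simp only: norm_minus_cancel norm_mult norm_of_nat n_def)
    qed
    also have "\<dots> \<le> n x * (real (Suc k) * norm (lat3 z x - lat3 c x) / (3 * (m x * n x)) ^ 5)"
      using mn[of x] lbz(3)[of x] lbc(3)[of x] k
      by (intro mult_left_mono inverse_power_diff_le[OF X1]) (simp_all add: m_def n_def mult.assoc del: of_nat_Suc)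
    also have "\<dots> = D * (1 / 243) * (n x * (m x + n x) / (m x * n x) ^ 5)"
      unfolding d3 D_def power_mult_distrib by (simp add: field_simps)
    also have "n x * (m x + n x) / (m x * n x) ^ 5 = zeta_term 4 4 x + zeta_term 5 3 x"
      unfolding zeta_term_apply m_def[symmetric] n_def[symmetric] using mn[of x]
      by (simp add: m_def n_def field_simps eval_nat_numeral del: of_nat_Suc)
    finally show "norm (- (of_nat (Suc (snd x)) / lat3 z x ^ Suc k) - - (of_nat (Suc (snd x)) / lat3 c x ^ Suc k)) \<le> D * (1 / 243) * (zeta_term 4 4 x + zeta_term 5 3 x)"
      by simp
  qed
  also have "\<dots> \<le> D * (1 / 243) * (1091 / 1000 * (1091 / 1000) + 1041 / 1000 * (121 / 100))"
    using zeta_nat_bounds zeta_nat_le[of 5] zeta_nat_nonneg[of 3] zeta_nat_nonneg[of 4] zeta_nat_nonneg[of 5] D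
    by (intro mult_left_mono add_mono mult_mono) auto
  finally have b3: "norm (p3 - q3) \<le> D * (101 / 10000)" using D by simp
  have eq: "(p1 + p2 + p3) - (q1 + q2 + q3) = (p1 - q1) + (p2 - q2) + (p3 - q3)" by simp
  have "norm ((p1 + p2 + p3) - (q1 + q2 + q3)) \<le> norm (p1 - q1) + norm (p2 - q2) + norm (p3 - q3)"
    unfolding eq using norm_triangle_ineq[of "(p1 - q1) + (p2 - q2)" "p3 - q3"] norm_triangle_ineq[of "p1 - q1" "p2 - q2"] by linarith
  also have "\<dots> \<le> D * (97 / 1000)" using b1 b2 b3 D by simp
  finally show ?thesis by (simp add: D_def)
qed

section \<open>The corner and the sign of the real part near it\<close>

definition corner :: complex where "corner = Complex (1 / 2) (sqrt 3 / 2)"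

lemma Re_Im_corner [simp]: "Re corner = 1 / 2" "Im corner = sqrt 3 / 2"
  by (auto simp: corner_def)

lemma norm_corner [simp]: "norm corner = 1"
  by (simp add: corner_def cmod_def power_divide)

lemma one_minus_corner: "1 - corner = cnj corner"
  by (simp add: complex_eq_iff)

lemma corner_mult_cnj: "corner * cnj corner = 1"
  by (simp add: complex_eq_iff)

lemma corner_cubed: "corner ^ 3 = -1"
  by (simp add: complex_eq_iff power3_eq_cube algebra_simps)

lemma corner_in_half_strip: "corner \<in> half_strip"
  by (simp add: half_strip_def)

lemma corner_nonzero: "corner \<noteq> 0"
  using corner_mult_cnj by force

text \<open>The corner is fixed by z -> 1 / (1 - z), and 1 - z = cnj z there. The transformation law
  becomes two linear relations between A and B with the factor \<open>cnj corner ^ Suc k\<close>,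
  which depends only on k mod 6.\<close>

lemma eis_corner:
  assumes k: "k \<ge> 4"
  shows "eis_A k corner = - (cnj corner ^ Suc k) * eis_B k corner"
    and "eis_B k corner = cnj corner ^ Suc k * (eis_B k corner + eis_A k corner)"
proof -
  have m: "moebius_int 0 1 (- 1) 1 corner = corner"
  proof -
    have "moebius_int 0 1 (- 1) 1 corner = 1 / (1 - corner)" by (simp add: moebius_def)
    also have "\<dots> = corner" unfolding one_minus_corner using corner_mult_cnj corner_nonzero by (simp add: field_simps)
    finally show ?thesis .
  qed
  have "Im corner > 0" by simp
  from eis_transform[where a = 0 and b = 1 and c = "-1" and d = 1, OF this k] m one_minus_corner
  show "eis_A k corner = - (cnj corner ^ Suc k) * eis_B k corner"
    and "eis_B k corner = cnj corner ^ Suc k * (eis_B k corner + eis_A k corner)"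
    by (simp_all add: add.commute)
qed

lemma cnj_corner_power: "cnj corner ^ (6 * n + r) = cnj corner ^ r"
proof -
  have "cnj corner ^ 3 = -1" using arg_cong[OF corner_cubed, of cnj] by simp
  hence "cnj corner ^ (3 * 2) = 1" unfolding power_mult by simp
  thus ?thesis by (simp add: power_add power_mult)
qed

text \<open>Here the factor is -1, so the relations read A = B and B = - (B + A).\<close>

lemma eis_corner_zero:
  assumes k: "k \<ge> 4" "k mod 6 = 2"
  shows "eis_A k corner = 0" "eis_B k corner = 0"
proof -
  have "Suc k = 6 * (k div 6) + 3" using k by presburger
  hence "cnj corner ^ Suc k = cnj corner ^ 3" by (metis cnj_corner_power)
  also have "\<dots> = -1" using arg_cong[OF corner_cubed, of cnj] by simp
  finally have J: "cnj corner ^ Suc k = -1" .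
  show "eis_B k corner = 0" "eis_A k corner = 0"
    using eis_corner[OF k(1)] unfolding J by auto
qed

lemma eis_corner_4:
  assumes k: "k \<ge> 4" "k mod 6 = 4"
  shows "eis_A k corner = - corner * eis_B k corner"
proof -
  have "Suc k = 6 * (k div 6) + 5" using k by presburger
  hence "cnj corner ^ Suc k = cnj corner ^ 5" by (metis cnj_corner_power)
  also have "\<dots> = cnj corner ^ 3 * (cnj corner * cnj corner)" by (simp add: eval_nat_numeral)
  also have "cnj corner ^ 3 = -1" using arg_cong[OF corner_cubed, of cnj] by simp
  also have "-1 * (cnj corner * cnj corner) = corner" by (simp add: complex_eq_iff)
  finally show ?thesis using eis_corner[OF k(1)] by simp
qed

lemma eis_corner_0:
  assumes k: "k \<ge> 4" "k mod 6 = 0"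
  shows "eis_A k corner = - cnj corner * eis_B k corner"
proof -
  have "Suc k = 6 * (k div 6) + 1" using k by presburger
  hence "cnj corner ^ Suc k = cnj corner ^ 1" by (metis cnj_corner_power)
  thus ?thesis using eis_corner[OF k(1)] by simp
qed

text \<open>With a and b the horizontal and vertical distances from the corner and D the distance
  itself, |z - 1|^2 = 1 + D^2 + a + b sqrt 3 and a + b >= D.\<close>

lemma norm_minus_1_half_strip:
  assumes z: "z \<in> half_strip"
  shows "norm (z - 1) \<ge> 1 + norm (z - corner) / 2"
proof -
  define a b where "a = 1 / 2 - Re z" and "b = Im z - sqrt 3 / 2"
  have ab: "a \<ge> 0" "b \<ge> 0" using z by (auto simp: half_strip_def a_def b_def)
  define D where "D = norm (z - corner)"
  have D2: "D ^ 2 = a ^ 2 + b ^ 2" by (simp add: D_def cmod_power2 a_def b_def power2_commute)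
  have "D ^ 2 \<le> (a + b) ^ 2" unfolding D2 using ab by (simp add: power2_sum)
  hence D: "D \<le> a + b" by (rule power2_le_imp_le) (use ab in simp)
  have "sqrt 3 \<ge> (1::real)" by simp
  hence "b * 1 \<le> b * sqrt 3" using ab by (intro mult_left_mono) auto
  moreover have "norm (z - 1) ^ 2 = 1 + D ^ 2 + a + b * sqrt 3"
  proof -
    have "norm (z - 1) ^ 2 = (1 / 2 + a) ^ 2 + (b + sqrt 3 / 2) ^ 2"
      by (simp only: cmod_power2 a_def b_def) (simp add: power2_eq_square algebra_simps)
    also have "\<dots> = 1 + (a ^ 2 + b ^ 2) + a + b * sqrt 3"
      by (simp add: power2_eq_square algebra_simps)
    finally show ?thesis by (simp only: D2)
  qed
  ultimately have "norm (z - 1) ^ 2 \<ge> 1 + D ^ 2 + D" using D by linarith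
  moreover have "(1 + D / 2) ^ 2 = 1 + D + D ^ 2 / 4" by (simp add: power2_eq_square algebra_simps)
  ultimately have "(1 + D / 2) ^ 2 \<le> norm (z - 1) ^ 2" using zero_le_power2[of D] by linarith
  thus ?thesis unfolding D_def by (rule power2_le_imp_le) simp
qed

text \<open>Bernoulli's inequality gives |z - 1|^s >= 1 + t. The bound degenerates to 0 at the
  corner.\<close>

lemma Re_main_term_ge:
  assumes z: "z \<in> half_strip" and t: "t = real s * norm (z - corner) / 2"
  shows "Re (1 - 1 / (z - 1) ^ s) \<ge> t / (1 + t)"
proof -
  have t0: "t \<ge> 0" by (simp add: t)
  have "1 + t \<le> 1 + real s * (norm (z - corner) / 2)" by (simp add: t)
  also have "\<dots> \<le> (1 + norm (z - corner) / 2) ^ s"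
    by (rule Bernoulli_inequality) (use norm_ge_zero[of "z - corner"] in linarith)
  also have "\<dots> \<le> norm (z - 1) ^ s"
    by (intro power_mono norm_minus_1_half_strip[OF z]) auto
  finally have "norm (1 / (z - 1) ^ s) \<le> 1 / (1 + t)"
    using t0 by (simp add: norm_divide norm_power frac_le)
  moreover have "Re (1 / (z - 1) ^ s) \<le> norm (1 / (z - 1) ^ s)" by (rule complex_Re_le_cmod)
  moreover have "1 - 1 / (1 + t) = t / (1 + t)" using t0 by (simp add: field_simps)
  ultimately show ?thesis by simp
qed

text \<open>\<open>corner - 1\<close> is a primitive cube root of unity. For even k with k mod 6 not
  2 the number 3 does not divide k + 1, so the main term has real part exactly 3/2 at the corner;
  the Lipschitz bound (k + 1) |z - corner| = 2 t carries this to nearby points.\<close>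

lemma Re_main_term_ge':
  assumes z: "z \<in> half_strip" and k: "even k" "k mod 6 \<noteq> 2" and t: "t = real (Suc k) * norm (z - corner) / 2"
  shows "Re (1 - 1 / (z - 1) ^ Suc k) \<ge> 3 / 2 - 2 * t"
proof -
  define \<omega> where "\<omega> = corner - 1"
  have \<omega>: "\<omega> = Complex (- (1 / 2)) (sqrt 3 / 2)" by (rule complex_eqI) (simp_all add: \<omega>_def)
  have \<omega>2: "\<omega> ^ 2 = cnj \<omega>" by (simp add: \<omega> complex_eq_iff power2_eq_square)
  have \<omega>3: "\<omega> ^ 3 = 1" by (simp add: \<omega> complex_eq_iff power3_eq_cube)
  have n\<omega>: "norm \<omega> = 1" by (simp add: \<omega> cmod_def power_divide)
  have "\<omega> ^ Suc k = \<omega> ^ (Suc k mod 3)"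
  proof -
    have "\<omega> ^ Suc k = \<omega> ^ (3 * (Suc k div 3) + Suc k mod 3)" by (simp only: mult_div_mod_eq)
    thus ?thesis by (simp only: power_add power_mult \<omega>3 power_one mult_1_left)
  qed
  moreover have "Suc k mod 3 = 1 \<or> Suc k mod 3 = 2" using k by presburger
  ultimately have "Re (\<omega> ^ Suc k) = - 1 / 2" using \<omega>2 by (auto simp: \<omega>)
  hence "Re (cnj (\<omega> ^ Suc k)) = - 1 / 2" by (simp only: cnj.sel)
  moreover have "1 / \<omega> ^ Suc k = cnj (\<omega> ^ Suc k)"
    using divide_conv_cnj[of "\<omega> ^ Suc k" 1] n\<omega> by (simp add: norm_power del: power_Suc)
  ultimately have r: "Re (1 / \<omega> ^ Suc k) = - 1 / 2" by metis
  have n1: "norm (z - 1) \<ge> 1" using norm_minus_1_half_strip[OF z] norm_ge_zero[of "z - corner"] by linarith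
  have nz: "z - 1 \<noteq> 0" "\<omega> \<noteq> 0" using n1 n\<omega> by force+
  have a: "norm (1 / (z - 1)) \<le> 1" "norm (1 / \<omega>) \<le> 1" using n1 n\<omega> by (simp_all add: norm_divide divide_le_eq)
  have "norm ((1 / (z - 1)) ^ Suc k - (1 / \<omega>) ^ Suc k) \<le> real (Suc k) * norm (1 / (z - 1) - 1 / \<omega>) * 1 ^ k"
    by (rule norm_power_diff_le[OF a])
  also have "1 / (z - 1) - 1 / \<omega> = (corner - z) / ((z - 1) * \<omega>)"
    using nz by (simp add: \<omega>_def field_simps)
  also have "norm \<dots> = norm (z - corner) / norm (z - 1)" using n\<omega> by (simp add: norm_divide norm_mult norm_minus_commute)
  also have "real (Suc k) * (norm (z - corner) / norm (z - 1)) * 1 ^ k \<le> real (Suc k) * (norm (z - corner) / 1) * 1 ^ k"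
    using n1 by (intro mult_right_mono mult_left_mono divide_left_mono) auto
  also have "\<dots> = 2 * t" by (simp add: t)
  finally have "norm (1 / (z - 1) ^ Suc k - 1 / \<omega> ^ Suc k) \<le> 2 * t" by (simp only: power_one_over)
  hence "Re (1 / (z - 1) ^ Suc k - 1 / \<omega> ^ Suc k) \<le> 2 * t"
    using complex_Re_le_cmod order_trans by blast
  thus ?thesis using r by simp
qed

lemma eis_A_pos_large:
  assumes z: "z \<in> half_strip" and k: "even k" "k \<ge> 6" and nz: "z \<noteq> corner \<or> k mod 6 \<noteq> 2"
  shows "Re (eis_A k z) > 0"
proof -
  define t where "t = real (Suc k) * norm (z - corner) / 2"
  have t0: "t \<ge> 0" by (simp add: t_def)
  have Z: "zeta_nat k \<ge> 1" using k by (intro zeta_nat_ge_1) auto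
  obtain p1 p2 p3 where p: "rest_terms k z p1 p2 p3"
    and A: "eis_A k z = of_real (zeta_nat k) * (1 - 1 / (z - 1) ^ Suc k) + p1 + p2 + p3"
    using eis_A_split[of z k] Im_half_strip(1)[OF z] k by auto
  define M where "M = Re (1 - 1 / (z - 1) ^ Suc k)"
  have M1: "M \<ge> t / (1 + t)" unfolding M_def by (rule Re_main_term_ge[OF z]) (simp add: t_def)
  have M0: "M \<ge> 0" using M1 t0 by (meson divide_nonneg_nonneg add_nonneg_nonneg order_trans zero_le_one)
  have ge: "Re (eis_A k z) \<ge> M - norm (p1 + p2 + p3)"
  proof -
    have "Re (eis_A k z) = zeta_nat k * M + Re (p1 + p2 + p3)" by (simp add: A M_def)
    moreover have "1 * M \<le> zeta_nat k * M" using Z M0 by (rule mult_right_mono)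
    moreover have "- Re (p1 + p2 + p3) \<le> norm (p1 + p2 + p3)" using abs_Re_le_cmod[of "p1 + p2 + p3"] by linarith
    ultimately show ?thesis by linarith
  qed
  have rest: "norm (p1 + p2 + p3) \<le> 352 / 1000" by (rule rest_bound[OF z k(2) p])
  have mono: "u / (1 + u) \<le> M" if "0 \<le> u" "u \<le> t" for u
  proof -
    have "u / (1 + u) \<le> t / (1 + t)" using that t0 by (simp add: field_simps)
    thus ?thesis using M1 by linarith
  qed
  show ?thesis
  proof (cases "k mod 6 = 2")
    case False
    have "M \<ge> 3 / 2 - 2 * t"
      unfolding M_def by (rule Re_main_term_ge'[OF z k(1) False]) (simp add: t_def)
    \<comment> \<open>The bounds t / (1 + t) and 3/2 - 2 t cross near t = 0.5686, where both are
      about 0.362.\<close>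
    hence "M > 352 / 1000" using mono[of "5686 / 10000"] by (cases "t \<ge> 5686 / 10000") auto
    thus ?thesis using ge rest by linarith
  next
    case True
    hence k8: "k \<ge> 8" using k by presburger
    have zc: "z \<noteq> corner" using nz True by auto
    hence t1: "t > 0" by (simp add: t_def)
    obtain q1 q2 q3 where q: "rest_terms k corner q1 q2 q3"
      and Ac: "eis_A k corner = of_real (zeta_nat k) * (1 - 1 / (corner - 1) ^ Suc k) + q1 + q2 + q3"
      using eis_A_split[of corner k] k by auto
    have "corner - 1 = - cnj corner" using one_minus_corner by (metis minus_diff_eq)
    moreover have "(- cnj corner) ^ 3 = 1" using arg_cong[OF corner_cubed, of cnj] by simp
    moreover have "Suc k = 3 * (Suc k div 3)" using True by presburger
    ultimately have "(corner - 1) ^ Suc k = 1" by (metis power_mult power_one)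
    \<comment> \<open>The main term and A both vanish at the corner, hence so does the
      remainder.\<close>
    hence q0: "q1 + q2 + q3 = 0" using Ac eis_corner_zero[of k] True k by simp
    have "norm ((p1 + p2 + p3) - (q1 + q2 + q3)) \<le> real (Suc k) * norm (z - corner) * (97 / 1000)"
      by (rule rest_diff_bound[OF z corner_in_half_strip k(1) k8 p q])
    hence small: "norm (p1 + p2 + p3) \<le> 2 * t * (97 / 1000)" unfolding q0 by (simp add: t_def)
    show ?thesis
    \<comment> \<open>For t >= 4 the uniform bound suffices, as 4/5 > 0.352. For t < 4 the
      proportional bound 0.194 t is below t / (1 + t), since 0.194 times 5 is less than 1.\<close>
    proof (cases "t \<ge> 4")
      case True
      thus ?thesis using mono[of 4] ge rest by simp
    next
      case False
      have "2 * t * (97 / 1000) * (1 + t) < t"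
      proof -
        have "t * (194 / 1000 * (1 + t)) < t * 1" using False t1 by (intro mult_strict_left_mono) auto
        thus ?thesis by (simp add: mult_ac)
      qed
      hence "2 * t * (97 / 1000) < t / (1 + t)" using t1 by (subst pos_less_divide_eq) auto
      thus ?thesis using ge M1 small by linarith
    qed
  qed
qed

section \<open>Positivity in weight 4, by the q-expansion\<close>

lemma bernoulli_4: "bernoulli 4 = - 1 / 30"
proof -
  define f where "f = (fps_exp 1 - 1 :: real fps)"
  define F where "F = fps_X / f"
  define G where "G = (Abs_fps (\<lambda>n. 1 / fact (Suc n)) :: real fps)"
  have f: "f = fps_X * G"
  proof (rule fps_ext)
    show "fps_nth f n = fps_nth (fps_X * G) n" for n by (cases n) (simp_all add: f_def G_def ring_distribs)
  qed
  have G0: "fps_nth G 0 \<noteq> 0" by (simp add: G_def)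
  have "F = fps_X / (fps_X * G)" by (simp add: F_def f)
  also have "\<dots> = 1 / G"
  proof -
    have "fps_X / (fps_X * G) = fps_X * 1 / (fps_X * G)" by simp
    also have "\<dots> = 1 / G" by (rule div_mult_mult1) simp
    finally show ?thesis .
  qed
  finally have "F * G = 1" using G0 by (metis dvd_div_mult_self fps_is_unit_iff is_unit_mult_iff unit_imp_dvd one_dvd)
  hence c: "(\<Sum>i=0..n. fps_nth F i * fps_nth G (n - i)) = (if n = 0 then 1 else 0)" for n
    by (metis fps_mult_nth fps_one_nth)
  have g: "fps_nth G n = 1 / fact (Suc n)" for n by (simp add: G_def)
  have 0: "fps_nth F 0 = 1" using c[of 0] by (simp add: g)
  have 1: "fps_nth F 1 = - 1 / 2" using c[of 1] 0 by (simp add: g fact_numeral)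
  have 2: "fps_nth F 2 = 1 / 12" using c[of 2] 0 1 by (simp add: g fact_numeral numeral_2_eq_2)
  have 3: "fps_nth F 3 = 0" using c[of 3] 0 1 2 by (simp add: g numeral_eq_Suc)
  have 4: "fps_nth F 4 = - 1 / 720" using c[of 4] 0 1 2 3 by (simp add: g numeral_eq_Suc)
  have "bernoulli 4 = fact 4 * fps_nth F 4" by (simp add: bernoulli_def F_def f_def)
  thus ?thesis unfolding 4 by (simp add: fact_numeral)
qed

text \<open>The M-th term of A / zeta(4) = E + z E' / 4. The coefficient 240 is - 8 / B_4 with B_4 =
  - 1/30. The lattice estimates for A start at weight 6, so weight 4 goes through this
  series.\<close>

definition weight4_term :: "complex \<Rightarrow> nat \<Rightarrow> complex" where
  "weight4_term z M = 240 * (of_nat (divisor_sigma 3 M) * nome z ^ M) * (1 + of_real (pi * real M / 2) * \<i> * z)"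

lemma eis_A_4:
  assumes z: "Im z > 0"
  shows "summable (weight4_term z)" "eis_A 4 z = of_real (zeta_nat 4) * (1 + (\<Sum>M. weight4_term z M))"
proof -
  define Z where "Z = complex_of_real (zeta_nat 4)"
  have Z0: "Z \<noteq> 0" using zeta_nat_ge_1[of 4] by (auto simp: Z_def)
  define S1 S2 where "S1 = (\<Sum>M. complex_of_nat (divisor_sigma 3 M) * nome z ^ M)"
    and "S2 = (\<Sum>M. complex_of_nat (M * divisor_sigma 3 M) * nome z ^ M)"
  have s1: "(\<lambda>M. complex_of_nat (divisor_sigma 3 M) * nome z ^ M) sums S1"
    using eisenstein_lattice(2)[OF z, of 4] by (simp add: S1_def summable_sums)
  have s2: "(\<lambda>M. complex_of_nat (M * divisor_sigma 3 M) * nome z ^ M) sums S2"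
    using eis_B_nome_series(2)[OF z, of 4] by (simp add: S2_def summable_sums del: of_nat_mult)
  have "(\<lambda>M. 240 * (complex_of_nat (divisor_sigma 3 M) * nome z ^ M) + 120 * of_real pi * \<i> * z * (complex_of_nat (M * divisor_sigma 3 M) * nome z ^ M))
     sums (240 * S1 + 120 * of_real pi * \<i> * z * S2)"
    by (intro sums_add sums_mult s1 s2)
  hence T: "weight4_term z sums (240 * S1 + 120 * of_real pi * \<i> * z * S2)"
    by (rule sums_cong[THEN iffD1, rotated]) (simp add: weight4_term_def algebra_simps)
  thus "summable (weight4_term z)" by (simp add: sums_iff)
  have E: "eisenstein 4 z = 1 + 240 * S1"
  proof -
    have "(\<Sum>n. complex_of_nat (divisor_sigma 3 (Suc n)) * nome z ^ Suc n) = S1"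
      using suminf_split_head[OF sums_summable[OF s1]] by (simp add: S1_def divisor_sigma_def)
    thus ?thesis unfolding eisenstein_def nome_def[symmetric] bernoulli_4 by simp
  qed
  have b: "of_real (bernoulli 4) * (2 * complex_of_real pi * \<i>) ^ 4 / fact 4 = - 2 * Z"
    unfolding Z_def by (rule bernoulli_zeta) auto
  have Zv: "Z = of_real pi ^ 4 / 90"
    using b unfolding bernoulli_4 by (simp add: power_mult_distrib fact_numeral)
  have "eis_B 4 z = (- 2 * pi * \<i>) ^ Suc 4 / fact 4 * S2"
    unfolding S2_def using eis_B_nome_series(1)[OF z, of 4] by simp
  also have "(- 2 * pi * \<i>) ^ Suc 4 / fact 4 = - 120 * of_real pi * \<i> * Z"
    unfolding Zv by (simp add: fact_numeral power_mult_distrib) (simp add: eval_nat_numeral)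
  finally have B: "eis_B 4 z = - 120 * of_real pi * \<i> * Z * S2" .
  have "eis_A 4 z = Z * eisenstein 4 z - z * eis_B 4 z"
    using eisenstein_lattice(1)[OF z, of 4] by (simp add: Z_def)
  also have "\<dots> = Z * (1 + (240 * S1 + 120 * of_real pi * \<i> * z * S2))"
    unfolding E B by (simp add: algebra_simps)
  finally show "eis_A 4 z = of_real (zeta_nat 4) * (1 + (\<Sum>M. weight4_term z M))"
    using T by (simp add: sums_iff Z_def)
qed

text \<open>The maximum is at the lowest height. With 2 pi y = pi sqrt 3 + v the linear factor is b
  + v/4, and b >= 1/4 gives b + v/4 <= b (1 + v) <= b exp(v). The constant 1.3684 bounds pi sqrt 3 /
  4 from above.\<close>

lemma linear_exp_bound:
  assumes y: "y \<ge> sqrt 3 / 2" and c: "c \<le> 1"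
  shows "(pi * y / 2 - c) * exp (- 2 * pi * y) \<le> (13684 / 10000 - c) / 225"
    and "pi * y / 2 - c \<ge> 0"
proof -
  define v where "v = 2 * pi * y - pi * sqrt 3"
  define b where "b = pi * sqrt 3 / 4 - c"
  have "pi * (sqrt 3 / 2) \<le> pi * y" using y by (intro mult_left_mono) auto
  hence v: "v \<ge> 0" by (simp add: v_def)
  have s3: "sqrt 3 \<ge> 173 / 100" "sqrt 3 \<le> 17321 / 10000"
    by (rule real_le_rsqrt, simp add: power2_eq_square) (rule real_le_lsqrt, auto simp: power2_eq_square)
  have "(313 / 100) * (173 / 100) \<le> pi * sqrt 3" using pi_bounds s3 by (intro mult_mono) auto
  hence b: "b \<ge> 1 / 4" using c by (simp add: b_def)
  have "pi * sqrt 3 \<le> (316 / 100) * (17321 / 10000)" using pi_bounds s3 by (intro mult_mono) auto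
  hence b': "b \<le> 13684 / 10000 - c" by (simp add: b_def)
  have eq: "pi * y / 2 - c = b + v / 4" by (simp add: b_def v_def field_simps)
  show "pi * y / 2 - c \<ge> 0" unfolding eq using b v by simp
  have "b + v / 4 \<le> b * (1 + v)" using mult_right_mono[OF b v] by (simp add: distrib_left)
  also have "\<dots> \<le> b * exp v" using b by (intro mult_left_mono exp_ge_add_one_self) auto
  finally have "(b + v / 4) * exp (- v) \<le> b * exp v * exp (- v)" by (intro mult_right_mono) auto
  also have "\<dots> = b" by (simp add: mult.assoc exp_add[symmetric])
  finally have "(b + v / 4) * exp (- v) * exp (- pi * sqrt 3) \<le> b * (1 / 225)"
    using b exp_pi_sqrt_3 by (intro mult_mono) auto
  also have "\<dots> \<le> (13684 / 10000 - c) * (1 / 225)" using b' by (intro mult_right_mono) auto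
  finally have "(b + v / 4) * exp (- v) * exp (- pi * sqrt 3) \<le> (13684 / 10000 - c) / 225" by simp
  moreover have "exp (- v) * exp (- pi * sqrt 3) = exp (- 2 * pi * y)" by (simp add: exp_add[symmetric] v_def)
  ultimately show "(pi * y / 2 - c) * exp (- 2 * pi * y) \<le> (13684 / 10000 - c) / 225"
    unfolding eq by (simp only: mult.assoc)
qed

text \<open>One factor |q| is spent on the linear factor, the other M - 1 are replaced by 1/225. The
  constant 2.1584 is 1.3684 + 0.79, where 0.79 bounds pi / 4 and accounts for Re z <= 1/2.\<close>

lemma norm_weight4_term_le:
  assumes z: "z \<in> half_strip" and M: "M \<ge> 1"
  shows "norm (weight4_term z M) \<le> 240 * real (divisor_sigma 3 M) * (real M * (21584 / 10000) - 1) / 225 ^ M"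
proof -
  define x y where "x = Re z" and "y = Im z"
  define r where "r = exp (- 2 * pi * y)"
  have y: "y \<ge> sqrt 3 / 2" and x: "0 \<le> x" "x \<le> 1 / 2" using z by (auto simp: half_strip_def x_def y_def)
  have r: "0 < r" "r \<le> 1 / 225" using exp_minus_2_pi_le[of z] y by (auto simp: r_def y_def)
  define c where "c = 1 / real M"
  have c: "c \<le> 1" "c > 0" "real M * c = 1" using M by (auto simp: c_def)
  have "norm (1 + of_real (pi * real M / 2) * \<i> * z) \<le> \<bar>1 - pi * real M / 2 * y\<bar> + \<bar>pi * real M / 2 * x\<bar>"
    using cmod_le[of "1 + of_real (pi * real M / 2) * \<i> * z"] by (simp add: x_def y_def)
  also have "1 - pi * real M / 2 * y = - (real M * (pi * y / 2 - c))" using c by (simp add: algebra_simps)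
  also have "\<bar>\<dots>\<bar> = real M * (pi * y / 2 - c)" using linear_exp_bound(2)[OF y c(1)] by simp
  also have "\<bar>pi * real M / 2 * x\<bar> = real M * (pi / 2 * x)" using x by simp
  also have "\<dots> \<le> real M * (79 / 100)"
  proof (intro mult_left_mono)
    have "pi / 2 * x \<le> (316 / 100) / 2 * (1 / 2)" using pi_bounds x by (intro mult_mono) auto
    thus "pi / 2 * x \<le> 79 / 100" by simp
  qed auto
  finally have n: "norm (1 + of_real (pi * real M / 2) * \<i> * z) \<le> real M * (pi * y / 2 - c) + real M * (79 / 100)" by simp
  have "norm (1 + of_real (pi * real M / 2) * \<i> * z) * r \<le> (real M * (pi * y / 2 - c) + real M * (79 / 100)) * r"
    using n r by (intro mult_right_mono) auto
  also have "\<dots> = real M * ((pi * y / 2 - c) * r) + real M * (79 / 100) * r" by (simp add: algebra_simps)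
  also have "\<dots> \<le> real M * ((13684 / 10000 - c) / 225) + real M * (79 / 100) * (1 / 225)"
    using linear_exp_bound(1)[OF y c(1)] r by (intro add_mono mult_left_mono) (auto simp: r_def)
  also have "\<dots> = (real M * (13684 / 10000 + 79 / 100) - real M * c) / 225"
  proof -
    have "m * ((a - c) / 225) + m * b * (1 / 225) = (m * (a + b) - m * c) / 225" for m a b :: real
      by (simp add: field_simps)
    thus ?thesis .
  qed
  also have "\<dots> = (real M * (21584 / 10000) - 1) / 225" unfolding c(3) by simp
  finally have n1: "norm (1 + of_real (pi * real M / 2) * \<i> * z) * r \<le> (real M * (21584 / 10000) - 1) / 225" .
  have "r ^ (M - 1) \<le> (1 / 225) ^ (M - 1)" using r by (intro power_mono) auto
  hence "norm (1 + of_real (pi * real M / 2) * \<i> * z) * r * r ^ (M - 1) \<le> (real M * (21584 / 10000) - 1) / 225 * (1 / 225) ^ (M - 1)"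
    using n1 r M by (intro mult_mono) auto
  hence le: "norm (1 + of_real (pi * real M / 2) * \<i> * z) * r ^ M \<le> (real M * (21584 / 10000) - 1) / 225 ^ M"
    using M by (cases M) (simp_all add: power_divide mult.assoc)
  have "norm (weight4_term z M) = 240 * real (divisor_sigma 3 M) * (norm (1 + of_real (pi * real M / 2) * \<i> * z) * r ^ M)"
    unfolding weight4_term_def norm_mult norm_power norm_nome r_def y_def norm_of_nat norm_numeral by (simp only: mult_ac)
  also have "\<dots> \<le> 240 * real (divisor_sigma 3 M) * ((real M * (21584 / 10000) - 1) / 225 ^ M)"
    using le by (intro mult_left_mono) auto
  finally show ?thesis by simp
qed

text \<open>The modulus bound for the first term exceeds 1, so its real part is taken. It splits
  into a cosine part with factor pi y / 2 - 1 and a sine part with factor pi x / 2, which are not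
  large together: cos(2 pi x) >= 0 forces x <= 1/4.\<close>

lemma Re_weight4_term_1:
  assumes z: "z \<in> half_strip"
  shows "Re (weight4_term z 1) \<ge> - 843 / 1000"
proof -
  define x y where "x = Re z" and "y = Im z"
  define r where "r = exp (- 2 * pi * y)"
  have y: "y \<ge> sqrt 3 / 2" and x: "0 \<le> x" "x \<le> 1 / 2" using z by (auto simp: half_strip_def x_def y_def)
  have r: "0 < r" "r \<le> 1 / 225" using exp_minus_2_pi_le[of z] y by (auto simp: r_def y_def)
  have "divisor_sigma 3 1 = 1" by (simp add: divisor_sigma_def)
  hence "weight4_term z 1 = 240 * (of_real r * cis (2 * pi * x)) * (1 + of_real (pi / 2) * \<i> * z)"
    unfolding weight4_term_def nome_polar by (simp add: r_def x_def y_def)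
  hence eq: "Re (weight4_term z 1) = - 240 * ((pi * y / 2 - 1) * r * cos (2 * pi * x) + pi * x / 2 * r * sin (2 * pi * x))"
    by (simp add: x_def y_def algebra_simps)
  have g: "(pi * y / 2 - 1) * r \<le> (3684 / 10000) / 225" "pi * y / 2 - 1 \<ge> 0"
    using linear_exp_bound[OF y, of 1] by (auto simp: r_def)
  have x1: "pi * x \<le> (316 / 100) * x" using pi_bounds x by (intro mult_right_mono) auto
  show ?thesis
  proof (cases "cos (2 * pi * x) \<ge> 0")
    case True
    have x4: "x \<le> 1 / 4"
    proof (rule ccontr)
      assume "\<not> x \<le> 1 / 4"
      hence "pi * (1 / 4) < pi * x" "pi * x \<le> pi * (1 / 2)" using x by (auto intro!: mult_left_mono)
      hence "cos (2 * pi * x) < cos (pi / 2)" by (intro cos_monotone_0_pi) auto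
      thus False using True by simp
    qed
    have "(pi * y / 2 - 1) * r * cos (2 * pi * x) \<le> (3684 / 10000) / 225 * 1"
      using g True r by (intro mult_mono) auto
    moreover have "pi * x / 2 * r * sin (2 * pi * x) \<le> (395 / 1000) * (1 / 225) * 1"
    proof -
      have "pi * x / 2 * r * sin (2 * pi * x) \<le> pi * x / 2 * r * 1"
        using x r by (intro mult_left_mono) auto
      also have "\<dots> \<le> (395 / 1000) * (1 / 225) * 1" using x x1 x4 r by (intro mult_mono) auto
      finally show ?thesis .
    qed
    ultimately show ?thesis unfolding eq by simp
  next
    case False
    have "(pi * y / 2 - 1) * r * cos (2 * pi * x) \<le> 0"
      using False g r by (intro mult_nonneg_nonpos) auto
    moreover have "pi * x / 2 * r * sin (2 * pi * x) \<le> (79 / 100) * (1 / 225) * 1"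
    proof -
      have "pi * x / 2 * r * sin (2 * pi * x) \<le> pi * x / 2 * r * 1"
        using x r by (intro mult_left_mono) auto
      also have "\<dots> \<le> (79 / 100) * (1 / 225) * 1" using x x1 r by (intro mult_mono) auto
      finally show ?thesis .
    qed
    ultimately show ?thesis unfolding eq by simp
  qed
qed

text \<open>The terms of index 1, of index 2 and the tail cost at most 0.843, 0.142 and 0.005,
  together less than the constant term 1.\<close>

lemma eis_A_pos_4:
  assumes z: "z \<in> half_strip"
  shows "Re (eis_A 4 z) > 0"
proof -
  have zp: "Im z > 0" by (rule Im_half_strip[OF z])
  note S = eis_A_4(1)[OF zp]
  have t0: "weight4_term z 0 = 0" by (simp add: weight4_term_def divisor_sigma_def)
  have "{d::nat. d dvd 2} = {1, 2}" using two_is_prime_nat prime_nat_iff by auto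
  hence "divisor_sigma 3 2 = 9" by (simp add: divisor_sigma_def)
  hence t2: "norm (weight4_term z 2) \<le> 142 / 1000" using norm_weight4_term_le[OF z, of 2] by simp
  have tail: "norm (\<Sum>n. weight4_term z (n + 3)) \<le> 5 / 1000"
  proof -
    have le: "norm (weight4_term z (n + 3)) \<le> 4605 / 1000000 * (16 / 225) ^ n" for n
    proof -
      define M where "M = real (n + 3)"
      have s: "real (divisor_sigma 3 (n + 3)) \<le> 5 / 4 * M ^ 3"
        using divisor_sigma_bounds(2)[of 4 "n + 3"] by (simp add: M_def)
      have "n + 1 \<le> 2 ^ n" by (induction n) auto
      hence "n + 3 \<le> 3 * 2 ^ n" by simp
      hence "M \<le> 3 * 2 ^ n" unfolding M_def by (metis of_nat_le_iff of_nat_mult of_nat_numeral of_nat_power)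
      hence "M ^ 4 \<le> (3 * 2 ^ n) ^ 4" by (intro power_mono) (auto simp: M_def)
      also have "(3 * 2 ^ n) ^ 4 = (81 * 16 ^ n :: real)"
      proof -
        have "((2::real) ^ n) ^ 4 = (2 ^ 4) ^ n" by (simp only: power_mult[symmetric] mult.commute)
        thus ?thesis by (simp add: power_mult_distrib)
      qed
      finally have M4: "M ^ 4 \<le> 81 * 16 ^ n" .
      have "norm (weight4_term z (n + 3)) \<le> 240 * real (divisor_sigma 3 (n + 3)) * (M * (21584 / 10000) - 1) / 225 ^ (n + 3)"
        unfolding M_def by (rule norm_weight4_term_le[OF z]) simp
      also have "\<dots> \<le> 240 * (5 / 4 * M ^ 3) * (M * (21584 / 10000)) / 225 ^ (n + 3)"
        using s by (intro divide_right_mono mult_mono) (auto simp: M_def)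
      also have "\<dots> = 64752 / 100 * M ^ 4 / 225 ^ (n + 3)" by (simp add: eval_nat_numeral)
      also have "\<dots> \<le> 64752 / 100 * (81 * 16 ^ n) / 225 ^ (n + 3)"
        using M4 by (intro divide_right_mono mult_left_mono) auto
      also have "\<dots> = 64752 / 100 * 81 / 225 ^ 3 * (16 / 225) ^ n" by (simp add: power_add power_divide)
      also have "\<dots> \<le> 4605 / 1000000 * (16 / 225) ^ n" by (intro mult_right_mono) auto
      finally show ?thesis .
    qed
    have g: "(\<lambda>n. 4605 / 1000000 * (16 / 225) ^ n) sums (4605 / 1000000 * (1 / (1 - 16 / 225 :: real)))"
      by (intro sums_mult geometric_sums) auto
    have "norm (\<Sum>n. weight4_term z (n + 3)) \<le> (\<Sum>n. 4605 / 1000000 * (16 / 225) ^ n)"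
      by (rule norm_suminf_le[OF le sums_summable[OF g]])
    also have "\<dots> = 4605 / 1000000 * (1 / (1 - 16 / 225))" using g by (simp add: sums_iff)
    finally show ?thesis by simp
  qed
  have "(\<Sum>M. weight4_term z M) = (\<Sum>n. weight4_term z (n + 3)) + (weight4_term z 1 + weight4_term z 2)"
    using suminf_split_initial_segment[OF S, of 3] t0 by (simp add: numeral_3_eq_3 numeral_2_eq_2)
  hence "Re (1 + (\<Sum>M. weight4_term z M)) = 1 + Re (weight4_term z 1) + Re (weight4_term z 2) + Re (\<Sum>n. weight4_term z (n + 3))"
    by simp
  moreover have "Re (weight4_term z 2) \<ge> - norm (weight4_term z 2)" using abs_Re_le_cmod[of "weight4_term z 2"] by linarith
  moreover have "Re (\<Sum>n. weight4_term z (n + 3)) \<ge> - norm (\<Sum>n. weight4_term z (n + 3))"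
    using abs_Re_le_cmod[of "\<Sum>n. weight4_term z (n + 3)"] by linarith
  ultimately have "Re (1 + (\<Sum>M. weight4_term z M)) > 0" using Re_weight4_term_1[OF z] t2 tail by linarith
  moreover have "zeta_nat 4 > 0" using zeta_nat_ge_1[of 4] by simp
  ultimately show ?thesis unfolding eis_A_4(2)[OF zp] by simp
qed

section \<open>Non-vanishing of the derivative low in the strip\<close>

text \<open>(1 + s/N)^N increases with N; here s = L v is compared at N and at L. The induction on
  L, with v and N fixed, uses Bernoulli's inequality for the ratio of consecutive left
  sides.\<close>

lemma bernoulli_power_ratio:
  fixes v :: real
  assumes v: "v \<ge> 0" and N: "N > 0" "N \<le> L"
  shows "(1 + real L * v / real N) ^ N \<le> (1 + v) ^ L"
  using N(2)
proof (induction L rule: dec_induct)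
  case base
  show ?case using N by simp
next
  case (step L)
  define u where "u = v / real N"
  have u: "u \<ge> 0" "v = real N * u" using v N by (auto simp: u_def)
  define X Y where "X = 1 + real L * u" and "Y = 1 + real (Suc L) * u"
  have XY: "X > 0" "Y > 0" "Y = X + u" using u by (auto simp: X_def Y_def algebra_simps add_pos_nonneg)
  have "1 - real N * (u / Y) \<le> (1 + - (u / Y)) ^ N"
    using Bernoulli_inequality[of "- (u / Y)" N] XY u by simp
  also have "1 + - (u / Y) = X / Y" using XY by (simp add: field_simps)
  finally have b: "1 - real N * (u / Y) \<le> (X / Y) ^ N" .
  have "1 \<le> (1 + v) * (1 - real N * (u / Y))"
  proof -
    have "Y - real N * u = 1 + (real (Suc L) - real N) * u" by (simp add: Y_def algebra_simps)
    hence "Y - real N * u \<ge> 1" using u step by simp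
    hence "v * (Y - real N * u) \<ge> v * 1" using v by (intro mult_left_mono) auto
    hence "Y \<le> (1 + v) * (Y - real N * u)" using u by (simp add: algebra_simps)
    also have "\<dots> = (1 + v) * (1 - real N * (u / Y)) * Y" using XY by (simp add: field_simps)
    finally show ?thesis using XY by simp
  qed
  also have "\<dots> \<le> (1 + v) * (X / Y) ^ N" using b v by (intro mult_left_mono) auto
  finally have "Y ^ N \<le> (1 + v) * (X / Y) ^ N * Y ^ N" using XY by simp
  also have "\<dots> = (1 + v) * X ^ N" using XY by (simp add: power_divide)
  also have "\<dots> \<le> (1 + v) * (1 + v) ^ L"
    using step.IH v by (intro mult_left_mono) (auto simp: X_def u_def)
  finally show ?case by (simp add: Y_def u_def)
qed

text \<open>The margin up to 5/8 admits z together with its mirror image 1 - cnj z whenever 3/8 <=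
  Re z <= 5/8. L stands for k / 2, so the height is limited by (Im z)^2 <= k / 6.\<close>

definition wide_strip :: "nat \<Rightarrow> complex set" where
  "wide_strip L = {z. 0 \<le> Re z \<and> Re z \<le> 5 / 8 \<and> Im z > 0 \<and> 3 / 4 \<le> (Im z) ^ 2 \<and> (Im z) ^ 2 \<le> real L / 3}"

definition lattice_ratio :: "complex \<Rightarrow> nat \<times> int \<Rightarrow> real" where
  "lattice_ratio z x = norm z / norm (lat z (int (Suc (fst x))) (snd x))"

text \<open>The constants come from \<open>\<bar>z / (z + n)\<bar>\<^sup>2\<^sup>L \<le> (1 + 418/1000 \<cdot> d)\<^sup>-\<^sup>6\<close>, where \<open>d = n\<^sup>2\<close> for \<open>n > 0\<close> and
  \<open>d = n\<^sup>2 - 5/4 \<cdot> \<bar>n\<bar>\<close> for \<open>n < 0\<close>; all that matters is that their sum stays below \<open>1 / 2\<close>.\<close>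

definition low_majorant :: "nat \<times> int \<Rightarrow> real" where
  "low_majorant = (\<lambda>(i,n).
     if i = 0 then (if n = 1 then 1231 / 10000 else if n = -2 then 1079 / 10000
                    else if n > 0 then 176 / 1000 / real_of_int n ^ 5 else 687 / 1000 / \<bar>real_of_int n\<bar> ^ 5)
     else (if n = 0 then 1 / real (Suc i) ^ 11 else 16 / (real (Suc i) ^ 8 * real_of_int n ^ 2)))"

text \<open>The first coordinate is m - 1, so the removed indices are (m, n) = (1, 0) and (1,
  -1).\<close>

definition low_index :: "(nat \<times> int) set" where
  "low_index = - {(0, 0), (0, -1)}"

lemma has_sum_zeta_tail:
  assumes "k \<ge> 2"
  shows "((\<lambda>n. 1 / real (Suc (n + N)) ^ k) has_sum (zeta_nat k - (\<Sum>n<N. 1 / real (Suc n) ^ k))) UNIV"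
proof (rule sums_nonneg_imp_has_sum)
  show "(\<lambda>n. 1 / real (Suc (n + N)) ^ k) sums (zeta_nat k - (\<Sum>n<N. 1 / real (Suc n) ^ k))"
    using summable_zeta_nat[OF assms] unfolding zeta_nat_def
    by (intro sums_split_initial_segment summable_sums)
qed auto

lemma low_majorant_sum: obtains \<sigma> where "(low_majorant has_sum \<sigma>) low_index" "\<sigma> \<le> 473 / 1000"
proof -
  define e1 where "e1 = zeta_nat 5 - (\<Sum>n<1. 1 / real (Suc n) ^ 5)"
  define e2 where "e2 = zeta_nat 5 - (\<Sum>n<2. 1 / real (Suc n) ^ 5)"
  define e3 where "e3 = zeta_nat 11 - (\<Sum>n<1. 1 / real (Suc n) ^ 11)"
  define e4 where "e4 = zeta_nat 8 - (\<Sum>n<1. 1 / real (Suc n) ^ 8)"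
  define f1 f2 f3 f4 f5 where
    "f1 = (\<lambda>j. (0::nat, int (j + 2)))" and "f2 = (\<lambda>j. (0::nat, - int (j + 3)))" and "f3 = (\<lambda>i. (Suc i, 0::int))"
    and "f4 = (\<lambda>(i,j). (Suc i, int (Suc j)))" and "f5 = (\<lambda>(i,j). (Suc i, - int (Suc j)))"
  note fd = f1_def f2_def f3_def f4_def f5_def
  have 0: "(low_majorant has_sum (low_majorant (0, 1) + low_majorant (0, -2))) {(0, 1), (0, -2)}"
    by (rule has_sum_finiteI) auto
  have nat_image: "(low_majorant has_sum S) (f ` UNIV)" if "inj f" "((\<lambda>x. g x) has_sum S) UNIV" "\<And>x. low_majorant (f x) = g x"
    for f :: "'a \<Rightarrow> nat \<times> int" and g S
    using that by (subst has_sum_reindex) (auto simp: o_def)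
  have pair_image: "(low_majorant has_sum S) (f ` UNIV)" if "inj f" "((\<lambda>x. g x) has_sum S) UNIV" "\<And>x. low_majorant (f x) = g x"
    for f :: "nat \<times> nat \<Rightarrow> nat \<times> int" and g S
    using that by (subst has_sum_reindex) (auto simp: o_def)
  have 1: "(low_majorant has_sum (176 / 1000 * e1)) (f1 ` UNIV)"
  proof (rule nat_image)
    show "((\<lambda>j. 176 / 1000 * (1 / real (Suc (j + 1)) ^ 5)) has_sum (176 / 1000 * e1)) UNIV"
      unfolding e1_def by (intro has_sum_cmult_right has_sum_zeta_tail) auto
  qed (auto simp: fd inj_def low_majorant_def add_ac)
  have 2: "(low_majorant has_sum (687 / 1000 * e2)) (f2 ` UNIV)"
  proof (rule nat_image)
    show "((\<lambda>j. 687 / 1000 * (1 / real (Suc (j + 2)) ^ 5)) has_sum (687 / 1000 * e2)) UNIV"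
      unfolding e2_def by (intro has_sum_cmult_right has_sum_zeta_tail) auto
  qed (auto simp: fd inj_def low_majorant_def add_ac)
  have 3: "(low_majorant has_sum e3) (f3 ` UNIV)"
  proof (rule nat_image)
    show "((\<lambda>j. 1 / real (Suc (j + 1)) ^ 11) has_sum e3) UNIV"
      unfolding e3_def by (intro has_sum_zeta_tail) auto
  qed (auto simp: fd inj_def low_majorant_def add_ac)
  have P: "((\<lambda>(i,j). 1 / real (Suc (i + 1)) ^ 8 * (1 / real (Suc j) ^ 2)) has_sum (e4 * zeta_nat 2)) UNIV"
    unfolding e4_def by (intro has_sum_product_nonneg has_sum_zeta_tail has_sum_zeta_nat) auto
  have 4: "(low_majorant has_sum (16 * (e4 * zeta_nat 2))) (f4 ` UNIV)"
  proof (rule pair_image)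
    show "((\<lambda>x. 16 * (case x of (i,j) \<Rightarrow> 1 / real (Suc (i + 1)) ^ 8 * (1 / real (Suc j) ^ 2))) has_sum (16 * (e4 * zeta_nat 2))) UNIV"
      by (intro has_sum_cmult_right P)
  qed (auto simp: fd inj_def low_majorant_def add_ac)
  have 5: "(low_majorant has_sum (16 * (e4 * zeta_nat 2))) (f5 ` UNIV)"
  proof (rule pair_image)
    show "((\<lambda>x. 16 * (case x of (i,j) \<Rightarrow> 1 / real (Suc (i + 1)) ^ 8 * (1 / real (Suc j) ^ 2))) has_sum (16 * (e4 * zeta_nat 2))) UNIV"
      by (intro has_sum_cmult_right P)
  next
    show "low_majorant (f5 x) = 16 * (case x of (i,j) \<Rightarrow> 1 / real (Suc (i + 1)) ^ 8 * (1 / real (Suc j) ^ 2))" for x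
    proof (cases x)
      case (Pair i j)
      have "real_of_int (- int (Suc j)) ^ 2 = real (Suc j) ^ 2" by (simp only: of_int_minus of_int_of_nat_eq power2_minus)
      moreover have "- int (Suc j) \<noteq> 0" by simp
      ultimately show ?thesis by (simp add: Pair fd low_majorant_def del: of_nat_Suc of_int_minus)
    qed
  qed (auto simp: fd inj_def)
  define S where "S = low_majorant (0, 1) + low_majorant (0, -2) + 176 / 1000 * e1 + 687 / 1000 * e2 + e3 + 16 * (e4 * zeta_nat 2) + 16 * (e4 * zeta_nat 2)"
  have "(low_majorant has_sum S) ({(0, 1), (0, -2)} \<union> f1 ` UNIV \<union> f2 ` UNIV \<union> f3 ` UNIV \<union> f4 ` UNIV \<union> f5 ` UNIV)"
    unfolding S_def by (intro has_sum_Un_disjoint 0 1 2 3 4 5) (auto simp: fd)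
  also have "{(0, 1), (0, -2)} \<union> f1 ` UNIV \<union> f2 ` UNIV \<union> f3 ` UNIV \<union> f4 ` UNIV \<union> f5 ` UNIV = low_index"
  proof (intro equalityI subsetI)
    fix x assume x: "x \<in> low_index"
    obtain i n where xi: "x = (i, n)" by force
    have n: "n = int (nat n) \<or> n = - int (nat (- n))" by auto
    show "x \<in> {(0, 1), (0, -2)} \<union> f1 ` UNIV \<union> f2 ` UNIV \<union> f3 ` UNIV \<union> f4 ` UNIV \<union> f5 ` UNIV"
    proof (cases i)
      case 0
      consider "n = 1" | "n = -2" | "n \<ge> 2" | "n \<le> -3" using x by (force simp: low_index_def xi 0)
      thus ?thesis
      proof cases
        case 3
        hence "x = f1 (nat (n - 2))" by (simp add: fd xi 0)
        thus ?thesis by blast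
      next
        case 4
        hence "x = f2 (nat (- n - 3))" by (simp add: fd xi 0)
        thus ?thesis by blast
      qed (auto simp: xi 0)
    next
      case (Suc l)
      consider "n = 0" | "n \<ge> 1" | "n \<le> -1" by linarith
      thus ?thesis
      proof cases
        case 1
        hence "x = f3 l" by (simp add: fd xi Suc)
        thus ?thesis by blast
      next
        case 2
        hence "x = f4 (l, nat (n - 1))" by (simp add: fd xi Suc)
        thus ?thesis by blast
      next
        case 3
        hence "x = f5 (l, nat (- n - 1))" by (simp add: fd xi Suc)
        thus ?thesis by blast
      qed
    qed
  qed (auto simp: low_index_def fd)
  finally have sum: "(low_majorant has_sum S) low_index" .
  have "e1 \<le> 1 / 32 + 1 / 108" "e2 \<le> 1 / 108" "e3 \<le> 6 / 10000" "e4 \<le> 1 / 256 + 1 / 2916"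
    using zeta_nat_le[of 5] zeta_nat_le[of 11] zeta_nat_le[of 8]
    by (simp_all add: e1_def e2_def e3_def e4_def lessThan_Suc numeral_2_eq_2)
  moreover have "e4 * zeta_nat 2 \<le> (1 / 256 + 1 / 2916) * (1665 / 1000)"
    using calculation zeta_nat_2_le zeta_nat_ge_1[of 2] by (intro mult_mono) auto
  ultimately have "S \<le> 473 / 1000" by (simp add: S_def low_majorant_def)
  thus ?thesis using sum that by blast
qed

text \<open>The factor \<open>max 1 \<bar>n\<bar>\<close> prepares for differences of terms at
  mirror points, which carry an extra |n|. Apart from n = 0 in the rows m >= 2, where R^2 <= 1 / m^2
  is immediate, the L-th powers are reduced to sixth powers by
  \<open>bernoulli_power_ratio\<close>.\<close>

lemma lattice_ratio_bound:
  assumes z: "z \<in> wide_strip L" and L: "L \<ge> 6" and x: "x \<in> low_index"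
  shows "real (Suc (fst x)) * max 1 \<bar>real_of_int (snd x)\<bar> * lattice_ratio z x ^ (2 * L) \<le> low_majorant x"
    and "lattice_ratio z x \<le> 1"
proof -
  obtain i n where xi: "x = (i, n)" by force
  define m where "m = real (Suc i)"
  have m: "m \<ge> 1" by (simp add: m_def)
  have rz: "0 \<le> Re z" "Re z \<le> 5 / 8" "Im z > 0" "3 / 4 \<le> (Im z) ^ 2" "(Im z) ^ 2 \<le> real L / 3"
    using z by (auto simp: wide_strip_def)
  define N where "N = norm z ^ 2"
  have N: "N = (Re z) ^ 2 + (Im z) ^ 2" by (simp add: N_def cmod_power2)
  have N0: "N > 0" unfolding N using rz by (intro add_nonneg_pos) auto
  have rx2: "(Re z) ^ 2 \<le> 25 / 64" using power_mono[OF rz(2,1), of 2] by (simp add: power_divide)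
  have NL: "N \<le> 25 / 64 + real L / 3" using rx2 rz by (simp add: N)
  have Ny: "N \<le> 1521 / 1000 * (Im z) ^ 2" using rx2 rz by (simp add: N)
  define P where "P = norm (lat z (int (Suc i)) n) ^ 2"
  have P: "P = (m * Re z + real_of_int n) ^ 2 + (m * Im z) ^ 2"
    by (simp add: P_def cmod_power2 m_def)
  define R where "R = lattice_ratio z x"
  have R0: "R \<ge> 0" by (simp add: R_def lattice_ratio_def)
  have R2: "R ^ 2 = N / P" by (simp add: R_def lattice_ratio_def xi N_def P_def power_divide)
  have "(m * Im z) ^ 2 > 0" using rz m by simp
  hence P0: "P > 0" unfolding P by (intro add_nonneg_pos) auto
  have row1: "R ^ (2 * L) \<le> 1 / X ^ 6" if "P \<ge> N + d" "d \<ge> 0" "0 < X" "X \<le> 1 + 418 / 1000 * d" for d X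
  proof -
    \<comment> \<open>0.418 is chosen so that 6 times 0.418 times (25/64 + L/3) is at most L from L
      = 6 on.\<close>
    have "d * (418 / 1000) * (6 * N) \<le> d * (real L)"
    proof -
      have "418 / 1000 * (6 * N) \<le> real L" using NL L by simp
      from mult_left_mono[OF this that(2)] show ?thesis by (simp add: mult_ac)
    qed
    hence "418 / 1000 * d \<le> real L * (d / N) / real 6" using N0 by (simp add: field_simps)
    hence "X \<le> 1 + real L * (d / N) / real 6" using that(4) by linarith
    hence "X ^ 6 \<le> (1 + real L * (d / N) / real 6) ^ 6" using that(3) by (intro power_mono) auto
    also have "\<dots> \<le> (1 + d / N) ^ L" using that N0 L by (intro bernoulli_power_ratio) auto
    also have "\<dots> \<le> (P / N) ^ L"
    proof (intro power_mono)
      have "(N + d) / N \<le> P / N" using that(1) N0 by (intro divide_right_mono) auto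
      thus "1 + d / N \<le> P / N" using N0 by (simp add: add_divide_distrib)
    qed (use that N0 in auto)
    finally have le: "X ^ 6 \<le> (P / N) ^ L" .
    have "R ^ (2 * L) = 1 / (P / N) ^ L" unfolding power_mult R2 by (simp add: power_divide)
    also have "\<dots> \<le> 1 / X ^ 6" using le that by (intro divide_left_mono mult_pos_pos) (use N0 P0 in auto)
    finally show ?thesis .
  qed
  have cancel: "b * (c / b ^ 6) = c / b ^ 5" if "b \<noteq> 0" for b c :: real
    using that by (simp add: eval_nat_numeral)
  have bound: "m * max 1 \<bar>real_of_int n\<bar> * R ^ (2 * L) \<le> low_majorant (i, n)"
  proof (cases "i = 0")
    case True
    hence m1: "m = 1" by (simp add: m_def)
    have PN: "P = N + 2 * Re z * real_of_int n + (real_of_int n) ^ 2"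
      by (simp add: P N m1 power2_eq_square algebra_simps)
    consider "n = 1" | "n = -2" | "n \<ge> 2" | "n \<le> -3" using x by (force simp: low_index_def xi True)
    thus ?thesis
    proof cases
      case 1
      have "R ^ (2 * L) \<le> 1 / (1418 / 1000) ^ 6" by (rule row1[of 1]) (use rz in \<open>auto simp: PN 1\<close>)
      also have "\<dots> \<le> 1231 / 10000" by (simp add: power_divide)
      finally show ?thesis by (simp add: 1 m1 True low_majorant_def)
    next
      case 2
      have "R ^ (2 * L) \<le> 1 / (1627 / 1000) ^ 6" by (rule row1[of "3 / 2"]) (use rz in \<open>auto simp: PN 2\<close>)
      also have "2 * \<dots> \<le> 1079 / 10000" by (simp add: power_divide)
      finally show ?thesis by (simp add: 2 m1 True low_majorant_def)
    next
      case 3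
      define b where "b = real_of_int n"
      have b: "b \<ge> 2" using 3 by (simp add: b_def)
      have "(b - 2) * (418 / 1000 * b - 1 / 2) \<ge> 0" using b by (intro mult_nonneg_nonneg) auto
      moreover have "(b - e) * (c * b - f) = c * b ^ 2 - (c * e + f) * b + e * f" for c e f
        by (simp add: power2_eq_square algebra_simps)
      from this[of 2 "418 / 1000" "1 / 2"] have "(b - 2) * (418 / 1000 * b - 1 / 2) = 418 / 1000 * b ^ 2 - 1336 / 1000 * b + 1"
        by simp
      ultimately have "1336 / 1000 * b \<le> 1 + 418 / 1000 * b ^ 2" by linarith
      hence "R ^ (2 * L) \<le> 1 / (1336 / 1000 * b) ^ 6"
        using b rz by (intro row1[of "b ^ 2"]) (auto simp: PN b_def[symmetric])
      also have "\<dots> = 1 / (1336 / 1000) ^ 6 / b ^ 6" by (simp only: power_mult_distrib divide_divide_eq_left)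
      finally have "b * R ^ (2 * L) \<le> b * (1 / (1336 / 1000) ^ 6 / b ^ 6)" using b by (intro mult_left_mono) auto
      also have "\<dots> = 1 / (1336 / 1000) ^ 6 / b ^ 5" using b by (intro cancel) auto
      also have "\<dots> \<le> 176 / 1000 / b ^ 5" using b by (intro divide_right_mono) (auto simp: power_divide)
      finally show ?thesis using 3 b by (simp add: m1 True low_majorant_def b_def[symmetric] max_def)
    next
      case 4
      define b where "b = - real_of_int n"
      have nb: "real_of_int n = - b" by (simp add: b_def)
      have b: "b \<ge> 3" using 4 by (simp add: b_def)
      have "(b - 3) * (418 / 1000 * b - 3334 / 10000) \<ge> 0" using b by (intro mult_nonneg_nonneg) auto
      moreover have "(b - e) * (c * b - f) = c * b ^ 2 - (c * e + f) * b + e * f" for c e f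
        by (simp add: power2_eq_square algebra_simps)
      from this[of 3 "418 / 1000" "3334 / 10000"]
      have "(b - 3) * (418 / 1000 * b - 3334 / 10000) = 418 / 1000 * b ^ 2 - 15874 / 10000 * b + 10002 / 10000"
        by simp
      ultimately have q: "10647 / 10000 * b \<le> 1 + 418 / 1000 * (b ^ 2 - 5 / 4 * b)" using b by (simp only: right_diff_distrib)
      have d0: "b ^ 2 - 5 / 4 * b = b * (b - 5 / 4)" by (simp add: power2_eq_square algebra_simps)
      have "Re z * b \<le> 5 / 8 * b" using rz b by (intro mult_right_mono) auto
      hence "P \<ge> N + (b ^ 2 - 5 / 4 * b)" by (simp add: PN nb)
      moreover have "b ^ 2 - 5 / 4 * b \<ge> 0" unfolding d0 using b by (intro mult_nonneg_nonneg) auto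
      ultimately have "R ^ (2 * L) \<le> 1 / (10647 / 10000 * b) ^ 6" by (rule row1[OF _ _ _ q]) (use b in auto)
      also have "\<dots> = 1 / (10647 / 10000) ^ 6 / b ^ 6" by (simp only: power_mult_distrib divide_divide_eq_left)
      finally have "b * R ^ (2 * L) \<le> b * (1 / (10647 / 10000) ^ 6 / b ^ 6)" using b by (intro mult_left_mono) auto
      also have "\<dots> = 1 / (10647 / 10000) ^ 6 / b ^ 5" using b by (intro cancel) auto
      also have "\<dots> \<le> 687 / 1000 / b ^ 5" using b by (intro divide_right_mono) (auto simp: power_divide)
      finally show ?thesis using 4 b by (simp add: m1 True low_majorant_def nb max_def)
    qed
  next
    case False
    hence m2: "m \<ge> 2" by (simp add: m_def)
    define u where "u = \<bar>real_of_int n\<bar>"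
    \<comment> \<open>\<tau> is the horizontal distance of z from - n / m, so that P = m^2 (\<tau>^2
      + (Im z)^2).\<close>
    define \<tau> where "\<tau> = \<bar>m * Re z + real_of_int n\<bar> / m"
    have \<tau>0: "\<tau> \<ge> 0" using m by (simp add: \<tau>_def)
    have "(m * Re z + real_of_int n) ^ 2 = (\<tau> * m) ^ 2" using m by (simp add: \<tau>_def)
    hence P': "P = m ^ 2 * (\<tau> ^ 2 + (Im z) ^ 2)" by (simp add: P power_mult_distrib algebra_simps)
    define A where "A = 1 + \<tau> ^ 2 / (Im z) ^ 2"
    define A' where "A' = 1 + \<tau> ^ 2 / 2"
    define q where "q = 1521 / 1000 / m ^ 2"
    have y2: "(Im z) ^ 2 > 0" using rz by simp
    have A: "A \<ge> 1" "A' \<ge> 1" by (auto simp: A_def A'_def)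
    have mm: "m ^ 2 \<ge> 4" using power_mono[OF m2, of 2] by simp
    have q: "0 \<le> q" "q \<le> 1" using mm by (auto simp: q_def divide_le_eq)
    have "R ^ 2 \<le> (1521 / 1000 * (Im z) ^ 2) / P" unfolding R2 using Ny P0 by (intro divide_right_mono) auto
    also have "P = m ^ 2 * (Im z) ^ 2 * A" using y2 by (simp add: P' A_def field_simps)
    also have "(1521 / 1000 * (Im z) ^ 2) / (m ^ 2 * (Im z) ^ 2 * A) = q * (1 / A)" using y2 by (simp add: q_def)
    finally have "(R ^ 2) ^ L \<le> (q * (1 / A)) ^ L" by (intro power_mono) auto
    also have "\<dots> = q ^ L * (1 / A ^ L)" by (simp only: power_mult_distrib power_one_over)
    also have "\<dots> \<le> q ^ 6 * (1 / A' ^ 6)"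
    proof (intro mult_mono)
      show "q ^ L \<le> q ^ 6" using q L by (intro power_decreasing) auto
      have "\<tau> ^ 2 / 2 \<le> real L * (\<tau> ^ 2 / (Im z) ^ 2) / 6"
      proof -
        have "\<tau> ^ 2 * (3 * (Im z) ^ 2) \<le> \<tau> ^ 2 * real L" using rz by (intro mult_left_mono) auto
        thus ?thesis using y2 by (simp add: field_simps)
      qed
      hence "A' ^ 6 \<le> (1 + real L * (\<tau> ^ 2 / (Im z) ^ 2) / real 6) ^ 6" using A unfolding A'_def by (intro power_mono) auto
      also have "\<dots> \<le> A ^ L" unfolding A_def using L by (intro bernoulli_power_ratio) auto
      finally show "1 / A ^ L \<le> 1 / A' ^ 6" using A by (intro divide_left_mono mult_pos_pos) auto
    qed (use q A in auto)
    finally have RL: "R ^ (2 * L) \<le> q ^ 6 * (1 / A' ^ 6)" by (simp only: power_mult)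
    show ?thesis
    proof (cases "n = 0")
      case True
      have "N / P \<le> 1 / m ^ 2" using N0 by (simp add: P N True power_mult_distrib distrib_left[symmetric])
      hence "(R ^ 2) ^ L \<le> (1 / m ^ 2) ^ L" unfolding R2 using N0 P0 by (intro power_mono) auto
      also have "\<dots> \<le> (1 / m ^ 2) ^ 6" using L mm by (intro power_decreasing) (auto simp: divide_le_eq)
      also have "\<dots> = 1 / m ^ 12" by (simp add: power_one_over power_mult[symmetric])
      finally have "m * R ^ (2 * L) \<le> m * (1 / m ^ 12)" using m by (intro mult_left_mono) (auto simp: power_mult)
      also have "\<dots> = 1 / m ^ 11" using m by (simp add: eval_nat_numeral)
      finally show ?thesis using False True by (simp add: low_majorant_def m_def del: of_nat_Suc)
    next
      case n0: False
      have u: "u \<ge> 1" using n0 by (simp add: u_def)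
      have "u \<le> \<bar>m * Re z + real_of_int n\<bar> + m * Re z" using mult_nonneg_nonneg[of m "Re z"] rz m unfolding u_def by linarith
      also have "\<dots> \<le> \<tau> * m + m * (5 / 8)" using rz m by (intro add_mono mult_left_mono) (auto simp: \<tau>_def)
      finally have "u / m \<le> \<tau> + 5 / 8" using m by (simp add: field_simps)
      \<comment> \<open>The tangent of 1 + \<tau>^2 / 2 at 0.92 has constant term 0.5768, just above
        0.92 times 5/8; so the quadratic dominates 0.92 (\<tau> + 5/8), and u / m <= \<tau> +
        5/8.\<close>
      moreover have "0 \<le> (\<tau> - 92 / 100) ^ 2" by simp
      hence e: "92 / 100 * (\<tau> + 5 / 8) \<le> A'" by (simp add: A'_def power2_eq_square algebra_simps)
      ultimately have "92 / 100 * (u / m) \<le> 92 / 100 * (\<tau> + 5 / 8)" by (intro mult_left_mono) auto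
      hence le: "92 / 100 * (u / m) \<le> A'" by (rule order_trans[OF _ e])
      have "A' ^ 3 * A' ^ 3 \<ge> 1 * (92 / 100 * (u / m)) ^ 3"
        using A le u m by (intro mult_mono power_mono one_le_power) auto
      hence A6: "A' ^ 6 \<ge> (92 / 100) ^ 3 * u ^ 3 / m ^ 3" by (simp add: power_add[symmetric] power_mult_distrib power_divide)
      have "R ^ (2 * L) \<le> q ^ 6 * (1 / ((92 / 100) ^ 3 * u ^ 3 / m ^ 3))"
        by (rule order_trans[OF RL], intro mult_left_mono divide_left_mono A6 mult_pos_pos) (use q A u m in auto)
      also have "q ^ 6 = q ^ 3 * q ^ 3" by (simp add: power_add[symmetric])
      also have "q ^ 3 * q ^ 3 * (1 / ((92 / 100) ^ 3 * u ^ 3 / m ^ 3)) \<le> 16 / (m ^ 9 * u ^ 3)"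
      proof -
        have "q ^ 3 = (1521 / 1000) ^ 3 / m ^ 6" by (simp add: q_def power_divide power_mult[symmetric])
        hence "q ^ 3 * q ^ 3 * (1 / ((92 / 100) ^ 3 * u ^ 3 / m ^ 3)) =
            (1521 / 1000) ^ 3 / m ^ 6 * ((1521 / 1000) ^ 3 / m ^ 6) * (1 / ((92 / 100) ^ 3 * u ^ 3 / m ^ 3))" by (simp only:)
        also have "\<dots> = (1521 / 1000) ^ 3 * (1521 / 1000) ^ 3 / (92 / 100) ^ 3 / (m ^ 9 * u ^ 3)"
          using m u by (simp add: eval_nat_numeral)
        also have "\<dots> \<le> 16 / (m ^ 9 * u ^ 3)"
          using m u by (intro divide_right_mono) (auto simp: power_divide)
        finally show ?thesis .
      qed
      finally have "m * u * R ^ (2 * L) \<le> m * u * (16 / (m ^ 9 * u ^ 3))" using m u by (intro mult_left_mono) auto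
      also have "\<dots> = 16 / (m ^ 8 * u ^ 2)" using m u by (simp add: eval_nat_numeral)
      finally show ?thesis using n0 False u by (simp add: low_majorant_def m_def u_def max_def del: of_nat_Suc)
    qed
  qed
  show "real (Suc (fst x)) * max 1 \<bar>real_of_int (snd x)\<bar> * lattice_ratio z x ^ (2 * L) \<le> low_majorant x"
    using bound by (simp only: xi fst_conv snd_conv m_def R_def)
  have "low_majorant (i, n) \<le> 1"
  proof (cases "i = 0")
    case True
    have le: "a / \<bar>real_of_int n\<bar> ^ 5 \<le> 1" if "0 \<le> a" "a \<le> 1" for a
    proof (cases "n = 0")
      case False
      hence "1 \<le> \<bar>real_of_int n\<bar>" by linarith
      hence "1 \<le> \<bar>real_of_int n\<bar> ^ 5" by (rule one_le_power)
      hence "a / \<bar>real_of_int n\<bar> ^ 5 \<le> a / 1" using that by (intro divide_left_mono) auto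
      thus ?thesis using that by simp
    qed simp
    show ?thesis using True le[of "176 / 1000"] le[of "687 / 1000"] by (auto simp: low_majorant_def)
  next
    case False
    hence "m \<ge> 2" by (simp add: m_def)
    hence "m ^ 8 \<ge> 2 ^ 8" by (rule power_mono) simp
    moreover have "m ^ 11 \<ge> 1" using m by (rule one_le_power)
    moreover have "1 \<le> \<bar>real_of_int n\<bar> ^ 2" if "n \<noteq> 0" using that by (intro one_le_power) linarith
    hence "(real_of_int n) ^ 2 \<ge> 1" if "n \<noteq> 0" using that by simp
    hence "m ^ 8 * (real_of_int n) ^ 2 \<ge> 2 ^ 8 * 1" if "n \<noteq> 0" using that calculation by (intro mult_mono) auto
    ultimately show ?thesis using False m by (auto simp: low_majorant_def m_def[symmetric] divide_le_eq simp del: of_nat_Suc)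
  qed
  moreover have "1 * R ^ (2 * L) \<le> m * max 1 \<bar>real_of_int n\<bar> * R ^ (2 * L)"
    using m R0 mult_mono[of 1 m 1 "max 1 \<bar>real_of_int n\<bar>"] by (intro mult_right_mono) auto
  ultimately have "R ^ (2 * L) \<le> 1" using bound by linarith
  moreover have "1 < R ^ (2 * L)" if "R > 1" using that by (rule one_less_power) (use L in simp)
  ultimately have "R \<le> 1" by linarith
  thus "lattice_ratio z x \<le> 1" by (simp add: R_def)
qed


text \<open>If \<open>B\<close> vanishes at \<open>z\<close>, it vanishes at the mirror image \<open>w = 1 - cnj z\<close>. Comparing the terms of index \<open>(1, 0)\<close> and \<open>(1, -1)\<close>
  with the remainders \<open>g\<close> and \<open>h\<close> yields \<open>\<bar>1 + g\<bar> = 1 / \<rho>\<close> and \<open>\<bar>1 + h\<bar> = \<rho>\<close>. Near the line \<open>Re z = 1 / 2\<close> both \<open>\<rho> - 1\<close> and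
  \<open>h - g\<close> are of first order in \<open>1 - 2 Re z\<close>, and the former wins.\<close>

lemma eis_B_nonzero_low:
  assumes z: "0 \<le> Re z" "Re z < 1 / 2" "Im z > 0" "(Im z) ^ 2 \<ge> 3 / 4" and k: "even k" "k \<ge> 12" and y: "(Im z) ^ 2 \<le> real k / 6"
  shows "eis_B k z \<noteq> 0"
proof
  assume B0: "eis_B k z = 0"
  define L where "L = k div 2"
  have kL: "k = 2 * L" "L \<ge> 6" using k by (auto simp: L_def)
  define w where "w = 1 - cnj z"
  have w: "Re w = 1 - Re z" "Im w = Im z" by (auto simp: w_def)
  have k4: "k \<ge> 4" using k by simp
  have Bw: "eis_B k w = 0"
  proof -
    have "eis_B k (- cnj z) = 0" using eis_reflect(2)[OF z(3) k4] B0 by simp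
    moreover have "Im (- cnj z) > 0" using z by simp
    from eis_transform(1)[where a = 1 and b = 1 and c = 0 and d = 1, OF this k4]
    have "eis_B k (1 - cnj z) = eis_B k (- cnj z)" by (simp add: moebius_def)
    ultimately show ?thesis by (simp add: w_def)
  qed
  \<comment> \<open>Normalising by v^(k+1) makes the term of index (1, 0) equal to 1 and the term of
    index (1, -1) equal to (v / (v - 1))^(k+1).\<close>
  define T where "T = (\<lambda>v x. of_nat (Suc (fst x)) * (v / lat v (int (Suc (fst x))) (snd x)) ^ Suc k)"
  have norm_T: "norm (T v x) = real (Suc (fst x)) * lattice_ratio v x ^ Suc k" for v x
    unfolding T_def lattice_ratio_def norm_mult norm_power norm_divide norm_of_nat ..
  have split: "\<exists>g. (T v has_sum g) low_index \<and> 1 + (v / (v - 1)) ^ Suc k + g = 0"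
    if v: "Im v > 0" and "eis_B k v = 0" for v
  proof -
    have "((\<lambda>x. v ^ Suc k * (case x of (i::nat,n::int) \<Rightarrow> of_nat (Suc i) / lat v (int (Suc i)) n ^ Suc k)) has_sum (v ^ Suc k * eis_B k v)) UNIV"
      by (intro has_sum_cmult_right has_sum_eis_B_half v k(1) k4)
    moreover have "v ^ Suc k * (case x of (i::nat,n::int) \<Rightarrow> of_nat (Suc i) / lat v (int (Suc i)) n ^ Suc k) = T v x" for x
      unfolding T_def power_divide by (cases x) (simp only: prod.case fst_conv snd_conv times_divide_eq_right mult.commute)
    ultimately have "(T v has_sum 0) UNIV" using that(2) by (simp only: mult_zero_right)
    moreover have "(T v has_sum (T v (0, 0) + T v (0, -1))) {(0, 0), (0, -1)}" by (rule has_sum_finiteI) auto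
    ultimately have "(T v has_sum (0 - (T v (0, 0) + T v (0, -1)))) (UNIV - {(0, 0), (0, -1)})"
      by (intro has_sum_Diff) auto
    moreover have "UNIV - {(0, 0), (0, -1)} = low_index" by (auto simp: low_index_def)
    moreover have "T v (0, 0) = 1" using v by (auto simp: T_def)
    moreover have "T v (0, -1) = (v / (v - 1)) ^ Suc k" by (simp add: T_def)
    ultimately show ?thesis by (intro exI[of _ "0 - (1 + (v / (v - 1)) ^ Suc k)"]) auto
  qed
  obtain g where g: "(T z has_sum g) low_index" "1 + (z / (z - 1)) ^ Suc k + g = 0"
    using split[OF z(3) B0] by blast
  obtain h where h: "(T w has_sum h) low_index" "1 + (w / (w - 1)) ^ Suc k + h = 0"
    using split[of w] z Bw by (auto simp: w_def)
  obtain \<sigma> where \<sigma>: "(low_majorant has_sum \<sigma>) low_index" "\<sigma> \<le> 473 / 1000" by (rule low_majorant_sum)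
  have zs: "z \<in> wide_strip L" using z y by (simp add: wide_strip_def kL)
  define N where "N = norm z ^ 2"
  have N: "N = (Re z) ^ 2 + (Im z) ^ 2" by (simp add: N_def cmod_power2)
  have N0: "N > 0" unfolding N using z by (intro add_nonneg_pos) auto
  have nz: "norm z > 0" "norm w > 0" using z w by (auto simp: complex_eq_iff)
  define a where "a = 1 - 2 * Re z"
  have a: "a > 0" using z by (simp add: a_def)
  define \<rho> where "\<rho> = (norm w / norm z) ^ Suc k"
  have \<rho>0: "\<rho> > 0" using nz by (simp add: \<rho>_def)
  have w2: "(norm w / norm z) ^ 2 = 1 + a / N"
  proof -
    have "norm w ^ 2 = N + a" by (simp only: cmod_power2 w N a_def) (simp add: power2_eq_square algebra_simps)
    thus ?thesis using N0 by (simp add: power_divide N_def[symmetric] field_simps)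
  qed
  have \<rho>2: "\<rho> ^ 2 = (1 + a / N) ^ Suc k" unfolding \<rho>_def w2[symmetric] by (simp only: power_mult[symmetric] mult.commute)
  have zm: "norm (z - 1) = norm w" "norm (w - 1) = norm z"
    by (simp_all add: w_def norm_minus_commute) (metis complex_cnj_diff complex_cnj_one complex_mod_cnj)
  have og: "norm ((z / (z - 1)) ^ Suc k) = 1 / \<rho>"
    unfolding norm_power norm_divide zm \<rho>_def by (simp add: power_divide del: power_Suc)
  have oh: "norm ((w / (w - 1)) ^ Suc k) = \<rho>"
    unfolding norm_power norm_divide zm \<rho>_def ..
  have g1: "norm (1 + g) = 1 / \<rho>"
  proof -
    have "1 + g = - ((z / (z - 1)) ^ Suc k)" using g(2) by (simp add: eq_neg_iff_add_eq_0 add_ac del: power_Suc)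
    thus ?thesis using og by (simp only: norm_minus_cancel)
  qed
  have h1: "norm (1 + h) = \<rho>"
  proof -
    have "1 + h = - ((w / (w - 1)) ^ Suc k)" using h(2) by (simp add: eq_neg_iff_add_eq_0 add_ac del: power_Suc)
    thus ?thesis using oh by (simp only: norm_minus_cancel)
  qed
  show False
  proof (cases "Re z \<le> 3 / 8")
    case True
    \<comment> \<open>Away from the line Re z = 1/2 sizes suffice: |g| <= 0.473 and |1 + g| = 1 /
      \<rho> <= 0.492 contradict the triangle inequality.\<close>
    have "norm g \<le> \<sigma>"
    proof (rule norm_infsum_le[OF g(1) \<sigma>(1)])
      fix x assume x: "x \<in> low_index"
      note lb = lattice_ratio_bound[OF zs kL(2) x]
      have R0: "lattice_ratio z x \<ge> 0" by (simp add: lattice_ratio_def)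
      have "real (Suc (fst x)) * 1 * lattice_ratio z x ^ Suc k \<le> real (Suc (fst x)) * max 1 \<bar>real_of_int (snd x)\<bar> * lattice_ratio z x ^ (2 * L)"
        using lb(2) R0 by (intro mult_mono power_decreasing) (auto simp: kL(1))
      thus "norm (T z x) \<le> low_majorant x" using lb(1) unfolding norm_T by (simp only: mult_1_right)
    qed
    moreover have "1 / \<rho> \<le> 492 / 1000"
    proof -
      have "N \<le> 9 / 64 + real k / 6" using power_mono[OF True z(1), of 2] y by (simp add: N power_divide)
      hence "3 / 2 * N \<le> real (Suc k) * (1 / 4)" using k by simp
      also have "\<dots> \<le> real (Suc k) * a" using True by (intro mult_left_mono) (auto simp: a_def)
      finally have "3 / 2 / 13 \<le> real (Suc k) * (a / N) / real 13" using N0 by (simp add: field_simps)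
      \<comment> \<open>13 is the least possible value of k + 1, and (1 + 1.5/13)^13 just exceeds
        (1000/492)^2.\<close>
      hence "(1 + 3 / 2 / 13) ^ 13 \<le> (1 + real (Suc k) * (a / N) / real 13) ^ 13" by (intro power_mono) auto
      also have "\<dots> \<le> \<rho> ^ 2" unfolding \<rho>2 using a N0 k by (intro bernoulli_power_ratio) auto
      finally have "(1000 / 492) ^ 2 \<le> \<rho> ^ 2" by (simp add: power_divide)
      hence "1000 / 492 \<le> \<rho>" by (rule power2_le_imp_le) (use \<rho>0 in simp)
      thus ?thesis using \<rho>0 by (simp add: field_simps)
    qed
    moreover have "1 \<le> norm (1 + g) + norm g" using norm_triangle_ineq4[of "1 + g" g] by simp
    ultimately show False using g1 \<sigma>(2) by linarith
  next
    case False
    have ws: "w \<in> wide_strip L" using z y False by (simp add: wide_strip_def kL w)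
    define C where "C = real (Suc k) * a / N"
    have C0: "C > 0" using a N0 by (simp add: C_def)
    have "norm (h - g) \<le> C * \<sigma>"
    proof (rule norm_infsum_le)
      show "((\<lambda>x. T w x - T z x) has_sum (h - g)) low_index" by (intro has_sum_diff h g)
      show "((\<lambda>x. C * low_majorant x) has_sum (C * \<sigma>)) low_index" by (intro has_sum_cmult_right \<sigma>)
      fix x assume x: "x \<in> low_index"
      define m n where "m = Suc (fst x)" and "n = snd x"
      define p q where "p = lat w (int m) n" and "q = lat z (int m) n"
      have pq: "p \<noteq> 0" "q \<noteq> 0" using z w by (auto simp: p_def q_def m_def complex_eq_iff)
      define M where "M = max (lattice_ratio w x) (lattice_ratio z x)"
      note lb = lattice_ratio_bound[OF zs kL(2) x] lattice_ratio_bound[OF ws kL(2) x]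
      have M: "0 \<le> M" "M \<le> 1" using lb by (auto simp: M_def lattice_ratio_def max_def)
      have Mn: "norm (w / p) \<le> M" "norm (z / q) \<le> M"
        by (simp_all add: M_def lattice_ratio_def p_def q_def m_def n_def norm_divide)
      have majorant: "real m * max 1 \<bar>real_of_int n\<bar> * M ^ (2 * L) \<le> low_majorant x"
        using lb by (simp add: M_def max_def m_def n_def)
      \<comment> \<open>In w q - z p the index m cancels and n (w - z) remains, with w - z = 1 - 2
        Re z = a: this is the first-order smallness near the line.\<close>
      have "w / p - z / q = of_int n * (w - z) / (p * q)"
        using pq by (simp add: divide_simps) (simp add: p_def q_def algebra_simps)
      also have "w - z = of_real a" by (simp add: w_def a_def complex_eq_iff)
      finally have "norm (w / p - z / q) = \<bar>real_of_int n\<bar> * a / (norm p * norm q)"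
        using a by (simp add: norm_mult norm_divide)
      also have "\<dots> = \<bar>real_of_int n\<bar> * a * (norm (w / p) * norm (z / q)) / (norm w * norm z)"
        using nz by (simp add: norm_divide)
      also have "\<dots> \<le> \<bar>real_of_int n\<bar> * a * (M * M) / (norm z * norm z)"
      proof (intro frac_le mult_left_mono mult_mono Mn)
        have "norm z \<le> norm w"
        proof (rule power2_le_imp_le)
          show "norm z ^ 2 \<le> norm w ^ 2" using z by (simp only: cmod_power2 w) (simp add: power2_eq_square algebra_simps)
        qed simp
        thus "norm z \<le> norm w" .
      qed (use nz a M in auto)
      finally have d: "norm (w / p - z / q) \<le> \<bar>real_of_int n\<bar> * a * (M * M) / N" by (simp add: N_def power2_eq_square)
      have "norm (T w x - T z x) = real m * norm ((w / p) ^ Suc k - (z / q) ^ Suc k)"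
      proof -
        have "T w x - T z x = of_nat m * ((w / p) ^ Suc k - (z / q) ^ Suc k)"
          unfolding T_def m_def[symmetric] n_def[symmetric] p_def[symmetric] q_def[symmetric] by (simp only: right_diff_distrib)
        thus ?thesis by (simp only: norm_mult norm_of_nat)
      qed
      also have "\<dots> \<le> real m * (real (Suc k) * norm (w / p - z / q) * M ^ k)"
        by (intro mult_left_mono norm_power_diff_le Mn) auto
      also have "\<dots> \<le> real m * (real (Suc k) * (\<bar>real_of_int n\<bar> * a * (M * M) / N) * M ^ k)"
        using d M by (intro mult_left_mono mult_right_mono) auto
      also have "\<dots> = C * (real m * \<bar>real_of_int n\<bar> * (M * M * M ^ k))" by (simp add: C_def)
      also have "\<dots> \<le> C * (real m * max 1 \<bar>real_of_int n\<bar> * (1 * 1 * M ^ k))"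
        using C0 M by (intro mult_left_mono mult_mono) auto
      also have "\<dots> \<le> C * low_majorant x" using majorant C0 unfolding kL(1) by (intro mult_left_mono) auto
      finally show "norm (T w x - T z x) \<le> C * low_majorant x" .
    qed
    \<comment> \<open>From \<rho>^2 = (1 + a/N)^(k+1) >= (1 + C/2)^2. Hence \<rho> - 1/\<rho> >=
      C/2, whereas |1 + h| - |1 + g| <= |h - g| <= 0.473 C.\<close>
    moreover have "1 + C / 2 \<le> \<rho>"
    proof -
      have "(1 + real (Suc k) * (a / N) / real 2) ^ 2 \<le> \<rho> ^ 2"
        unfolding \<rho>2 using a N0 k by (intro bernoulli_power_ratio) auto
      thus ?thesis using \<rho>0 by (simp add: C_def power2_le_iff_abs_le)
    qed
    moreover have "C * \<sigma> \<le> C * (473 / 1000)" using \<sigma> C0 by (intro mult_left_mono) auto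
    moreover have "norm (1 + h) - norm (1 + g) \<le> norm (h - g)" using norm_triangle_ineq2[of "1 + h" "1 + g"] by simp
    moreover have "1 / \<rho> \<le> 1" using calculation(2) C0 by simp
    ultimately show False using C0 g1 h1 by linarith
  qed
qed

section \<open>Level sets of a logarithm outside the unit circle\<close>

lemma interval_clopen_induct:
  fixes I :: "real set"
  assumes I: "connected I" and t0: "t0 \<in> I" "P t0" and t: "t \<in> I"
    and op: "\<And>s. s \<in> I \<Longrightarrow> P s \<Longrightarrow> \<exists>e>0. \<forall>s'\<in>I. \<bar>s' - s\<bar> < e \<longrightarrow> P s'"
    and cl: "\<And>u s. s \<in> I \<Longrightarrow> (\<And>n. u n \<in> I \<and> P (u n)) \<Longrightarrow> u \<longlonglongrightarrow> s \<Longrightarrow> P s"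
  shows "P t"
proof -
  let ?T = "{s\<in>I. P s}"
  have "openin (top_of_set I) ?T"
    unfolding openin_euclidean_subtopology_iff using op by (auto simp: dist_real_def)
  moreover have "closedin (top_of_set I) ?T"
    unfolding closedin_limpt
  proof (intro conjI allI impI)
    fix s assume s: "s islimpt ?T \<and> s \<in> I"
    then obtain u where "\<And>n. u n \<in> ?T - {s}" "u \<longlonglongrightarrow> s"
      unfolding islimpt_sequential by auto
    thus "s \<in> ?T" using cl[of s u] s by auto
  qed auto
  ultimately have "?T = {} \<or> ?T = I" using I unfolding connected_clopen by blast
  thus ?thesis using t0 t by blast
qed

text \<open>For c < 0 an n-th root of -i is needed, found at angle - pi / (2 n); for c > 0 an n-th
  root of i, found at angle - 3 pi / (2 n), which is greater than - pi only if n >= 2. For n = 1 and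
  c > 0 the sole solution is i itself, in the upper half-plane.\<close>

lemma nonzero_power_direction:
  fixes c :: real and n :: nat
  assumes "n \<ge> 2 \<or> c < 0" "n \<ge> 1" "c \<noteq> 0"
  obtains u :: complex where "Im u < 0" "of_real c * u ^ n = \<i> * of_real \<bar>c\<bar>"
proof (cases "c < 0")
  case True
  define u where "u = cis (- (pi / (2 * n)))"
  have "u ^ n = cis (real n * - (pi / (2 * n)))" unfolding u_def by (rule Complex.DeMoivre)
  also have "real n * - (pi / (2 * n)) = - (pi / 2)" using assms by simp
  also have "cis (- (pi / 2)) = - \<i>" by (simp add: complex_eq_iff)
  finally have "of_real c * u ^ n = \<i> * of_real \<bar>c\<bar>" using True by simp
  moreover have "pi / (2 * n) < pi" using assms by (simp add: field_simps)
  hence "Im u < 0" unfolding u_def using assms by (auto intro!: sin_gt_zero)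
  ultimately show ?thesis using that by blast
next
  case False
  with assms have n: "n \<ge> 2" "c > 0" by auto
  define u where "u = cis (- (3 * pi / (2 * n)))"
  have "u ^ n = cis (real n * - (3 * pi / (2 * n)))" unfolding u_def by (rule Complex.DeMoivre)
  also have "real n * - (3 * pi / (2 * n)) = - (3 / 2 * pi)" using n by simp
  also have "cis (- (3 / 2 * pi)) = \<i>"
    using sin_3over2_pi cos_3over2_pi by (simp add: complex_eq_iff)
  finally have "of_real c * u ^ n = \<i> * of_real \<bar>c\<bar>" using n by simp
  moreover have "3 * pi / (2 * n) < pi"
  proof -
    have "3 < 2 * real n" using n by linarith
    thus ?thesis using n by (simp add: divide_less_eq mult.commute)
  qed
  hence "Im u < 0" unfolding u_def using n by (auto intro!: sin_gt_zero)
  ultimately show ?thesis using that by blast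
qed

text \<open>Some derivative of positive order is nonzero at \<xi>, since otherwise f would be
  constant on the connected set; the least such order is n, and the remaining unit has a holomorphic
  n-th root near \<xi>.\<close>

lemma holomorphic_factor_power:
  assumes hol: "f holomorphic_on S" and S: "open S" "connected S" "\<xi> \<in> S" and nc: "\<not> f constant_on S"
  obtains g r n where "0 < r" "0 < n" "ball \<xi> r \<subseteq> S" "g holomorphic_on ball \<xi> r"
     "\<And>w. w \<in> ball \<xi> r \<Longrightarrow> f w - f \<xi> = ((w - \<xi>) * g w) ^ n" "\<And>w. w \<in> ball \<xi> r \<Longrightarrow> g w \<noteq> 0"
proof -
  have "\<exists>n. 0 < n \<and> (deriv ^^ n) f \<xi> \<noteq> 0"
  proof (rule ccontr)
    assume "\<nexists>n. 0 < n \<and> (deriv ^^ n) f \<xi> \<noteq> 0"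
    hence 0: "(deriv ^^ n) f \<xi> = 0" if "0 < n" for n using that by blast
    have "f w = f \<xi>" if "w \<in> S" for w
      by (rule holomorphic_fun_eq_const_on_connected[OF hol S(1,2) 0 S(3) that])
    with nc show False unfolding constant_on_def by blast
  qed
  define n where "n = (LEAST n. 0 < n \<and> (deriv ^^ n) f \<xi> \<noteq> 0)"
  have n: "0 < n" "(deriv ^^ n) f \<xi> \<noteq> 0"
    using LeastI_ex[OF \<open>\<exists>n. _\<close>] by (auto simp: n_def)
  have least: "(deriv ^^ i) f \<xi> = 0" if "0 < i" "i < n" for i
    using not_less_Least[of i "\<lambda>n. 0 < n \<and> (deriv ^^ n) f \<xi> \<noteq> 0"] that by (auto simp: n_def)
  obtain g r where gr: "0 < r" "g holomorphic_on ball \<xi> r"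
     "\<And>w. w \<in> ball \<xi> r \<Longrightarrow> f w - f \<xi> = ((w - \<xi>) * g w) ^ n" "\<And>w. w \<in> ball \<xi> r \<Longrightarrow> g w \<noteq> 0"
    by (rule holomorphic_factor_order_of_zero_strong[OF hol S(1,3) n least], assumption, assumption, (rule that; assumption))
  obtain r' where r': "r' > 0" "ball \<xi> r' \<subseteq> S" using S unfolding open_contains_ball by blast
  show ?thesis
    by (rule that[of "min r r'" n g]) (use n gr r' in \<open>auto intro: holomorphic_on_subset\<close>)
qed

text \<open>In the coordinate \<open>z0 exp (\<i> \<zeta>)\<close> the function \<open>(l - l z0) / \<i>\<close> is real on the real axis and an \<open>m\<close>-th power of a local coordinate.
  Unless \<open>m = 1\<close> with a positive derivative, some direction into the lower half-plane (the outside of the circle) is sent to \<open>\<i> e\<close>.\<close>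

lemma boundary_derivative_pos:
  assumes W: "open W" "connected W" and hol: "l holomorphic_on W" and z0: "z0 \<in> W" "norm z0 = 1"
    and circ: "\<And>z. z \<in> W \<Longrightarrow> norm z = 1 \<Longrightarrow> Re (l z) = 0"
    and nc: "\<not> l constant_on W"
    and excl: "\<And>z e. z \<in> W \<Longrightarrow> norm z > 1 \<Longrightarrow> e > 0 \<Longrightarrow> l z \<noteq> l z0 - of_real e"
  obtains r where "r > 0" "z0 * deriv l z0 = of_real r"
proof -
  define E where "E = (\<lambda>\<zeta>. z0 * exp (\<i> * \<zeta>))"
  define p where "p = (\<lambda>\<zeta>. (l (E \<zeta>) - l z0) / \<i>)"
  have E0: "E 0 = z0" by (simp add: E_def)
  have contE: "continuous_on UNIV E" unfolding E_def by (intro continuous_intros)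
  have "open (E -` W)" using contE W(1) by (simp add: continuous_on_open_vimage)
  moreover have "0 \<in> E -` W" using z0 E0 by simp
  ultimately obtain R where R: "R > 0" "ball 0 R \<subseteq> E -` W"
    unfolding open_contains_ball by blast
  have EW: "E \<zeta> \<in> W" if "\<zeta> \<in> ball 0 R" for \<zeta> using R that by auto
  have normE: "norm (E \<zeta>) = exp (- Im \<zeta>)" for \<zeta>
    using z0 by (simp add: E_def norm_mult norm_exp_eq_Re)
  have p_hol: "p holomorphic_on ball 0 R" unfolding p_def
    by (intro holomorphic_intros holomorphic_on_compose_gen[OF _ hol, unfolded o_def])
       (use EW in \<open>auto simp: E_def intro!: holomorphic_intros\<close>)
  have p_real: "p (of_real t) \<in> \<real>" if "\<bar>t\<bar> < R" for t
  proof -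
    have "Re (l (E (of_real t))) = 0" "Re (l z0) = 0"
      using circ[OF EW, of "of_real t"] circ[OF z0] normE that by auto
    thus ?thesis by (simp add: p_def complex_is_Real_iff Im_divide)
  qed
  have zR: "0 \<in> ball (0::complex) R" using R(1) by simp
  \<comment> \<open>If p were constant, l would be constant along arc points converging to z0 and
    hence on all of W.\<close>
  have ncp: "\<not> p constant_on ball 0 R"
  proof
    assume "p constant_on ball 0 R"
    hence p0: "p \<zeta> = 0" if "\<zeta> \<in> ball 0 R" for \<zeta>
      using that R(1) unfolding constant_on_def p_def by (metis E0 centre_in_ball diff_self div_0)
    define u where "u = (\<lambda>n. E (of_real (R / (real n + 2))))"
    have un: "of_real (R / (real n + 2)) \<in> ball (0::complex) R" for n
    proof -
      have "R * 1 < R * (real n + 2)" using R(1) by (intro mult_strict_left_mono) auto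
      hence "R / (real n + 2) < R" using R(1) by (simp add: divide_less_eq)
      moreover have "norm (complex_of_real (R / (real n + 2))) = R / (real n + 2)"
        unfolding norm_of_real using R(1) by simp
      ultimately show ?thesis unfolding mem_ball dist_0_norm by linarith
    qed
    have u_lim: "u \<longlonglongrightarrow> z0"
    proof -
      have "(\<lambda>n. R / (real n + 2)) \<longlonglongrightarrow> 0" by real_asymp
      hence "(\<lambda>n. complex_of_real (R / (real n + 2))) \<longlonglongrightarrow> 0"
        using tendsto_of_real_iff[where c = 0, of "\<lambda>n. R / (real n + 2)" sequentially, where 'a = complex] by simp
      hence "u \<longlonglongrightarrow> E 0" unfolding u_def E_def by (intro tendsto_intros)
      thus ?thesis by (simp add: E0)
    qed
    obtain e where e: "e > 0" "e < R" "e < 1" using R(1) by (metis field_lbound_gt_zero zero_less_one)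
    have une: "\<exists>N. \<forall>n\<ge>N. u n \<noteq> z0"
    proof -
      have "eventually (\<lambda>n. R / (real n + 2) < pi) sequentially" by real_asymp
      then obtain N where N: "\<And>n. n \<ge> N \<Longrightarrow> R / (real n + 2) < pi" unfolding eventually_sequentially by blast
      have "u n \<noteq> z0" if "n \<ge> N" for n
      proof
        assume "u n = z0"
        hence "exp (\<i> * of_real (R / (real n + 2))) = 1" using z0 by (auto simp: u_def E_def)
        hence "sin (R / (real n + 2)) = 0" by (simp add: complex_eq_iff Im_exp)
        moreover have "sin (R / (real n + 2)) > 0" using N[OF that] R(1) by (intro sin_gt_zero) auto
        ultimately show False by simp
      qed
      thus ?thesis by blast
    qed
    then obtain N where N: "\<And>n. n \<ge> N \<Longrightarrow> u n \<noteq> z0" by blast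
    have "z0 islimpt (range u - {z0})"
    proof -
      have "(\<lambda>n. u (n + N)) \<longlonglongrightarrow> z0" using u_lim by (rule LIMSEQ_ignore_initial_segment)
      thus ?thesis unfolding islimpt_sequential using N
        by (intro exI[of _ "\<lambda>n. u (n + N)"]) auto
    qed
    moreover have "(\<lambda>z. l z - l z0) holomorphic_on W" by (intro holomorphic_intros hol)
    moreover have "l z - l z0 = 0" if "z \<in> range u - {z0}" for z
      using that p0[OF un] by (auto simp: u_def p_def)
    moreover have "range u - {z0} \<subseteq> W" using EW[OF un] by (auto simp: u_def)
    ultimately have "l z - l z0 = 0" if "z \<in> W" for z
      using analytic_continuation[of "\<lambda>z. l z - l z0" W "range u - {z0}" z0 z] W z0 that by auto
    hence "l constant_on W" unfolding constant_on_def by (intro exI[of _ "l z0"]) auto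
    with nc show False by blast
  qed
  obtain g s n where gsn: "0 < s" "0 < n" "ball (0::complex) s \<subseteq> ball 0 R" "g holomorphic_on ball 0 s"
      "\<And>w. w \<in> ball 0 s \<Longrightarrow> p w - p 0 = ((w - 0) * g w) ^ n" and gsn6: "\<And>w. w \<in> ball 0 s \<Longrightarrow> g w \<noteq> 0"
    by (rule holomorphic_factor_power[OF p_hol open_ball connected_ball zR ncp], (rule that; assumption))
  have p00: "p 0 = 0" by (simp add: p_def E0)
  have pw: "p w = (w * g w) ^ n" if "w \<in> ball 0 s" for w using gsn(5)[OF that] p00 by simp
  have g_cont: "isCont g 0" using gsn(1,4)
    by (meson analytic_at analytic_at_imp_isCont centre_in_ball holomorphic_on_subset open_ball subset_refl)
  have g0: "g 0 \<noteq> 0" using gsn(1) by (intro gsn6) auto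
  \<comment> \<open>For small real t > 0 the quotient p(t) / t^n = g(t)^n is real, and the real line
    is closed.\<close>
  have c_real: "g 0 ^ n \<in> \<real>"
  proof (rule closed_sequentially[OF closed_complex_Reals, of "\<lambda>i. g (of_real (s / (real i + 2))) ^ n"])
    have un: "of_real (s / (real i + 2)) \<in> ball (0::complex) s" for i
    proof -
      have "s * 1 < s * (real i + 2)" using gsn(1) by (intro mult_strict_left_mono) auto
      hence "s / (real i + 2) < s" using gsn(1) by (simp add: divide_less_eq)
      moreover have "norm (complex_of_real (s / (real i + 2))) = s / (real i + 2)"
        unfolding norm_of_real using gsn(1) by simp
      ultimately show ?thesis unfolding mem_ball dist_0_norm by linarith
    qed
    show "g (of_real (s / (real i + 2))) ^ n \<in> \<real>" for i
    proof -
      let ?t = "s / (real i + 2)"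
      have "?t > 0" using gsn(1) by simp
      have "of_real ?t \<in> ball (0::complex) R" using un[of i] gsn(3) by blast
      hence "\<bar>?t\<bar> < R" unfolding mem_ball dist_0_norm norm_of_real .
      hence "p (of_real ?t) \<in> \<real>" by (rule p_real)
      moreover have "p (of_real ?t) = of_real ?t ^ n * g (of_real ?t) ^ n"
        unfolding pw[OF un[of i]] by (rule power_mult_distrib)
      ultimately have "p (of_real ?t) / of_real ?t ^ n \<in> \<real>" by (intro Reals_divide Reals_power) auto
      moreover have tn: "(of_real ?t :: complex) ^ n \<noteq> 0" using \<open>?t > 0\<close>
        by (metis of_real_eq_0_iff power_not_zero less_irrefl)
      have "p (of_real ?t) / of_real ?t ^ n = g (of_real ?t) ^ n"
        unfolding \<open>p (of_real ?t) = _\<close> by (rule nonzero_mult_div_cancel_left[OF tn])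
      ultimately show "g (of_real ?t) ^ n \<in> \<real>" by simp
    qed
    have "(\<lambda>i. s / (real i + 2)) \<longlonglongrightarrow> 0" by real_asymp
    hence "(\<lambda>i. complex_of_real (s / (real i + 2))) \<longlonglongrightarrow> 0"
      using tendsto_of_real_iff[where c = 0, of "\<lambda>i. s / (real i + 2)" sequentially, where 'a = complex] by simp
    from isCont_tendsto_compose[OF g_cont this]
    show "(\<lambda>i. g (of_real (s / (real i + 2))) ^ n) \<longlonglongrightarrow> g 0 ^ n" by (intro tendsto_power)
  qed
  then obtain c where c: "g 0 ^ n = of_real c" by (auto elim: Reals_cases)
  have c0: "c \<noteq> 0" using g0 c by auto
  have "n = 1 \<and> c > 0"
  proof (rule ccontr)
    assume "\<not> (n = 1 \<and> c > 0)"
    hence "n \<ge> 2 \<or> c < 0" using gsn(2) c0 by linarith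
    then obtain u where u: "Im u < 0" "of_real c * u ^ n = \<i> * of_real \<bar>c\<bar>"
      using nonzero_power_direction[of n c] gsn(2) c0 by auto
    have u0: "u \<noteq> 0" using u by auto
    \<comment> \<open>The margin that keeps w in the lower half-plane although g w differs from g 0:
      if |g 0 / g w - 1| < k, the imaginary part of u changes by less than |u| k = - Im u.\<close>
    define k where "k = - Im u / norm u"
    have k: "k > 0" using u u0 by (simp add: k_def divide_neg_pos)
    have "isCont (\<lambda>w. g 0 / g w) 0" by (intro continuous_intros g_cont) (use g0 in auto)
    hence "\<exists>d>0. \<forall>w. dist w 0 < d \<longrightarrow> dist (g 0 / g w) (g 0 / g 0) < k"
      using k unfolding continuous_at_eps_delta by blast
    then obtain d where d: "d > 0" "\<And>w. norm w < d \<Longrightarrow> norm (g 0 / g w - 1) < k"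
      using g0 by (auto simp: dist_norm)
    define m where "m = min d s"
    have m: "m > 0" "m \<le> s" "m \<le> d" using d gsn by (auto simp: m_def)
    let ?\<sigma> = "\<lambda>w. w * g w"
    have \<sigma>_hol: "?\<sigma> holomorphic_on ball 0 m"
      by (intro holomorphic_intros holomorphic_on_subset[OF gsn(4)]) (use m in auto)
    have "open (?\<sigma> ` ball 0 m)"
    proof (rule open_mapping_thm[OF \<sigma>_hol])
      show "\<not> ?\<sigma> constant_on ball 0 m"
      proof
        assume "?\<sigma> constant_on ball 0 m"
        moreover have "of_real (m / 2) \<in> ball (0::complex) m" "(0::complex) \<in> ball 0 m" using m by auto
        ultimately have "?\<sigma> (of_real (m / 2)) = ?\<sigma> 0" unfolding constant_on_def by metis
        moreover have "g (of_real (m / 2)) \<noteq> 0" using gsn6[of "of_real (m/2)"] m by auto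
        ultimately show False using m by auto
      qed
    qed auto
    moreover have "0 \<in> ?\<sigma> ` ball 0 m" using m by (auto intro!: image_eqI[of _ _ 0])
    ultimately obtain e where e: "e > 0" "ball 0 e \<subseteq> ?\<sigma> ` ball 0 m"
      unfolding open_contains_ball by blast
    \<comment> \<open>Small enough for r g(0) u to lie in the image of w -> w g(w); then p w = r^n c
      u^n is i times a positive number.\<close>
    define r where "r = e / (2 * norm (g 0 * u))"
    have gu: "norm (g 0 * u) > 0" using g0 u0 by simp
    have r: "r > 0" using e gu by (simp add: r_def)
    have "norm (of_real r * (g 0 * u)) = \<bar>r\<bar> * norm (g 0 * u)" by (simp only: norm_mult norm_of_real)
    also have "\<dots> = e / 2" using e gu by (simp add: r_def)
    finally have "norm (of_real r * (g 0 * u)) = e / 2" .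
    hence "of_real r * (g 0 * u) \<in> ball 0 e" using e by simp
    with e obtain w where w: "w \<in> ball 0 m" "w * g w = of_real r * (g 0 * u)" by (metis (no_types, lifting) imageE subsetD)
    have gw: "g w \<noteq> 0" using gsn6[of w] w m by auto
    have weq: "w = of_real r * (u * (g 0 / g w))" using w(2) gw by (simp add: field_simps)
    have "Im (u * (g 0 / g w)) = Im u + Im (u * (g 0 / g w - 1))" by (simp add: algebra_simps)
    also have "Im (u * (g 0 / g w - 1)) \<le> norm (u * (g 0 / g w - 1))" using abs_Im_le_cmod[of "u * (g 0 / g w - 1)"] by linarith
    also have "\<dots> < norm u * k" using d(2)[of w] w m u0 by (simp add: norm_mult)
    also have "norm u * k = - Im u" using u0 by (simp add: k_def)
    finally have "Im (u * (g 0 / g w)) < 0" by simp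
    moreover have "Im w = r * Im (u * (g 0 / g w))"
    proof -
      have "Im (of_real r * X) = r * Im X" for X :: complex by simp
      thus ?thesis by (subst weq)
    qed
    ultimately have Imw: "Im w < 0" using r by (simp only: mult_pos_neg)
    have ws: "w \<in> ball 0 s" using w m by auto
    have "p w = of_real r ^ n * (of_real c * u ^ n)"
      unfolding pw[OF ws] w(2) c[symmetric] by (simp add: power_mult_distrib)
    hence pwe: "p w = \<i> * of_real (r ^ n * \<bar>c\<bar>)" by (simp add: u(2))
    have "l (E w) = l z0 + \<i> * p w" by (simp add: p_def)
    hence "l (E w) = l z0 - of_real (r ^ n * \<bar>c\<bar>)" by (simp add: pwe)
    moreover have "E w \<in> W" using EW ws gsn(3) by blast
    moreover have "norm (E w) > 1" using Imw by (simp add: normE)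
    moreover have "r ^ n * \<bar>c\<bar> > 0" using r c0 by simp
    ultimately show False using excl by blast
  qed
  hence n1: "n = 1" and cpos: "c > 0" by auto
  have "(p has_field_derivative (1 * g 0 + deriv g 0 * 0)) (at 0)"
  proof (rule has_field_derivative_transform_within_open[of "\<lambda>w. w * g w" _ _ "ball 0 s"])
    have "(g has_field_derivative deriv g 0) (at 0)"
      using gsn(1,4) by (intro holomorphic_derivI[of g "ball 0 s"]) auto
    thus "((\<lambda>w. w * g w) has_field_derivative (1 * g 0 + deriv g 0 * 0)) (at 0)"
      by (auto intro!: derivative_eq_intros)
  qed (use gsn pw n1 in auto)
  moreover have "(p has_field_derivative (deriv l z0 * (z0 * \<i>)) / \<i>) (at 0)"
  proof -
    have "(E has_field_derivative z0 * \<i>) (at 0)" unfolding E_def by (auto intro!: derivative_eq_intros)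
    moreover have "(l has_field_derivative deriv l z0) (at (E 0))"
      unfolding E0 by (rule holomorphic_derivI[OF hol W(1) z0(1)])
    ultimately have "((\<lambda>w. l (E w)) has_field_derivative deriv l z0 * (z0 * \<i>)) (at 0)"
      by (rule DERIV_chain2[rotated])
    hence "((\<lambda>w. (l (E w) - l z0) / \<i>) has_field_derivative (deriv l z0 * (z0 * \<i>) - 0) / \<i>) (at 0)"
      by (intro DERIV_cdivide DERIV_diff DERIV_const)
    thus ?thesis unfolding p_def by (simp only: diff_zero)
  qed
  ultimately have "1 * g 0 + deriv g 0 * 0 = deriv l z0 * (z0 * \<i>) / \<i>" by (rule DERIV_unique)
  moreover have "a * (b * \<i>) / \<i> = b * a" for a b :: complex by (simp add: field_simps)
  ultimately have "z0 * deriv l z0 = of_real c" using c n1 by simp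
  thus ?thesis using that cpos by blast
qed

text \<open>The interface between topology and estimates. \<open>lim\<close> is a properness
  condition: solutions for convergent t accumulate inside W. \<open>not_all_neg\<close> supplies a
  single negative t without solutions, from which emptiness spreads to all negative t.\<close>

locale arc_sheet =
  fixes W :: "complex set" and l :: "complex \<Rightarrow> complex" and c :: real
  assumes open_W: "open W" and conn_W: "connected W" and hol: "l holomorphic_on W"
    and nonconst: "\<not> l constant_on W"
    and circ: "\<And>z. z \<in> W \<Longrightarrow> norm z = 1 \<Longrightarrow> Re (l z) = 0"
    and lim: "\<And>z t t0. (\<And>n. z n \<in> W \<and> 1 \<le> norm (z n) \<and> l (z n) = Complex (t n) c) \<Longrightarrow>
                 t \<longlonglongrightarrow> t0 \<Longrightarrow> \<exists>x r. strict_mono (r :: nat \<Rightarrow> nat) \<and> (z \<circ> r) \<longlonglongrightarrow> x \<and> x \<in> W"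
    and not_all_neg: "\<exists>t<0. \<forall>z\<in>W. 1 \<le> norm z \<longrightarrow> l z \<noteq> Complex t c"
begin

definition lev :: "real \<Rightarrow> complex set" where
  "lev t = {z\<in>W. 1 \<le> norm z \<and> l z = Complex t c}"

lemma cont_l: "x \<in> W \<Longrightarrow> isCont l x"
  using holomorphic_on_imp_continuous_on[OF hol] continuous_on_eq_continuous_at[OF open_W] by blast

lemma lev_lim:
  assumes "\<And>n. z n \<in> lev (t n)" "t \<longlonglongrightarrow> t0"
  obtains x r where "strict_mono (r :: nat \<Rightarrow> nat)" "(z \<circ> r) \<longlonglongrightarrow> x" "x \<in> lev t0"
proof -
  obtain x r where xr: "strict_mono (r :: nat \<Rightarrow> nat)" "(z \<circ> r) \<longlonglongrightarrow> x" "x \<in> W"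
    using lim[of z t t0] assms by (auto simp: lev_def)
  have "(\<lambda>n. norm ((z \<circ> r) n)) \<longlonglongrightarrow> norm x" by (intro tendsto_norm xr)
  hence "1 \<le> norm x" by (rule LIMSEQ_le_const) (use assms in \<open>auto simp: lev_def\<close>)
  moreover have "l x = Complex t0 c"
  proof (rule LIMSEQ_unique)
    show "(\<lambda>n. l ((z \<circ> r) n)) \<longlonglongrightarrow> l x" by (rule isCont_tendsto_compose[OF cont_l xr(2)]) fact
    have "(\<lambda>n. Complex (t (r n)) c) \<longlonglongrightarrow> Complex t0 c"
      using LIMSEQ_subseq_LIMSEQ[OF assms(2) xr(1)] by (intro tendsto_Complex) (auto simp: o_def)
    thus "(\<lambda>n. l ((z \<circ> r) n)) \<longlonglongrightarrow> Complex t0 c" using assms(1) by (simp add: lev_def)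
  qed
  ultimately show ?thesis using that xr by (auto simp: lev_def)
qed

text \<open>Open mapping theorem. Strictly outside the circle a whole neighbourhood of z is
  admissible, so all values near l z are attained there.\<close>

lemma lev_open:
  assumes z: "z \<in> lev t" "norm z > 1" and U: "open U" "z \<in> U"
  obtains e where "e > 0" "\<And>t'. \<bar>t' - t\<bar> < e \<Longrightarrow> \<exists>z'\<in>U. z' \<in> lev t'"
proof -
  let ?V = "U \<inter> W \<inter> (- cball 0 1)"
  have "open (l ` ?V)"
    by (rule open_mapping_thm[OF hol open_W conn_W _ _ nonconst]) (use U open_W in auto)
  moreover have "Complex t c \<in> l ` ?V" using z U by (intro image_eqI[of _ _ z]) (auto simp: lev_def)
  ultimately obtain e where e: "e > 0" "ball (Complex t c) e \<subseteq> l ` ?V"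
    unfolding open_contains_ball by blast
  show ?thesis
  proof (rule that[OF e(1)])
    fix t' :: real assume t': "\<bar>t' - t\<bar> < e"
    have "dist (Complex t c) (Complex t' c) = \<bar>t - t'\<bar>" by (simp add: dist_norm cmod_def)
    hence "dist (Complex t c) (Complex t' c) < e" using t' by linarith
    hence "Complex t' c \<in> l ` ?V" using e(2) by auto
    then obtain w where "w \<in> ?V" "l w = Complex t' c" by auto
    thus "\<exists>z'\<in>U. z' \<in> lev t'" by (auto simp: lev_def)
  qed
qed

lemma norm_gt_1: "z \<in> lev t \<Longrightarrow> t \<noteq> 0 \<Longrightarrow> norm z > 1"
proof -
  assume z: "z \<in> lev t" "t \<noteq> 0"
  have "norm z \<noteq> 1"
  proof
    assume "norm z = 1"
    hence "Re (l z) = 0" using circ[of z] z(1) by (simp add: lev_def)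
    thus False using z by (simp add: lev_def)
  qed
  moreover have "1 \<le> norm z" using z(1) by (simp add: lev_def)
  ultimately show "norm z > 1" by linarith
qed

text \<open>Non-emptiness is open in t by \<open>lev_open\<close>, which applies because t \<noteq>
  0 keeps the points off the circle, and closed by \<open>lev_lim\<close>.\<close>

lemma lev_nonempty_propagate:
  assumes I: "connected I" "0 \<notin> I" and t0: "t0 \<in> I" "lev t0 \<noteq> {}" and t: "t \<in> I"
  shows "lev t \<noteq> {}"
proof (rule interval_clopen_induct[where P = "\<lambda>t. lev t \<noteq> {}", OF I(1) t0 t])
  fix s assume s: "s \<in> I" "lev s \<noteq> {}"
  then obtain z where z: "z \<in> lev s" by blast
  have "norm z > 1" using norm_gt_1[OF z] s I by auto
  from lev_open[OF z this open_UNIV]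
  show "\<exists>e>0. \<forall>s'\<in>I. \<bar>s' - s\<bar> < e \<longrightarrow> lev s' \<noteq> {}" by (metis UNIV_I empty_iff)
next
  fix u s assume s: "s \<in> I" and u: "\<And>n. u n \<in> I \<and> lev (u n) \<noteq> {}" "u \<longlonglongrightarrow> s"
  hence "\<forall>n. \<exists>z. z \<in> lev (u n)" by blast
  then obtain z where "\<And>n. z n \<in> lev (u n)" by metis
  from lev_lim[OF this u(2)] show "lev s \<noteq> {}" by blast
qed

lemma lev_neg: "t < 0 \<Longrightarrow> lev t = {}"
proof (rule ccontr)
  assume t: "t < 0" "lev t \<noteq> {}"
  obtain t' where t': "t' < 0" "lev t' = {}" using not_all_neg by (auto simp: lev_def)
  have "lev t' \<noteq> {}" by (rule lev_nonempty_propagate[of "{..<0}" t]) (use t t' in auto)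
  with t' show False by blast
qed

text \<open>A point of level 0 off the circle would persist to small negative t, where the levels
  are empty.\<close>

lemma lev_0_norm:
  assumes z: "z \<in> lev 0"
  shows "norm z = 1"
proof (rule ccontr)
  assume "norm z \<noteq> 1"
  hence "norm z > 1" using z by (auto simp: lev_def)
  from lev_open[OF z this open_UNIV] obtain e where "e > 0" "\<And>t'. \<bar>t' - 0\<bar> < e \<Longrightarrow> lev t' \<noteq> {}"
    by (metis UNIV_I empty_iff)
  from this(2)[of "- e / 2"] this(1) lev_neg[of "- e / 2"] show False by auto
qed

lemma lev_0_deriv:
  assumes z: "z \<in> lev 0"
  obtains r where "r > 0" "z * deriv l z = of_real r"
proof (rule boundary_derivative_pos[OF open_W conn_W hol _ lev_0_norm[OF z] circ nonconst])
  show "z \<in> W" using z by (simp add: lev_def)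
  fix w e :: "_" assume w: "w \<in> W" "norm w > 1" "(e::real) > 0"
  show "l w \<noteq> l z - of_real e"
  proof
    assume "l w = l z - of_real e"
    hence "w \<in> lev (- e)" using z w by (auto simp: lev_def complex_eq_iff)
    with lev_neg[of "- e"] w show False by auto
  qed
qed (use that in auto)

text \<open>Otherwise the levels 1 / (n + 1) would all be nonempty and their points would accumulate
  in level 0.\<close>

lemma lev_pos_empty:
  assumes "lev 0 = {}" "t > 0"
  shows "lev t = {}"
proof (rule ccontr)
  assume ne: "lev t \<noteq> {}"
  have "lev (inverse (real (Suc n))) \<noteq> {}" for n
    by (rule lev_nonempty_propagate[of "{0<..}" t]) (use ne assms in auto)
  hence "\<forall>n. \<exists>z. z \<in> lev (inverse (real (Suc n)))" by blast
  then obtain z where "\<And>n. z n \<in> lev (inverse (real (Suc n)))" by metis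
  from lev_lim[OF this LIMSEQ_inverse_real_of_nat] assms(1) show False by blast
qed

text \<open>Since z0 l'(z0) > 0, increasing Re l moves a point outwards to first order. With the
  difference quotient g of l at z0, a preimage of e/2 + i c has the form w = z0 (1 + (e/2) / (z0 g
  w)), and the added term has positive real part.\<close>

lemma lev_pos_nonempty:
  assumes z0: "z0 \<in> lev 0" and t: "t > 0"
  shows "lev t \<noteq> {}"
proof -
  obtain r where r: "r > 0" "z0 * deriv l z0 = of_real r" by (rule lev_0_deriv[OF z0])
  have z0W: "z0 \<in> W" and lz0: "l z0 = Complex 0 c" using z0 by (auto simp: lev_def)
  have z0n: "norm z0 = 1" by (rule lev_0_norm[OF z0])
  have "(l has_field_derivative deriv l z0) (at z0)" by (rule holomorphic_derivI[OF hol open_W z0W])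
  then obtain g where g: "\<And>z. l z - l z0 = g z * (z - z0)" "isCont g z0" "g z0 = deriv l z0"
    unfolding DERIV_caratheodory_within by (auto simp: DERIV_caratheodory_within)
  have gz0: "z0 * g z0 = of_real r" using r g by simp
  have "isCont (\<lambda>z. Re (inverse (z0 * g z))) z0"
    unfolding isCont_def by (intro tendsto_intros g(2)[unfolded isCont_def]) (use gz0 r in auto)
  moreover have "Re (inverse (z0 * g z0)) > 0" using gz0 r by simp
  ultimately have "eventually (\<lambda>z. Re (inverse (z0 * g z)) > 0) (nhds z0)"
    unfolding isCont_def eventually_nhds_conv_at using order_tendstoD(1) by blast
  then obtain d where d: "d > 0" "\<And>z. dist z z0 < d \<Longrightarrow> Re (inverse (z0 * g z)) > 0"
    unfolding eventually_nhds_metric by blast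
  have "open (l ` (ball z0 d \<inter> W))"
    by (rule open_mapping_thm[OF hol open_W conn_W _ _ nonconst]) (use open_W in auto)
  moreover have "Complex 0 c \<in> l ` (ball z0 d \<inter> W)" using z0W lz0 d by (auto intro!: image_eqI[of _ _ z0])
  ultimately obtain e where e: "e > 0" "ball (Complex 0 c) e \<subseteq> l ` (ball z0 d \<inter> W)"
    unfolding open_contains_ball by blast
  have "dist (Complex 0 c) (Complex (e / 2) c) < e" using e(1) by (simp add: dist_norm cmod_def)
  hence "Complex (e / 2) c \<in> l ` (ball z0 d \<inter> W)" using e(2) by auto
  then obtain w where w: "w \<in> ball z0 d" "w \<in> W" "l w = Complex (e / 2) c" by auto
  have pos: "Re (inverse (z0 * g w)) > 0" using d(2)[of w] w by (simp add: dist_commute)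
  hence nz: "z0 * g w \<noteq> 0" by auto
  have "g w * (w - z0) = of_real (e / 2)" using g(1)[of w] w lz0 by (simp add: complex_eq_iff)
  hence "w = z0 + of_real (e / 2) / g w" using nz by (auto simp: field_simps)
  moreover have "z0 * (1 + x * inverse (z0 * g w)) = z0 + x / g w" for x
    using nz by (simp add: field_simps)
  ultimately have "w = z0 * (1 + of_real (e / 2) * inverse (z0 * g w))" by (simp only:)
  hence "norm w = norm (1 + of_real (e / 2) * inverse (z0 * g w))" using z0n by (metis mult.left_neutral norm_mult)
  also have "\<dots> \<ge> Re (1 + of_real (e / 2) * inverse (z0 * g w))" by (rule complex_Re_le_cmod)
  also have "Re (1 + of_real (e / 2) * inverse (z0 * g w)) = 1 + e / 2 * Re (inverse (z0 * g w))"
    by (simp del: inverse_mult_distrib)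
  finally have "1 \<le> norm w" using pos e(1) by (smt (verit) mult_pos_pos half_gt_zero)
  hence "w \<in> lev (e / 2)" using w by (simp add: lev_def)
  thus ?thesis using lev_nonempty_propagate[of "{0<..}" "e / 2" t] e t by auto
qed

text \<open>One point of the level at which the derivative vanishes counts as two.\<close>

definition multiple_level :: "real \<Rightarrow> bool" where
  "multiple_level t \<longleftrightarrow> (\<exists>z\<in>lev t. \<exists>w\<in>lev t. z \<noteq> w \<or> deriv l z = 0)"

text \<open>Let x and y be limits of the two points. If x = y and l'(x) \<noteq> 0, then l is
  injective near x and its derivative does not vanish there, which contradicts multiplicity nearby;
  in every other case x and y show multiplicity at s.\<close>

lemma multiple_level_lim:
  assumes u: "\<And>n. multiple_level (u n)" "u \<longlonglongrightarrow> s"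
  shows "multiple_level s"
proof -
  have "\<forall>n. \<exists>p. fst p \<in> lev (u n) \<and> snd p \<in> lev (u n) \<and> (fst p \<noteq> snd p \<or> deriv l (fst p) = 0)"
    using u(1) unfolding multiple_level_def by (metis fst_conv snd_conv)
  then obtain p where p: "\<And>n. fst (p n) \<in> lev (u n)" "\<And>n. snd (p n) \<in> lev (u n)"
      "\<And>n. fst (p n) \<noteq> snd (p n) \<or> deriv l (fst (p n)) = 0" by metis
  obtain x r where x: "strict_mono r" "((\<lambda>n. fst (p n)) \<circ> r) \<longlonglongrightarrow> x" "x \<in> lev s"
    using lev_lim[OF p(1) u(2)] by blast
  have "(\<lambda>n. u (r n)) \<longlonglongrightarrow> s" using LIMSEQ_subseq_LIMSEQ[OF u(2) x(1)] by (simp add: o_def)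
  from lev_lim[of "\<lambda>n. snd (p (r n))", OF p(2) this]
  obtain y r' where y: "strict_mono r'" "((\<lambda>n. snd (p (r n))) \<circ> r') \<longlonglongrightarrow> y" "y \<in> lev s" by blast
  have x': "(\<lambda>n. fst (p (r (r' n)))) \<longlonglongrightarrow> x"
    using LIMSEQ_subseq_LIMSEQ[OF x(2) y(1)] by (simp add: o_def)
  have y': "(\<lambda>n. snd (p (r (r' n)))) \<longlonglongrightarrow> y" using y(2) by (simp add: o_def)
  show ?thesis
  proof (cases "x = y \<and> deriv l x \<noteq> 0")
    case False
    thus ?thesis using x y unfolding multiple_level_def by blast
  next
    case True
    have xW: "x \<in> W" using x by (simp add: lev_def)
    obtain d where d: "d > 0" "ball x d \<subseteq> W" "inj_on l (ball x d)"
      using has_complex_derivative_locally_injective[OF hol xW open_W] True by blast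
    have "continuous_on W (deriv l)" by (intro holomorphic_on_imp_continuous_on holomorphic_deriv hol open_W)
    hence "isCont (deriv l) x" using xW open_W by (simp add: continuous_on_eq_continuous_at)
    hence "(\<lambda>n. deriv l (fst (p (r (r' n))))) \<longlonglongrightarrow> deriv l x" by (rule isCont_tendsto_compose[OF _ x'])
    hence 1: "eventually (\<lambda>n. deriv l (fst (p (r (r' n)))) \<noteq> 0) sequentially"
      using True by (intro tendsto_imp_eventually_ne) auto
    have 2: "eventually (\<lambda>n. fst (p (r (r' n))) \<in> ball x d) sequentially"
      using x' d(1) by (intro topological_tendstoD) auto
    have 3: "eventually (\<lambda>n. snd (p (r (r' n))) \<in> ball x d) sequentially"
      using y' True d(1) by (intro topological_tendstoD) auto
    have "eventually (\<lambda>n. False) sequentially" using 1 2 3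
    proof eventually_elim
      case (elim n)
      hence "fst (p (r (r' n))) \<noteq> snd (p (r (r' n)))" using p(3) by blast
      moreover have "l (fst (p (r (r' n)))) = l (snd (p (r (r' n))))" using p(1,2) by (simp add: lev_def)
      ultimately show False using d(3) elim by (auto dest: inj_onD)
    qed
    thus ?thesis by simp
  qed
qed

text \<open>Two distinct points persist in disjoint neighbourhoods. At a double point l - l z is the
  n-th power of a local coordinate with n >= 2, so for t near s, t \<noteq> s, different n-th roots
  of t - s give different points.\<close>

lemma multiple_level_open:
  assumes s: "s > 0" "multiple_level s"
  obtains e where "e > 0" "\<And>t. t > 0 \<Longrightarrow> \<bar>t - s\<bar> < e \<Longrightarrow> multiple_level t"
proof -
  obtain z w where zw: "z \<in> lev s" "w \<in> lev s" "z \<noteq> w \<or> deriv l z = 0" using s unfolding multiple_level_def by blast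
  have nz: "norm z > 1" "norm w > 1" using norm_gt_1 zw s by auto
  show ?thesis
  proof (cases "z = w")
    case False
    then obtain U V where UV: "open U" "open V" "z \<in> U" "w \<in> V" "U \<inter> V = {}" by (metis hausdorff)
    obtain e1 where e1: "e1 > 0" "\<And>t'. \<bar>t' - s\<bar> < e1 \<Longrightarrow> \<exists>z'\<in>U. z' \<in> lev t'"
      using lev_open[OF zw(1) nz(1) UV(1,3)] by blast
    obtain e2 where e2: "e2 > 0" "\<And>t'. \<bar>t' - s\<bar> < e2 \<Longrightarrow> \<exists>z'\<in>V. z' \<in> lev t'"
      using lev_open[OF zw(2) nz(2) UV(2,4)] by blast
    show ?thesis
    proof (rule that[of "min e1 e2"])
      fix t assume "\<bar>t - s\<bar> < min e1 e2"
      then obtain z' w' where "z' \<in> U" "z' \<in> lev t" "w' \<in> V" "w' \<in> lev t"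
        using e1(2)[of t] e2(2)[of t] by auto
      moreover from this UV(5) have "z' \<noteq> w'" by blast
      ultimately show "multiple_level t" unfolding multiple_level_def by blast
    qed (use e1 e2 in auto)
  next
    case True
    with zw have dz: "deriv l z = 0" by blast
    have zW: "z \<in> W" using zw by (simp add: lev_def)
    obtain g r n where gr: "0 < r" "0 < n" "ball z r \<subseteq> W" "g holomorphic_on ball z r"
     "\<And>w. w \<in> ball z r \<Longrightarrow> l w - l z = ((w - z) * g w) ^ n" "\<And>w. w \<in> ball z r \<Longrightarrow> g w \<noteq> 0"
      by (rule holomorphic_factor_power[OF hol open_W conn_W zW nonconst], (rule that; assumption))
    have n2: "n \<ge> 2"
    proof (rule ccontr)
      assume "\<not> n \<ge> 2"
      hence n1: "n = 1" using gr(2) by linarith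
      have "((\<lambda>w. l z + (w - z) * g w) has_field_derivative g z) (at z)"
      proof -
        have "(g has_field_derivative deriv g z) (at z)"
          using gr(1,4) by (intro holomorphic_derivI[of g "ball z r"]) auto
        thus ?thesis by (auto intro!: derivative_eq_intros)
      qed
      hence "(l has_field_derivative g z) (at z)"
        by (rule has_field_derivative_transform_within_open[of _ _ _ "ball z r"])
           (use gr n1 in \<open>auto simp: algebra_simps\<close>)
      with dz gr(6)[of z] gr(1) show False by (simp add: DERIV_imp_deriv)
    qed
    define r' where "r' = min r (norm z - 1)"
    have r': "r' > 0" "r' \<le> r" using gr nz by (auto simp: r'_def)
    let ?\<sigma> = "\<lambda>w. (w - z) * g w"
    have \<sigma>_hol: "?\<sigma> holomorphic_on ball z r'"
      by (intro holomorphic_intros holomorphic_on_subset[OF gr(4)]) (use r' in auto)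
    have "open (?\<sigma> ` ball z r')"
    proof (rule open_mapping_thm[OF \<sigma>_hol])
      show "\<not> ?\<sigma> constant_on ball z r'"
      proof
        assume "?\<sigma> constant_on ball z r'"
        moreover have *: "z + of_real (r' / 2) \<in> ball z r'" "z \<in> ball z r'" using r' by (auto simp: dist_norm)
        ultimately have "?\<sigma> (z + of_real (r' / 2)) = ?\<sigma> z" unfolding constant_on_def by metis
        moreover have "g (z + of_real (r' / 2)) \<noteq> 0" using * r' by (intro gr(6)) auto
        ultimately show False using r' by auto
      qed
    qed auto
    moreover have "0 \<in> ?\<sigma> ` ball z r'" using r' by (auto intro!: image_eqI[of _ _ z])
    ultimately obtain e where e: "e > 0" "ball 0 e \<subseteq> ?\<sigma> ` ball z r'"
      unfolding open_contains_ball by blast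
    show ?thesis
    proof (rule that[of "e ^ n"])
      fix t assume t: "\<bar>t - s\<bar> < e ^ n"
      show "multiple_level t"
      proof (cases "t = s")
        case False
        define \<eta> where "\<eta> = exp (Ln (of_real (t - s)) / of_nat n)"
        have \<eta>: "\<eta> ^ n = of_real (t - s)"
          using gr(2) False by (simp add: \<eta>_def exp_of_nat_mult[symmetric] del: of_real_diff)
        have \<eta>0: "\<eta> \<noteq> 0" by (simp add: \<eta>_def)
        define \<eta>' where "\<eta>' = \<eta> * cis (2 * pi / n)"
        have "cis (2 * pi / n) ^ n = cis (real n * (2 * pi / n))" by (rule Complex.DeMoivre)
        also have "real n * (2 * pi / n) = 2 * pi" using gr(2) by simp
        also have "cis (2 * pi) = 1" by (simp add: complex_eq_iff)
        finally have \<eta>': "\<eta>' ^ n = of_real (t - s)" by (simp add: \<eta>'_def power_mult_distrib \<eta>)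
        have "norm \<eta> ^ n < e ^ n" using arg_cong[OF \<eta>, of norm] t
          by (simp add: norm_power del: of_real_diff)
        hence \<eta>e: "norm \<eta> < e" by (rule power_less_imp_less_base) (use e in simp)
        have \<eta>e': "norm \<eta>' < e" using \<eta>e by (simp add: \<eta>'_def norm_mult)
        have ne: "\<eta> \<noteq> \<eta>'"
        proof
          assume "\<eta> = \<eta>'"
          hence "cis (2 * pi / n) = 1" using \<eta>0 by (simp add: \<eta>'_def)
          hence c1: "cos (2 * pi / n) = 1" by (simp add: complex_eq_iff)
          have "cos (2 * pi / n) < cos 0"
            using n2 by (intro cos_monotone_0_pi) (auto simp: field_simps)
          with c1 show False by simp
        qed
        obtain x where x: "x \<in> ball z r'" "(x - z) * g x = \<eta>"
          using e(2) \<eta>e by (metis (no_types, lifting) imageE subsetD mem_ball_0)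
        obtain y where y: "y \<in> ball z r'" "(y - z) * g y = \<eta>'"
          using e(2) \<eta>e' by (metis (no_types, lifting) imageE subsetD mem_ball_0)
        have lev: "v \<in> lev t" if "v \<in> ball z r'" "((v - z) * g v) ^ n = of_real (t - s)" for v
        proof -
          have "v \<in> ball z r" using that r' by auto
          from gr(5)[OF this] that(2) have "l v = l z + of_real (t - s)" by (simp add: algebra_simps)
          hence "l v = Complex t c" using zw by (simp add: lev_def complex_eq_iff)
          moreover have "norm z \<le> norm v + norm (z - v)" by (metis add.commute diff_add_cancel norm_triangle_ineq)
          hence "norm v \<ge> 1" using that(1) by (auto simp: r'_def dist_norm)
          ultimately show ?thesis using \<open>v \<in> ball z r\<close> gr(3) by (auto simp: lev_def)
        qed
        have "x \<in> lev t" "y \<in> lev t" using lev x y \<eta> \<eta>' by auto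
        moreover have "x \<noteq> y" using x y ne by auto
        ultimately show ?thesis unfolding multiple_level_def by blast
      qed (use s in auto)
    qed (use e in auto)
  qed
qed

text \<open>Multiplicity at one t > 0 spreads to all t > 0 and, in the limit, to t = 0. There z0 is
  the only point and l'(z0) \<noteq> 0.\<close>

lemma lev_pos_singleton:
  assumes z0: "lev 0 = {z0}" and t: "t > 0"
  obtains z where "lev t = {z}"
proof -
  have "\<not> multiple_level t"
  proof
    assume t': "multiple_level t"
    have *: "multiple_level s" if "s > 0" for s
    proof (rule interval_clopen_induct[of "{0<..}" t multiple_level])
      fix s assume "s \<in> {0<..}" "multiple_level s"
      then obtain e where "e > 0" "\<And>t. t > 0 \<Longrightarrow> \<bar>t - s\<bar> < e \<Longrightarrow> multiple_level t" using multiple_level_open[of s] by auto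
      thus "\<exists>e>0. \<forall>s'\<in>{0<..}. \<bar>s' - s\<bar> < e \<longrightarrow> multiple_level s'" by auto
    qed (use t t' that multiple_level_lim in auto)
    have "multiple_level 0" by (rule multiple_level_lim[OF _ LIMSEQ_inverse_real_of_nat]) (rule *, simp)
    hence "deriv l z0 = 0" using z0 by (auto simp: multiple_level_def)
    moreover obtain r where "r > 0" "z0 * deriv l z0 = of_real r" by (rule lev_0_deriv[of z0]) (use z0 in auto)
    ultimately show False by simp
  qed
  moreover obtain z where "z \<in> lev t" using lev_pos_nonempty[of z0 t] z0 t by blast
  ultimately show ?thesis using that unfolding multiple_level_def by blast
qed

end

section \<open>Behaviour at the boundary of the fundamental domain\<close>

lemma eis_A_pos:
  assumes z: "z \<in> half_strip" and k: "even k" "k \<ge> 4" and nz: "z \<noteq> corner \<or> k mod 6 \<noteq> 2"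
  shows "Re (eis_A k z) > 0"
proof (cases "k = 4")
  case False
  hence "k \<ge> 6" using k by presburger
  thus ?thesis using eis_A_pos_large[OF z k(1) _ nz] by blast
qed (use eis_A_pos_4[OF z] in simp)

lemma eis_B_nonzero:
  assumes z: "0 \<le> Re z" "Re z < 1 / 2" "Im z \<ge> sqrt 3 / 2" and k: "even k" "k \<ge> 4"
  shows "eis_B k z \<noteq> 0"
proof (cases "k \<le> 10")
  case True
  thus ?thesis using eis_B_nonzero_small_weight z k by blast
next
  case False
  hence k12: "k \<ge> 12" using k by presburger
  have "z \<in> half_strip" using z by (simp add: half_strip_def)
  note y = Im_half_strip[OF this]
  show ?thesis
    using eis_B_nonzero_low[OF z(1,2) y k(1) k12] eis_B_nonzero_high[OF y(1) z(1,2) k(1) k12] by linarith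
qed

section \<open>Holomorphy, symmetries and limits of the two halves\<close>

lemma eisenstein_holomorphic:
  assumes k: "even k" "k \<ge> 4"
  shows "eisenstein k holomorphic_on {z. Im z > 0}"
  unfolding holomorphic_on_def field_differentiable_def
  using has_field_derivative_at_within[OF has_field_derivative_eisenstein[OF _ k]] by blast

lemma deriv_eisenstein:
  assumes "Im z > 0" "even k" "k \<ge> 4"
  shows "deriv (eisenstein k) z = - of_nat k * eis_B k z / of_real (zeta_nat k)"
  by (rule DERIV_imp_deriv[OF has_field_derivative_eisenstein[OF assms]])

lemma zeta_nat_nonzero: "k \<ge> 4 \<Longrightarrow> complex_of_real (zeta_nat k) \<noteq> 0"
  using zeta_nat_ge_1[of k] by auto

lemma eis_holomorphic:
  assumes k: "even k" "k \<ge> 4"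
  shows "eis_B k holomorphic_on {z. Im z > 0}" "eis_A k holomorphic_on {z. Im z > 0}"
proof -
  have D: "deriv (eisenstein k) holomorphic_on {z. Im z > 0}"
    by (intro holomorphic_deriv eisenstein_holomorphic k open_halfspace_Im_gt)
  have "(\<lambda>z. - (of_real (zeta_nat k) * deriv (eisenstein k) z / of_nat k)) holomorphic_on {z. Im z > 0}"
    by (intro holomorphic_on_minus holomorphic_on_divide holomorphic_on_mult holomorphic_on_const D) (use k in auto)
  thus B: "eis_B k holomorphic_on {z. Im z > 0}"
    by (rule holomorphic_transform) (use deriv_eisenstein[OF _ k] zeta_nat_nonzero[OF k(2)] k in auto)
  have "(\<lambda>z. of_real (zeta_nat k) * eisenstein k z - z * eis_B k z) holomorphic_on {z. Im z > 0}"
    by (intro holomorphic_intros eisenstein_holomorphic k B)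
  thus "eis_A k holomorphic_on {z. Im z > 0}"
    by (rule holomorphic_transform) (use eisenstein_lattice(1)[OF _ k] in auto)
qed

lemma isCont_eis:
  assumes "even k" "k \<ge> 4" "Im z > 0"
  shows "isCont (eis_A k) z" "isCont (eis_B k) z"
  using eis_holomorphic[OF assms(1,2), THEN holomorphic_on_imp_continuous_on]
    continuous_on_eq_continuous_at[OF open_halfspace_Im_gt] assms(3) by blast+

lemma eis_B_shift:
  assumes "Im z > 0" "k \<ge> 4"
  shows "eis_B k (z + 1) = eis_B k z"
  using eis_transform(1)[where a = 1 and b = 1 and c = 0 and d = 1, OF assms] by (simp add: moebius_def)

text \<open>Each of the two lines is fixed by a reflection, z -> - cnj z or z -> 1 - cnj z, and
  either of them takes B to - cnj B.\<close>

lemma eis_B_imaginary: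
  assumes z: "Im z > 0" "k \<ge> 4" and x: "Re z = 0 \<or> Re z = 1 / 2"
  shows "Re (eis_B k z) = 0"
proof -
  have z': "Im (- cnj z) > 0" using z by simp
  have "eis_B k (- cnj z) = eis_B k z"
  proof (cases "Re z = 0")
    case True
    hence "- cnj z = z" by (simp add: complex_eq_iff)
    thus ?thesis by simp
  next
    case False
    hence "z = - cnj z + 1" using x by (simp add: complex_eq_iff)
    thus ?thesis using eis_B_shift[OF z' z(2)] by simp
  qed
  hence "eis_B k z = - cnj (eis_B k z)" using eis_reflect(2)[OF z] by simp
  thus ?thesis by (metis cnj.sel(1) equal_neg_zero uminus_complex.sel(1))
qed

text \<open>On the circle - 1/z = - cnj z, so the inversion followed by the reflection relates A and
  B at one and the same point.\<close>

lemma eis_arc: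
  assumes z: "norm z = 1" "Im z > 0" and k: "k \<ge> 4"
  shows "cnj (eis_A k z) = z ^ Suc k * eis_B k z" "norm (eis_A k z) = norm (eis_B k z)"
proof -
  have zz: "z * cnj z = 1" using z by (simp add: complex_norm_square[symmetric])
  have z0: "z \<noteq> 0" using z by auto
  have "moebius_int 0 (- 1) 1 0 z = - cnj z" using zz z0 by (simp add: moebius_def field_simps)
  with eis_transform(1)[where a = 0 and b = "-1" and c = 1 and d = 0, OF z(2) k]
  have "eis_B k (- cnj z) = - (z ^ Suc k * eis_A k z)" by (simp del: power_Suc)
  hence B: "cnj (eis_B k z) = z ^ Suc k * eis_A k z" using eis_reflect(2)[OF z(2) k] by simp
  have "cnj (cnj (eis_B k z)) = cnj z ^ Suc k * cnj (eis_A k z)" unfolding B by simp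
  hence "z ^ Suc k * eis_B k z = z ^ Suc k * cnj z ^ Suc k * cnj (eis_A k z)" by (simp only: complex_cnj_cnj mult.assoc)
  also have "z ^ Suc k * cnj z ^ Suc k = 1" unfolding power_mult_distrib[symmetric] zz by simp
  finally show "cnj (eis_A k z) = z ^ Suc k * eis_B k z" by simp
  from arg_cong[OF B, of norm] show "norm (eis_A k z) = norm (eis_B k z)" using z(1) by (simp add: norm_mult norm_power)
qed

text \<open>Neighbourhoods of \<open>\<i> \<infinity>\<close> inside the strip \<open>\<bar>Re z\<bar> \<le> 1 / 2\<close>.\<close>

definition cusp :: "complex filter" where
  "cusp = inf (filtercomap Im at_top) (principal {z. \<bar>Re z\<bar> \<le> 1 / 2})"

lemma filterlim_Im_cusp: "filterlim Im at_top cusp"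
  unfolding cusp_def by (rule filterlim_mono[OF filterlim_filtercomap order_refl inf_le1])

lemma eventually_cusp: "(\<forall>\<^sub>F z in cusp. P z) \<longleftrightarrow> (\<exists>Y. \<forall>z. Im z \<ge> Y \<and> \<bar>Re z\<bar> \<le> 1 / 2 \<longrightarrow> P z)"
  unfolding cusp_def eventually_inf_principal eventually_filtercomap_at_top_linorder by auto

lemma tendsto_nome_cusp: "(nome \<longlongrightarrow> 0) cusp" "((\<lambda>z. z * nome z) \<longlongrightarrow> 0) cusp"
proof -
  have 0: "((\<lambda>y. exp (- 2 * pi * y)) \<longlongrightarrow> 0) at_top"
    by (rule filterlim_compose[OF exp_at_bot]) (intro filterlim_tendsto_neg_mult_at_bot[OF tendsto_const] filterlim_ident; simp)
  have "((\<lambda>z. norm (nome z)) \<longlongrightarrow> 0) cusp"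
    unfolding norm_nome by (rule filterlim_compose[OF 0 filterlim_Im_cusp])
  thus n: "(nome \<longlongrightarrow> 0) cusp" by (rule tendsto_norm_zero_cancel)
  have "((\<lambda>y. y ^ 1 / exp y) \<longlongrightarrow> (0::real)) at_top" by (rule tendsto_power_div_exp_0)
  hence 1: "((\<lambda>z. Im z ^ 1 / exp (Im z)) \<longlongrightarrow> 0) cusp" by (rule filterlim_compose[OF _ filterlim_Im_cusp])
  have ev: "\<forall>\<^sub>F z in cusp. Im z \<ge> 1 \<and> \<bar>Re z\<bar> \<le> 1 / 2" unfolding eventually_cusp by auto
  show "((\<lambda>z. z * nome z) \<longlongrightarrow> 0) cusp"
  proof (rule Lim_null_comparison[OF _ tendsto_mult_right_zero[OF 1, of 2]])
    show "\<forall>\<^sub>F z in cusp. norm (z * nome z) \<le> 2 * (Im z ^ 1 / exp (Im z))"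
      using ev
    proof eventually_elim
      case (elim z)
      have "norm z \<le> 2 * Im z" using cmod_le[of z] elim by linarith
      moreover have "exp (- 2 * pi * Im z) \<le> exp (- Im z)" using elim pi_gt3 by simp
      ultimately have "norm (z * nome z) \<le> 2 * Im z * exp (- Im z)"
        unfolding norm_mult norm_nome by (intro mult_mono) (use elim in auto)
      thus ?case by (simp add: exp_minus field_simps)
    qed
  qed
qed

lemma tendsto_powser_nome_cusp:
  fixes a :: "nat \<Rightarrow> complex"
  assumes "\<And>q. norm q < 1 \<Longrightarrow> summable (\<lambda>n. a n * q ^ n)"
  shows "((\<lambda>z. \<Sum>n. a n * nome z ^ n) \<longlongrightarrow> a 0) cusp"
proof -
  have "isCont (\<lambda>q. \<Sum>n. a n * q ^ n) 0"
    by (rule isCont_powser[where K = "1 / 2"]) (use assms in \<open>auto simp: norm_divide\<close>)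
  hence "((\<lambda>z. \<Sum>n. a n * nome z ^ n) \<longlongrightarrow> (\<Sum>n. a n * 0 ^ n)) cusp"
    by (rule isCont_tendsto_compose) (rule tendsto_nome_cusp)
  thus ?thesis by (simp add: powser_zero)
qed

lemma summable_index_divisor_sigma:
  fixes q :: complex
  assumes "norm q < 1"
  shows "summable (\<lambda>M. of_nat (M * divisor_sigma j M) * q ^ M)"
proof -
  have "summable (\<lambda>M. diffs (\<lambda>M. of_nat (divisor_sigma j M)) M * q ^ M)"
    using assms by (rule termdiff_converges) (rule summable_divisor_sigma)
  hence "summable (\<lambda>M. q * (diffs (\<lambda>M. of_nat (divisor_sigma j M)) M * q ^ M))" by (rule summable_mult)
  moreover have "q * (diffs (\<lambda>M. of_nat (divisor_sigma j M)) M * q ^ M) = of_nat (Suc M * divisor_sigma j (Suc M)) * q ^ Suc M" for M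
    by (simp only: diffs_def of_nat_mult power_Suc mult_ac)
  ultimately have "summable (\<lambda>M. of_nat (Suc M * divisor_sigma j (Suc M)) * q ^ Suc M)" by (simp only:)
  thus ?thesis by (subst (asm) summable_Suc_iff)
qed

text \<open>The expansion of B starts with q, and A = zeta(k) E - z B. In the strip |z| grows only
  like Im z, so z q still tends to 0.\<close>

lemma eis_cusp:
  assumes k: "even k" "k \<ge> 4"
  shows "(eis_A k \<longlongrightarrow> of_real (zeta_nat k)) cusp" "(eis_B k \<longlongrightarrow> 0) cusp"
proof -
  have ev: "\<forall>\<^sub>F z in cusp. Im z > 0" unfolding eventually_cusp by (auto intro: exI[of _ 1])
  define a b where "a = (\<lambda>M. complex_of_nat (divisor_sigma (k - 1) (Suc M)))"
    and "b = (\<lambda>M. complex_of_nat (Suc M * divisor_sigma (k - 1) (Suc M)))"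
  have sh: "summable (\<lambda>n. f (Suc n) * q ^ n)" if "summable (\<lambda>n. f n * q ^ n)" for f and q :: complex
    using that by (rule summable_powser_ignore_initial_segment[of f 1, THEN iffD2, simplified])
  have s: "summable (\<lambda>n. a n * q ^ n)" "summable (\<lambda>n. b n * q ^ n)" if "norm q < 1" for q
    unfolding a_def b_def
    using sh[OF summable_divisor_sigma[OF that]] sh[OF summable_index_divisor_sigma[OF that]] by blast+
  have ps: "(\<Sum>n. f n * q ^ n) = q * (\<Sum>n. f (Suc n) * q ^ n)" if "summable (\<lambda>n. f n * q ^ n)" "f 0 = 0"
    for f and q :: complex
  proof -
    have "(\<Sum>n. f n * q ^ n) = (\<Sum>n. f (Suc n) * q ^ Suc n)" using suminf_split_head[OF that(1)] that(2) by simp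
    also have "\<dots> = (\<Sum>n. q * (f (Suc n) * q ^ n))" by (simp add: mult_ac)
    also have "\<dots> = q * (\<Sum>n. f (Suc n) * q ^ n)" by (rule suminf_mult[OF sh[OF that(1)]])
    finally show ?thesis .
  qed
  define C where "C = (- 2 * complex_of_real pi * \<i>) ^ Suc k / fact k"
  have B: "eis_B k z = C * (nome z * (\<Sum>n. b n * nome z ^ n))" if "Im z > 0" for z
    unfolding eis_B_nome_series(1)[OF that k] C_def b_def
    using ps[of "\<lambda>M. of_nat (M * divisor_sigma (k - 1) M)" "nome z"] eis_B_nome_series(2)[OF that k] by simp
  have Bl: "((\<lambda>z. C * (nome z * (\<Sum>n. b n * nome z ^ n))) \<longlongrightarrow> C * (0 * b 0)) cusp"
    by (intro tendsto_intros tendsto_nome_cusp tendsto_powser_nome_cusp s)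
  have "(eis_B k \<longlongrightarrow> C * (0 * b 0)) cusp"
    by (rule Lim_transform_eventually[OF Bl]) (use ev B in \<open>auto elim: eventually_mono\<close>)
  thus "(eis_B k \<longlongrightarrow> 0) cusp" by simp
  define D where "D = complex_of_real (2 * real k / bernoulli k)"
  have E: "eisenstein k z = 1 - D * (nome z * (\<Sum>n. a n * nome z ^ n))" if "Im z > 0" for z
  proof -
    have "(\<Sum>n. of_nat (divisor_sigma (k - 1) (Suc n)) * nome z ^ Suc n) = (\<Sum>n. nome z * (a n * nome z ^ n))"
      by (simp add: a_def mult_ac)
    also have "\<dots> = nome z * (\<Sum>n. a n * nome z ^ n)" by (rule suminf_mult[OF s(1)]) (rule norm_nome_less_1[OF that])
    finally show ?thesis unfolding eisenstein_def nome_def[symmetric] D_def by simp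
  qed
  have Al: "((\<lambda>z. of_real (zeta_nat k) * (1 - D * (nome z * (\<Sum>n. a n * nome z ^ n))) - C * ((z * nome z) * (\<Sum>n. b n * nome z ^ n)))
     \<longlongrightarrow> of_real (zeta_nat k) * (1 - D * (0 * a 0)) - C * (0 * b 0)) cusp"
    by (intro tendsto_intros tendsto_nome_cusp tendsto_powser_nome_cusp s)
  have "(eis_A k \<longlongrightarrow> of_real (zeta_nat k) * (1 - D * (0 * a 0)) - C * (0 * b 0)) cusp"
  proof (rule Lim_transform_eventually[OF Al], use ev in eventually_elim)
    case (elim z)
    have "eis_A k z = of_real (zeta_nat k) * eisenstein k z - z * eis_B k z"
      using eisenstein_lattice(1)[OF elim k] by simp
    thus ?case unfolding E[OF elim] B[OF elim] by (simp add: mult_ac)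
  qed
  thus "(eis_A k \<longlongrightarrow> of_real (zeta_nat k)) cusp" by simp
qed

text \<open>Near \<xi> write f = u^n with u = (w - \<xi>) g(w). Then f / f' = u / (n u'), where u
  vanishes at \<xi> and u' does not.\<close>

lemma tendsto_div_deriv_zero:
  assumes f: "f holomorphic_on S" "open S" "connected S" "\<xi> \<in> S" "f \<xi> = 0" and nc: "\<not> f constant_on S"
  shows "((\<lambda>z. f z / deriv f z) \<longlongrightarrow> 0) (at \<xi>)"
proof -
  obtain g r n where g: "0 < r" "0 < n" "ball \<xi> r \<subseteq> S" "g holomorphic_on ball \<xi> r"
     "\<And>w. w \<in> ball \<xi> r \<Longrightarrow> f w - f \<xi> = ((w - \<xi>) * g w) ^ n" "\<And>w. w \<in> ball \<xi> r \<Longrightarrow> g w \<noteq> 0"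
    by (rule holomorphic_factor_power[OF f(1-4) nc], rule that)
  have \<xi>: "\<xi> \<in> ball \<xi> r" using g by simp
  have "isCont g \<xi>" "isCont (deriv g) \<xi>"
    using \<xi> holomorphic_on_imp_continuous_on[OF g(4)] holomorphic_on_imp_continuous_on[OF holomorphic_deriv[OF g(4) open_ball]]
      continuous_on_eq_continuous_at[OF open_ball] by blast+
  hence "((\<lambda>w. (w - \<xi>) * g w / (of_nat n * (g w + (w - \<xi>) * deriv g w))) \<longlongrightarrow>
      (\<xi> - \<xi>) * g \<xi> / (of_nat n * (g \<xi> + (\<xi> - \<xi>) * deriv g \<xi>))) (at \<xi>)"
    using g(2) g(6)[OF \<xi>] by (intro tendsto_intros) (auto simp: isCont_def)
  hence lim: "((\<lambda>w. (w - \<xi>) * g w / (of_nat n * (g w + (w - \<xi>) * deriv g w))) \<longlongrightarrow> 0) (at \<xi>)" by simp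
  have ev: "\<forall>\<^sub>F w in at \<xi>. w \<in> ball \<xi> r - {\<xi>}"
    using g(1) by (intro eventually_at_in_open) auto
  show ?thesis
  proof (rule Lim_transform_eventually[OF lim], use ev in eventually_elim)
    case (elim w)
    define u where "u = (w - \<xi>) * g w"
    have u: "u \<noteq> 0" using elim g(6) by (auto simp: u_def)
    have "(g has_field_derivative deriv g w) (at w)"
      using elim holomorphic_derivI[OF g(4) open_ball] by blast
    hence "((\<lambda>w. ((w - \<xi>) * g w) ^ n) has_field_derivative of_nat n * u ^ (n - 1) * (g w + (w - \<xi>) * deriv g w)) (at w)"
      unfolding u_def by (auto intro!: derivative_eq_intros simp: algebra_simps)
    hence "(f has_field_derivative of_nat n * u ^ (n - 1) * (g w + (w - \<xi>) * deriv g w)) (at w)"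
      by (rule has_field_derivative_transform_within_open[OF _ open_ball[of \<xi> r]]) (use elim g(5) f(5) in auto)
    hence "deriv f w = of_nat n * u ^ (n - 1) * (g w + (w - \<xi>) * deriv g w)" by (rule DERIV_imp_deriv)
    moreover have "f w = u ^ (n - 1) * u" unfolding power_minus_mult[OF g(2)] using g(5)[of w] elim f(5) by (simp add: u_def)
    ultimately have "f w / deriv f w = u ^ (n - 1) * u / (u ^ (n - 1) * (of_nat n * (g w + (w - \<xi>) * deriv g w)))"
      by (simp only: mult_ac)
    also have "\<dots> = u / (of_nat n * (g w + (w - \<xi>) * deriv g w))" using u by simp
    finally show ?case by (simp add: u_def)
  qed
qed

text \<open>Here \<open>- A / B = z + k E / E'\<close>, and \<open>E / E'\<close> tends to \<open>0\<close> at every zero of \<open>E\<close>.\<close>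

lemma eis_ratio_at_corner:
  assumes k: "even k" "k \<ge> 4" and c: "eisenstein k corner = 0"
  shows "((\<lambda>z. - eis_A k z / eis_B k z) \<longlongrightarrow> corner) (at corner)"
proof -
  let ?H = "{z. Im z > 0}"
  have nc: "\<not> eisenstein k constant_on ?H"
  proof
    assume "eisenstein k constant_on ?H"
    then obtain v where v: "\<And>z. Im z > 0 \<Longrightarrow> eisenstein k z = v" by (auto simp: constant_on_def)
    have "((\<lambda>_. v) has_field_derivative 0) (at \<i>)" by simp
    hence "(eisenstein k has_field_derivative 0) (at \<i>)"
      by (rule has_field_derivative_transform_within_open[OF _ open_halfspace_Im_gt[of 0]]) (use v in auto)
    hence "deriv (eisenstein k) \<i> = 0" by (rule DERIV_imp_deriv)
    hence "eis_B k \<i> = 0" using deriv_eisenstein[of \<i> k] k zeta_nat_nonzero[of k] by simp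
    moreover have "eis_B k \<i> \<noteq> 0" by (rule eis_B_nonzero) (use k real_sqrt_le_mono[of 3 4] in auto)
    ultimately show False by blast
  qed
  have "((\<lambda>z. eisenstein k z / deriv (eisenstein k) z) \<longlongrightarrow> 0) (at corner)"
    using c nc by (intro tendsto_div_deriv_zero[where S = ?H] eisenstein_holomorphic k open_halfspace_Im_gt)
      (auto intro: convex_connected convex_halfspace_Im_gt)
  hence "((\<lambda>z. z + of_nat k * (eisenstein k z / deriv (eisenstein k) z)) \<longlongrightarrow> corner + of_nat k * 0) (at corner)"
    by (intro tendsto_intros)
  hence lim: "((\<lambda>z. z + of_nat k * (eisenstein k z / deriv (eisenstein k) z)) \<longlongrightarrow> corner) (at corner)" by simp
  have ev: "\<forall>\<^sub>F z in at corner. Im z > 0 \<and> eis_B k z \<noteq> 0"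
  proof -
    have 1: "connected ?H" by (rule convex_connected[OF convex_halfspace_Im_gt])
    have 2: "eis_B k \<i> \<noteq> 0" by (rule eis_B_nonzero) (use k real_sqrt_le_mono[of 3 4] in auto)
    have "\<forall>\<^sub>F z in at corner. eis_B k z \<noteq> 0 \<and> z \<in> ?H"
      by (rule non_zero_neighbour_alt[OF eis_holomorphic(1)[OF k] open_halfspace_Im_gt 1 _ _ 2]) auto
    thus ?thesis by eventually_elim auto
  qed
  show ?thesis
  proof (rule Lim_transform_eventually[OF lim], use ev in eventually_elim)
    case (elim z)
    have "eisenstein k z = (z * eis_B k z + eis_A k z) / of_real (zeta_nat k)"
      using eisenstein_lattice(1)[of z k] elim k zeta_nat_nonzero[OF k(2)] by (simp add: field_simps)
    moreover have "deriv (eisenstein k) z = - of_nat k * eis_B k z / of_real (zeta_nat k)"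
      by (rule deriv_eisenstein) (use elim k in auto)
    ultimately have "of_nat k * (eisenstein k z / deriv (eisenstein k) z) = - ((z * eis_B k z + eis_A k z) / eis_B k z)"
      using elim k zeta_nat_nonzero[OF k(2)] by simp
    thus ?case using elim by (simp add: add_divide_distrib)
  qed
qed

section \<open>Values along the unit arc and in the right half of the domain\<close>

lemma isCont_cis: "isCont cis t"
  unfolding cis_conv_exp by (intro continuous_intros)

text \<open>Just after x the function exceeds v. If it came back, the first later point z with f z
  <= v would have f z = v, but a positive derivative there forces values below v just before
  z.\<close>

lemma upcrossing:
  fixes f :: "real \<Rightarrow> real"
  assumes cont: "continuous_on {a<..<b} f"
    and der: "\<And>x. x \<in> {a<..<b} \<Longrightarrow> f x = v \<Longrightarrow> \<exists>r>0. (f has_real_derivative r) (at x)"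
    and x: "x \<in> {a<..<b}" "f x = v" and y: "y \<in> {a<..<b}" "x < y"
  shows "f y > v"
proof (rule ccontr)
  assume fy: "\<not> f y > v"
  obtain d where d: "d > 0" "\<And>h. h > 0 \<Longrightarrow> h < d \<Longrightarrow> f x < f (x + h)"
    using der[OF x] DERIV_pos_inc_right by blast
  define x1 where "x1 = x + min (d / 2) ((y - x) / 2)"
  have x1: "x < x1" "x1 < y" "f x1 > v"
    using d(1) d(2)[of "x1 - x"] y x by (auto simp: x1_def min_def field_simps)
  define S where "S = {t \<in> {x1..y}. f t \<le> v}"
  have sub: "{x1..y} \<subseteq> {a<..<b}" using x y x1 by auto
  have "closed S" unfolding S_def
    by (intro continuous_on_closed_Collect_le continuous_on_subset[OF cont sub] continuous_on_const closed_atLeastAtMost)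
  moreover have ne: "y \<in> S" "bdd_below S" using fy x1 by (auto simp: S_def)
  ultimately have zS: "Inf S \<in> S" by (intro closed_contains_Inf) auto
  define z where "z = Inf S"
  have z: "z \<in> {x1..y}" "f z \<le> v" using zS by (auto simp: S_def z_def)
  have above: "f t > v" if "x1 \<le> t" "t < z" for t
  proof (rule ccontr)
    assume "\<not> f t > v"
    hence "t \<in> S" using that z by (auto simp: S_def)
    hence "z \<le> t" unfolding z_def by (rule cInf_lower) (rule ne)
    thus False using that by simp
  qed
  have zx: "x1 < z" using z x1 by (cases "z = x1") auto
  have "f z = v"
  proof (rule ccontr)
    assume "f z \<noteq> v"
    hence "f z < v" using z by simp
    have "continuous_on {x1..z} f" by (rule continuous_on_subset[OF cont]) (use sub z in auto)
    from IVT2'[of f z v x1, OF _ _ _ this] \<open>f z < v\<close> x1 zx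
    obtain t where "x1 \<le> t" "t \<le> z" "f t = v" by auto
    moreover have "t \<noteq> z" using \<open>f z < v\<close> calculation by auto
    ultimately show False using above[of t] by auto
  qed
  moreover have "z \<in> {a<..<b}" using z sub by auto
  ultimately obtain e where e: "e > 0" "\<And>h. h > 0 \<Longrightarrow> h < e \<Longrightarrow> f (z - h) < f z"
    using der DERIV_pos_inc_left by blast
  define h where "h = min (e / 2) ((z - x1) / 2)"
  have "h > 0" "h < e" "x1 \<le> z - h" "z - h < z" using e zx by (auto simp: h_def min_def field_simps)
  thus False using e(2)[of h] above[of "z - h"] \<open>f z = v\<close> by simp
qed

lemma upcrossing':
  fixes f :: "real \<Rightarrow> real"
  assumes cont: "continuous_on {a<..<b} f"
    and der: "\<And>x. x \<in> {a<..<b} \<Longrightarrow> f x = v \<Longrightarrow> \<exists>r>0. (f has_real_derivative r) (at x)"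
    and x: "x \<in> {a<..<b}" "f x = v" and y: "y \<in> {a<..<b}" "y < x"
  shows "f y < v"
proof -
  have "- f (- (- y)) > - v"
  proof (rule upcrossing[where a = "- b" and b = "- a" and x = "- x" and f = "\<lambda>t. - f (- t)"])
    show "continuous_on {- b<..<- a} (\<lambda>t. - f (- t))"
      by (intro continuous_intros continuous_on_compose2[OF cont]) auto
    fix t assume t: "t \<in> {- b<..<- a}" "- f (- t) = - v"
    obtain r where r: "r > 0" "(f has_real_derivative r) (at (- t))" using der[of "- t"] t by auto
    hence "((\<lambda>t. f (- t)) has_real_derivative - r) (at t)" by (simp add: DERIV_mirror)
    from DERIV_minus[OF this] r show "\<exists>r>0. ((\<lambda>t. - f (- t)) has_real_derivative r) (at t)" by auto
  qed (use x y in auto)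
  thus ?thesis by simp
qed

text \<open>Open and convex, so that a logarithm of the ratio exists. It extends below the unit
  circle, which makes the points of the open arc interior points.\<close>

definition right_region :: "complex set" where
  "right_region = {z. 0 < Re z \<and> Re z < 1 / 2 \<and> Im z > sqrt 3 / 2}"

lemma right_region_props:
  assumes "z \<in> right_region"
  shows "Im z > 0" "z \<in> half_strip" "z \<noteq> corner" "0 < Re z" "Re z < 1 / 2"
proof -
  have "sqrt 3 / 2 > (0::real)" by simp
  moreover have "sqrt 3 / 2 < Im z" using assms by (simp add: right_region_def)
  ultimately show "Im z > 0" by linarith
  show "z \<in> half_strip" "z \<noteq> corner" "0 < Re z" "Re z < 1 / 2"
    using assms by (auto simp: right_region_def half_strip_def)
qed

lemma right_region_eq: "right_region = {z. Re z > 0} \<inter> {z. Re z < 1 / 2} \<inter> {z. Im z > sqrt 3 / 2}"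
  by (auto simp: right_region_def)

lemma open_right_region: "open right_region" and convex_right_region: "convex right_region"
  unfolding right_region_eq
  by (intro open_Int open_halfspace_Re_gt open_halfspace_Re_lt open_halfspace_Im_gt)
     (intro convex_Int convex_halfspace_Re_gt convex_halfspace_Re_lt convex_halfspace_Im_gt)

lemma right_regionI:
  assumes "0 < Re z" "Re z < 1 / 2" "Im z > 0" "norm z \<ge> 1"
  shows "z \<in> right_region"
proof -
  have "1 \<le> (Re z) ^ 2 + (Im z) ^ 2" using power_mono[OF assms(4), of 2] by (simp add: cmod_power2)
  moreover have "(Re z) ^ 2 < (1 / 2) ^ 2" using assms by (intro power_strict_mono) auto
  ultimately have "(sqrt 3 / 2) ^ 2 < (Im z) ^ 2" by (simp add: power_divide)
  hence "sqrt 3 / 2 < Im z" by (rule power2_less_imp_less) (use assms in simp)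
  thus ?thesis using assms by (simp add: right_region_def)
qed

lemma cis_in_right_region:
  assumes "pi / 3 < \<theta>" "\<theta> < pi / 2"
  shows "cis \<theta> \<in> right_region"
proof (rule right_regionI)
  show "0 < Re (cis \<theta>)" using assms by (simp add: cos_gt_zero_pi)
  have "cos \<theta> < cos (pi / 3)" using assms by (intro cos_monotone_0_pi) auto
  thus "Re (cis \<theta>) < 1 / 2" by (simp add: cos_60)
  show "Im (cis \<theta>) > 0" using assms by (auto intro!: sin_gt_zero)
qed auto

lemma right_region_arc:
  assumes z: "z \<in> right_region" "norm z = 1"
  obtains \<theta> where "pi / 3 < \<theta>" "\<theta> < pi / 2" "z = cis \<theta>"
proof -
  note p = right_region_props[OF z(1)]
  have ze: "z = cis (Arg z)" using z p rcis_cmod_Arg[of z] by (simp add: rcis_def)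
  have A: "0 < Arg z" "Arg z < pi" using p(1) Arg_lt_pi[of z] by auto
  have "cos (Arg z) = Re z" using arg_cong[OF ze, of Re] by simp
  hence c: "cos (pi / 2) < cos (Arg z)" "cos (Arg z) < cos (pi / 3)" using p by (auto simp: cos_60)
  have "Arg z < pi / 2" using c(1) A by (subst (asm) cos_mono_less_eq) auto
  moreover have "pi / 3 < Arg z" using c(2) A by (subst (asm) cos_mono_less_eq) auto
  ultimately show ?thesis using that ze by blast
qed

text \<open>On the circle B = cnj A / z^(k+1), so - A / B = - z^(k+1) A / cnj A has this argument.
  Because Re A > 0, \<open>Arg\<close> of A stays strictly between - pi/2 and pi/2, and the formula
  is a continuous branch.\<close>

definition arc_angle :: "nat \<Rightarrow> real \<Rightarrow> real" where
  "arc_angle k \<theta> = pi + real (Suc k) * \<theta> + 2 * Arg (eis_A k (cis \<theta>))"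

lemma half_strip_arc:
  assumes "pi / 3 < \<theta>" "\<theta> \<le> pi / 2"
  shows "cis \<theta> \<in> half_strip" "cis \<theta> \<noteq> corner" "Im (cis \<theta>) > 0"
proof -
  have "cis \<theta> \<in> half_strip \<and> cis \<theta> \<noteq> corner \<and> Im (cis \<theta>) > 0"
  proof (cases "\<theta> = pi / 2")
    case True
    have "sqrt 3 \<le> sqrt 4" by (rule real_sqrt_le_mono) simp
    moreover have "cis \<theta> = \<i>" using True by (simp only: cis_pi_half)
    ultimately show ?thesis by (auto simp: half_strip_def complex_eq_iff)
  next
    case False
    thus ?thesis using right_region_props[OF cis_in_right_region[of \<theta>]] assms by auto
  qed
  thus "cis \<theta> \<in> half_strip" "cis \<theta> \<noteq> corner" "Im (cis \<theta>) > 0" by auto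
qed

lemma arc_angle_props:
  assumes \<theta>: "pi / 3 < \<theta>" "\<theta> \<le> pi / 2" and k: "even k" "k \<ge> 4"
  shows "exp (\<i> * of_real (arc_angle k \<theta>)) = - eis_A k (cis \<theta>) / eis_B k (cis \<theta>)"
    and "isCont (arc_angle k) \<theta>" and "real (Suc k) * \<theta> < arc_angle k \<theta>" "arc_angle k \<theta> < real (Suc k) * \<theta> + 2 * pi"
proof -
  define A where "A = eis_A k (cis \<theta>)"
  note hs = half_strip_arc[OF \<theta>]
  have Ap: "Re A > 0" unfolding A_def by (rule eis_A_pos[OF hs(1) k]) (use hs in auto)
  have A0: "A \<noteq> 0" using Ap by auto
  have Ar: "\<bar>Arg A\<bar> < pi / 2" using Arg_Re_pos Ap by blast
  thus "real (Suc k) * \<theta> < arc_angle k \<theta>" "arc_angle k \<theta> < real (Suc k) * \<theta> + 2 * pi"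
    by (auto simp: arc_angle_def A_def[symmetric] abs_less_iff)
  have Bc: "cnj A = cis \<theta> ^ Suc k * eis_B k (cis \<theta>)"
    unfolding A_def by (rule eis_arc(1)) (use hs k in auto)
  hence B: "eis_B k (cis \<theta>) = cnj A / cis \<theta> ^ Suc k" by simp
  have "A / cnj A = cis (Arg A) * cis (Arg A)"
  proof -
    have "A = of_real (norm A) * cis (Arg A)" using rcis_cmod_Arg[of A] by (simp add: rcis_def)
    moreover from this have "cnj A = of_real (norm A) * cis (- Arg A)" by (metis cis_cnj complex_cnj_complex_of_real complex_cnj_mult)
    ultimately have "A / cnj A = cis (Arg A) / cis (- Arg A)" using A0 by (metis mult_divide_mult_cancel_left norm_eq_zero of_real_eq_0_iff)
    thus ?thesis by (simp add: cis_divide cis_mult)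
  qed
  have "- A / eis_B k (cis \<theta>) = - (cis \<theta> ^ Suc k * (A / cnj A))" unfolding B by (simp del: power_Suc)
  also have "\<dots> = cis pi * (cis (real (Suc k) * \<theta>) * (cis (Arg A) * cis (Arg A)))"
    unfolding \<open>A / cnj A = _\<close> Complex.DeMoivre by simp
  also have "\<dots> = cis (arc_angle k \<theta>)" by (simp only: cis_mult arc_angle_def A_def[symmetric] add.assoc mult_2)
  finally show "exp (\<i> * of_real (arc_angle k \<theta>)) = - eis_A k (cis \<theta>) / eis_B k (cis \<theta>)"
    by (simp add: cis_conv_exp A_def)
  have "A \<notin> \<real>\<^sub>\<le>\<^sub>0" using Ap by (auto simp: complex_nonpos_Reals_iff)
  hence "isCont Arg (eis_A k (cis \<theta>))" unfolding A_def by (rule continuous_at_Arg)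
  moreover have "isCont (\<lambda>t. eis_A k (cis t)) \<theta>"
    by (rule isCont_o2[OF isCont_cis isCont_eis(1)[OF k hs(3)]])
  ultimately have "isCont (\<lambda>t. Arg (eis_A k (cis t))) \<theta>" by (rule isCont_o2[rotated])
  thus "isCont (arc_angle k) \<theta>" unfolding arc_angle_def by (intro continuous_intros)
qed

text \<open>For k mod 6 = 2 the ratio is 0/0 and the limit comes from E / E' tending to 0; otherwise
  it is a value, given by the fixed-point relations. In each case the limit is not real.\<close>

lemma eis_ratio_tendsto_corner:
  assumes k: "even k" "k \<ge> 4"
  shows "((\<lambda>z. - eis_A k z / eis_B k z) \<longlongrightarrow> (if k mod 6 = 0 then cnj corner else corner)) (at corner)"
proof (cases "k mod 6 = 2")
  case True
  have "eisenstein k corner = 0"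
    using eisenstein_lattice(1)[of corner k] eis_corner_zero[of k] True k zeta_nat_nonzero[of k] by simp
  thus ?thesis using eis_ratio_at_corner[OF k] True by simp
next
  case False
  have Ap: "eis_A k corner \<noteq> 0" using eis_A_pos[OF corner_in_half_strip k] False by auto
  have B: "eis_B k corner \<noteq> 0" using eis_corner(1)[OF k(2)] Ap by auto
  have "((\<lambda>z. - eis_A k z / eis_B k z) \<longlongrightarrow> - eis_A k corner / eis_B k corner) (at corner)"
    using isCont_eis[OF k, of corner] B by (intro tendsto_intros) (auto simp: isCont_def)
  moreover have "- eis_A k corner / eis_B k corner = (if k mod 6 = 0 then cnj corner else corner)"
  proof (cases "k mod 6 = 0")
    case True
    thus ?thesis using eis_corner_0[OF k(2)] B by simp
  next
    case 4: False
    hence "k mod 6 = 4" using False k by presburger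
    thus ?thesis using eis_corner_4[OF k(2)] B by simp
  qed
  ultimately show ?thesis by simp
qed

text \<open>The window covers three half periods of alternating sign, and only the middle one
  carries the sign prescribed by the parity of J.\<close>

lemma sin_sign_window:
  fixes J :: int
  assumes s: "(if even J then sin x else - sin x) > 0" and x: "(real_of_int J - 1) * pi < x" "x < (real_of_int J + 2) * pi"
  shows "real_of_int J * pi < x" "x < (real_of_int J + 1) * pi"
proof -
  define y where "y = x - pi * real_of_int J"
  have "sin y = sin x * cos (pi * real_of_int J) - cos x * sin (pi * real_of_int J)"
    unfolding y_def by (rule sin_diff)
  hence sy: "sin y > 0" using s by (simp split: if_splits)
  have y: "- pi < y" "y < 2 * pi" using x by (auto simp: y_def algebra_simps)
  have "y > 0"
  proof (rule ccontr)
    assume "\<not> y > 0"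
    hence "sin (- y) \<ge> 0" using y by (intro sin_ge_zero) auto
    thus False using sy by simp
  qed
  moreover have "y < pi"
  proof (rule ccontr)
    assume "\<not> y < pi"
    hence "sin (y - pi) \<ge> 0" using y by (intro sin_ge_zero) auto
    thus False using sy by simp
  qed
  ultimately show "real_of_int J * pi < x" "x < (real_of_int J + 1) * pi" by (auto simp: y_def algebra_simps)
qed

text \<open>The bound on \<open>Arg\<close> confines the angle to an interval of length 2 pi. The
  sign of Im (- A / B) in the limit, positive unless k mod 6 = 0, then selects the half period; J is
  odd exactly when k mod 6 = 0.\<close>

lemma arc_angle_at_corner:
  assumes k: "even k" "k \<ge> 4" and J: "J = int (Suc k div 3) + 1"
  shows "\<forall>\<^sub>F \<theta> in at_right (pi / 3). real_of_int J * pi < arc_angle k \<theta> \<and> arc_angle k \<theta> < (real_of_int J + 1) * pi"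
proof -
  define v where "v = (if k mod 6 = 0 then cnj corner else corner)"
  have cc: "cis (pi / 3) = corner" by (simp add: complex_eq_iff cos_60 sin_60)
  have ev0: "\<forall>\<^sub>F \<theta> in at_right (pi / 3). \<theta> \<in> {pi / 3<..<pi / 2}"
    by (rule eventually_at_right_real) simp
  have "filterlim cis (at corner) (at_right (pi / 3))"
  proof (rule filterlim_atI)
    have "isCont cis (pi / 3)" by (rule isCont_cis)
    thus "(cis \<longlongrightarrow> corner) (at_right (pi / 3))" unfolding cc[symmetric]
      by (simp add: isCont_def filterlim_at_split)
    show "\<forall>\<^sub>F \<theta> in at_right (pi / 3). cis \<theta> \<noteq> corner"
      using ev0 by eventually_elim (use half_strip_arc in auto)
  qed
  hence "((\<lambda>\<theta>. - eis_A k (cis \<theta>) / eis_B k (cis \<theta>)) \<longlongrightarrow> v) (at_right (pi / 3))"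
    unfolding v_def by (rule filterlim_compose[OF eis_ratio_tendsto_corner[OF k]])
  hence "((\<lambda>\<theta>. Im (- eis_A k (cis \<theta>) / eis_B k (cis \<theta>))) \<longlongrightarrow> Im v) (at_right (pi / 3))" by (rule tendsto_Im)
  hence t: "((\<lambda>\<theta>. sin (arc_angle k \<theta>)) \<longlongrightarrow> Im v) (at_right (pi / 3))"
  proof (rule Lim_transform_eventually)
    show "\<forall>\<^sub>F \<theta> in at_right (pi / 3). Im (- eis_A k (cis \<theta>) / eis_B k (cis \<theta>)) = sin (arc_angle k \<theta>)"
      using ev0
    proof eventually_elim
      case (elim \<theta>)
      have "- eis_A k (cis \<theta>) / eis_B k (cis \<theta>) = cis (arc_angle k \<theta>)"
        using arc_angle_props(1)[of \<theta> k] elim k by (simp add: cis_conv_exp)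
      thus ?case by (metis cis.sel(2))
    qed
  qed
  have sgn: "(if even J then Im v else - Im v) > 0"
  proof -
    have "even J \<longleftrightarrow> k mod 6 \<noteq> 0" using J k by presburger
    thus ?thesis by (simp add: v_def)
  qed
  have ev1: "\<forall>\<^sub>F \<theta> in at_right (pi / 3). (if even J then sin (arc_angle k \<theta>) else - sin (arc_angle k \<theta>)) > 0"
  proof (cases "even J")
    case True
    thus ?thesis using order_tendstoD(1)[OF t, of 0] sgn by simp
  next
    case False
    thus ?thesis using order_tendstoD(2)[OF t, of 0] sgn by simp
  qed
  have J1: "(real_of_int J - 1) \<le> real (Suc k) / 3" "real (Suc k) / 3 < real_of_int J"
  proof -
    have "3 * (Suc k div 3) \<le> Suc k" "Suc k < 3 * (Suc k div 3) + 3" by presburger+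
    hence "3 * real (Suc k div 3) \<le> real (Suc k)" "real (Suc k) < 3 * real (Suc k div 3) + 3" by linarith+
    thus "(real_of_int J - 1) \<le> real (Suc k) / 3" "real (Suc k) / 3 < real_of_int J" by (simp_all add: J)
  qed
  have ev2: "\<forall>\<^sub>F \<theta> in at_right (pi / 3). \<theta> \<in> {pi / 3<..<real_of_int J * pi / real (Suc k)}"
  proof (rule eventually_at_right_real)
    have "real (Suc k) / 3 * pi < real_of_int J * pi" using J1 by (intro mult_strict_right_mono) auto
    thus "pi / 3 < real_of_int J * pi / real (Suc k)" by (simp add: field_simps)
  qed
  show ?thesis using ev0 ev1 ev2
  proof eventually_elim
    case (elim \<theta>)
    note b = arc_angle_props(3,4)[of \<theta> k]
    have "(real_of_int J - 1) * pi \<le> real (Suc k) / 3 * pi" using J1 by (intro mult_right_mono) auto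
    also have "\<dots> = real (Suc k) * (pi / 3)" by simp
    also have "\<dots> \<le> real (Suc k) * \<theta>" using elim by (intro mult_left_mono) auto
    also have "\<dots> < arc_angle k \<theta>" using b elim k by auto
    finally have 1: "(real_of_int J - 1) * pi < arc_angle k \<theta>" .
    have "real (Suc k) * \<theta> < real_of_int J * pi" using elim(3) by (simp add: field_simps)
    hence "arc_angle k \<theta> < real_of_int J * pi + 2 * pi" using b(2) elim k by auto
    hence 2: "arc_angle k \<theta> < (real_of_int J + 2) * pi" by (simp add: algebra_simps)
    show ?case using sin_sign_window[OF elim(2) 1 2] by blast
  qed
qed

text \<open>The reflection fixes i, so A is real there, and positive. Its argument is 0 and the
  angle equals (J + 1/2) pi.\<close>

lemma arc_angle_at_i:
  assumes k: "even k" "k \<ge> 4" and J: "J = int (k div 2) + 1"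
  shows "\<forall>\<^sub>F \<theta> in at_left (pi / 2). real_of_int J * pi < arc_angle k \<theta> \<and> arc_angle k \<theta> < (real_of_int J + 1) * pi"
proof -
  have "eis_A k (- cnj \<i>) = cnj (eis_A k \<i>)" by (rule eis_reflect) (use k in auto)
  hence "Im (eis_A k \<i>) = 0" by (simp add: complex_eq_iff)
  moreover have "Re (eis_A k (cis (pi / 2))) > 0"
    by (rule eis_A_pos) (use half_strip_arc[of "pi / 2"] k in auto)
  ultimately have "Arg (eis_A k \<i>) = 0" by (simp add: Arg_eq_0 complex_is_Real_iff)
  hence a: "arc_angle k (pi / 2) = pi + real (Suc k) * (pi / 2)" by (simp add: arc_angle_def)
  have "real k = 2 * real (k div 2)" using k by (metis dvd_mult_div_cancel of_nat_mult of_nat_numeral)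
  hence v: "arc_angle k (pi / 2) = (real_of_int J + 1 / 2) * pi" unfolding a J by (simp add: algebra_simps)
  have "isCont (arc_angle k) (pi / 2)" by (rule arc_angle_props) (use k in auto)
  hence t: "(arc_angle k \<longlongrightarrow> (real_of_int J + 1 / 2) * pi) (at_left (pi / 2))"
    unfolding v[symmetric] by (simp add: isCont_def filterlim_at_split)
  show ?thesis
    using order_tendstoD(1)[OF t, of "real_of_int J * pi"] order_tendstoD(2)[OF t, of "(real_of_int J + 1) * pi"]
    by (simp add: eventually_conj_iff algebra_simps)
qed

text \<open>Escape is excluded one boundary piece at a time. At the cusp A tends to zeta(k) and B to
  0 while u is bounded; at the corner with k mod 6 = 2 the real numbers u would tend to a non-real
  limit; elsewhere on the vertical sides B is purely imaginary while Re A > 0.\<close>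

lemma right_region_convergent_subseq:
  assumes k: "even k" "k \<ge> 4" and z: "\<And>n. z n \<in> right_region \<and> 1 \<le> norm (z n)"
    and eq: "\<And>n. eis_A k (z n) + of_real (u n) * eis_B k (z n) = 0" and u: "u \<longlonglongrightarrow> u0"
  obtains x r where "strict_mono (r :: nat \<Rightarrow> nat)" "(z \<circ> r) \<longlonglongrightarrow> x" "x \<in> right_region"
    "eis_A k x + of_real u0 * eis_B k x = 0"
proof -
  obtain M where M: "M > 0" "\<And>n. \<bar>u n\<bar> \<le> M"
    using Bseq_def convergent_imp_Bseq[of u] u by (auto simp: convergent_def Bseq_def)
  have Z: "zeta_nat k \<ge> 1" using k by (intro zeta_nat_ge_1) auto
  have "\<forall>\<^sub>F z in cusp. norm (eis_A k z) > 1 / 2"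
    by (rule order_tendstoD(1)[OF tendsto_norm[OF eis_cusp(1)[OF k]]]) (use Z in simp)
  moreover have "\<forall>\<^sub>F z in cusp. norm (eis_B k z) < 1 / (2 * M)"
    by (rule order_tendstoD(2)[OF tendsto_norm[OF eis_cusp(2)[OF k]]]) (use M in simp)
  ultimately have "\<forall>\<^sub>F z in cusp. norm (eis_A k z) > 1 / 2 \<and> norm (eis_B k z) < 1 / (2 * M)"
    by (rule eventually_conj)
  then obtain Y where Y: "\<And>z. Im z \<ge> Y \<Longrightarrow> \<bar>Re z\<bar> \<le> 1 / 2 \<Longrightarrow> norm (eis_A k z) > 1 / 2 \<and> norm (eis_B k z) < 1 / (2 * M)"
    unfolding eventually_cusp by blast
  have ImY: "Im (z n) < Y" for n
  proof (rule ccontr)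
    assume "\<not> Im (z n) < Y"
    hence y: "norm (eis_A k (z n)) > 1 / 2" "norm (eis_B k (z n)) < 1 / (2 * M)"
      using Y[of "z n"] z[of n] by (auto simp: right_region_def)
    have "eis_A k (z n) = - (of_real (u n) * eis_B k (z n))" using eq[of n] by (simp add: eq_neg_iff_add_eq_0)
    hence "norm (eis_A k (z n)) = \<bar>u n\<bar> * norm (eis_B k (z n))" by (simp add: norm_mult)
    also have "\<dots> \<le> M * (1 / (2 * M))" using M y by (intro mult_mono) auto
    also have "\<dots> = 1 / 2" using M by simp
    finally show False using y by simp
  qed
  define K where "K = cbox (Complex 0 (sqrt 3 / 2)) (Complex (1 / 2) Y)"
  have "z n \<in> K" for n using z[of n] ImY[of n] by (auto simp: K_def in_cbox_complex_iff right_region_def)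
  moreover have "seq_compact K" unfolding K_def using compact_cbox compact_imp_seq_compact by blast
  ultimately obtain x r where xr: "x \<in> K" "strict_mono (r :: nat \<Rightarrow> nat)" "(z \<circ> r) \<longlonglongrightarrow> x"
    using seq_compactE[of K z] by metis
  have xh: "x \<in> half_strip" using xr(1) by (auto simp: K_def in_cbox_complex_iff half_strip_def)
  have xp: "Im x > 0" by (rule Im_half_strip[OF xh])
  have "(\<lambda>n. norm ((z \<circ> r) n)) \<longlonglongrightarrow> norm x" by (intro tendsto_norm xr)
  hence x1: "1 \<le> norm x" by (rule LIMSEQ_le_const) (use z in auto)
  have ur: "(\<lambda>n. u (r n)) \<longlonglongrightarrow> u0" using LIMSEQ_subseq_LIMSEQ[OF u xr(2)] by (simp add: o_def)
  have "(\<lambda>n. eis_A k ((z \<circ> r) n) + of_real (u (r n)) * eis_B k ((z \<circ> r) n)) \<longlonglongrightarrow> eis_A k x + of_real u0 * eis_B k x"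
    by (intro tendsto_intros ur isCont_tendsto_compose[OF _ xr(3)] isCont_eis k xp)
  hence lim0: "eis_A k x + of_real u0 * eis_B k x = 0" using eq by (simp add: LIMSEQ_const_iff)
  have "\<not> (x = corner \<and> k mod 6 = 2)"
  proof
    assume *: "x = corner \<and> k mod 6 = 2"
    have "filterlim (z \<circ> r) (at corner) sequentially"
      using xr(3) * right_region_props(3) z by (intro filterlim_atI) auto
    moreover have "((\<lambda>z. - eis_A k z / eis_B k z) \<longlongrightarrow> corner) (at corner)"
      using eis_ratio_tendsto_corner[OF k] * by simp
    ultimately have "(\<lambda>n. - eis_A k ((z \<circ> r) n) / eis_B k ((z \<circ> r) n)) \<longlonglongrightarrow> corner"
      by (rule filterlim_compose[rotated])
    moreover have "- eis_A k ((z \<circ> r) n) / eis_B k ((z \<circ> r) n) = of_real (u (r n))" for n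
    proof -
      have "z (r n) \<in> right_region" using z by blast
      hence "eis_B k (z (r n)) \<noteq> 0" using right_region_props[of "z (r n)"] by (intro eis_B_nonzero k) (auto simp: half_strip_def)
      thus ?thesis using minus_unique[OF eq[of "r n"]] by simp
    qed
    ultimately have "(\<lambda>n. complex_of_real (u (r n))) \<longlonglongrightarrow> corner" by simp
    from tendsto_Im[OF this] show False by (simp add: LIMSEQ_const_iff)
  qed
  hence Ap: "Re (eis_A k x) > 0" using eis_A_pos[OF xh k] by blast
  have "\<not> (Re x = 0 \<or> Re x = 1 / 2)"
  proof
    assume "Re x = 0 \<or> Re x = 1 / 2"
    from eis_B_imaginary[OF xp k(2) this] have "Re (eis_A k x + of_real u0 * eis_B k x) = Re (eis_A k x)" by simp
    thus False using lim0 Ap by simp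
  qed
  hence "x \<in> right_region" using xh x1 xp by (intro right_regionI) (auto simp: half_strip_def)
  thus ?thesis using that xr lim0 by blast
qed

section \<open>Counting solutions\<close>

lemma eis_right_nonzero:
  assumes z: "z \<in> right_region" and k: "even k" "k \<ge> 4"
  shows "eis_A k z \<noteq> 0" "eis_B k z \<noteq> 0"
proof -
  note p = right_region_props[OF z]
  have "Re (eis_A k z) > 0" by (rule eis_A_pos[OF p(2) k]) (use p in auto)
  thus "eis_A k z \<noteq> 0" by auto
  show "eis_B k z \<noteq> 0" using p by (intro eis_B_nonzero k) (auto simp: half_strip_def)
qed

text \<open>The last clause fixes the branch, which gives the index j of a level an absolute
  meaning.\<close>

definition ratio_log :: "nat \<Rightarrow> (complex \<Rightarrow> complex) \<Rightarrow> bool" where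
  "ratio_log k l \<longleftrightarrow> l holomorphic_on right_region \<and>
     (\<forall>z\<in>right_region. exp (l z) = - eis_A k z / eis_B k z) \<and>
     (\<forall>\<theta>. pi / 3 < \<theta> \<longrightarrow> \<theta> < pi / 2 \<longrightarrow> l (cis \<theta>) = \<i> * of_real (arc_angle k \<theta>))"

text \<open>Along the arc any logarithm differs from i times \<open>arc_angle\<close> by a
  continuous function with values in the multiples of 2 pi i, hence by a constant that can be
  subtracted.\<close>

lemma ratio_log_exists:
  assumes k: "even k" "k \<ge> 4"
  obtains l where "ratio_log k l"
proof -
  let ?I = "{pi / 3<..<pi / 2}"
  have sub: "right_region \<subseteq> {z. Im z > 0}" using right_region_props(1) by blast
  have "(\<lambda>z. - eis_A k z / eis_B k z) holomorphic_on right_region"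
    by (intro holomorphic_on_divide holomorphic_on_minus eis_holomorphic[OF k, THEN holomorphic_on_subset] sub eis_right_nonzero k)
  moreover have "contractible right_region" by (rule convex_imp_contractible[OF convex_right_region])
  moreover have "- eis_A k z / eis_B k z \<noteq> 0" if "z \<in> right_region" for z using eis_right_nonzero[OF that k] by simp
  ultimately obtain g where g: "g holomorphic_on right_region" "\<And>z. z \<in> right_region \<Longrightarrow> - eis_A k z / eis_B k z = exp (g z)"
    using contractible_imp_holomorphic_log by (metis (no_types, lifting))
  define f where "f = (\<lambda>\<theta>. g (cis \<theta>) - \<i> * of_real (arc_angle k \<theta>))"
  have fN: "\<exists>n::int. f \<theta> = of_int (2 * n) * of_real pi * \<i>" if "\<theta> \<in> ?I" for \<theta>
  proof -
    have "exp (g (cis \<theta>)) = exp (\<i> * of_real (arc_angle k \<theta>))"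
      using g(2)[OF cis_in_right_region] arc_angle_props(1)[of \<theta> k] that k by auto
    thus ?thesis unfolding exp_eq f_def by auto
  qed
  have "f constant_on ?I"
  proof (rule continuous_discrete_range_constant)
    show "continuous_on ?I f"
      unfolding f_def
    proof (intro continuous_intros continuous_on_compose2[OF holomorphic_on_imp_continuous_on[OF g(1)]])
      show "continuous_on ?I (arc_angle k)"
        by (intro continuous_at_imp_continuous_on ballI arc_angle_props k) auto
    qed (use cis_in_right_region in auto)
    fix \<theta> assume \<theta>: "\<theta> \<in> ?I"
    obtain n :: int where n: "f \<theta> = of_int (2 * n) * of_real pi * \<i>" using fN[OF \<theta>] by blast
    show "\<exists>e>0. \<forall>y. y \<in> ?I \<and> f y \<noteq> f \<theta> \<longrightarrow> e \<le> norm (f y - f \<theta>)"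
    proof (intro exI[of _ 1] conjI allI impI)
      fix y assume y: "y \<in> ?I \<and> f y \<noteq> f \<theta>"
      obtain m :: int where m: "f y = of_int (2 * m) * of_real pi * \<i>" using fN y by blast
      have "m \<noteq> n" using y m n by auto
      hence "1 \<le> \<bar>real_of_int (m - n)\<bar>" by linarith
      hence "1 * 1 \<le> \<bar>real_of_int (m - n)\<bar> * (2 * pi)" using pi_gt3 by (intro mult_mono) auto
      moreover have "f y - f \<theta> = of_real (real_of_int (m - n) * (2 * pi)) * \<i>" by (simp add: m n algebra_simps)
      hence "norm (f y - f \<theta>) = \<bar>real_of_int (m - n)\<bar> * (2 * pi)" by (simp only: norm_mult norm_of_real norm_ii abs_mult) simp
      ultimately show "1 \<le> norm (f y - f \<theta>)" by simp
    qed simp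
  qed (rule connected_Ioo)
  then obtain v where v: "\<And>\<theta>. \<theta> \<in> ?I \<Longrightarrow> f \<theta> = v" by (auto simp: constant_on_def)
  have "5 * pi / 12 \<in> ?I" by simp
  then obtain N :: int where N: "v = of_int (2 * N) * of_real pi * \<i>" using fN v by metis
  define l where "l = (\<lambda>z. g z - of_int (2 * N) * of_real pi * \<i>)"
  have "ratio_log k l"
    unfolding ratio_log_def
  proof (intro conjI ballI allI impI)
    show "l holomorphic_on right_region" unfolding l_def by (intro holomorphic_intros g)
    show "exp (l z) = - eis_A k z / eis_B k z" if "z \<in> right_region" for z
    proof -
      have "exp (l z) = exp (g z)" unfolding exp_eq l_def by (rule exI[of _ "- N"]) simp
      thus ?thesis using g(2)[OF that] by simp
    qed
    show "l (cis \<theta>) = \<i> * of_real (arc_angle k \<theta>)" if "pi / 3 < \<theta>" "\<theta> < pi / 2" for \<theta>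
      using v[of \<theta>] that N by (simp add: f_def l_def algebra_simps)
  qed
  thus ?thesis by (rule that)
qed

lemma ratio_log_real:
  assumes l: "ratio_log k l" and z: "z \<in> right_region" and k: "even k" "k \<ge> 4" and lz: "l z = Complex t (of_int j * pi)"
  shows "eis_A k z + of_real (exp t * cos (of_int j * pi)) * eis_B k z = 0"
proof -
  have "exp (l z) = - eis_A k z / eis_B k z" using l z by (auto simp: ratio_log_def)
  moreover have "sin (of_int j * pi) = 0" by (metis mult.commute sin_npi_int)
  hence "exp (l z) = of_real (exp t * cos (of_int j * pi))" unfolding lz by (simp add: complex_eq_iff Re_exp Im_exp)
  ultimately have "- eis_A k z = of_real (exp t * cos (of_int j * pi)) * eis_B k z"
    using eis_right_nonzero[OF z k] by (simp add: field_simps)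
  thus ?thesis by (simp add: eq_neg_iff_add_eq_0[symmetric] minus_equation_iff[of "eis_A k z"])
qed

text \<open>Constancy of l contradicts the cusp, where B tends to 0 and A does not. If every
  negative t had a solution, letting t tend to minus infinity would produce a zero of A in the
  region.\<close>

lemma ratio_log_arc_sheet:
  assumes l: "ratio_log k l" and k: "even k" "k \<ge> 4"
  shows "arc_sheet right_region l (of_int j * pi)"
proof
  have hol: "l holomorphic_on right_region" and ex: "\<And>z. z \<in> right_region \<Longrightarrow> exp (l z) = - eis_A k z / eis_B k z"
    using l by (auto simp: ratio_log_def)
  show "open right_region" by (rule open_right_region)
  show "connected right_region" by (rule convex_connected[OF convex_right_region])
  show "l holomorphic_on right_region" by (rule hol)
  show "\<not> l constant_on right_region"
  proof
    assume "l constant_on right_region"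
    then obtain v where v: "\<And>z. z \<in> right_region \<Longrightarrow> l z = v" by (auto simp: constant_on_def)
    define e where "e = 1 / (2 * norm (exp v))"
    have Z: "zeta_nat k \<ge> 1" using k by (intro zeta_nat_ge_1) auto
    have "\<forall>\<^sub>F z in cusp. norm (eis_A k z) > 1 / 2"
      by (rule order_tendstoD(1)[OF tendsto_norm[OF eis_cusp(1)[OF k]]]) (use Z in simp)
    moreover have "\<forall>\<^sub>F z in cusp. norm (eis_B k z) < e"
      by (rule order_tendstoD(2)[OF tendsto_norm[OF eis_cusp(2)[OF k]]]) (simp add: e_def)
    ultimately have "\<forall>\<^sub>F z in cusp. norm (eis_A k z) > 1 / 2 \<and> norm (eis_B k z) < e"
      by (rule eventually_conj)
    then obtain Y where Y: "\<And>z. Im z \<ge> Y \<Longrightarrow> \<bar>Re z\<bar> \<le> 1 / 2 \<Longrightarrow> norm (eis_A k z) > 1 / 2 \<and> norm (eis_B k z) < e"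
      unfolding eventually_cusp by blast
    define z where "z = Complex (1 / 4) (max Y 2)"
    have "sqrt 3 \<le> sqrt 4" by (rule real_sqrt_le_mono) simp
    hence z: "z \<in> right_region" by (simp add: right_region_def z_def)
    have "exp v = - eis_A k z / eis_B k z" using ex[OF z] v[OF z] by simp
    hence "norm (eis_A k z) = norm (exp v) * norm (eis_B k z)"
      using eis_right_nonzero[OF z k] by (simp add: norm_divide)
    also have "\<dots> \<le> norm (exp v) * e" using Y[of z] by (intro mult_left_mono) (auto simp: z_def)
    also have "\<dots> = 1 / 2" by (simp add: e_def)
    finally show False using Y[of z] by (simp add: z_def)
  qed
  show "Re (l z) = 0" if z: "z \<in> right_region" "norm z = 1" for z
  proof -
    have "norm (exp (l z)) = 1"
      using ex[OF z(1)] eis_arc(2)[OF z(2) right_region_props(1)[OF z(1)] k(2)] eis_right_nonzero[OF z(1) k]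
      by (simp add: norm_divide)
    thus ?thesis by simp
  qed
  show "\<exists>x r. strict_mono (r :: nat \<Rightarrow> nat) \<and> (z \<circ> r) \<longlonglongrightarrow> x \<and> x \<in> right_region"
    if z: "\<And>n. z n \<in> right_region \<and> 1 \<le> norm (z n) \<and> l (z n) = Complex (t n) (of_int j * pi)" and t: "t \<longlonglongrightarrow> t0" for z t t0
  proof -
    have "(\<lambda>n. exp (t n) * cos (of_int j * pi)) \<longlonglongrightarrow> exp t0 * cos (of_int j * pi)" by (intro tendsto_intros t)
    moreover have "eis_A k (z n) + of_real (exp (t n) * cos (of_int j * pi)) * eis_B k (z n) = 0" for n
      by (rule ratio_log_real[OF l _ k]) (use z in auto)
    ultimately show ?thesis using right_region_convergent_subseq[OF k, of z] z by metis
  qed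
  show "\<exists>t<0. \<forall>z\<in>right_region. 1 \<le> norm z \<longrightarrow> l z \<noteq> Complex t (of_int j * pi)"
  proof (rule ccontr)
    assume "\<not> ?thesis"
    hence "\<exists>z. z \<in> right_region \<and> 1 \<le> norm z \<and> l z = Complex (- real (Suc n)) (of_int j * pi)" for n
      by (metis neg_less_0_iff_less of_nat_0_less_iff zero_less_Suc)
    then obtain z where z: "\<And>n. z n \<in> right_region \<and> 1 \<le> norm (z n) \<and> l (z n) = Complex (- real (Suc n)) (of_int j * pi)"
      by metis
    have "(\<lambda>n. exp (- real (Suc n))) \<longlonglongrightarrow> 0"
      by (rule filterlim_compose[OF exp_at_bot])
        (simp add: filterlim_uminus_at_top[symmetric] filterlim_compose[OF filterlim_real_sequentially filterlim_Suc] del: of_nat_Suc)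
    hence "(\<lambda>n. exp (- real (Suc n)) * cos (of_int j * pi)) \<longlonglongrightarrow> 0 * cos (of_int j * pi)" by (intro tendsto_intros)
    moreover have "eis_A k (z n) + of_real (exp (- real (Suc n)) * cos (of_int j * pi)) * eis_B k (z n) = 0" for n
      by (rule ratio_log_real[OF l _ k]) (use z in auto)
    ultimately obtain x where "x \<in> right_region" "eis_A k x + of_real (0 * cos (of_int j * pi)) * eis_B k x = 0"
      using right_region_convergent_subseq[OF k, of z] z by metis
    thus False using eis_right_nonzero[of x k] k by simp
  qed
qed

definition ratio_level :: "(complex \<Rightarrow> complex) \<Rightarrow> int \<Rightarrow> real \<Rightarrow> complex set" where
  "ratio_level l j t = {z \<in> right_region. 1 \<le> norm z \<and> l z = Complex t (of_int j * pi)}"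

text \<open>At a point of the level, Im l has derivative z l'(z) > 0 with respect to the angle, so
  it crosses j pi upwards and at most once. Near the two ends of the arc it lies between J pi and (J
  + 1) pi, respectively between J' pi and (J' + 1) pi, which forces a crossing exactly for J < j <=
  J'.\<close>

lemma ratio_level_zero:
  assumes l: "ratio_log k l" and k: "even k" "k \<ge> 4"
  shows "z \<in> ratio_level l j 0 \<Longrightarrow> norm z = 1"
    and "j \<in> {int (Suc k div 3) + 1<..int (k div 2) + 1} \<Longrightarrow> \<exists>z. ratio_level l j 0 = {z}"
    and "j \<notin> {int (Suc k div 3) + 1<..int (k div 2) + 1} \<Longrightarrow> ratio_level l j 0 = {}"
proof -
  interpret arc_sheet right_region l "of_int j * pi" by (rule ratio_log_arc_sheet[OF l k])
  have lev: "ratio_level l j t = lev t" for t by (simp add: ratio_level_def lev_def)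
  show "z \<in> ratio_level l j 0 \<Longrightarrow> norm z = 1" unfolding lev by (rule lev_0_norm)
  define J J' where "J = int (Suc k div 3) + 1" and "J' = int (k div 2) + 1"
  let ?I = "{pi / 3<..<pi / 2}"
  define a where "a = arc_angle k"
  have la: "l (cis \<theta>) = \<i> * of_real (a \<theta>)" if "\<theta> \<in> ?I" for \<theta>
    using l that by (auto simp: ratio_log_def a_def)
  have in_lev: "cis \<theta> \<in> lev 0 \<longleftrightarrow> a \<theta> = of_int j * pi" if "\<theta> \<in> ?I" for \<theta>
    using la[OF that] cis_in_right_region[of \<theta>] that by (auto simp: lev_def complex_eq_iff)
  have lev_eq: "lev 0 = cis ` {\<theta> \<in> ?I. a \<theta> = of_int j * pi}"
  proof (intro equalityI subsetI)
    fix z assume z: "z \<in> lev 0"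
    have "z \<in> right_region" "norm z = 1" using lev_0_norm[OF z] z by (simp_all add: lev_def)
    then obtain \<theta> where "pi / 3 < \<theta>" "\<theta> < pi / 2" "z = cis \<theta>" by (rule right_region_arc)
    thus "z \<in> cis ` {\<theta> \<in> ?I. a \<theta> = of_int j * pi}" using in_lev[of \<theta>] z by auto
  qed (use in_lev in auto)
  have cont: "continuous_on ?I a" unfolding a_def
    by (intro continuous_at_imp_continuous_on ballI arc_angle_props k) auto
  have der: "\<exists>r>0. (a has_real_derivative r) (at \<theta>)" if \<theta>: "\<theta> \<in> ?I" "a \<theta> = of_int j * pi" for \<theta>
  proof -
    have "cis \<theta> \<in> lev 0" using in_lev \<theta> by blast
    then obtain r where r: "r > 0" "cis \<theta> * deriv l (cis \<theta>) = of_real r" by (rule lev_0_deriv)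
    have "(cis has_vector_derivative \<i> * cis \<theta>) (at \<theta>)"
      using has_derivative_cis[OF has_derivative_ident, of \<theta> UNIV] by (simp add: has_vector_derivative_def)
    moreover have "(l has_field_derivative deriv l (cis \<theta>)) (at (cis \<theta>))"
      using cis_in_right_region[of \<theta>] \<theta> holomorphic_derivI[OF hol open_W] by auto
    ultimately have "((l \<circ> cis) has_vector_derivative (\<i> * cis \<theta> * deriv l (cis \<theta>))) (at \<theta>)"
      by (rule field_vector_diff_chain_at)
    also have "\<i> * cis \<theta> * deriv l (cis \<theta>) = \<i> * of_real r" by (simp only: mult.assoc r(2))
    finally have "((\<lambda>t. Im ((l \<circ> cis) t)) has_vector_derivative Im (\<i> * of_real r)) (at \<theta>)"
      by (rule bounded_linear.has_vector_derivative[OF bounded_linear_Im])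
    hence "((\<lambda>t. Im ((l \<circ> cis) t)) has_real_derivative r) (at \<theta>)"
      by (simp add: has_real_derivative_iff_has_vector_derivative)
    hence "(a has_real_derivative r) (at \<theta>)"
      by (rule has_field_derivative_transform_within_open[of _ _ _ ?I]) (use \<theta> la in auto)
    thus ?thesis using r by blast
  qed
  note up = upcrossing[OF cont, of "of_int j * pi"] and up' = upcrossing'[OF cont, of "of_int j * pi"]
  have uniq: "x = y" if "x \<in> ?I" "a x = of_int j * pi" "y \<in> ?I" "a y = of_int j * pi" for x y
  proof (rule ccontr)
    assume "x \<noteq> y"
    then consider "x < y" | "y < x" by linarith
    thus False
    proof cases
      case 1
      from up[OF der that(1,2,3) 1] that(4) show False by simp
    next
      case 2
      from up[OF der that(3,4,1) 2] that(2) show False by simp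
    qed
  qed
  have evI: "\<forall>\<^sub>F \<theta> in at_right (pi / 3). \<theta> \<in> {pi / 3<..<b}" if "pi / 3 < b" for b by (rule eventually_at_right_real) (rule that)
  have evI': "\<forall>\<^sub>F \<theta> in at_left (pi / 2). \<theta> \<in> {b<..<pi / 2}" if "b < pi / 2" for b by (rule eventually_at_left_real) (rule that)
  have ex1: "\<exists>\<theta>\<in>?I. \<theta> < b \<and> real_of_int J * pi < a \<theta> \<and> a \<theta> < (real_of_int J + 1) * pi" if "pi / 3 < b" "b \<le> pi / 2" for b
    using eventually_happens'[OF _ eventually_conj[OF evI[OF that(1)] arc_angle_at_corner[OF k J_def]]] that
    by (force simp: a_def)
  have ex2: "\<exists>\<theta>\<in>?I. b < \<theta> \<and> real_of_int J' * pi < a \<theta> \<and> a \<theta> < (real_of_int J' + 1) * pi" if "pi / 3 \<le> b" "b < pi / 2" for b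
    using eventually_happens'[OF _ eventually_conj[OF evI'[OF that(2)] arc_angle_at_i[OF k J'_def]]] that
    by (force simp: a_def)
  show "j \<in> {int (Suc k div 3) + 1<..int (k div 2) + 1} \<Longrightarrow> \<exists>z. ratio_level l j 0 = {z}"
  proof -
    assume "j \<in> {int (Suc k div 3) + 1<..int (k div 2) + 1}"
    hence j: "J + 1 \<le> j" "j \<le> J'" by (auto simp: J_def J'_def)
    obtain x where x: "x \<in> ?I" "a x < (real_of_int J + 1) * pi" using ex1[of "pi / 2"] by auto
    obtain y where y: "y \<in> ?I" "x < y" "real_of_int J' * pi < a y" using ex2[of x] x by auto
    have "(real_of_int J + 1) * pi \<le> of_int j * pi" "of_int j * pi \<le> real_of_int J' * pi"
      using j by (intro mult_right_mono; simp; linarith)+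
    hence "a x \<le> of_int j * pi" "of_int j * pi \<le> a y" using x y by linarith+
    moreover have "continuous_on {x..y} a" by (rule continuous_on_subset[OF cont]) (use x y in auto)
    ultimately obtain t where t: "x \<le> t" "t \<le> y" "a t = of_int j * pi" using IVT'[of a x "of_int j * pi" y] y by auto
    hence "t \<in> ?I" using x y by auto
    hence "{\<theta> \<in> ?I. a \<theta> = of_int j * pi} = {t}" using uniq t by auto
    thus ?thesis unfolding lev lev_eq by auto
  qed
  show "j \<notin> {int (Suc k div 3) + 1<..int (k div 2) + 1} \<Longrightarrow> ratio_level l j 0 = {}"
  proof (rule ccontr)
    assume j: "j \<notin> {int (Suc k div 3) + 1<..int (k div 2) + 1}" and "ratio_level l j 0 \<noteq> {}"
    then obtain t where t: "t \<in> ?I" "a t = of_int j * pi" unfolding lev lev_eq by auto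
    obtain x where x: "x \<in> ?I" "x < t" "real_of_int J * pi < a x" using ex1[of t] t by auto
    obtain y where y: "y \<in> ?I" "t < y" "a y < (real_of_int J' + 1) * pi" using ex2[of t] t by auto
    have "a x < of_int j * pi" by (rule up'[OF der t x(1,2)])
    moreover have "of_int j * pi < a y" by (rule up[OF der t y(1,2)])
    ultimately have "real_of_int J * pi < real_of_int j * pi" "real_of_int j * pi < (real_of_int J' + 1) * pi" using x y by linarith+
    hence "J < j" "j < J' + 1" by simp_all
    thus False using j by (auto simp: J_def J'_def)
  qed
qed

definition right_solutions :: "nat \<Rightarrow> real \<Rightarrow> complex set" where
  "right_solutions k c = {z. 0 < Re z \<and> Re z < 1 / 2 \<and> Im z > 0 \<and> 1 \<le> norm z \<and>
     (eis_A k z = of_real c * eis_B k z \<or> eis_A k z = - (of_real c * eis_B k z))}"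

lemma right_solutions_eq:
  assumes l: "ratio_log k l" and k: "even k" "k \<ge> 4" and c: "c \<noteq> 0"
  shows "right_solutions k c = (\<Union>j. ratio_level l j (ln \<bar>c\<bar>))"
proof (intro equalityI subsetI)
  fix z assume z: "z \<in> right_solutions k c"
  hence W: "z \<in> right_region" "1 \<le> norm z" using right_regionI by (auto simp: right_solutions_def)
  note nz = eis_right_nonzero[OF W(1) k]
  have "- eis_A k z / eis_B k z = of_real c \<or> - eis_A k z / eis_B k z = of_real (- c)"
    using z nz by (auto simp: right_solutions_def)
  moreover have "exp (l z) = - eis_A k z / eis_B k z" using l W by (auto simp: ratio_log_def)
  ultimately obtain b where b: "exp (l z) = of_real b" "\<bar>b\<bar> = \<bar>c\<bar>" by (metis abs_minus)
  have "exp (Re (l z)) = \<bar>c\<bar>" using arg_cong[OF b(1), of norm] b(2) by simp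
  hence re: "Re (l z) = ln \<bar>c\<bar>" by (metis ln_exp)
  have "Im (exp (l z)) = 0" using b by simp
  hence "sin (Im (l z)) = 0" by (simp add: Im_exp)
  then obtain j :: int where "Im (l z) = of_int j * pi" using sin_zero_iff_int2 by auto
  hence "l z = Complex (ln \<bar>c\<bar>) (of_int j * pi)" using re by (simp add: complex_eq_iff)
  thus "z \<in> (\<Union>j. ratio_level l j (ln \<bar>c\<bar>))" using W by (auto simp: ratio_level_def)
next
  fix z assume "z \<in> (\<Union>j. ratio_level l j (ln \<bar>c\<bar>))"
  then obtain j where W: "z \<in> right_region" "1 \<le> norm z" and lz: "l z = Complex (ln \<bar>c\<bar>) (of_int j * pi)"
    by (auto simp: ratio_level_def)
  have A: "eis_A k z + of_real (exp (ln \<bar>c\<bar>) * cos (of_int j * pi)) * eis_B k z = 0"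
    by (rule ratio_log_real[OF l W(1) k lz])
  have "cos (of_int j * pi) = 1 \<or> cos (of_int j * pi) = -1" using cos_npi_int[of j] by (simp add: mult.commute split: if_splits)
  hence "exp (ln \<bar>c\<bar>) * cos (of_int j * pi) = c \<or> exp (ln \<bar>c\<bar>) * cos (of_int j * pi) = - c" using c by auto
  moreover have "eis_A k z = - (of_real (exp (ln \<bar>c\<bar>) * cos (of_int j * pi)) * eis_B k z)"
    using A by (simp only: eq_neg_iff_add_eq_0)
  ultimately have "eis_A k z = of_real c * eis_B k z \<or> eis_A k z = - (of_real c * eis_B k z)"
    by (elim disjE) (simp_all only: of_real_minus mult_minus_left minus_minus simp_thms)
  thus "z \<in> right_solutions k c" using W right_region_props[OF W(1)] by (auto simp: right_solutions_def)
qed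

lemma right_solutions_empty:
  assumes k: "even k" "k \<ge> 4" and c: "\<bar>c\<bar> < 1"
  shows "right_solutions k c = {}"
proof (cases "c = 0")
  case True
  show ?thesis
  proof (rule equals0I)
    fix z assume z: "z \<in> right_solutions k c"
    hence "z \<in> right_region" by (intro right_regionI) (auto simp: right_solutions_def)
    thus False using eis_right_nonzero(1)[OF _ k] z True by (simp add: right_solutions_def)
  qed
next
  case False
  obtain l where l: "ratio_log k l" by (rule ratio_log_exists[OF k])
  have "ratio_level l j (ln \<bar>c\<bar>) = {}" for j
  proof -
    interpret arc_sheet right_region l "of_int j * pi" by (rule ratio_log_arc_sheet[OF l k])
    show ?thesis using lev_neg[of "ln \<bar>c\<bar>"] c False by (simp add: ratio_level_def lev_def)
  qed
  thus ?thesis unfolding right_solutions_eq[OF l k False] by simp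
qed

text \<open>Each admissible j contributes one point at the height t = ln |c|, and different j give
  different points because Im l differs.\<close>

lemma right_solutions_card:
  assumes k: "even k" "k \<ge> 4" and c: "\<bar>c\<bar> \<ge> 1"
  shows "finite (right_solutions k c)" "card (right_solutions k c) = (k + 2) div 6"
    and "z \<in> right_solutions k c \<Longrightarrow> norm z = 1 \<longleftrightarrow> \<bar>c\<bar> = 1"
proof -
  obtain l where l: "ratio_log k l" by (rule ratio_log_exists[OF k])
  have c0: "c \<noteq> 0" using c by auto
  define t where "t = ln \<bar>c\<bar>"
  have t: "t \<ge> 0" using c by (simp add: t_def)
  define J where "J = {int (Suc k div 3) + 1<..int (k div 2) + 1}"
  have lv: "(j \<in> J \<longrightarrow> (\<exists>z. ratio_level l j t = {z})) \<and> (j \<notin> J \<longrightarrow> ratio_level l j t = {}) \<and>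
     (\<forall>z\<in>ratio_level l j t. norm z = 1 \<longleftrightarrow> t = 0)" for j
  proof -
    interpret arc_sheet right_region l "of_int j * pi" by (rule ratio_log_arc_sheet[OF l k])
    have lev: "ratio_level l j t = lev t" for t by (simp add: ratio_level_def lev_def)
    note z = ratio_level_zero[OF l k, where j = j, folded J_def, unfolded lev]
    show ?thesis
    proof (cases "t = 0")
      case True
      show ?thesis unfolding lev True
        by (intro conjI impI ballI) (erule z(2), erule z(3), simp add: z(1))
    next
      case False
      hence t: "t > 0" using t by simp
      have "\<exists>z. lev t = {z}" if j: "j \<in> J"
      proof -
        obtain z0 where "lev 0 = {z0}" using z(2)[OF j] by blast
        from lev_pos_singleton[OF this t] show ?thesis by metis
      qed
      moreover have "lev t = {}" if "j \<notin> J" using lev_pos_empty[OF z(3)[OF that] t] .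
      moreover have "norm z \<noteq> 1" if "z \<in> lev t" for z using norm_gt_1[OF that False] by simp
      ultimately show ?thesis unfolding lev using False by auto
    qed
  qed
  then obtain f where f: "\<And>j. j \<in> J \<Longrightarrow> ratio_level l j t = {f j}" by metis
  have R: "right_solutions k c = f ` J"
  proof -
    have "right_solutions k c = (\<Union>j. ratio_level l j t)" unfolding t_def by (rule right_solutions_eq[OF l k c0])
    also have "\<dots> = (\<Union>j\<in>J. ratio_level l j t)" using lv by blast
    also have "\<dots> = f ` J" using f by auto
    finally show ?thesis .
  qed
  have inj: "inj_on f J"
  proof (rule inj_onI)
    fix i j assume ij: "i \<in> J" "j \<in> J" "f i = f j"
    hence "f i \<in> ratio_level l i t" "f i \<in> ratio_level l j t" using f by auto
    hence "of_int i * pi = of_int j * pi" by (auto simp: ratio_level_def)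
    thus "i = j" by simp
  qed
  have "finite J" by (simp add: J_def)
  thus "finite (right_solutions k c)" unfolding R by simp
  have "card (right_solutions k c) = card J" unfolding R by (rule card_image[OF inj])
  also have "\<dots> = k div 2 - Suc k div 3" by (simp add: J_def)
  also have "\<dots> = (k + 2) div 6"
  proof -
    obtain h where "k = 2 * h" using k by (auto elim: evenE)
    moreover define q where "q = h div 3"
    have "h = 3 * q \<or> h = 3 * q + 1 \<or> h = 3 * q + 2" unfolding q_def by presburger
    ultimately have "k = 6 * q \<or> k = 6 * q + 2 \<or> k = 6 * q + 4" by auto
    thus ?thesis by (elim disjE; simp)
  qed
  finally show "card (right_solutions k c) = (k + 2) div 6" .
  show "norm z = 1 \<longleftrightarrow> \<bar>c\<bar> = 1" if "z \<in> right_solutions k c"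
  proof -
    have "norm z = 1 \<longleftrightarrow> t = 0" using that lv right_solutions_eq[OF l k c0] by (auto simp: t_def[symmetric])
    thus ?thesis using c by (auto simp: t_def)
  qed
qed

section \<open>Transport to the translates of the fundamental domain\<close>

lemma moebius_int_inj:
  assumes det: "a * d - b * c = (1::int)"
  shows "inj_on (moebius_int a b c d) upper_half_plane"
proof (rule inj_onI)
  fix z w assume zw: "z \<in> upper_half_plane" "w \<in> upper_half_plane" and eq: "moebius_int a b c d z = moebius_int a b c d w"
  define p q where "p = of_int c * z + of_int d" and "q = of_int c * w + of_int d"
  have nz: "p \<noteq> 0" "q \<noteq> 0"
    using moebius_denom_nonzero[OF _ det] zw by (auto simp: p_def q_def upper_half_plane_def)
  have "(of_int a * z + of_int b) / p = (of_int a * w + of_int b) / q" using eq by (simp add: moebius_def p_def q_def)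
  hence "(of_int a * z + of_int b) * q = (of_int a * w + of_int b) * p" using nz by (simp add: frac_eq_eq)
  hence "(of_int a * of_int d - of_int b * of_int c) * (z - w) = 0" by (simp add: p_def q_def algebra_simps)
  moreover have "of_int a * of_int d - of_int b * of_int c = (1 :: complex)" using arg_cong[OF det, of complex_of_int] by simp
  ultimately show "z = w" by simp
qed

lemma moebius_int_holomorphic:
  assumes det: "a * d - b * c = (1::int)" and S: "S \<subseteq> upper_half_plane"
  shows "moebius_int a b c d holomorphic_on S"
proof -
  have "(\<lambda>z. (of_int a * z + of_int b) / (of_int c * z + of_int d)) holomorphic_on S"
    by (intro holomorphic_intros moebius_denom_nonzero[OF _ det]) (use S in \<open>auto simp: upper_half_plane_def\<close>)
  thus ?thesis by (simp add: moebius_def[abs_def])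
qed

text \<open>E' vanishes at the image point iff c A = d B at z. Then E there is a nonzero multiple of
  a A - b B, and c (a A - b B) = (a d - b c) B = B.\<close>

lemma moebius_in_eisenstein_critical_iff:
  assumes z: "Im z > 0" and k: "even k" "k \<ge> 4" and det: "a * d - b * c = (1::int)" and c: "c \<noteq> 0"
  shows "moebius_int a b c d z \<in> eisenstein_critical k \<longleftrightarrow>
    of_int c * eis_A k z = of_int d * eis_B k z \<and> eis_B k z \<noteq> 0"
proof -
  define g where "g = moebius_int a b c d z"
  define J where "J = of_int c * z + of_int d"
  have J: "J \<noteq> 0" unfolding J_def by (rule moebius_denom_nonzero[OF z det])
  have g: "Im g > 0" unfolding g_def by (rule Im_moebius_int_pos[OF z det])
  have B: "eis_B k g = J ^ Suc k * (of_int d * eis_B k z - of_int c * eis_A k z)"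
    and A: "eis_A k g = J ^ Suc k * (of_int a * eis_A k z - of_int b * eis_B k z)"
    unfolding g_def J_def by (rule eis_transform[OF z k(2) det])+
  have Z: "complex_of_real (zeta_nat k) \<noteq> 0" by (rule zeta_nat_nonzero[OF k(2)])
  have "deriv (eisenstein k) g = 0 \<longleftrightarrow> eis_B k g = 0" using deriv_eisenstein[OF g k] Z k by simp
  moreover have "eis_B k g = 0 \<longleftrightarrow> of_int c * eis_A k z = of_int d * eis_B k z" unfolding B using J by auto
  moreover have "eisenstein k g \<noteq> 0 \<longleftrightarrow> eis_B k z \<noteq> 0" if eq: "of_int c * eis_A k z = of_int d * eis_B k z"
  proof -
    have "eis_B k g = 0" unfolding B using eq by simp
    hence "eisenstein k g \<noteq> 0 \<longleftrightarrow> eis_A k g \<noteq> 0" using eisenstein_lattice(1)[OF g k] Z by auto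
    also have "\<dots> \<longleftrightarrow> of_int c * (of_int a * eis_A k z - of_int b * eis_B k z) \<noteq> 0" unfolding A using J c by simp
    also have "of_int c * (of_int a * eis_A k z - of_int b * eis_B k z) = of_int (a * d - b * c) * eis_B k z"
    proof -
      have "of_int c * (of_int a * eis_A k z - of_int b * eis_B k z) = of_int a * (of_int c * eis_A k z) - of_int b * of_int c * eis_B k z"
        by (simp add: algebra_simps)
      thus ?thesis unfolding eq by (simp add: algebra_simps)
    qed
    finally show ?thesis unfolding det by simp
  qed
  ultimately show ?thesis using g unfolding g_def[symmetric] by (auto simp: eisenstein_critical_def upper_half_plane_def)
qed

text \<open>x stands for d / c. The condition on B expresses that E does not vanish at the image
  point; for k mod 6 = 2 it removes the corner.\<close>

definition domain_solutions :: "nat \<Rightarrow> real \<Rightarrow> complex set" where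
  "domain_solutions k x = {z \<in> fund_domain. eis_A k z = of_real x * eis_B k z \<and> eis_B k z \<noteq> 0}"

text \<open>A is a real multiple of B, whereas on Re z = 0 and Re z = 1/2 the value of B is purely
  imaginary and Re A > 0.\<close>

lemma domain_solutions_right:
  assumes k: "even k" "k \<ge> 4" and z: "z \<in> domain_solutions k x" "Re z \<ge> 0"
  shows "z \<in> right_region"
proof -
  have zp: "Im z > 0" "Re z \<le> 1 / 2" "norm z \<ge> 1" "eis_A k z = of_real x * eis_B k z" "eis_B k z \<noteq> 0"
    using z by (auto simp: domain_solutions_def fund_domain_def upper_half_plane_def)
  have "1 \<le> (Re z) ^ 2 + (Im z) ^ 2" using power_mono[OF zp(3), of 2] by (simp add: cmod_power2)
  moreover have "(Re z) ^ 2 \<le> (1 / 2) ^ 2" using z zp by (intro power_mono) auto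
  ultimately have "(sqrt 3 / 2) ^ 2 \<le> (Im z) ^ 2" by (simp add: power_divide)
  hence "sqrt 3 / 2 \<le> Im z" by (rule power2_le_imp_le) (use zp in simp)
  hence h: "z \<in> half_strip" using z zp by (simp add: half_strip_def)
  have "z \<noteq> corner \<or> k mod 6 \<noteq> 2" using eis_corner_zero[of k] k zp by auto
  hence "Re (eis_A k z) > 0" by (rule eis_A_pos[OF h k])
  hence "Re (eis_B k z) \<noteq> 0" using zp by auto
  hence "\<not> (Re z = 0 \<or> Re z = 1 / 2)" using eis_B_imaginary[OF zp(1) k(2)] by blast
  thus ?thesis using z zp by (intro right_regionI) auto
qed

lemma domain_solutions_reflect:
  assumes "z \<in> domain_solutions k x" "k \<ge> 4"
  shows "- cnj z \<in> domain_solutions k (- x)"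
proof -
  have z: "Im z > 0" using assms by (auto simp: domain_solutions_def fund_domain_def upper_half_plane_def)
  have "cnj (eis_A k z) = of_real x * cnj (eis_B k z)" using assms by (simp add: domain_solutions_def)
  thus ?thesis using assms eis_reflect[OF z assms(2)]
    by (auto simp: domain_solutions_def fund_domain_def upper_half_plane_def)
qed

text \<open>The domain is folded along the imaginary axis. Two points can be identified only if one
  point solves the equation for both x and - x, which would force A = 0.\<close>

lemma domain_solutions_bij:
  assumes k: "even k" "k \<ge> 4"
  shows "bij_betw (\<lambda>z. if Re z \<ge> 0 then z else - cnj z) (domain_solutions k x) (right_solutions k x)"
    (is "bij_betw ?f _ _")
  unfolding bij_betw_def
proof
  have left: "- cnj z \<in> right_region" if "z \<in> domain_solutions k x" "\<not> Re z \<ge> 0" for z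
    using domain_solutions_right[OF k domain_solutions_reflect[OF that(1) k(2)]] that by simp
  have right: "z \<in> right_region" if "z \<in> domain_solutions k x" "Re z \<ge> 0" for z
    using domain_solutions_right[OF k that] .
  have no: False if "z \<in> domain_solutions k x" "z \<in> domain_solutions k (- x)" "Re z \<ge> 0" for z
  proof -
    have "eis_A k z = 0" using that by (auto simp: domain_solutions_def)
    thus False using eis_right_nonzero(1)[OF right[OF that(1,3)] k] by blast
  qed
  show "inj_on ?f (domain_solutions k x)"
  proof (rule inj_onI)
    fix z w assume zw: "z \<in> domain_solutions k x" "w \<in> domain_solutions k x" and eq: "?f z = ?f w"
    note r = domain_solutions_reflect[OF zw(1) k(2)] domain_solutions_reflect[OF zw(2) k(2)]
    show "z = w"
    proof (cases "Re z \<ge> 0"; cases "Re w \<ge> 0")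
      assume "Re z \<ge> 0" "\<not> Re w \<ge> 0"
      thus ?thesis using eq no[OF zw(1)] r by auto
    next
      assume "\<not> Re z \<ge> 0" "Re w \<ge> 0"
      thus ?thesis using eq no[OF zw(2)] r by auto
    qed (use eq in auto)
  qed
  have sub: "z \<in> domain_solutions k x' \<and> Re z \<ge> 0"
    if "z \<in> right_region" "1 \<le> norm z" "eis_A k z = of_real x' * eis_B k z" for z x'
    using that right_region_props[OF that(1)] eis_right_nonzero[OF that(1) k]
    by (auto simp: domain_solutions_def fund_domain_def upper_half_plane_def)
  show "?f ` domain_solutions k x = right_solutions k x"
  proof (intro equalityI subsetI)
    fix w assume "w \<in> ?f ` domain_solutions k x"
    then obtain z where z: "z \<in> domain_solutions k x" "w = ?f z" by blast
    have "w \<in> right_region \<and> w \<in> domain_solutions k x \<or> w \<in> right_region \<and> w \<in> domain_solutions k (- x)"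
      using z left right domain_solutions_reflect[OF z(1) k(2)] by auto
    thus "w \<in> right_solutions k x"
      using right_region_props[of w] by (auto simp: right_solutions_def domain_solutions_def fund_domain_def)
  next
    fix w assume w: "w \<in> right_solutions k x"
    hence wW: "w \<in> right_region" "1 \<le> norm w" by (auto intro!: right_regionI simp: right_solutions_def)
    from w consider "eis_A k w = of_real x * eis_B k w" | "eis_A k w = of_real (- x) * eis_B k w"
      by (auto simp: right_solutions_def)
    thus "w \<in> ?f ` domain_solutions k x"
    proof cases
      case 1
      thus ?thesis using sub[OF wW 1] by (intro image_eqI[of _ _ w]) auto
    next
      case 2
      have "- cnj w \<in> domain_solutions k x"
        using domain_solutions_reflect[of w k "- x"] sub[OF wW 2] k by simp
      moreover have "w = ?f (- cnj w)" using right_region_props[OF wW(1)] by simp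
      ultimately show ?thesis by blast
    qed
  qed
qed

lemma domain_solutions_props:
  assumes k: "even k" "k \<ge> 4"
  shows "\<bar>x\<bar> < 1 \<Longrightarrow> domain_solutions k x = {}"
    and "\<bar>x\<bar> \<ge> 1 \<Longrightarrow> finite (domain_solutions k x)"
    and "\<bar>x\<bar> \<ge> 1 \<Longrightarrow> card (domain_solutions k x) = (k + 2) div 6"
    and "\<bar>x\<bar> \<ge> 1 \<Longrightarrow> z \<in> domain_solutions k x \<Longrightarrow> \<bar>Re z\<bar> < 1 / 2 \<and> (norm z = 1 \<longleftrightarrow> \<bar>x\<bar> = 1)"
proof -
  note bij = domain_solutions_bij[OF k, of x]
  show "domain_solutions k x = {}" if "\<bar>x\<bar> < 1"
    using bij_betw_imp_surj_on[OF bij] right_solutions_empty[OF k that] by (simp only: image_is_empty)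
  show "finite (domain_solutions k x)" if "\<bar>x\<bar> \<ge> 1"
    using bij_betw_finite[OF bij] right_solutions_card(1)[OF k that] by simp
  show "card (domain_solutions k x) = (k + 2) div 6" if "\<bar>x\<bar> \<ge> 1"
    using bij_betw_same_card[OF bij] right_solutions_card(2)[OF k that] by simp
  show "\<bar>Re z\<bar> < 1 / 2 \<and> (norm z = 1 \<longleftrightarrow> \<bar>x\<bar> = 1)" if x: "\<bar>x\<bar> \<ge> 1" and z: "z \<in> domain_solutions k x"
  proof -
    define w where "w = (if Re z \<ge> 0 then z else - cnj z)"
    have w: "w \<in> right_solutions k x" using bij_betw_apply[OF bij z] by (simp add: w_def)
    have "norm w = norm z" "\<bar>Re w\<bar> = \<bar>Re z\<bar>" by (auto simp: w_def)
    moreover have "\<bar>Re w\<bar> < 1 / 2" using w by (auto simp: right_solutions_def)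
    ultimately show ?thesis using right_solutions_card(3)[OF k x w] by simp
  qed
qed

lemma fund_arcI:
  assumes "norm z = 1" "Im z > 0" "\<bar>Re z\<bar> < 1 / 2"
  shows "z \<in> fund_arc"
proof -
  have ze: "z = cis (Arg z)" using assms rcis_cmod_Arg[of z] by (simp add: rcis_def)
  have A: "0 < Arg z" "Arg z < pi" using assms(2) Arg_lt_pi[of z] by auto
  have c: "cos (Arg z) = Re z" using arg_cong[OF ze, of Re] by simp
  have "cos (pi / 3) > cos (Arg z)" using c assms by (simp add: cos_60)
  hence "pi / 3 < Arg z" using A by (subst (asm) cos_mono_less_eq) auto
  moreover have "cos (Arg z) > cos (2 * pi / 3)" using c assms by (simp add: cos_120)
  hence "Arg z < 2 * pi / 3" using A by (subst (asm) cos_mono_less_eq) auto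
  ultimately show ?thesis using ze by (auto simp: fund_arc_def cis_conv_exp)
qed

theorem theorem5:
  fixes k :: nat and a b c d :: int
  assumes "k \<ge> 4" and "even k"
    and "a * d - b * c = 1" and "c \<noteq> 0"
  shows "(\<bar>d\<bar> < \<bar>c\<bar> \<longrightarrow>
            eisenstein_critical k \<inter> moebius_int a b c d ` fund_domain = {}) \<and>
         (\<bar>d\<bar> \<ge> \<bar>c\<bar> \<longrightarrow>
            finite (eisenstein_critical k \<inter> moebius_int a b c d ` fund_domain) \<and>
            card (eisenstein_critical k \<inter> moebius_int a b c d ` fund_domain) = (k + 2) div 6 \<and>
            (\<bar>d\<bar> \<noteq> \<bar>c\<bar> \<longrightarrow>
               eisenstein_critical k \<inter> moebius_int a b c d ` fund_domain
                 \<subseteq> interior (moebius_int a b c d ` fund_domain)) \<and>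
            (\<bar>d\<bar> = \<bar>c\<bar> \<longrightarrow>
               eisenstein_critical k \<inter> moebius_int a b c d ` fund_domain
                 \<subseteq> moebius_int a b c d ` fund_arc))"
proof -
  note k = assms(2,1) and det = assms(3)
  define x where "x = real_of_int d / real_of_int c"
  define S where "S = domain_solutions k x"
  let ?g = "moebius_int a b c d"
  have dom: "fund_domain \<subseteq> upper_half_plane" by (auto simp: fund_domain_def)
  have sol: "of_int c * eis_A k z = of_int d * eis_B k z \<longleftrightarrow> eis_A k z = of_real x * eis_B k z" for z
    using assms(4) by (simp add: x_def field_simps)
  have crit: "eisenstein_critical k \<inter> ?g ` fund_domain = ?g ` S"
    unfolding S_def domain_solutions_def
    using moebius_in_eisenstein_critical_iff[OF _ k det assms(4)] dom sol
    by (auto simp: upper_half_plane_def)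
  have SD: "S \<subseteq> fund_domain" by (auto simp: S_def domain_solutions_def)
  have inj: "inj_on ?g S" using moebius_int_inj[OF det] SD dom by (meson inj_on_subset)
  have cmp: "\<bar>x\<bar> < 1 \<longleftrightarrow> \<bar>d\<bar> < \<bar>c\<bar>" "\<bar>x\<bar> = 1 \<longleftrightarrow> \<bar>d\<bar> = \<bar>c\<bar>"
  proof -
    have "\<bar>real_of_int c\<bar> > 0" using assms(4) by simp
    hence "\<bar>x\<bar> < 1 \<longleftrightarrow> \<bar>real_of_int d\<bar> < \<bar>real_of_int c\<bar>" "\<bar>x\<bar> = 1 \<longleftrightarrow> \<bar>real_of_int d\<bar> = \<bar>real_of_int c\<bar>"
      unfolding x_def abs_divide by (simp_all add: divide_less_eq divide_eq_eq)
    thus "\<bar>x\<bar> < 1 \<longleftrightarrow> \<bar>d\<bar> < \<bar>c\<bar>" "\<bar>x\<bar> = 1 \<longleftrightarrow> \<bar>d\<bar> = \<bar>c\<bar>"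
      by (simp_all only: of_int_abs[symmetric] of_int_less_iff of_int_eq_iff)
  qed
  note props = domain_solutions_props[OF k, of x, folded S_def]
  have int: "?g ` S \<subseteq> interior (?g ` fund_domain)" if "\<bar>x\<bar> > 1"
  proof -
    \<comment> \<open>The open part of D containing all solutions for |x| > 1; its image is open
      because an injective holomorphic map is open.\<close>
    define U where "U = {z. Re z < 1 / 2} \<inter> {z. Re z > - 1 / 2} \<inter> {z. Im z > 0} \<inter> - cball 0 1"
    have U: "open U" unfolding U_def
      by (intro open_Int open_halfspace_Re_lt open_halfspace_Re_gt open_halfspace_Im_gt) auto
    have UD: "U \<subseteq> fund_domain" by (auto simp: U_def fund_domain_def upper_half_plane_def)
    have "open (?g ` U)"
      by (rule open_mapping_thm3[OF moebius_int_holomorphic[OF det] U inj_on_subset[OF moebius_int_inj[OF det]]])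
        (use UD dom in auto)
    moreover have "S \<subseteq> U"
    proof
      fix z assume z: "z \<in> S"
      hence "z \<in> fund_domain" using SD by blast
      moreover have "\<bar>Re z\<bar> < 1 / 2" "norm z \<noteq> 1" using props(4)[of z] z that by auto
      ultimately show "z \<in> U" by (auto simp: U_def fund_domain_def upper_half_plane_def)
    qed
    ultimately show ?thesis using UD by (meson image_mono interior_maximal order_trans)
  qed
  have arc: "?g ` S \<subseteq> ?g ` fund_arc" if "\<bar>x\<bar> = 1"
  proof (intro image_mono subsetI)
    fix z assume z: "z \<in> S"
    thus "z \<in> fund_arc" using props(4)[of z] that SD by (intro fund_arcI) (auto simp: fund_domain_def upper_half_plane_def)
  qed
  show ?thesis
  proof (intro conjI impI)
    show "eisenstein_critical k \<inter> ?g ` fund_domain = {}" if "\<bar>d\<bar> < \<bar>c\<bar>"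
      unfolding crit using props(1) cmp that by simp
    assume ge: "\<bar>d\<bar> \<ge> \<bar>c\<bar>"
    hence x: "\<bar>x\<bar> \<ge> 1" using cmp by linarith
    show "finite (eisenstein_critical k \<inter> ?g ` fund_domain)" unfolding crit using props(2)[OF x] by simp
    show "card (eisenstein_critical k \<inter> ?g ` fund_domain) = (k + 2) div 6"
      unfolding crit card_image[OF inj] by (rule props(3)[OF x])
    show "eisenstein_critical k \<inter> ?g ` fund_domain \<subseteq> interior (?g ` fund_domain)" if "\<bar>d\<bar> \<noteq> \<bar>c\<bar>"
      unfolding crit using int x cmp that by linarith
    show "eisenstein_critical k \<inter> ?g ` fund_domain \<subseteq> ?g ` fund_arc" if "\<bar>d\<bar> = \<bar>c\<bar>"
      unfolding crit using arc cmp that by blast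
  qed
qed

end
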